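(* Let the setting, the signature kernel $\mathbf{\Psi}$, the selected basis, the coefficient maps, the network class $\mathcal N_r(R,\kappa,L,p,K)$ and the reconstructed measures $\widehat\rho^r_{n,m}(\mu)$ be as defined in the context. Assume: (1) $\mathcal M$ has positive reach $\tau_{\mathcal M}>0$. (2) $\mathbf{\Psi}$ satisfies: (i) $\Delta_r^{\rm cont}:=\max_{(\mu_1,\dots,\mu_r)\in\mathcal M^r,\,(x_1,\dots,x_r)\in\Omega^r}\left|\det[\mathbf{\Psi}(\mu_i,x_j)]_{i,j=1}^r\right|>0$; (ii) there is $L_{\mathbf{\Psi}}>0$ with $|\mathbf{\Psi}(\mu',x')-\mathbf{\Psi}(\mu,x)|\le L_{\mathbf{\Psi}}\sqrt{d_{\mathcal M}(\mu,\mu')^2+\|x'-x\|_2^2}$ for all $(\mu,x),(\mu',x')\in\mathcal M\times\Omega$; (iii) there is $U>0$ with $\sup_{\mathcal M\times\Omega}|\mathbf{\Psi}|\le U$. (3) (i) The Gram matrix $G$ is positive definite, with $\gamma_r:=\lambda_{\min}(G)>0$ and $\Gamma_r:=\lambda_{\max}(G)<\infty$; (ii) there is a constant $C_{\rm quad}$ such that $\left|\int_\Omega f\,dx-\frac1m\sum_{k=1}^m f(x_k)\right|\le C_{\rm quad}\,\mathrm{Lip}(f)\,h_x(m)$ for every Lipschitz $f:\Omega\to\mathbb R$; (iii) $h_x(m)\le \frac{\gamma_r}{4C_{\rm quad}\,r\,U L_{\mathbf{\Psi}}}$. (4) For the selected point sets $I_\mu=\{\nu_1,\dots,\nu_r\}\subset\mathcal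 M$ and $J_x=\{\zeta_1,\dots,\zeta_r\}\subset\Omega$ and some $\theta\in(0,1]$, $$|\det\mathbf{\Psi}(I_\mu,J_x)|\ge\theta\,\Delta_r^{\rm cont},\qquad(\ast)$$ and the skeleton approximation $\mathbf{\Psi}_r^{\rm skel}(\mu,x):=\mathbf{\Psi}(\mu,J_x)[\mathbf{\Psi}(I_\mu,J_x)]^{-1}\mathbf{\Psi}(I_\mu,x)$ satisfies $$\|\mathbf{\Psi}-\mathbf{\Psi}_r^{\rm skel}\|_{L^\infty(\mathcal M\times\Omega)}\le\frac{C(r+1)}{\theta}\,\sigma_{r+1}(\mathbf{\Psi}),$$ where $C$ is a constant independent of $\theta$, $r$ and the particular kernel $\mathbf{\Psi}$ (it may depend on the regularity class under consideration) and $\sigma_k(\mathbf{\Psi})$ is the $k$th singular value of the operator $H_\Psi$. Conditional on the selected basis and grid, let $\widehat a_m$ be the empirical risk minimizer over $\mathcal N_r(R,\kappa,L,p,K)$. Choose $R\ge R_a:=\frac{2\sqrt r\,U^2}{\gamma_r}$ and choose $$L=\tilde O\left(\tfrac{\log n}{2+d}\right),\quad p=\tilde O\left(r\,n^{\frac{d}{2+d}}\right),\quad K=\tilde O\left(\tfrac{r}{2+d}\,n^{\frac d{2+d}}\log n\right),\quad \kappa=O\left(\max\{1,b,\sqrt d,\tau_{\mathcal M}^2\}\right),$$ where $\tilde O(\cdot)$ hides factors depending on $d$ and some logarithmic factors. Then $$\mathbb E\left[\int_{\mathcal M}W_2^2\big(\rho(\mu),\widehat\rho^r_{n,m}(\mu)\big)\,dQ(\mu)\right]\le\frac{4C^2(r+1)^2\sigma_{r+1}^2(\mathbf{\Psi})}{\theta^2}+4C_1\Gamma_r\,h_x(m)^2+2c\,\Gamma_r\frac{r^2U^4}{\gamma_r^2}\left(n^{-\frac2{2+d}}+\frac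 Dn\right)\log^3 n .$$ Here $C_1$ is a constant depending only on $r,\gamma_r,U,L_{\mathbf{\Psi}},C_{\rm quad}$, and $c$ is a constant depending on $\log D$, $d$, $b$, $\kappa$, $\mathcal M$ and the Lipschitz radius of the coefficient functions. Moreover, if the skeleton-selection parameter sample and the spatial grid have fill distances $h_\mu^{\rm skel}(n_{\rm skel}):=\sup_{\mu\in\mathcal M}\min_{1\le\ell\le n_{\rm skel}}d_{\mathcal M}(\mu,\mu_\ell^{\rm skel})$ and $h_x(m)$, then the volume condition $(\ast)$ holds with $$\theta=1-\frac{C_{\rm det}(r)\,U^{r-1}L_{\mathbf{\Psi}}\big(h_\mu^{\rm skel}(n_{\rm skel})+h_x(m)\big)}{\Delta_r^{\rm cont}},\qquad C_{\rm det}(r):=r^{\frac r2+1},$$ provided the right-hand side is positive.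
   Context: Setting. $\mathcal M\subseteq[-b,b]^D$ is a compact, connected, $d$-dimensional Riemannian submanifold, $d<D$, with Riemannian distance $d_{\mathcal M}$; its reach is $\tau_{\mathcal M}=\sup\{s>0:\text{every point within distance }s\text{ of }\mathcal M\text{ has a unique nearest point on }\mathcal M\}$. $Q$ is a probability measure on $\mathcal M$ with density with respect to the Riemannian volume measure bounded above and below by positive constants. $\Omega=[-\xi,\xi]^{D_{\bar\rho}}$, and $dx$ denotes the normalized Lebesgue (probability) measure on $\Omega$. For each $\mu\in\mathcal M$, $\rho(\mu)$ is a probability measure with support in $\Omega$ (coming from a parametrized PDE). $\bar\rho$ is a reference probability measure on $\Omega$, absolutely continuous with respect to $dx$, with density also written $\bar\rho$. $W_2$ is the 2-Wasserstein distance with Euclidean cost. Transport signature. $\mathbf{\Phi}(\mu,\cdot)=\phi(\mu)$ is the Kantorovich potential for the quadratic cost $\frac12\|x-y\|_2^2$ from $\bar\rho$ to $\rho(\mu)$, normalized by $\int_\Omega\phi(\mu)\,dx=0$, so that $\mathbf T(\mu,\cdot)=I-\nabla_x\mathbf{\Phi}(\mu,\cdot)$ is the optimal transport map from $\bar\rho$ to $\rho(\mu)$. $\mathcal Lf=\nabla_x\cdot(\bar\rho\nabla_xf)$, with a self-adjoint realization on $L^2(\Omega,dx)$ whose boundary conditions make integration-by-parts boundary terms vanish; thus $I-\mathcal L$ is positive self-adjoint, and $\|(I-\mathcal L)^{1/2}f\|_{L^2(dx)}^2=\|f\|_{L^2(dx)}^2+\|\nabla_xf\|_{L^2(\bar\rho)}^2$.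 The transport signature is $\mathbf{\Psi}=(I-\mathcal L)^{1/2}\mathbf{\Phi}:\mathcal M\times\Omega\to\mathbb R$. $H_\Psi:L^2(\Omega,dx)\to L^2(\mathcal M,Q)$ is $(H_\Psi f)(\mu)=\int_\Omega\mathbf{\Psi}(\mu,x)f(x)\,dx$. Selected basis. Let $\{\mu_\ell^{\rm skel}\}_{\ell=1}^{n_{\rm skel}}\subset\mathcal M$ be a parameter sample used for skeleton selection and $\{x_k\}_{k=1}^m\subset\Omega$ a spatial grid, with fill distance $h_x(m)=\sup_{x\in\Omega}\min_{k}\|x-x_k\|_2$. Let $\Psi^{\rm skel}_{\ell,k}=\mathbf{\Psi}(\mu_\ell^{\rm skel},x_k)$. A maximum-volume skeleton decomposition of $\Psi^{\rm skel}$ selects row indices $i_1,\dots,i_r$ and column indices $j_1,\dots,j_r$ (i.e. the $r\times r$ submatrix of $\Psi^{\rm skel}$ of largest absolute determinant). Put $\nu_s=\mu_{i_s}^{\rm skel}$, $\zeta_s=x_{j_s}$, $\psi_s(\cdot)=\mathbf{\Psi}(\nu_s,\cdot)$, $\psi=(\psi_1,\dots,\psi_r)^\top$. Notation: $\mathbf{\Psi}(I_\mu,J_x)=[\mathbf{\Psi}(\nu_s,\zeta_t)]_{s,t=1}^r$, $\mathbf{\Psi}(\mu,J_x)$ is the row vector $(\mathbf{\Psi}(\mu,\zeta_t))_t$, and $\mathbf{\Psi}(I_\mu,x)$ the column vector $(\mathbf{\Psi}(\nu_s,x))_s$. Coefficients. $G=\int_\Omega\psi\psi^\top dx$, $G_m=\frac1m\sum_{k=1}^m\psi(x_k)\psi(x_k)^\top$,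 $b_m(\mu)=\frac1m\sum_{k=1}^m\mathbf{\Psi}(\mu,x_k)\psi(x_k)$, $a_m(\mu)=G_m^{-1}b_m(\mu)\in\mathbb R^r$. The "coefficient functions" are the coordinates of $a_m$. Learning. Conditional on the selected basis and grid, $\{\mu_j^{\rm train}\}_{j=1}^n$ are i.i.d. from $Q$, independent of the skeleton-selection sample; the expectation $\mathbb E$ is over these training samples. $\mathcal N_r(R,\kappa,L,p,K)$ is the class of maps $S:\mathcal M\to\mathbb R^r$ representable by a feedforward (ReLU) neural network with at most $L$ layers, width at most $p$, weight matrices $W_\ell$ and biases $b_\ell$, with $\|S\|_\infty\le R$ (sup norm), $\|W_\ell\|_{\infty,\infty}\le\kappa$ (largest absolute entry), $\|b_\ell\|_\infty\le\kappa$, and $\sum_{\ell=1}^L(\|W_\ell\|_0+\|b_\ell\|_0)\le K$, where $\|\cdot\|_0$ counts nonzero entries. The empirical risk minimizer is $\widehat a_m\in\arg\min_{\widetilde a\in\mathcal N_r(R,\kappa,L,p,K)}\frac1n\sum_{j=1}^n\|\widetilde a(\mu_j^{\rm train})-a_m(\mu_j^{\rm train})\|_2^2$. Reconstruction. $\widehat{\mathbf{\Psi}}^r_{n,m}(\mu,x)=\widehat a_m(\mu)^\top\psi(x)$, $\widehat{\mathbf{\Phi}}^r_{n,m}=(I-\mathcal L)^{-1/2}\widehat{\mathbf{\Psi}}^r_{n,m}$, $\widehat{\mathbf T}^r_{n,m}(\mu,x)=x-\nabla_x\widehat{\mathbf{\Phi}}^r_{n,m}(\mu,x)$, and $\widehat\rho^r_{n,m}(\mu)=(\widehat{\mathbf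 T}^r_{n,m}(\mu,\cdot))_\#\bar\rho$.
   Formalization: The constant c may also depend on the ratio R/R_a (with c independent of R the bound fails for very large R; R = R_a gives the listed dependencies), and n ≥ 2 is assumed since log n vanishes at n = 1. *)

theory Defs
  imports
    "HOL-Probability.Probability"
    "Jordan_Normal_Form.Char_Poly"
    "Jordan_Normal_Form.Gauss_Jordan_Elimination"
begin

text \<open>
  The constants of the theorem are chosen before, and uniformly in, all the dimensions occurring in
  it, so the dimension cannot be a type.  All spaces \<open>R^n\<close> live in the one inner product
  space of finitely supported real sequences; \<open>R^n\<close> consists of the sequences supported
  in \<open>{..<n}\<close>, and \<open>Rn m \<subseteq> Rn n\<close> for \<open>m \<le> n\<close>.
\<close>

typedef evec = "{f :: nat \<Rightarrow> real. finite {i. f i \<noteq> 0}}"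
  morphisms coord Abs_evec
  by (rule exI[of _ "\<lambda>_. 0"]) simp

lemma finite_coord: "finite {i. coord x i \<noteq> 0}"
  using coord[of x] by simp

lemma evec_eqI: "(\<And>i. coord x i = coord y i) \<Longrightarrow> x = y"
  by (meson coord_inject ext)

lemma coord_Abs: "finite {i. f i \<noteq> 0} \<Longrightarrow> coord (Abs_evec f) = f"
  by (simp add: Abs_evec_inverse)

instantiation evec :: real_inner
begin

definition zero_evec :: evec where "(0::evec) = Abs_evec (\<lambda>_. 0)"
definition plus_evec :: "evec \<Rightarrow> evec \<Rightarrow> evec" where
  "(x::evec) + y = Abs_evec (\<lambda>i. coord x i + coord y i)"
definition uminus_evec :: "evec \<Rightarrow> evec" where "- (x::evec) = Abs_evec (\<lambda>i. - coord x i)"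
definition minus_evec :: "evec \<Rightarrow> evec \<Rightarrow> evec" where
  "(x::evec) - y = Abs_evec (\<lambda>i. coord x i - coord y i)"
definition scaleR_evec :: "real \<Rightarrow> evec \<Rightarrow> evec" where
  "scaleR a (x::evec) = Abs_evec (\<lambda>i. a * coord x i)"
definition inner_evec :: "evec \<Rightarrow> evec \<Rightarrow> real" where
  "inner (x::evec) y = (\<Sum>i | coord x i \<noteq> 0. coord x i * coord y i)"
definition norm_evec :: "evec \<Rightarrow> real" where "norm (x::evec) = sqrt (inner x x)"
definition sgn_evec :: "evec \<Rightarrow> evec" where "sgn (x::evec) = inverse (norm x) *\<^sub>R x"
definition dist_evec :: "evec \<Rightarrow> evec \<Rightarrow> real" where "dist (x::evec) y = norm (x - y)"
definition uniformity_evec :: "(evec \<times> evec) filter" where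
  "(uniformity :: (evec \<times> evec) filter) = (INF e\<in>{0 <..}. principal {(x::evec, y). dist x y < e})"
definition open_evec :: "evec set \<Rightarrow> bool" where
  "open (U::evec set) \<longleftrightarrow> (\<forall>x\<in>U. \<forall>\<^sub>F (x', y) in uniformity. x' = x \<longrightarrow> y \<in> U)"

lemma coord_zero [simp]: "coord 0 i = 0"
  by (simp add: zero_evec_def coord_Abs)

lemma coord_plus [simp]: "coord (x + y) i = coord x i + coord y i"
proof -
  have "finite {i. coord x i + coord y i \<noteq> 0}"
    by (rule finite_subset[of _ "{i. coord x i \<noteq> 0} \<union> {i. coord y i \<noteq> 0}"])
      (auto simp: finite_coord)
  then show ?thesis by (simp add: plus_evec_def coord_Abs)
qed

lemma coord_uminus [simp]: "coord (- x) i = - coord x i"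
  by (simp add: uminus_evec_def coord_Abs finite_coord)

lemma coord_minus [simp]: "coord (x - y) i = coord x i - coord y i"
proof -
  have "finite {i. coord x i - coord y i \<noteq> 0}"
    by (rule finite_subset[of _ "{i. coord x i \<noteq> 0} \<union> {i. coord y i \<noteq> 0}"])
      (auto simp: finite_coord)
  then show ?thesis by (simp add: minus_evec_def coord_Abs)
qed

lemma coord_scaleR [simp]: "coord (a *\<^sub>R x) i = a * coord x i"
proof -
  have "finite {i. a * coord x i \<noteq> 0}"
    by (rule finite_subset[of _ "{i. coord x i \<noteq> 0}"]) (auto simp: finite_coord)
  then show ?thesis by (simp add: scaleR_evec_def coord_Abs)
qed

lemma inner_evec_superset:
  assumes "finite A" "{i. coord x i \<noteq> 0} \<subseteq> A"
  shows "inner x y = (\<Sum>i\<in>A. coord x i * coord y i)"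
  unfolding inner_evec_def by (rule sum.mono_neutral_left) (use assms in auto)

instance
proof
  fix x y z :: evec and a b :: real
  show "x + y + z = x + (y + z)" "x + y = y + x" "0 + x = x" "- x + x = 0" "x - y = x + - y"
    "a *\<^sub>R (x + y) = a *\<^sub>R x + a *\<^sub>R y" "(a + b) *\<^sub>R x = a *\<^sub>R x + b *\<^sub>R x"
    "a *\<^sub>R b *\<^sub>R x = (a * b) *\<^sub>R x" "1 *\<^sub>R x = x"
    by (rule evec_eqI; simp add: algebra_simps)+
  let ?A = "{i. coord x i \<noteq> 0} \<union> {i. coord y i \<noteq> 0}"
  have A: "finite ?A" by (simp add: finite_coord)
  show "inner x y = inner y x"
    by (simp add: inner_evec_superset[OF A] mult.commute)
  have *: "inner (x + y) z = (\<Sum>i\<in>?A. coord (x + y) i * coord z i)"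
    by (rule inner_evec_superset[OF A]) auto
  show "inner (x + y) z = inner x z + inner y z"
    unfolding * by (simp add: inner_evec_superset[OF A] sum.distrib algebra_simps)
  have **: "inner (a *\<^sub>R x) y = (\<Sum>i\<in>?A. coord (a *\<^sub>R x) i * coord y i)"
    by (rule inner_evec_superset[OF A]) auto
  show "inner (a *\<^sub>R x) y = a * inner x y"
    unfolding ** by (simp add: inner_evec_superset[OF A] sum_distrib_left mult.assoc)
  show "0 \<le> inner x x" by (auto simp: inner_evec_def intro: sum_nonneg)
  have "inner x x = 0 \<longleftrightarrow> (\<forall>i\<in>{i. coord x i \<noteq> 0}. coord x i * coord x i = 0)"
    unfolding inner_evec_def by (rule sum_nonneg_eq_0_iff) (simp_all add: finite_coord)
  also have "\<dots> \<longleftrightarrow> x = 0" by (auto intro: evec_eqI)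
  finally show "inner x x = 0 \<longleftrightarrow> x = 0" .
qed (simp_all add: norm_evec_def dist_evec_def sgn_evec_def uniformity_evec_def open_evec_def)

end

definition Rn :: "nat \<Rightarrow> evec set" where
  "Rn n = {x. \<forall>i\<ge>n. coord x i = 0}"

definition of_coords :: "nat \<Rightarrow> (nat \<Rightarrow> real) \<Rightarrow> evec" where
  "of_coords n f = Abs_evec (\<lambda>i. if i < n then f i else 0)"

lemma coord_of_coords [simp]: "coord (of_coords n f) i = (if i < n then f i else 0)"
proof -
  have "finite {i. (if i < n then f i else 0) \<noteq> 0}"
    by (rule finite_subset[of _ "{..<n}"]) (auto split: if_splits)
  then show ?thesis by (simp add: of_coords_def coord_Abs)
qed

lemma inner_Rn: "x \<in> Rn n \<Longrightarrow> inner x y = (\<Sum>i<n. coord x i * coord y i)"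
  by (rule inner_evec_superset) (auto simp: Rn_def not_less[symmetric])

lemma norm_Rn: "x \<in> Rn n \<Longrightarrow> norm x = sqrt (\<Sum>i<n. (coord x i)\<^sup>2)"
  by (simp add: norm_eq_sqrt_inner inner_Rn power2_eq_square)

definition unit_evec :: "nat \<Rightarrow> evec" where
  "unit_evec i = of_coords (Suc i) (\<lambda>j. if j = i then 1 else 0)"

definition lborel_n :: "nat \<Rightarrow> evec measure" where
  "lborel_n n = distr (PiM {..<n} (\<lambda>_. lborel)) borel (of_coords n)"

definition cube :: "nat \<Rightarrow> real \<Rightarrow> evec set" where
  "cube n a = {x \<in> Rn n. \<forall>i<n. \<bar>coord x i\<bar> \<le> a}"

definition open_cube :: "nat \<Rightarrow> real \<Rightarrow> evec set" where
  "open_cube n a = {x \<in> Rn n. \<forall>i<n. \<bar>coord x i\<bar> < a}"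

definition to_vec :: "nat \<Rightarrow> evec \<Rightarrow> real Matrix.vec" where
  "to_vec n x = Matrix.vec n (coord x)"

definition of_vec :: "real Matrix.vec \<Rightarrow> evec" where
  "of_vec v = of_coords (dim_vec v) (vec_index v)"

definition pd :: "nat \<Rightarrow> (evec \<Rightarrow> 'b::real_normed_vector) \<Rightarrow> evec \<Rightarrow> 'b" where
  "pd i f x = vector_derivative (\<lambda>t. f (x + t *\<^sub>R unit_evec i)) (at 0)"

primrec C_k_on :: "nat \<Rightarrow> nat \<Rightarrow> evec set \<Rightarrow> (evec \<Rightarrow> 'b::real_normed_vector) \<Rightarrow> bool" where
  "C_k_on 0 n U f \<longleftrightarrow> continuous_on U f"
| "C_k_on (Suc k) n U f \<longleftrightarrow> continuous_on U f \<and>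
     (\<forall>i<n. (\<forall>x\<in>U. (\<lambda>t. f (x + t *\<^sub>R unit_evec i)) differentiable (at 0))
        \<and> C_k_on k n U (pd i f))"

text \<open>Only meant for relatively open subsets \<open>U\<close> of \<open>Rn n\<close>.\<close>

definition smooth_on :: "nat \<Rightarrow> evec set \<Rightarrow> (evec \<Rightarrow> 'b::real_normed_vector) \<Rightarrow> bool" where
  "smooth_on n U f \<longleftrightarrow> (\<forall>k. C_k_on k n U f)"

definition local_param :: "nat \<Rightarrow> evec set \<Rightarrow> evec set \<Rightarrow> (evec \<Rightarrow> evec) \<Rightarrow> bool" where
  "local_param d M U \<phi> \<longleftrightarrow>
     openin (top_of_set (Rn d)) U \<and> smooth_on d U \<phi> \<and>
     openin (top_of_set M) (\<phi> ` U) \<and> (\<exists>g. homeomorphism U (\<phi> ` U) \<phi> g) \<and>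
     (\<forall>x\<in>U. \<forall>a. (\<Sum>i<d. a i *\<^sub>R pd i \<phi> x) = 0 \<longrightarrow> (\<forall>i<d. a i = 0))"

definition submanifold :: "nat \<Rightarrow> nat \<Rightarrow> evec set \<Rightarrow> bool" where
  "submanifold D d M \<longleftrightarrow> M \<subseteq> Rn D \<and> (\<forall>p\<in>M. \<exists>U \<phi>. local_param d M U \<phi> \<and> p \<in> \<phi> ` U)"

definition speed :: "(real \<Rightarrow> evec) \<Rightarrow> real \<Rightarrow> real" where
  "speed g t = norm (vector_derivative g (at t))"

text \<open>
  The library's piecewise \<open>C\<^sup>1\<close> curves may have an unbounded derivative near a break
  point, and a non-rectifiable one would get length 0; hence the integrability requirement.
\<close>

definition geodesic_dist :: "evec set \<Rightarrow> evec \<Rightarrow> evec \<Rightarrow> real" where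
  "geodesic_dist M p q = Inf {integral {0..1} (speed g) | g.
     g piecewise_C1_differentiable_on {0..1} \<and> speed g integrable_on {0..1} \<and>
     path_image g \<subseteq> M \<and> pathstart g = p \<and> pathfinish g = q}"

definition riemannian_volume :: "nat \<Rightarrow> evec set \<Rightarrow> evec measure \<Rightarrow> bool" where
  "riemannian_volume d M V \<longleftrightarrow> sets V = sets (restrict_space borel M) \<and>
     (\<forall>U \<phi> A. local_param d M U \<phi> \<longrightarrow> A \<in> sets borel \<longrightarrow> A \<subseteq> U \<longrightarrow>
        emeasure V (\<phi> ` A) =
          (\<integral>\<^sup>+x\<in>A. ennreal (sqrt (Determinant.det
             (Matrix.mat d d (\<lambda>(i, j). inner (pd i \<phi> x) (pd j \<phi> x))))) \<partial>lborel_n d))"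

text \<open>Extended-real valued: a one-point manifold has infinite reach.\<close>

definition reach :: "nat \<Rightarrow> evec set \<Rightarrow> ereal" where
  "reach D M = Sup (ereal ` {s. 0 < s \<and> (\<forall>x\<in>Rn D. infdist x M \<le> s \<longrightarrow>
     (\<exists>!y. y \<in> M \<and> dist x y = infdist x M))})"

definition couplings :: "evec measure \<Rightarrow> evec measure \<Rightarrow> (evec \<times> evec) measure set" where
  "couplings \<alpha> \<beta> = {\<pi>. sets \<pi> = sets (borel \<Otimes>\<^sub>M borel) \<and>
     distr \<pi> borel fst = \<alpha> \<and> distr \<pi> borel snd = \<beta>}"

text \<open>The square of the 2-Wasserstein distance.\<close>

definition W2_sq :: "evec measure \<Rightarrow> evec measure \<Rightarrow> ennreal" where
  "W2_sq \<alpha> \<beta> = (INF \<pi>\<in>couplings \<alpha> \<beta>. \<integral>\<^sup>+(x, y). ennreal ((dist x y)\<^sup>2) \<partial>\<pi>)"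

text \<open>The source measure may be carried by a subset; it is read as a measure on the whole space.\<close>

definition optimal_map :: "evec measure \<Rightarrow> evec measure \<Rightarrow> (evec \<Rightarrow> evec) \<Rightarrow> bool" where
  "optimal_map \<alpha> \<beta> T \<longleftrightarrow> T \<in> measurable \<alpha> borel \<and> distr \<alpha> borel T = \<beta> \<and>
     (\<integral>\<^sup>+x. ennreal ((dist x (T x))\<^sup>2) \<partial>\<alpha>) = W2_sq (distr \<alpha> borel (\<lambda>x. x)) \<beta>"

definition c_transform :: "evec set \<Rightarrow> (evec \<Rightarrow> real) \<Rightarrow> evec \<Rightarrow> real" where
  "c_transform S f y = (INF x\<in>S. (dist x y)\<^sup>2 / 2 - f x)"

definition kantorovich_potential ::
    "evec set \<Rightarrow> evec measure \<Rightarrow> evec measure \<Rightarrow> (evec \<Rightarrow> real) \<Rightarrow> bool" where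
  "kantorovich_potential S \<alpha> \<beta> f \<longleftrightarrow> continuous_on S f \<and>
     (\<forall>x\<in>S. f x = c_transform S (c_transform S f) x) \<and>
     (\<forall>g h. continuous_on S g \<longrightarrow> continuous_on S h \<longrightarrow>
        (\<forall>x\<in>S. \<forall>y\<in>S. g x + h y \<le> (dist x y)\<^sup>2 / 2) \<longrightarrow>
        (LINT x:S|\<alpha>. g x) + (LINT y:S|\<beta>. h y)
          \<le> (LINT x:S|\<alpha>. f x) + (LINT y:S|\<beta>. c_transform S f y))"

text \<open>
  An operator is its graph, a set of pairs of square-integrable functions which is saturated under
  almost-everywhere equality (a consequence of being equal to its adjoint).
\<close>

type_synonym l2_graph = "((evec \<Rightarrow> real) \<times> (evec \<Rightarrow> real)) set"

definition L2 :: "evec measure \<Rightarrow> (evec \<Rightarrow> real) set" where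
  "L2 \<nu> = {f. f \<in> borel_measurable \<nu> \<and> integrable \<nu> (\<lambda>x. (f x)\<^sup>2)}"

definition ip :: "evec measure \<Rightarrow> (evec \<Rightarrow> real) \<Rightarrow> (evec \<Rightarrow> real) \<Rightarrow> real" where
  "ip \<nu> f g = (LINT x|\<nu>. f x * g x)"

definition adjoint_graph :: "evec measure \<Rightarrow> l2_graph \<Rightarrow> l2_graph" where
  "adjoint_graph \<nu> A = {(u, v). u \<in> L2 \<nu> \<and> v \<in> L2 \<nu> \<and> (\<forall>(f, g)\<in>A. ip \<nu> g u = ip \<nu> f v)}"

text \<open>For a relation equal to its adjoint, single-valuedness is the density of the domain.\<close>

definition selfadjoint :: "evec measure \<Rightarrow> l2_graph \<Rightarrow> bool" where
  "selfadjoint \<nu> A \<longleftrightarrow> adjoint_graph \<nu> A = A \<and>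
     (\<forall>g. ((\<lambda>_. 0), g) \<in> A \<longrightarrow> (AE x in \<nu>. g x = 0))"

definition nonneg_graph :: "evec measure \<Rightarrow> l2_graph \<Rightarrow> bool" where
  "nonneg_graph \<nu> A \<longleftrightarrow> (\<forall>(f, g)\<in>A. 0 \<le> ip \<nu> f g)"

definition id_minus :: "l2_graph \<Rightarrow> l2_graph" where
  "id_minus A = {(f, \<lambda>x. f x - g x) | f g. (f, g) \<in> A}"

definition is_sqrt :: "evec measure \<Rightarrow> l2_graph \<Rightarrow> l2_graph \<Rightarrow> bool" where
  "is_sqrt \<nu> B A \<longleftrightarrow> selfadjoint \<nu> B \<and> nonneg_graph \<nu> B \<and> B O B = A"

definition op_inv :: "l2_graph \<Rightarrow> (evec \<Rightarrow> real) \<Rightarrow> evec \<Rightarrow> real" where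
  "op_inv A g = (SOME f. (f, g) \<in> A)"

definition unif_cube :: "nat \<Rightarrow> real \<Rightarrow> evec measure" where
  "unif_cube E a = restrict_space (uniform_measure (lborel_n E) (cube E a)) (cube E a)"

definition test_fun :: "nat \<Rightarrow> real \<Rightarrow> (evec \<Rightarrow> real) \<Rightarrow> bool" where
  "test_fun E a \<eta> \<longleftrightarrow> smooth_on E (Rn E) \<eta> \<and>
     (\<exists>K. compact K \<and> K \<subseteq> open_cube E a \<and> (\<forall>x \<in> Rn E - K. \<eta> x = 0))"

definition weak_gradient :: "nat \<Rightarrow> real \<Rightarrow> (evec \<Rightarrow> real) \<Rightarrow> (evec \<Rightarrow> evec) \<Rightarrow> bool" where
  "weak_gradient E a f g \<longleftrightarrow> g \<in> measurable (unif_cube E a) borel \<and> (\<forall>x\<in>cube E a. g x \<in> Rn E) \<and>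
     (\<forall>i<E. (\<forall>K. compact K \<and> K \<subseteq> open_cube E a \<longrightarrow>
               set_integrable (unif_cube E a) K (\<lambda>x. coord (g x) i)) \<and>
            (\<forall>\<eta>. test_fun E a \<eta> \<longrightarrow>
               (LINT x|unif_cube E a. f x * pd i \<eta> x)
                 = - (LINT x|unif_cube E a. coord (g x) i * \<eta> x)))"

definition weakly_differentiable :: "nat \<Rightarrow> real \<Rightarrow> (evec \<Rightarrow> real) \<Rightarrow> bool" where
  "weakly_differentiable E a f \<longleftrightarrow> (\<exists>g. weak_gradient E a f g)"

definition grad :: "nat \<Rightarrow> real \<Rightarrow> (evec \<Rightarrow> real) \<Rightarrow> evec \<Rightarrow> evec" where
  "grad E a f = (SOME g. weak_gradient E a f g)"

text \<open>
  \<open>L\<close> is a self-adjoint realization of \<open>f \<mapsto> div (rho grad f)\<close> without boundary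
  terms, \<open>B\<close> is the square root of \<open>I - L\<close>, and \<open>\<alpha>\<close> is the measure with
  density \<open>rho\<close>.  The divergence is the distributional one.
\<close>

definition divergence_realization ::
    "nat \<Rightarrow> real \<Rightarrow> evec measure \<Rightarrow> l2_graph \<Rightarrow> l2_graph \<Rightarrow> bool" where
  "divergence_realization E a \<alpha> L B \<longleftrightarrow>
     selfadjoint (unif_cube E a) L \<and>
     is_sqrt (unif_cube E a) B (id_minus L) \<and>
     (\<forall>(f, g)\<in>L. \<forall>\<eta>. test_fun E a \<eta> \<longrightarrow>
        ip (unif_cube E a) g \<eta> = - (LINT x|\<alpha>. (\<Sum>i<E. coord (grad E a f x) i * pd i \<eta> x))) \<and>
     (\<forall>(f, g)\<in>L. \<forall>(u, w)\<in>L.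
        ip (unif_cube E a) g u = - (LINT x|\<alpha>. inner (grad E a f x) (grad E a u x))) \<and>
     (\<forall>(f, g)\<in>B. weakly_differentiable E a f \<and>
        integrable \<alpha> (\<lambda>x. (norm (grad E a f x))\<^sup>2) \<and>
        ip (unif_cube E a) g g
          = ip (unif_cube E a) f f + (LINT x|\<alpha>. (norm (grad E a f x))\<^sup>2))"

definition kernel_op ::
    "evec measure \<Rightarrow> (evec \<Rightarrow> evec \<Rightarrow> real) \<Rightarrow> (evec \<Rightarrow> real) \<Rightarrow> evec \<Rightarrow> real" where
  "kernel_op \<nu> \<Psi> f \<mu> = (LINT x|\<nu>. \<Psi> \<mu> x * f x)"

definition kernel_adj ::
    "evec measure \<Rightarrow> (evec \<Rightarrow> evec \<Rightarrow> real) \<Rightarrow> (evec \<Rightarrow> real) \<Rightarrow> evec \<Rightarrow> real" where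
  "kernel_adj Q \<Psi> g x = (LINT \<mu>|Q. \<Psi> \<mu> x * g \<mu>)"

text \<open>
  The square root of the \<open>k\<close>-th largest eigenvalue, counted with multiplicity from
  \<open>k = 1\<close>, of the composition of the operator with its adjoint.
\<close>

definition singular_value ::
    "evec measure \<Rightarrow> evec measure \<Rightarrow> (evec \<Rightarrow> evec \<Rightarrow> real) \<Rightarrow> nat \<Rightarrow> real" where
  "singular_value \<nu> Q \<Psi> k = Sup {s. 0 \<le> s \<and> (\<exists>u ev.
     (\<forall>i<k. u i \<in> L2 \<nu> \<and> s\<^sup>2 \<le> ev i \<and>
        (AE x in \<nu>. kernel_adj Q \<Psi> (kernel_op \<nu> \<Psi> (u i)) x = ev i * u i x)) \<and>
     (\<forall>i<k. \<forall>j<k. ip \<nu> (u i) (u j) = (if i = j then 1 else 0)))}"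

type_synonym net = "(real Matrix.mat \<times> real Matrix.vec) list"

fun net_eval :: "net \<Rightarrow> real Matrix.vec \<Rightarrow> real Matrix.vec" where
  "net_eval [] x = x"
| "net_eval [(W, v)] x = W *\<^sub>v x + v"
| "net_eval ((W, v) # l # ls) x = net_eval (l # ls) (map_vec (max 0) (W *\<^sub>v x + v))"

text \<open>Only hidden layers count for the width \<open>p\<close>: input dimension \<open>k\<close>, output dimension \<open>r\<close>, hidden layers of width at most \<open>p\<close>.\<close>

fun wf_net :: "nat \<Rightarrow> nat \<Rightarrow> nat \<Rightarrow> net \<Rightarrow> bool" where
  "wf_net p k r [] = False"
| "wf_net p k r [(W, v)] \<longleftrightarrow> W \<in> carrier_mat r k \<and> v \<in> carrier_vec r"
| "wf_net p k r ((W, v) # l # ls) \<longleftrightarrow>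
     (\<exists>h\<le>p. W \<in> carrier_mat h k \<and> v \<in> carrier_vec h \<and> wf_net p h r (l # ls))"

definition mat_nnz :: "real Matrix.mat \<Rightarrow> nat" where
  "mat_nnz W = card {(i, j). i < dim_row W \<and> j < dim_col W \<and> index_mat W (i, j) \<noteq> 0}"

definition vec_nnz :: "real Matrix.vec \<Rightarrow> nat" where
  "vec_nnz v = card {i. i < dim_vec v \<and> vec_index v i \<noteq> 0}"

text \<open>The supremum norm of a vector-valued map is taken with the Euclidean norm of its values.\<close>

definition net_class ::
    "nat \<Rightarrow> evec set \<Rightarrow> nat \<Rightarrow> real \<Rightarrow> real \<Rightarrow> nat \<Rightarrow> nat \<Rightarrow> nat \<Rightarrow> (evec \<Rightarrow> evec) set" where
  "net_class D M r R \<kappa> L p K = {S. (\<forall>\<mu>\<in>M. norm (S \<mu>) \<le> R) \<and>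
     (\<exists>net. wf_net p D r net \<and> length net \<le> L \<and>
        (\<forall>(W, v)\<in>set net.
           (\<forall>i<dim_row W. \<forall>j<dim_col W. \<bar>index_mat W (i, j)\<bar> \<le> \<kappa>) \<and>
           (\<forall>i<dim_vec v. \<bar>vec_index v i\<bar> \<le> \<kappa>)) \<and>
        (\<Sum>(W, v)\<leftarrow>net. mat_nnz W + vec_nnz v) \<le> K \<and>
        (\<forall>\<mu>\<in>M. S \<mu> = of_vec (net_eval net (to_vec D \<mu>))))}"

text \<open>Finite index sets start at 0.\<close>

record problem =
  amb_dim :: nat                                (* D *)
  man_dim :: nat                                (* d *)
  amb_bound :: real                             (* b *)
  man :: "evec set"                             (* M *)
  par_law :: "evec measure"                     (* Q *)
  space_dim :: nat                              (* dimension of Omega *)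
  half_width :: real                            (* xi *)
  ref_density :: "evec \<Rightarrow> real"
  target :: "evec \<Rightarrow> evec measure"    (* rho *)
  gen_op :: l2_graph                            (* L *)
  root_op :: l2_graph                           (* (I - L)^(1/2) *)
  potential :: "evec \<Rightarrow> evec \<Rightarrow> real"     (* Phi *)
  signature :: "evec \<Rightarrow> evec \<Rightarrow> real"     (* Psi *)
  rnk :: nat                                    (* r *)
  skel_size :: nat
  skel_pt :: "nat \<Rightarrow> evec"
  grid_size :: nat                              (* m *)
  grid_pt :: "nat \<Rightarrow> evec"
  row_sel :: "nat \<Rightarrow> nat"
  col_sel :: "nat \<Rightarrow> nat"

abbreviation Omega :: "problem \<Rightarrow> evec set" where
  "Omega P \<equiv> cube (space_dim P) (half_width P)"

abbreviation dx :: "problem \<Rightarrow> evec measure" where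
  "dx P \<equiv> unif_cube (space_dim P) (half_width P)"

definition ref_measure :: "problem \<Rightarrow> evec measure" where
  "ref_measure P = density (dx P) (\<lambda>x. ennreal (ref_density P x))"

definition transport_map :: "problem \<Rightarrow> (evec \<Rightarrow> real) \<Rightarrow> evec \<Rightarrow> evec" where
  "transport_map P f x = x - grad (space_dim P) (half_width P) f x"

definition par_nodes :: "problem \<Rightarrow> nat \<Rightarrow> evec" where
  "par_nodes P s = skel_pt P (row_sel P s)"

definition space_nodes :: "problem \<Rightarrow> nat \<Rightarrow> evec" where
  "space_nodes P t = grid_pt P (col_sel P t)"

definition kernel_mat :: "problem \<Rightarrow> (nat \<Rightarrow> evec) \<Rightarrow> (nat \<Rightarrow> evec) \<Rightarrow> real Matrix.mat" where
  "kernel_mat P \<mu> x = Matrix.mat (rnk P) (rnk P) (\<lambda>(s, t). signature P (\<mu> s) (x t))"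

definition max_volume_selection :: "problem \<Rightarrow> bool" where
  "max_volume_selection P \<longleftrightarrow>
     (let r = rnk P; sel = (\<lambda>N. {f. inj_on f {..<r} \<and> f ` {..<r} \<subseteq> {..<N}});
          vol = (\<lambda>i j. \<bar>Determinant.det
            (kernel_mat P (\<lambda>s. skel_pt P (i s)) (\<lambda>t. grid_pt P (j t)))\<bar>)
      in row_sel P \<in> sel (skel_size P) \<and> col_sel P \<in> sel (grid_size P) \<and>
         (\<forall>i\<in>sel (skel_size P). \<forall>j\<in>sel (grid_size P). vol i j \<le> vol (row_sel P) (col_sel P)))"

text \<open>
  The measures \<open>dx P\<close>, \<open>ref_measure P\<close> and \<open>par_law P\<close> live on the spaces
  \<open>Omega P\<close> and \<open>man P\<close>, so values of functions off these sets are irrelevant;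
  \<open>target P \<mu>\<close> and the reconstructed measures live on the whole space, because an
  approximate transport map need not preserve \<open>Omega P\<close>.
\<close>

definition transport_setting :: "problem \<Rightarrow> bool" where
  "transport_setting P \<longleftrightarrow>
     man_dim P < amb_dim P \<and> 0 < amb_bound P \<and>
     submanifold (amb_dim P) (man_dim P) (man P) \<and>
     compact (man P) \<and> connected (man P) \<and> man P \<subseteq> cube (amb_dim P) (amb_bound P) \<and>
     prob_space (par_law P) \<and>
     (\<exists>V q lo hi. riemannian_volume (man_dim P) (man P) V \<and> q \<in> borel_measurable V \<and>
        0 < lo \<and> (\<forall>\<mu>\<in>man P. lo \<le> q \<mu> \<and> q \<mu> \<le> hi) \<and>
        par_law P = density V (\<lambda>\<mu>. ennreal (q \<mu>))) \<and>
     1 \<le> space_dim P \<and> 0 < half_width P \<and>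
     ref_density P \<in> borel_measurable (dx P) \<and> (\<forall>x\<in>Omega P. 0 \<le> ref_density P x) \<and>
     prob_space (ref_measure P) \<and>
     (\<forall>\<mu>\<in>man P. prob_space (target P \<mu>) \<and> sets (target P \<mu>) = sets borel \<and>
        emeasure (target P \<mu>) (Omega P) = 1) \<and>
     divergence_realization (space_dim P) (half_width P) (ref_measure P) (gen_op P) (root_op P) \<and>
     (\<forall>\<mu>\<in>man P. kantorovich_potential (Omega P) (ref_measure P) (target P \<mu>) (potential P \<mu>) \<and>
        (LINT x|dx P. potential P \<mu> x) = 0 \<and>
        optimal_map (ref_measure P) (target P \<mu>) (transport_map P (potential P \<mu>)) \<and>
        (potential P \<mu>, signature P \<mu>) \<in> root_op P) \<and>
     1 \<le> rnk P \<and> 1 \<le> skel_size P \<and> 1 \<le> grid_size P \<and>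
     (\<forall>l<skel_size P. skel_pt P l \<in> man P) \<and> (\<forall>k<grid_size P. grid_pt P k \<in> Omega P) \<and>
     max_volume_selection P"

definition par_dist :: "problem \<Rightarrow> evec \<Rightarrow> evec \<Rightarrow> real" where
  "par_dist P = geodesic_dist (man P)"

definition fill_par :: "problem \<Rightarrow> real" where
  "fill_par P = (SUP \<mu>\<in>man P. Min ((\<lambda>l. par_dist P \<mu> (skel_pt P l)) ` {..<skel_size P}))"

definition fill_space :: "problem \<Rightarrow> real" where
  "fill_space P = (SUP x\<in>Omega P. Min ((\<lambda>k. norm (x - grid_pt P k)) ` {..<grid_size P}))"

definition Delta_cont :: "problem \<Rightarrow> real" where
  "Delta_cont P = Sup {\<bar>Determinant.det (kernel_mat P \<mu> x)\<bar> | \<mu> x.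
     (\<forall>s<rnk P. \<mu> s \<in> man P) \<and> (\<forall>t<rnk P. x t \<in> Omega P)}"

definition sing_val :: "problem \<Rightarrow> nat \<Rightarrow> real" where
  "sing_val P k = singular_value (dx P) (par_law P) (signature P) k"

definition basis :: "problem \<Rightarrow> nat \<Rightarrow> evec \<Rightarrow> real" where
  "basis P s = signature P (par_nodes P s)"

definition gram :: "problem \<Rightarrow> real Matrix.mat" where
  "gram P = Matrix.mat (rnk P) (rnk P) (\<lambda>(s, t). LINT x|dx P. basis P s x * basis P t x)"

definition gram_grid :: "problem \<Rightarrow> real Matrix.mat" where
  "gram_grid P = Matrix.mat (rnk P) (rnk P) (\<lambda>(s, t).
     (\<Sum>k<grid_size P. basis P s (grid_pt P k) * basis P t (grid_pt P k)) / real (grid_size P))"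

definition rhs_grid :: "problem \<Rightarrow> evec \<Rightarrow> real Matrix.vec" where
  "rhs_grid P \<mu> = Matrix.vec (rnk P) (\<lambda>s.
     (\<Sum>k<grid_size P. signature P \<mu> (grid_pt P k) * basis P s (grid_pt P k)) / real (grid_size P))"

definition coef :: "problem \<Rightarrow> evec \<Rightarrow> evec" where
  "coef P \<mu> = of_vec (the (mat_inverse (gram_grid P)) *\<^sub>v rhs_grid P \<mu>)"

definition lambda_min :: "real Matrix.mat \<Rightarrow> real" where
  "lambda_min A = Min {e. eigenvalue A e}"

definition lambda_max :: "real Matrix.mat \<Rightarrow> real" where
  "lambda_max A = Max {e. eigenvalue A e}"

definition pos_definite :: "real Matrix.mat \<Rightarrow> bool" where
  "pos_definite A \<longleftrightarrow> dim_row A = dim_col A \<and>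
     (\<forall>v\<in>carrier_vec (dim_row A). v \<noteq> 0\<^sub>v (dim_row A) \<longrightarrow> 0 < scalar_prod v (A *\<^sub>v v))"

text \<open>The least Lipschitz constant of \<open>f\<close> on \<open>S\<close> for the distance function \<open>\<delta>\<close>.\<close>

definition lip_const :: "('x \<Rightarrow> 'x \<Rightarrow> real) \<Rightarrow> 'x set \<Rightarrow> ('x \<Rightarrow> real) \<Rightarrow> real" where
  "lip_const \<delta> S f = Inf {l. 0 \<le> l \<and> (\<forall>x\<in>S. \<forall>y\<in>S. \<bar>f x - f y\<bar> \<le> l * \<delta> x y)}"

definition coef_lip :: "problem \<Rightarrow> real" where
  "coef_lip P = Max ((\<lambda>s. lip_const (par_dist P) (man P) (\<lambda>\<mu>. coord (coef P \<mu>) s)) ` {..<rnk P})"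

definition skeleton_kernel :: "problem \<Rightarrow> evec \<Rightarrow> evec \<Rightarrow> real" where
  "skeleton_kernel P \<mu> x =
     scalar_prod (Matrix.vec (rnk P) (\<lambda>t. signature P \<mu> (space_nodes P t)))
       (the (mat_inverse (kernel_mat P (par_nodes P) (space_nodes P)))
          *\<^sub>v Matrix.vec (rnk P) (\<lambda>s. signature P (par_nodes P s) x))"

definition kernel_regular :: "problem \<Rightarrow> real \<Rightarrow> real \<Rightarrow> bool" where
  "kernel_regular P Lip U \<longleftrightarrow> 0 < Delta_cont P \<and>
     0 < Lip \<and> (\<forall>\<mu>\<in>man P. \<forall>\<mu>'\<in>man P. \<forall>x\<in>Omega P. \<forall>x'\<in>Omega P.
        \<bar>signature P \<mu>' x' - signature P \<mu> x\<bar>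
          \<le> Lip * sqrt ((par_dist P \<mu> \<mu>')\<^sup>2 + (norm (x' - x))\<^sup>2)) \<and>
     0 < U \<and> (\<forall>\<mu>\<in>man P. \<forall>x\<in>Omega P. \<bar>signature P \<mu> x\<bar> \<le> U)"

text \<open>The largest eigenvalue of the Gram matrix is a real number, so its finiteness is automatic.\<close>

definition quadrature_regular :: "problem \<Rightarrow> real \<Rightarrow> real \<Rightarrow> real \<Rightarrow> bool" where
  "quadrature_regular P Lip U (Cq :: real) \<longleftrightarrow>
     pos_definite (gram P) \<and> 0 < lambda_min (gram P) \<and> 0 < Cq \<and>
     (\<forall>f. (\<exists>l. l-lipschitz_on (Omega P) f) \<longrightarrow>
        \<bar>(LINT x|dx P. f x) - (\<Sum>k<grid_size P. f (grid_pt P k)) / real (grid_size P)\<bar>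
          \<le> Cq * lip_const dist (Omega P) f * fill_space P) \<and>
     fill_space P \<le> lambda_min (gram P) / (4 * Cq * real (rnk P) * U * Lip)"

definition volume_condition :: "problem \<Rightarrow> real \<Rightarrow> bool" where
  "volume_condition P \<theta> \<longleftrightarrow> 0 < \<theta> \<and> \<theta> \<le> 1 \<and>
     \<bar>Determinant.det (kernel_mat P (par_nodes P) (space_nodes P))\<bar> \<ge> \<theta> * Delta_cont P"

definition skeleton_accurate :: "problem \<Rightarrow> real \<Rightarrow> real \<Rightarrow> bool" where
  "skeleton_accurate P \<theta> C \<longleftrightarrow> (\<forall>\<mu>\<in>man P. \<forall>x\<in>Omega P.
     \<bar>signature P \<mu> x - skeleton_kernel P \<mu> x\<bar> \<le> C * (real (rnk P) + 1) / \<theta> * sing_val P (rnk P + 1))"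

definition sample_law :: "problem \<Rightarrow> nat \<Rightarrow> (nat \<Rightarrow> evec) measure" where
  "sample_law P n = PiM {..<n} (\<lambda>_. par_law P)"

definition emp_risk :: "problem \<Rightarrow> nat \<Rightarrow> (nat \<Rightarrow> evec) \<Rightarrow> (evec \<Rightarrow> evec) \<Rightarrow> real" where
  "emp_risk P n X S = (\<Sum>j<n. (norm (S (X j) - coef P (X j)))\<^sup>2) / real n"

definition erm_estimator ::
    "problem \<Rightarrow> nat \<Rightarrow> (evec \<Rightarrow> evec) set \<Rightarrow> ((nat \<Rightarrow> evec) \<Rightarrow> evec \<Rightarrow> evec) \<Rightarrow> bool" where
  "erm_estimator P n F ahat \<longleftrightarrow>
     (\<lambda>(X, \<mu>). ahat X \<mu>) \<in> measurable (sample_law P n \<Otimes>\<^sub>M par_law P) borel \<and>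
     (\<forall>X\<in>space (sample_law P n). ahat X \<in> F \<and> (\<forall>S\<in>F. emp_risk P n X (ahat X) \<le> emp_risk P n X S))"

definition recon_signature :: "problem \<Rightarrow> (evec \<Rightarrow> evec) \<Rightarrow> evec \<Rightarrow> evec \<Rightarrow> real" where
  "recon_signature P a \<mu> x = (\<Sum>s<rnk P. coord (a \<mu>) s * basis P s x)"

definition recon_measure :: "problem \<Rightarrow> (evec \<Rightarrow> evec) \<Rightarrow> evec \<Rightarrow> evec measure" where
  "recon_measure P a \<mu> =
     distr (ref_measure P) borel (transport_map P (op_inv (root_op P) (recon_signature P a \<mu>)))"

definition expected_error :: "problem \<Rightarrow> nat \<Rightarrow> ((nat \<Rightarrow> evec) \<Rightarrow> evec \<Rightarrow> evec) \<Rightarrow> ennreal" where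
  "expected_error P n ahat =
     (\<integral>\<^sup>+X. (\<integral>\<^sup>+\<mu>. W2_sq (target P \<mu>) (recon_measure P (ahat X) \<mu>) \<partial>par_law P) \<partial>sample_law P n)"

end

theory Submission
  imports Defs
begin

text \<open>
  Since \<open>(I - L)^(1/2)\<close> turns an error in the signature into an error of the transport maps, the squared
  Wasserstein error is at most the squared \<open>L2\<close> error of the reconstructed signature.  The latter splits
  into the distance of the signature to its discrete least-squares fit, which the skeleton approximation and the
  quadrature error control, and \<open>\<Gamma>\<close> times the squared error of the learned coefficients.

  The coefficient maps are Lipschitz on the manifold, because the geodesic distance is comparable to the
  Euclidean one.  A McShane extension over an \<open>\<epsilon>\<close>-net, with about \<open>\<epsilon>^(-d)\<close> points, is a minimum of
  finitely many piecewise linear functions and hence a sparse network.  An exponential moment bound over the finitely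
  many networks with rounded weights gives the estimation error, and \<open>\<epsilon> = n powr (-1/(2+d))\<close> balances both errors.

  The volume condition holds since the determinant of maximal volume, moved to the nearest sample points,
  changes by a quantity controlled by Hadamard's inequality.
\<close>

section \<open>Finitely supported vectors\<close>

text \<open>The obstacle is uniformity: the constant \<open>c\<close> may depend on the manifold and
  on the Lipschitz radius of the coefficients, but neither on \<open>r\<close> nor on the bounds of
  the kernel, and the size bounds may carry only factors depending on \<open>d\<close> and
  logarithms. At the selected nodes the coefficient vectors are unit vectors. Hence Lipschitz radius
  and diameter bound all coefficients; they also separate the nodes, which bounds the rank, and the
  constants of the finitely many ranks are summed. Constants in the network sizes are absorbed by
  one logarithm for large \<open>n\<close>; for small \<open>n\<close> networks of size one are
  covered by the trivial error bound. The slope of the extension, which bounded weights cannot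
  carry, is produced by doubling layers.

  Two smaller obstacles: the output bound may equal the bound on the coefficients exactly, so a
  slightly shrunk coefficient map is approximated; and \<open>grad\<close> is an arbitrary choice of
  weak gradient, so its linearity up to null sets has to come from uniqueness, which is what the
  smooth bump functions are for.\<close>

lemma coord_unit_evec [simp]: "coord (unit_evec i) j = (if j = i then 1 else 0)"
  by (auto simp: unit_evec_def)

lemma coord_sum [simp]: "coord (\<Sum>i\<in>A. f i) j = (\<Sum>i\<in>A. coord (f i) j)"
  by (induction A rule: infinite_finite_induct) auto

lemma unit_evec_Rn: "i < n \<Longrightarrow> unit_evec i \<in> Rn n"
  by (auto simp: Rn_def)

lemma inner_unit_evec [simp]: "inner (unit_evec i) x = coord x i"
proof -
  have "inner (unit_evec i) x = (\<Sum>j<Suc i. coord (unit_evec i) j * coord x j)"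
    by (intro inner_Rn unit_evec_Rn) simp
  also have "\<dots> = coord x i" by (subst sum.lessThan_Suc) simp
  finally show ?thesis .
qed

lemma norm_unit_evec [simp]: "norm (unit_evec i) = 1"
  by (simp add: norm_eq_sqrt_inner)

lemma abs_coord_le_norm: "\<bar>coord x i\<bar> \<le> norm x"
  using Cauchy_Schwarz_ineq2[of "unit_evec i" x] by simp

lemma bounded_linear_coord: "bounded_linear (\<lambda>x. coord x i)"
  using bounded_linear_inner_right[of "unit_evec i"] by simp

lemmas continuous_on_coord [continuous_intros] =
  bounded_linear.continuous_on[OF bounded_linear_coord]

lemma of_coords_eq_sum: "of_coords n f = (\<Sum>i<n. f i *\<^sub>R unit_evec i)"
proof (rule evec_eqI)
  fix j
  have "(\<Sum>i<n. f i * (if j = i then 1 else 0)) = (if j < n then f j else 0)"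
    by (simp add: sum.delta if_distrib cong: if_cong)
  then show "coord (of_coords n f) j = coord (\<Sum>i<n. f i *\<^sub>R unit_evec i) j" by simp
qed

lemma of_coords_Rn [simp]: "of_coords n f \<in> Rn n"
  by (auto simp: Rn_def)

lemma of_coords_coord: "x \<in> Rn n \<Longrightarrow> of_coords n (coord x) = x"
  by (rule evec_eqI) (auto simp: Rn_def)

lemma Rn_0 [simp]: "0 \<in> Rn n"
  and Rn_add: "x \<in> Rn n \<Longrightarrow> y \<in> Rn n \<Longrightarrow> x + y \<in> Rn n"
  and Rn_diff: "x \<in> Rn n \<Longrightarrow> y \<in> Rn n \<Longrightarrow> x - y \<in> Rn n"
  and Rn_scaleR: "x \<in> Rn n \<Longrightarrow> c *\<^sub>R x \<in> Rn n"
  by (auto simp: Rn_def)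

lemma Rn_exhaust: "\<exists>n. x \<in> Rn n"
proof -
  obtain n where "{i. coord x i \<noteq> 0} \<subseteq> {..<n}"
    using finite_coord[of x] finite_nat_iff_bounded by auto
  then have "x \<in> Rn n" by (auto simp: Rn_def not_le[symmetric])
  then show ?thesis ..
qed

lemma norm_le_sum_coord:
  assumes "x \<in> Rn n"
  shows "norm x \<le> (\<Sum>i<n. \<bar>coord x i\<bar>)"
proof -
  have "norm x = norm (\<Sum>i<n. coord x i *\<^sub>R unit_evec i)"
    using of_coords_coord[OF assms] by (simp add: of_coords_eq_sum)
  also have "\<dots> \<le> (\<Sum>i<n. norm (coord x i *\<^sub>R unit_evec i))" by (rule norm_sum)
  finally show ?thesis by simp
qed

lemma closed_Rn: "closed (Rn n)"
proof -
  have "Rn n = (\<Inter>i\<in>{n..}. {x. coord x i = 0})" by (auto simp: Rn_def)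
  moreover have "closed {x. coord x i = 0}" for i
    by (intro closed_Collect_eq continuous_intros)
  ultimately show ?thesis by auto
qed

text \<open>\<open>evec\<close> is infinite-dimensional, so closed bounded sets need not be compact;
  compactness is available only inside some \<open>Rn n\<close>. The cube with one more coordinate
  is the continuous image of the product of a smaller cube and an interval.\<close>

lemma compact_cube: "compact (cube n a)"
proof (induction n)
  case 0
  have "cube 0 a = {0}" by (auto simp: cube_def Rn_def intro: evec_eqI)
  then show ?case by simp
next
  case (Suc n)
  let ?f = "\<lambda>(x, t). x + t *\<^sub>R unit_evec n"
  have "cube (Suc n) a = ?f ` (cube n a \<times> {-a..a})"
  proof (intro equalityI subsetI)
    fix x assume x: "x \<in> cube (Suc n) a"
    let ?y = "x - coord x n *\<^sub>R unit_evec n"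
    have "coord ?y i = 0" if "n \<le> i" for i
      using x that by (cases "i = n") (auto simp: cube_def Rn_def)
    moreover have "\<bar>coord ?y i\<bar> \<le> a" if "i < n" for i using x that by (auto simp: cube_def)
    ultimately have "?y \<in> cube n a" unfolding cube_def Rn_def by blast
    moreover have "\<bar>coord x n\<bar> \<le> a" using x by (auto simp: cube_def)
    ultimately have "(?y, coord x n) \<in> cube n a \<times> {-a..a}" by auto
    then show "x \<in> ?f ` (cube n a \<times> {-a..a})"
      by (rule rev_image_eqI) simp
  next
    fix x assume "x \<in> ?f ` (cube n a \<times> {-a..a})"
    then obtain y t where x: "x = y + t *\<^sub>R unit_evec n" and y: "y \<in> cube n a" "\<bar>t\<bar> \<le> a"
      by (auto simp: abs_le_iff)
    have "coord x i = 0" if "Suc n \<le> i" for i using y that by (auto simp: x cube_def Rn_def)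
    moreover have "\<bar>coord x i\<bar> \<le> a" if "i < Suc n" for i
      using y that by (cases "i = n") (auto simp: x cube_def Rn_def)
    ultimately show "x \<in> cube (Suc n) a" unfolding cube_def Rn_def by blast
  qed
  moreover have "compact (?f ` (cube n a \<times> {-a..a}))"
    by (intro compact_continuous_image compact_Times Suc compact_Icc)
      (auto intro!: continuous_intros simp: case_prod_unfold)
  ultimately show ?case by simp
qed

lemma compact_closed_subset_cube: "closed S \<Longrightarrow> S \<subseteq> cube n a \<Longrightarrow> compact S"
  by (metis closed_Int_compact compact_cube inf.absorb1)

lemma cball_Rn_subset_cube: "x \<in> Rn n \<Longrightarrow> norm x \<le> a \<Longrightarrow> x \<in> cube n a"
  unfolding cube_def by (auto intro: order_trans[OF abs_coord_le_norm])

text \<open>The space is the countable union of the cubes with integer half-width in all dimensions,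
  and each of them is totally bounded. Collecting finite nets for all accuracies
  \<open>1 / (m + 1)\<close> gives a countable dense set.\<close>

lemma separable_evec: "\<exists>C::evec set. countable C \<and> (\<forall>x. \<forall>e>0. \<exists>y\<in>C. dist x y < e)"
proof -
  have "\<exists>k. finite k \<and> cube n (real a) \<subseteq> (\<Union>x\<in>k. ball x (1 / real (Suc m)))"
    for n a m
  proof -
    have "0 < 1 / real (Suc m)" by simp
    with compact_cube[of n "real a"] show ?thesis
      unfolding compact_eq_totally_bounded by blast
  qed
  then obtain K where K: "\<And>n a m. finite (K n a m)"
    "\<And>n a m. cube n (real a) \<subseteq> (\<Union>x\<in>K n a m. ball x (1 / real (Suc m)))"
    by metis
  let ?C = "\<Union>n a m. K n a m"
  have "countable ?C" by (intro countable_UN countableI_type countable_finite K(1))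
  moreover have "\<exists>y\<in>?C. dist x y < e" if e: "0 < e" for x :: evec and e
  proof -
    obtain n where n: "x \<in> Rn n" using Rn_exhaust by blast
    obtain a where "norm x \<le> real a" using real_arch_simple by blast
    with n have "x \<in> cube n (real a)" by (rule cball_Rn_subset_cube)
    moreover obtain m where "1 / real (Suc m) < e"
      using nat_approx_posE[OF e] by blast
    ultimately obtain y where "y \<in> K n a m" "dist y x < e"
      using K(2)[where n = n and a = a and m = m] by force
    then have "y \<in> ?C" "dist x y < e" by (auto simp: dist_commute)
    then show ?thesis ..
  qed
  ultimately show ?thesis by blast
qed

text \<open>Second countability is what makes sums, differences and pairs of Borel maps into
  \<open>evec\<close> measurable again; the measure theory below relies on it throughout.\<close>

instance evec :: second_countable_topology
proof
  obtain C :: "evec set" where C: "countable C" "\<And>x e. 0 < e \<Longrightarrow> \<exists>y\<in>C. dist x y < e"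
    using separable_evec by metis
  let ?B = "(\<lambda>(y, m). ball y (1 / real (Suc m))) ` (C \<times> (UNIV :: nat set))"
  have "topological_basis ?B"
  proof (rule topological_basisI)
    show "open b" if "b \<in> ?B" for b using that by auto
    fix S :: "evec set" and x assume "open S" "x \<in> S"
    then obtain e where e: "0 < e" "ball x e \<subseteq> S" by (meson openE)
    obtain m where m: "1 / real (Suc m) < e / 2"
      using e by (metis half_gt_zero nat_approx_posE of_nat_Suc)
    obtain y where y: "y \<in> C" "dist x y < 1 / real (Suc m)"
      using C(2)[of "1 / real (Suc m)" x] by auto
    have "ball y (1 / real (Suc m)) \<subseteq> ball x e"
    proof
      fix z assume "z \<in> ball y (1 / real (Suc m))"
      then show "z \<in> ball x e" using y m dist_triangle[of x z y] by simp
    qed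
    then show "\<exists>B'\<in>?B. x \<in> B' \<and> B' \<subseteq> S"
      using y e by (intro bexI[of _ "ball y (1 / real (Suc m))"]) (auto simp: dist_commute)
  qed
  moreover have "countable ?B" using C(1) by auto
  ultimately show "\<exists>B::evec set set. countable B \<and> open = generate_topology B"
    by (intro exI[of _ ?B] conjI topological_basis_imp_subbasis)
qed

lemma borel_measurable_coord [measurable]: "(\<lambda>x. coord x i) \<in> borel_measurable borel"
  by (intro borel_measurable_continuous_onI continuous_intros)

lemma measurable_of_coords [measurable]:
  "of_coords n \<in> measurable (PiM {..<n} (\<lambda>_. lborel)) borel"
  unfolding of_coords_eq_sum[abs_def]
  by (intro borel_measurable_sum borel_measurable_scaleR) (auto intro!: measurable_component_singleton)

section \<open>Smooth bump functions\<close>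

text \<open>Quantifying over a derivative function, instead of iterating a derivative operator, lets
  the closure rules for sums, products and affine substitutions be proved by plain induction on the
  order.\<close>

primrec diff_times :: "nat \<Rightarrow> (real \<Rightarrow> real) \<Rightarrow> bool" where
  "diff_times 0 h \<longleftrightarrow> continuous_on UNIV h"
| "diff_times (Suc k) h \<longleftrightarrow> (\<exists>h'. (\<forall>x. (h has_real_derivative h' x) (at x)) \<and> diff_times k h')"

lemma diff_times_SucI:
  "(\<And>x. (h has_real_derivative h' x) (at x)) \<Longrightarrow> diff_times k h' \<Longrightarrow> diff_times (Suc k) h"
  unfolding diff_times.simps by (intro exI[of _ h']) simp

lemma diff_times_Suc_imp: "diff_times (Suc k) h \<Longrightarrow> diff_times k h"
proof (induction k arbitrary: h)
  case 0
  then show ?case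
    by (fastforce intro: continuous_at_imp_continuous_on DERIV_isCont)
next
  case (Suc k)
  from Suc.prems obtain h' where h': "\<And>x. (h has_real_derivative h' x) (at x)"
    and d: "diff_times (Suc k) h'" unfolding diff_times.simps(2)[of "Suc k"] by blast
  have "diff_times k h'" using d by (rule Suc.IH)
  with h' show ?case by (rule diff_times_SucI)
qed

lemma diff_times_continuous: "diff_times k h \<Longrightarrow> continuous_on UNIV h"
  by (induction k) (use diff_times_Suc_imp in auto)

lemma diff_times_add: "diff_times k f \<Longrightarrow> diff_times k g \<Longrightarrow> diff_times k (\<lambda>x. f x + g x)"
proof (induction k arbitrary: f g)
  case 0 then show ?case by (auto intro: continuous_intros)
next
  case (Suc k)
  obtain f' where f': "\<And>x. (f has_real_derivative f' x) (at x)" "diff_times k f'"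
    using Suc.prems(1) by auto
  obtain g' where g': "\<And>x. (g has_real_derivative g' x) (at x)" "diff_times k g'"
    using Suc.prems(2) by auto
  have "((\<lambda>x. f x + g x) has_real_derivative f' x + g' x) (at x)" for x
    by (intro derivative_intros f' g')
  then show ?case using Suc.IH[OF f'(2) g'(2)] by (rule diff_times_SucI)
qed

lemma diff_times_mult: "diff_times k f \<Longrightarrow> diff_times k g \<Longrightarrow> diff_times k (\<lambda>x. f x * g x)"
proof (induction k arbitrary: f g)
  case 0 then show ?case by (auto intro: continuous_intros)
next
  case (Suc k)
  obtain f' where f': "\<And>x. (f has_real_derivative f' x) (at x)" "diff_times k f'"
    using Suc.prems(1) by auto
  obtain g' where g': "\<And>x. (g has_real_derivative g' x) (at x)" "diff_times k g'"
    using Suc.prems(2) by auto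
  have "((\<lambda>x. f x * g x) has_real_derivative f' x * g x + f x * g' x) (at x)" for x
    by (rule derivative_eq_intros f' g' refl | simp)+
  moreover have "diff_times k (\<lambda>x. f' x * g x + f x * g' x)"
    using diff_times_add[OF Suc.IH[OF f'(2) diff_times_Suc_imp[OF Suc.prems(2)]]
        Suc.IH[OF diff_times_Suc_imp[OF Suc.prems(1)] g'(2)]] .
  ultimately show ?case by (rule diff_times_SucI)
qed

lemma diff_times_const: "diff_times k (\<lambda>_. c)"
  by (induction k arbitrary: c) (auto intro!: exI[of _ "\<lambda>_. 0"])

lemma diff_times_affine: "diff_times k h \<Longrightarrow> diff_times k (\<lambda>x. h (c * x + e))"
proof (induction k arbitrary: h)
  case 0
  have "continuous_on UNIV (h \<circ> (\<lambda>x. c * x + e))"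
    by (rule continuous_on_compose) (use 0 in \<open>auto intro: continuous_intros continuous_on_subset\<close>)
  then show ?case by (simp add: o_def)
next
  case (Suc k)
  obtain h' where h': "\<And>x. (h has_real_derivative h' x) (at x)" "diff_times k h'"
    using Suc.prems by auto
  have "((\<lambda>x. h (c * x + e)) has_real_derivative h' (c * x + e) * c) (at x)" for x
    by (rule DERIV_chain2[OF h'(1)]) (auto intro!: derivative_eq_intros)
  moreover have "diff_times k (\<lambda>x. h' (c * x + e) * c)"
    by (intro diff_times_mult diff_times_const Suc.IH h')
  ultimately show ?case by (rule diff_times_SucI)
qed

text \<open>The classical flat function \<open>exp (- (1 / t))\<close> with a polynomial prefactor
  in \<open>1 / t\<close>. The prefactor makes the family closed under differentiation, so one
  induction settles all derivatives.\<close>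

definition poly_bump :: "real poly \<Rightarrow> real \<Rightarrow> real" where
  "poly_bump p t = (if 0 < t then poly p (1 / t) * exp (- (1 / t)) else 0)"

lemma poly_exp_tendsto_0: "((\<lambda>x. poly p x * exp (- x)) \<longlongrightarrow> (0::real)) at_top"
proof -
  have "((\<lambda>x. \<Sum>i\<le>degree p. coeff p i * (x ^ i / exp x)) \<longlongrightarrow> (\<Sum>i\<le>degree p. coeff p i * 0)) at_top"
    by (intro tendsto_sum tendsto_mult tendsto_const tendsto_power_div_exp_0)
  then show ?thesis
    by (simp add: poly_altdef sum_distrib_right exp_minus divide_inverse mult.assoc)
qed

lemma poly_bump_tendsto_0: "(poly_bump p \<longlongrightarrow> 0) (at 0)"
proof -
  have "((\<lambda>t. poly p (inverse t) * exp (- inverse t)) \<longlongrightarrow> 0) (at_right (0::real))"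
    by (rule filterlim_compose[OF poly_exp_tendsto_0 filterlim_inverse_at_top_right])
  then have "(poly_bump p \<longlongrightarrow> 0) (at_right 0)"
    by (rule Lim_transform_eventually)
      (auto simp: eventually_at_filter poly_bump_def inverse_eq_divide)
  moreover have "(poly_bump p \<longlongrightarrow> 0) (at_left 0)"
    by (rule Lim_transform_eventually[OF tendsto_const])
      (auto simp: eventually_at_filter poly_bump_def)
  ultimately show ?thesis by (simp add: filterlim_split_at)
qed

text \<open>For positive arguments the chain rule yields 1/t^2 times p(1/t) - p'(1/t), whence the
  polynomial \<open>[:0, 0, 1:] * (p - pderiv p)\<close>. Only the point \<open>0\<close>, where the
  two branches meet, needs a limit.\<close>

lemma poly_bump_deriv:
  "(poly_bump p has_real_derivative poly_bump ([:0, 0, 1:] * (p - pderiv p)) x) (at x)"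
proof -
  consider "x > 0" | "x < 0" | "x = 0" by linarith
  then show ?thesis
  proof cases
    case 1
    have "((\<lambda>t. poly p (1 / t) * exp (- (1 / t))) has_real_derivative
        poly ([:0, 0, 1:] * (p - pderiv p)) (1 / x) * exp (- (1 / x))) (at x)"
      using 1 by (auto intro!: derivative_eq_intros simp: field_simps power2_eq_square)
    moreover have "\<forall>\<^sub>F t in nhds x. t > 0" using 1 eventually_nhds_in_open[of "{0<..}" x] by auto
    then have "\<forall>\<^sub>F t in nhds x. poly p (1 / t) * exp (- (1 / t)) = poly_bump p t"
      by eventually_elim (auto simp: poly_bump_def)
    ultimately show ?thesis using 1
      by (subst (asm) DERIV_cong_ev[OF refl _ refl]) (auto simp: poly_bump_def)
  next
    case 2
    have "((\<lambda>t. 0) has_real_derivative 0) (at x)" by simp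
    moreover have "\<forall>\<^sub>F t in nhds x. t < 0" using 2 eventually_nhds_in_open[of "{..<0}" x] by auto
    then have "\<forall>\<^sub>F t in nhds x. 0 = poly_bump p t"
      by eventually_elim (auto simp: poly_bump_def)
    ultimately show ?thesis using 2
      by (subst (asm) DERIV_cong_ev[OF refl _ refl]) (auto simp: poly_bump_def)
  next
    case 3
    \<comment> \<open>Dividing by \<open>t\<close> multiplies the polynomial by its variable, so the
      difference quotient at \<open>0\<close> is again a member of the family, and it tends to
      \<open>0\<close>.\<close>
    have "((\<lambda>t. poly_bump ([:0, 1:] * p) t) \<longlongrightarrow> 0) (at 0)" by (rule poly_bump_tendsto_0)
    then have "((\<lambda>t. (poly_bump p t - poly_bump p 0) / (t - 0)) \<longlongrightarrow> 0) (at 0)"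
      by (rule Lim_transform_eventually) (auto simp: eventually_at_filter poly_bump_def)
    then show ?thesis using 3 by (simp add: has_field_derivative_iff poly_bump_def)
  qed
qed

lemma diff_times_poly_bump: "diff_times k (poly_bump p)"
proof (induction k arbitrary: p)
  case 0
  show ?case
    by (auto intro!: continuous_at_imp_continuous_on DERIV_isCont[OF poly_bump_deriv])
next
  case (Suc k)
  show ?case by (rule diff_times_SucI[OF poly_bump_deriv Suc])
qed

text \<open>Smoothness is defined through iterated partial derivatives \<open>pd\<close>. Tensor
  products suit it: a partial derivative differentiates one factor and leaves the form
  unchanged.\<close>

definition coord_prod :: "nat \<Rightarrow> (nat \<Rightarrow> real \<Rightarrow> real) \<Rightarrow> evec \<Rightarrow> real" where
  "coord_prod n h x = (\<Prod>i<n. h i (coord x i))"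

lemma coord_prod_has_deriv:
  assumes "i < n" and h': "\<And>s. (h i has_real_derivative h' s) (at s)"
  shows "((\<lambda>t. coord_prod n h (x + t *\<^sub>R unit_evec i)) has_vector_derivative
    coord_prod n (h(i := h')) x) (at 0)"
proof -
  have split: "coord_prod n g y = g i (coord y i) * (\<Prod>j\<in>{..<n}-{i}. g j (coord y j))" for g y
    unfolding coord_prod_def using assms(1) by (subst prod.remove[of _ i]) auto
  have "((\<lambda>t. h i (coord x i + t)) has_real_derivative h' (coord x i) * 1) (at 0)"
    by (rule DERIV_chain2[where f = "h i"]) (auto intro!: derivative_eq_intros h')
  then have "((\<lambda>t. h i (coord x i + t) * (\<Prod>j\<in>{..<n}-{i}. h j (coord x j))) has_real_derivative
      h' (coord x i) * (\<Prod>j\<in>{..<n}-{i}. h j (coord x j))) (at 0)"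
    by (auto intro!: derivative_eq_intros)
  moreover have "coord_prod n h (x + t *\<^sub>R unit_evec i)
      = h i (coord x i + t) * (\<Prod>j\<in>{..<n}-{i}. h j (coord x j))" for t
    by (subst split) (auto intro!: prod.cong)
  moreover have "coord_prod n (h(i := h')) x = h' (coord x i) * (\<Prod>j\<in>{..<n}-{i}. h j (coord x j))"
    by (subst split) (auto intro!: prod.cong)
  ultimately show ?thesis by (simp add: has_real_derivative_iff_has_vector_derivative)
qed

lemma C_k_on_coord_prod:
  "(\<And>i. i < n \<Longrightarrow> diff_times k (h i)) \<Longrightarrow> C_k_on k n U (coord_prod n h)"
proof (induction k arbitrary: h)
  have cont: "continuous_on U (coord_prod n h)" if "\<And>i. i < n \<Longrightarrow> diff_times k (h i)" for k h
    unfolding coord_prod_def[abs_def]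
  proof (intro continuous_on_prod)
    fix i assume "i \<in> {..<n}"
    then have "continuous_on UNIV (h i)" using that diff_times_continuous by auto
    then show "continuous_on U (\<lambda>x. h i (coord x i))"
      by (rule continuous_on_compose2) (auto intro!: continuous_intros)
  qed
  {
    case 0
    show ?case unfolding C_k_on.simps by (rule cont[where k = 0]) (use 0 in blast)
  next
    case (Suc k)
    have "(\<lambda>t. coord_prod n h (x + t *\<^sub>R unit_evec i)) differentiable (at 0)
        \<and> C_k_on k n U (pd i (coord_prod n h))" if i: "i < n" for i x
    proof -
      obtain h' where h': "\<And>s. (h i has_real_derivative h' s) (at s)" and d: "diff_times k h'"
        using Suc.prems[OF i] by auto
      have D: "((\<lambda>t. coord_prod n h (x + t *\<^sub>R unit_evec i)) has_vector_derivative
          coord_prod n (h(i := h')) x) (at 0)" for x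
        using i h' by (rule coord_prod_has_deriv)
      have "pd i (coord_prod n h) = coord_prod n (h(i := h'))"
        unfolding pd_def using vector_derivative_at[OF D] by auto
      moreover have "C_k_on k n U (coord_prod n (h(i := h')))"
        by (rule Suc.IH) (use Suc.prems d diff_times_Suc_imp in auto)
      ultimately show ?thesis
        using D by (metis differentiableI_vector)
    qed
    then show ?case using cont[OF Suc.prems] by auto
  }
qed

lemma smooth_on_coord_prod:
  "(\<And>i k. i < n \<Longrightarrow> diff_times k (h i)) \<Longrightarrow> smooth_on n U (coord_prod n h)"
  by (simp add: smooth_on_def C_k_on_coord_prod)

section \<open>Boxes and bump functions supported in them\<close>

definition evec_box :: "nat \<Rightarrow> (nat \<Rightarrow> real) \<Rightarrow> (nat \<Rightarrow> real) \<Rightarrow> evec set" where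
  "evec_box n l u = {x \<in> Rn n. \<forall>i<n. l i < coord x i \<and> coord x i < u i}"

definition evec_cbox :: "nat \<Rightarrow> (nat \<Rightarrow> real) \<Rightarrow> (nat \<Rightarrow> real) \<Rightarrow> evec set" where
  "evec_cbox n l u = {x \<in> Rn n. \<forall>i<n. l i \<le> coord x i \<and> coord x i \<le> u i}"

lemma open_cube_eq_box: "open_cube n a = evec_box n (\<lambda>_. -a) (\<lambda>_. a)"
  unfolding open_cube_def evec_box_def abs_less_iff by auto

lemma closed_evec_cbox: "closed (evec_cbox n l u)"
proof -
  have "evec_cbox n l u = Rn n \<inter> (\<Inter>i\<in>{..<n}. {x. l i \<le> coord x i} \<inter> {x. coord x i \<le> u i})"
    by (auto simp: evec_cbox_def)
  moreover have "closed {x. l i \<le> coord x i}" "closed {x. coord x i \<le> u i}" for i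
    by (intro closed_Collect_le continuous_intros)+
  ultimately show ?thesis by (simp only:) (intro closed_Int closed_Rn closed_INT ballI)
qed

lemma compact_evec_cbox:
  assumes "\<And>i. i < n \<Longrightarrow> - a \<le> l i \<and> u i \<le> a"
  shows "compact (evec_cbox n l u)"
proof (rule compact_closed_subset_cube[OF closed_evec_cbox])
  show "evec_cbox n l u \<subseteq> cube n a"
    using assms by (fastforce simp: evec_cbox_def cube_def abs_le_iff)
qed

text \<open>The factor \<open>Suc k\<close> steepens the flanks: inside the open box the product of
  terms \<open>exp (- 1 / (Suc k * s))\<close> tends to one, off the box it vanishes. So these
  functions converge boundedly to the indicator of the open box.\<close>

definition box_bump :: "nat \<Rightarrow> (nat \<Rightarrow> real) \<Rightarrow> (nat \<Rightarrow> real) \<Rightarrow> nat \<Rightarrow> evec \<Rightarrow> real" where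
  "box_bump n l u k = coord_prod n (\<lambda>i t. poly_bump 1 (real (Suc k) * (t - l i)) * poly_bump 1 (real (Suc k) * (u i - t)))"

lemma poly_bump_1_bounds: "0 \<le> poly_bump 1 t" "poly_bump 1 t \<le> 1"
  by (auto simp: poly_bump_def)

lemma box_bump_bounds: "0 \<le> box_bump n l u k x" "box_bump n l u k x \<le> 1"
  unfolding box_bump_def coord_prod_def
  by (auto intro!: prod_nonneg prod_le_1 mult_nonneg_nonneg mult_le_one poly_bump_1_bounds)

lemma box_bump_zero: "x \<in> Rn n \<Longrightarrow> x \<notin> evec_box n l u \<Longrightarrow> box_bump n l u k x = 0"
  unfolding box_bump_def coord_prod_def evec_box_def
  by (auto simp: poly_bump_def not_less zero_less_mult_iff intro!: bexI)

lemma box_bump_tendsto: "x \<in> evec_box n l u \<Longrightarrow> (\<lambda>k. box_bump n l u k x) \<longlonglongrightarrow> 1"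
proof -
  assume x: "x \<in> evec_box n l u"
  have *: "(\<lambda>k. poly_bump 1 (real (Suc k) * t)) \<longlonglongrightarrow> 1" if "0 < t" for t
  proof -
    have "(\<lambda>k. exp (- ((1 / t) * (1 / real (Suc k))))) \<longlonglongrightarrow> exp (- ((1 / t) * 0))"
      by (intro tendsto_intros LIMSEQ_Suc[OF lim_1_over_n])
    then show ?thesis using that by (simp add: poly_bump_def mult.commute)
  qed
  have "(\<lambda>k. box_bump n l u k x) \<longlonglongrightarrow> (\<Prod>i<n. 1 * 1)"
    unfolding box_bump_def coord_prod_def
    by (intro tendsto_prod tendsto_mult *) (use x in \<open>auto simp: evec_box_def\<close>)
  then show ?thesis by simp
qed

lemma test_fun_box_bump:
  assumes "\<And>i. i < n \<Longrightarrow> - a < l i \<and> u i < a"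
  shows "test_fun n a (box_bump n l u k)"
  unfolding test_fun_def
proof (intro conjI exI[of _ "evec_cbox n l u"])
  show "smooth_on n (Rn n) (box_bump n l u k)"
    unfolding box_bump_def
  proof (intro smooth_on_coord_prod diff_times_mult)
    fix i j
    show "diff_times j (\<lambda>t. poly_bump 1 (real (Suc k) * (t - l i)))"
      using diff_times_affine[OF diff_times_poly_bump, of j 1 "real (Suc k)" "- real (Suc k) * l i"]
      by (simp add: algebra_simps)
    show "diff_times j (\<lambda>t. poly_bump 1 (real (Suc k) * (u i - t)))"
      using diff_times_affine[OF diff_times_poly_bump, of j 1 "- real (Suc k)" "real (Suc k) * u i"]
      by (simp add: algebra_simps)
  qed
  show "compact (evec_cbox n l u)"
    by (rule compact_evec_cbox[of _ a]) (use assms in force)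
  show "evec_cbox n l u \<subseteq> open_cube n a"
    using assms unfolding evec_cbox_def open_cube_def abs_less_iff by fastforce
  show "\<forall>x\<in>Rn n - evec_cbox n l u. box_bump n l u k x = 0"
    by (auto intro!: box_bump_zero simp: evec_cbox_def evec_box_def less_imp_le)
qed

section \<open>Weak derivatives on a cube\<close>

lemma cube_borel [measurable]: "cube n a \<in> sets borel"
  using compact_cube by (auto intro: borel_closed compact_imp_closed)

lemma sets_unif_cube: "sets (unif_cube n a) = sets (restrict_space borel (cube n a))"
  unfolding unif_cube_def lborel_n_def
  by (intro sets_restrict_space_cong) (simp add: sets_uniform_measure)

lemma space_unif_cube [simp]: "space (unif_cube n a) = cube n a"
  using sets_eq_imp_space_eq[OF sets_unif_cube] by (simp add: space_restrict_space)

lemma borel_measurable_unif_cube: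
  "f \<in> measurable borel N \<Longrightarrow> f \<in> measurable (unif_cube n a) N"
  by (subst measurable_cong_sets[OF sets_unif_cube refl]) (rule measurable_restrict_space1)

lemma in_sets_unif_cube: "A \<in> sets borel \<Longrightarrow> A \<subseteq> cube n a \<Longrightarrow> A \<in> sets (unif_cube n a)"
  by (auto simp: sets_unif_cube sets_restrict_space)

text \<open>The measure is a pushforward carried by \<open>Rn n\<close>, so only the trace of
  \<open>B\<close> on \<open>Rn n\<close> counts. This admits sets such as a coordinate hyperplane
  of the whole space.\<close>

lemma emeasure_lborel_n:
  assumes "\<And>i. i < n \<Longrightarrow> A i \<in> sets borel"
    and "B \<in> sets borel" "B \<inter> Rn n = {x \<in> Rn n. \<forall>i<n. coord x i \<in> A i}"
  shows "emeasure (lborel_n n) B = (\<Prod>i<n. emeasure lborel (A i))"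
proof -
  interpret product_sigma_finite "\<lambda>_::nat. lborel::real measure"
    by standard
  have "of_coords n f \<in> B \<longleftrightarrow> (\<forall>i<n. f i \<in> A i)" for f
  proof -
    have "of_coords n f \<in> B \<longleftrightarrow> of_coords n f \<in> B \<inter> Rn n" by simp
    also have "\<dots> \<longleftrightarrow> (\<forall>i<n. f i \<in> A i)" unfolding assms(3) by auto
    finally show ?thesis .
  qed
  then have "of_coords n -` B \<inter> space (PiM {..<n} (\<lambda>_. lborel)) = PiE {..<n} A"
    by (auto simp: space_PiM PiE_def Pi_def)
  then have "emeasure (lborel_n n) B = emeasure (PiM {..<n} (\<lambda>_. lborel)) (PiE {..<n} A)"
    unfolding lborel_n_def by (subst emeasure_distr) (use assms in auto)
  also have "\<dots> = (\<Prod>i<n. emeasure lborel (A i))"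
    by (rule emeasure_PiM) (use assms in auto)
  finally show ?thesis .
qed

lemma emeasure_lborel_n_cube:
  assumes "0 < a" shows "emeasure (lborel_n n) (cube n a) = ennreal ((2 * a) ^ n)"
proof -
  have "emeasure (lborel_n n) (cube n a) = (\<Prod>i<n. emeasure lborel {-a..a})"
  proof (rule emeasure_lborel_n)
    have "\<bar>t\<bar> \<le> a \<longleftrightarrow> t \<in> {-a..a}" for t :: real by auto
    then show "cube n a \<inter> Rn n = {x \<in> Rn n. \<forall>i<n. coord x i \<in> {-a..a}}"
      unfolding cube_def by blast
  qed auto
  also have "\<dots> = ennreal (2 * a) ^ n" using assms by simp
  also have "\<dots> = ennreal ((2 * a) ^ n)" using assms by (intro ennreal_power) simp
  finally show ?thesis .
qed

lemma prob_space_unif_cube: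
  assumes "0 < a" shows "prob_space (unif_cube n a)"
proof -
  have "prob_space (uniform_measure (lborel_n n) (cube n a))"
    by (rule prob_space_uniform_measure) (use assms in \<open>auto simp: emeasure_lborel_n_cube\<close>)
  moreover have "emeasure (uniform_measure (lborel_n n) (cube n a)) (cube n a) = 1"
    using assms by (subst emeasure_uniform_measure)
      (auto simp: lborel_n_def emeasure_lborel_n_cube[unfolded lborel_n_def] intro!: ennreal_divide_self)
  ultimately show ?thesis
    unfolding unif_cube_def
    by (intro prob_spaceI) (auto simp: emeasure_restrict_space space_restrict_space lborel_n_def sets_uniform_measure)
qed

text \<open>Every face lies in a coordinate hyperplane, whose measure is a product with a vanishing
  factor. Test functions are supported in the open cube and say nothing about the boundary, so the
  boundary has to be a null set.\<close>

lemma AE_unif_cube_open_cube: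
  assumes "0 < a" shows "AE x in unif_cube n a. x \<in> open_cube n a"
proof -
  have 1: "AE x in lborel_n n. coord x i \<noteq> c" if "i < n" for i c
  proof (rule AE_I)
    have m: "{x. coord x i = c} \<in> sets borel" by measurable
    have "emeasure (lborel_n n) {x. coord x i = c} = (\<Prod>j<n. emeasure lborel (if j = i then {c} else UNIV :: real set))"
      by (rule emeasure_lborel_n) (use m that in \<open>auto split: if_splits\<close>)
    also have "\<dots> = 0" using that by (intro prod_zero) auto
    finally show "emeasure (lborel_n n) {x. coord x i = c} = 0" .
    show "{x. coord x i = c} \<in> sets (lborel_n n)" using m by (simp add: lborel_n_def)
  qed auto
  have "AE x in lborel_n n. \<forall>i\<in>{..<n}. coord x i \<noteq> a \<and> coord x i \<noteq> -a"
    by (subst AE_finite_all) (auto intro!: AE_conjI 1)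
  then have "AE x in uniform_measure (lborel_n n) (cube n a). \<forall>i\<in>{..<n}. coord x i \<noteq> a \<and> coord x i \<noteq> -a"
    by (intro AE_uniform_measureI) (auto simp: lborel_n_def elim: AE_mp)
  then have "AE x in unif_cube n a. \<forall>i\<in>{..<n}. coord x i \<noteq> a \<and> coord x i \<noteq> -a"
    unfolding unif_cube_def
    by (subst AE_restrict_space_iff) (auto simp: lborel_n_def)
  then show ?thesis
  proof (rule AE_mp, intro AE_I2 impI)
    fix x assume x: "x \<in> space (unif_cube n a)" "\<forall>i\<in>{..<n}. coord x i \<noteq> a \<and> coord x i \<noteq> -a"
    have "\<bar>coord x i\<bar> < a" if "i < n" for i
    proof -
      have "\<bar>coord x i\<bar> \<le> a" "coord x i \<noteq> a" "coord x i \<noteq> -a" using x that by (auto simp: cube_def)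
      then show ?thesis by linarith
    qed
    then show "x \<in> open_cube n a" using x by (auto simp: open_cube_def cube_def)
  qed
qed

lemma evec_box_borel [measurable]: "evec_box n l u \<in> sets borel"
proof -
  have "evec_box n l u = Rn n \<inter> {x \<in> space borel. \<forall>i\<in>{..<n}. l i < coord x i \<and> coord x i < u i}"
    by (auto simp: evec_box_def)
  also have "\<dots> \<in> sets borel" using closed_Rn by measurable
  finally show ?thesis .
qed

lemma open_cube_subset: "open_cube n a \<subseteq> cube n a"
  by (auto simp: open_cube_def cube_def less_imp_le)

lemma open_cube_borel [measurable]: "open_cube n a \<in> sets borel"
  by (simp add: open_cube_eq_box)

lemma evec_box_Int:
  "evec_box n l u \<inter> evec_box n l' u' = evec_box n (\<lambda>i. max (l i) (l' i)) (\<lambda>i. min (u i) (u' i))"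
  by (auto simp: evec_box_def)

text \<open>Inside \<open>Rn n\<close> the norm is at most the sum of the absolute coordinates, so a
  box of half-side at most \<open>e / (n + 1)\<close> fits in the ball of radius \<open>e\<close>.
  Rational corners keep the family of such boxes countable.\<close>

lemma rational_box_nhd:
  assumes "open S" "x \<in> S" "x \<in> open_cube n a"
  obtains l u :: "nat \<Rightarrow> real" where "l \<in> PiE {..<n} (\<lambda>_. \<rat>)" "u \<in> PiE {..<n} (\<lambda>_. \<rat>)" "x \<in> evec_box n l u"
    "evec_box n l u \<subseteq> S" "\<And>i. i < n \<Longrightarrow> -a < l i \<and> u i < a"
proof -
  obtain e where e: "0 < e" "ball x e \<subseteq> S" using assms by (meson openE)
  define s where "s = e / (real n + 1)"
  have s: "0 < s" using e by (simp add: s_def)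
  have "\<exists>q\<in>\<rat>. max (-a) (coord x i - s) < q \<and> q < coord x i" if "i < n" for i
    by (rule Rats_dense_in_real) (use assms that s in \<open>auto simp: open_cube_def abs_less_iff\<close>)
  then obtain l where l: "\<And>i. i < n \<Longrightarrow> l i \<in> \<rat> \<and> max (-a) (coord x i - s) < l i \<and> l i < coord x i"
    by metis
  have "\<exists>q\<in>\<rat>. coord x i < q \<and> q < min a (coord x i + s)" if "i < n" for i
    by (rule Rats_dense_in_real) (use assms that s in \<open>auto simp: open_cube_def abs_less_iff\<close>)
  then obtain u where u: "\<And>i. i < n \<Longrightarrow> u i \<in> \<rat> \<and> coord x i < u i \<and> u i < min a (coord x i + s)"
    by metis
  let ?l = "restrict l {..<n}" and ?u = "restrict u {..<n}"
  have "evec_box n ?l ?u \<subseteq> ball x e"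
  proof
    fix y assume y: "y \<in> evec_box n ?l ?u"
    have xy: "x - y \<in> Rn n" using y assms by (auto simp: open_cube_def evec_box_def intro: Rn_diff)
    have "norm (x - y) \<le> (\<Sum>i<n. \<bar>coord (x - y) i\<bar>)" by (rule norm_le_sum_coord[OF xy])
    also have "\<dots> \<le> (\<Sum>i<n. s)"
    proof (rule sum_mono)
      fix i assume "i \<in> {..<n}"
      then show "\<bar>coord (x - y) i\<bar> \<le> s"
        using l[of i] u[of i] y by (force simp: evec_box_def)
    qed
    also have "\<dots> = real n * s" by simp
    also have "\<dots> < e" using e by (simp add: s_def field_simps)
    finally show "y \<in> ball x e" by (simp add: dist_norm)
  qed
  moreover have "x \<in> evec_box n ?l ?u" using l u assms by (auto simp: evec_box_def open_cube_def)
  ultimately show ?thesis using that[of ?l ?u] l u e by auto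
qed

text \<open>The strict inequalities keep the closed box inside the open cube, so that the bumps of
  the box are admissible test functions. The family is still stable under intersection and generates
  the Borel sets of the open cube.\<close>

definition inner_boxes :: "nat \<Rightarrow> real \<Rightarrow> evec set set" where
  "inner_boxes n a = {evec_box n l u | l u. \<forall>i<n. -a < l i \<and> u i < a}"

lemma sets_open_cube_inner_boxes:
  "sets (restrict_space borel (open_cube n a)) = sigma_sets (open_cube n a) (inner_boxes n a)"
proof -
  let ?O = "open_cube n a" and ?G = "inner_boxes n a"
  have G_sub: "?G \<subseteq> Pow ?O"
    unfolding inner_boxes_def open_cube_eq_box by (force simp: evec_box_def)
  interpret sigma_algebra ?O "sigma_sets ?O ?G" by (rule sigma_algebra_sigma_sets[OF G_sub])
  have open_in: "?O \<inter> S \<in> sigma_sets ?O ?G" if "open S" for S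
  proof -
    let ?R = "{(l, u). l \<in> PiE {..<n} (\<lambda>_. \<rat>) \<and> u \<in> PiE {..<n} (\<lambda>_. \<rat>) \<and> evec_box n l u \<subseteq> S
      \<and> (\<forall>i<n. -a < l i \<and> u i < a)}"
    have "countable (PiE {..<n} (\<lambda>_. \<rat>) :: (nat \<Rightarrow> real) set)"
      by (intro countable_PiE) (auto simp: countable_rat)
    then have "countable ((PiE {..<n} (\<lambda>_. \<rat>)) \<times> (PiE {..<n} (\<lambda>_. \<rat>)) :: ((nat \<Rightarrow> real) \<times> (nat \<Rightarrow> real)) set)"
      by auto
    then have "countable ?R" by (rule countable_subset[rotated]) auto
    moreover have "?O \<inter> S = (\<Union>(l, u)\<in>?R. evec_box n l u)"
    proof (intro equalityI subsetI)
      fix x assume "x \<in> ?O \<inter> S"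
      then have x: "x \<in> S" "x \<in> ?O" by auto
      from rational_box_nhd[OF that x] obtain l u :: "nat \<Rightarrow> real" where
        "l \<in> PiE {..<n} (\<lambda>_. \<rat>)" "u \<in> PiE {..<n} (\<lambda>_. \<rat>)" "x \<in> evec_box n l u"
        "evec_box n l u \<subseteq> S" "\<And>i. i < n \<Longrightarrow> -a < l i \<and> u i < a"
        by metis
      then have "(l, u) \<in> ?R" "x \<in> (case (l, u) of (l, u) \<Rightarrow> evec_box n l u)" by simp_all
      then show "x \<in> (\<Union>(l, u)\<in>?R. evec_box n l u)" by (rule UN_I)
    next
      fix x assume "x \<in> (\<Union>(l, u)\<in>?R. evec_box n l u)"
      then obtain l u where x: "x \<in> evec_box n l u" "evec_box n l u \<subseteq> S" "\<forall>i<n. -a < l i \<and> u i < a"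
        by auto
      then have "evec_box n l u \<in> ?G" unfolding inner_boxes_def by blast
      then show "x \<in> ?O \<inter> S" using G_sub x by blast
    qed
    moreover have "(case lu of (l, u) \<Rightarrow> evec_box n l u) \<in> sigma_sets ?O ?G" if "lu \<in> ?R" for lu
      using that by (auto simp: inner_boxes_def intro!: sigma_sets.Basic)
    ultimately show ?thesis by (simp only:) (intro countable_UN'')
  qed
  have "?O \<inter> A \<in> sigma_sets ?O ?G" if "A \<in> sigma_sets UNIV {S. open S}" for A
    using that
  proof (induction rule: sigma_sets.induct)
    fix B assume "?O \<inter> B \<in> sigma_sets ?O ?G"
    moreover have "?O \<inter> (UNIV - B) = ?O - (?O \<inter> B)" by auto
    ultimately show "?O \<inter> (UNIV - B) \<in> sigma_sets ?O ?G" by (simp add: sigma_sets.Compl)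
  next
    fix B :: "nat \<Rightarrow> evec set" assume "\<And>i. ?O \<inter> B i \<in> sigma_sets ?O ?G"
    then have "(\<Union>i. ?O \<inter> B i) \<in> sigma_sets ?O ?G" by (rule sigma_sets.Union)
    moreover have "?O \<inter> (\<Union>i. B i) = (\<Union>i. ?O \<inter> B i)" by auto
    ultimately show "?O \<inter> (\<Union>i. B i) \<in> sigma_sets ?O ?G" by (simp only:)
  qed (auto intro: sigma_sets.Empty open_in)
  then have "sets (restrict_space borel ?O) \<subseteq> sigma_sets ?O ?G"
    by (auto simp: sets_restrict_space borel_def)
  moreover have "sigma_sets ?O ?G \<subseteq> sets (restrict_space borel ?O)"
  proof (rule sets.sigma_sets_subset'[where M = "restrict_space borel ?O", unfolded space_restrict_space])
    show "?G \<subseteq> sets (restrict_space borel ?O)"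
    proof
      fix B assume "B \<in> ?G"
      then have "B \<in> sets borel" "B \<subseteq> ?O" using G_sub by (auto simp: inner_boxes_def)
      then show "B \<in> sets (restrict_space borel ?O)" by (auto simp: sets_restrict_space)
    qed
    show "?O \<in> sets (restrict_space borel ?O)"
      using sets.top[of "restrict_space borel ?O"] by (simp add: space_restrict_space)
  qed
  ultimately show ?thesis by auto
qed

lemma box_bump_measurable: "box_bump n l u k \<in> borel_measurable borel"
proof (rule borel_measurable_continuous_onI)
  have "C_k_on 0 n UNIV (box_bump n l u k)"
    unfolding box_bump_def
    by (rule C_k_on_coord_prod)
      (auto intro!: continuous_intros continuous_on_compose2[OF diff_times_continuous[OF diff_times_poly_bump]])
  then show "continuous_on UNIV (box_bump n l u k)" by simp
qed

text \<open>The fundamental lemma of the calculus of variations. Bumps approximate indicators of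
  boxes, so \<open>w\<close> has integral zero over every inner box; hence its positive and negative
  parts are densities of two measures that agree on a generator stable under intersections.\<close>

lemma AE_zero_if_orthogonal_to_bumps:
  assumes a: "0 < a" and w [measurable]: "w \<in> borel_measurable (unif_cube n a)"
    and int: "\<And>K. compact K \<Longrightarrow> K \<subseteq> open_cube n a \<Longrightarrow> set_integrable (unif_cube n a) K w"
    and zero: "\<And>\<eta>. test_fun n a \<eta> \<Longrightarrow> (LINT x|unif_cube n a. w x * \<eta> x) = 0"
  shows "AE x in unif_cube n a. w x = 0"
proof -
  let ?\<mu> = "unif_cube n a" and ?O = "open_cube n a"
  have box_meas: "B \<in> sets ?\<mu>" "B \<subseteq> ?O" if "B \<in> inner_boxes n a" for B
  proof -
    show "B \<subseteq> ?O" using that unfolding inner_boxes_def open_cube_eq_box by (force simp: evec_box_def)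
    then have "B \<subseteq> cube n a" using open_cube_subset by blast
    then show "B \<in> sets ?\<mu>" using that by (intro in_sets_unif_cube) (auto simp: inner_boxes_def)
  qed
  have box_zero: "(\<integral>\<^sup>+x\<in>B. ennreal (w x) \<partial>?\<mu>) = (\<integral>\<^sup>+x\<in>B. ennreal (- w x) \<partial>?\<mu>)
      \<and> (\<integral>\<^sup>+x\<in>B. ennreal (w x) \<partial>?\<mu>) \<noteq> \<infinity>" if "B \<in> inner_boxes n a" for B
  proof -
    obtain l u where B: "B = evec_box n l u" and lu: "\<And>i. i < n \<Longrightarrow> -a < l i \<and> u i < a"
      using \<open>B \<in> inner_boxes n a\<close> by (auto simp: inner_boxes_def)
    let ?K = "evec_cbox n l u"
    have "compact ?K" by (rule compact_evec_cbox[of _ a]) (use lu in force)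
    moreover have "?K \<subseteq> ?O"
      using lu unfolding evec_cbox_def open_cube_def abs_less_iff by fastforce
    ultimately have K: "integrable ?\<mu> (\<lambda>x. indicator ?K x * w x)"
      using int unfolding set_integrable_def by simp
    have B_meas [measurable]: "B \<in> sets ?\<mu>" by (rule box_meas) fact
    have [measurable]: "box_bump n l u k \<in> borel_measurable ?\<mu>" for k
      by (rule borel_measurable_unif_cube[OF box_bump_measurable])
    \<comment> \<open>Dominated convergence: the bumps are bounded by one and vanish off the closed
      box, on which \<open>w\<close> is integrable by assumption.\<close>
    have "(\<lambda>k. LINT x|?\<mu>. w x * box_bump n l u k x) \<longlonglongrightarrow> (LINT x|?\<mu>. w x * indicator B x)"
    proof (rule integral_dominated_convergence)
      show "integrable ?\<mu> (\<lambda>x. \<bar>indicator ?K x * w x\<bar>)" using K by (rule integrable_abs)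
      show "AE x in ?\<mu>. (\<lambda>k. w x * box_bump n l u k x) \<longlonglongrightarrow> w x * indicator B x"
      proof (rule AE_I2)
        fix x assume "x \<in> space ?\<mu>"
        then have x: "x \<in> Rn n" by (auto simp: cube_def)
        show "(\<lambda>k. w x * box_bump n l u k x) \<longlonglongrightarrow> w x * indicator B x"
          using tendsto_mult[OF tendsto_const[of "w x"] box_bump_tendsto[of x n l u]] box_bump_zero[OF x, of l u]
          by (cases "x \<in> B") (auto simp: B)
      qed
      show "AE x in ?\<mu>. norm (w x * box_bump n l u k x) \<le> \<bar>indicator ?K x * w x\<bar>" for k
      proof (rule AE_I2)
        fix x assume "x \<in> space ?\<mu>"
        then have x: "x \<in> Rn n" by (auto simp: cube_def)
        show "norm (w x * box_bump n l u k x) \<le> \<bar>indicator ?K x * w x\<bar>"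
        proof (cases "x \<in> ?K")
          case True
          then show ?thesis using box_bump_bounds[of n l u k x]
            by (simp add: abs_mult mult_left_le)
        next
          case False
          then have "x \<notin> evec_box n l u" by (auto simp: evec_cbox_def evec_box_def less_imp_le)
          then show ?thesis using box_bump_zero[OF x] by simp
        qed
      qed
    qed (use w in measurable)
    moreover have "(LINT x|?\<mu>. w x * box_bump n l u k x) = 0" for k
      by (rule zero[OF test_fun_box_bump]) (use lu in auto)
    ultimately have "(\<lambda>k::nat. 0) \<longlonglongrightarrow> (LINT x|?\<mu>. w x * indicator B x)" by (simp only:)
    then have *: "(LINT x|?\<mu>. w x * indicator B x) = 0" by (simp only: LIMSEQ_const_iff)
    have int_B: "integrable ?\<mu> (\<lambda>x. w x * indicator B x)"
    proof (rule Bochner_Integration.integrable_bound[OF K])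
      have "B \<subseteq> ?K" by (auto simp: B evec_box_def evec_cbox_def less_imp_le)
      then show "AE x in ?\<mu>. norm (w x * indicator B x) \<le> norm (indicator ?K x * w x)"
        by (intro AE_I2) (auto simp: indicator_def)
    qed measurable
    have eq: "(\<integral>\<^sup>+x. ennreal (w x * indicator B x) \<partial>?\<mu>) = (\<integral>\<^sup>+x\<in>B. ennreal (w x) \<partial>?\<mu>)"
      "(\<integral>\<^sup>+x. ennreal (- (w x * indicator B x)) \<partial>?\<mu>) = (\<integral>\<^sup>+x\<in>B. ennreal (- w x) \<partial>?\<mu>)"
      by (auto intro!: nn_integral_cong simp: indicator_def)
    have fin: "(\<integral>\<^sup>+x\<in>B. ennreal (w x) \<partial>?\<mu>) \<noteq> \<infinity>" "(\<integral>\<^sup>+x\<in>B. ennreal (- w x) \<partial>?\<mu>) \<noteq> \<infinity>"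
      using int_B unfolding real_integrable_def eq by auto
    have "enn2real (\<integral>\<^sup>+x\<in>B. ennreal (w x) \<partial>?\<mu>) = enn2real (\<integral>\<^sup>+x\<in>B. ennreal (- w x) \<partial>?\<mu>)"
      using * unfolding real_lebesgue_integral_def[OF int_B] eq by simp
    from arg_cong[OF this, of ennreal] show ?thesis using fin
      by (simp add: ennreal_enn2real_if)
  qed
  \<comment> \<open>\<open>ennreal\<close> cuts off negative values, so \<open>N w\<close> and
    \<open>N (\<lambda>x. - w x)\<close> have the positive and the negative part of \<open>w\<close>
    as densities. Since \<open>w\<close> is only locally integrable, they may be infinite on the
    whole open cube; on inner boxes they are finite.\<close>
  define N where "N f = restrict_space (density ?\<mu> (\<lambda>x. ennreal (f x))) ?O" for f
  have O_meas: "?O \<in> sets ?\<mu>" by (rule in_sets_unif_cube[OF open_cube_borel open_cube_subset])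
  have sets_N: "sets (N f) = sigma_sets ?O (inner_boxes n a)" for f
  proof -
    have "sets (N f) = sets (restrict_space (restrict_space borel (cube n a)) ?O)"
      unfolding N_def by (intro sets_restrict_space_cong) (simp add: sets_unif_cube)
    also have "\<dots> = sets (restrict_space borel ?O)"
      using open_cube_subset by (simp add: sets_restrict_restrict_space inf.absorb2)
    finally show ?thesis by (simp add: sets_open_cube_inner_boxes)
  qed
  have em_N: "emeasure (N f) A = (\<integral>\<^sup>+x\<in>A. ennreal (f x) \<partial>?\<mu>)"
    if "A \<in> sets ?\<mu>" "A \<subseteq> ?O" "f \<in> borel_measurable ?\<mu>" for f A
    unfolding N_def using that O_meas
    by (subst emeasure_restrict_space) (auto simp: emeasure_density open_cube_subset inf.absorb1)
  have "N w = N (\<lambda>x. - w x)"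
  \<comment> \<open>Uniqueness of measures needs an exhaustion of the open cube by sets of the
    generator with finite measure; shrinking the cube by \<open>a / Suc k\<close> on each side
    provides it.\<close>
  proof (rule measure_eqI_generator_eq[of "inner_boxes n a" ?O _ _ "\<lambda>k. evec_box n (\<lambda>_. - a + a / real (Suc k)) (\<lambda>_. a - a / real (Suc k))"])
    show "Int_stable (inner_boxes n a)"
    proof (rule Int_stableI)
      fix A B assume "A \<in> inner_boxes n a" "B \<in> inner_boxes n a"
      then obtain l u l' u' where A: "A = evec_box n l u" "\<forall>i<n. -a < l i \<and> u i < a"
        and B: "B = evec_box n l' u'" "\<forall>i<n. -a < l' i \<and> u' i < a"
        by (auto simp: inner_boxes_def)
      show "A \<inter> B \<in> inner_boxes n a"
        unfolding A B evec_box_Int inner_boxes_def using A B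
        by (intro CollectI exI[of _ "\<lambda>i. max (l i) (l' i)"] exI[of _ "\<lambda>i. min (u i) (u' i)"] conjI refl)
          (auto simp: less_max_iff_disj min_less_iff_disj)
    qed
    show "inner_boxes n a \<subseteq> Pow ?O" using box_meas by auto
    fix X assume X: "X \<in> inner_boxes n a"
    show "emeasure (N w) X = emeasure (N (\<lambda>x. - w x)) X"
      using box_zero[OF X] box_meas[OF X] by (simp add: em_N)
  next
    have "evec_box n (\<lambda>_. - a + a / real (Suc k)) (\<lambda>_. a - a / real (Suc k)) \<in> inner_boxes n a" for k
      unfolding inner_boxes_def
      by (intro CollectI exI[of _ "\<lambda>_. - a + a / real (Suc k)"] exI[of _ "\<lambda>_. a - a / real (Suc k)"] conjI refl)
        (use a in simp)
    then show r: "range (\<lambda>k. evec_box n (\<lambda>_. - a + a / real (Suc k)) (\<lambda>_. a - a / real (Suc k))) \<subseteq> inner_boxes n a"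
      by auto
    show "(\<Union>k. evec_box n (\<lambda>_. - a + a / real (Suc k)) (\<lambda>_. a - a / real (Suc k))) = ?O" (is "(\<Union>k. ?B k) = _")
    proof (intro equalityI subsetI)
      fix x assume "x \<in> (\<Union>k. ?B k)" then show "x \<in> ?O" using r box_meas(2) by blast
    next
      fix x assume x: "x \<in> ?O"
      define s where "s = Max (insert 0 ((\<lambda>i. \<bar>coord x i\<bar>) ` {..<n}))"
      have s: "s < a" "\<And>i. i < n \<Longrightarrow> \<bar>coord x i\<bar> \<le> s"
        using x a by (auto simp: s_def open_cube_def)
      then obtain k where "1 / real (Suc k) < (a - s) / a"
        using nat_approx_posE[of "(a - s) / a"] a by auto
      then have "a / real (Suc k) < a - s" using a by (simp add: field_simps)
      moreover have "-s \<le> coord x i \<and> coord x i \<le> s" if "i < n" for i using s(2)[OF that] by linarith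
      ultimately have "x \<in> ?B k" using x by (fastforce simp: evec_box_def open_cube_def)
      then show "x \<in> (\<Union>k. ?B k)" by blast
    qed
    show "emeasure (N w) (?B k) \<noteq> \<infinity>" for k
    proof -
      have B: "?B k \<in> inner_boxes n a" using r by blast
      show ?thesis using box_zero[OF B] unfolding em_N[OF box_meas[OF B] w] by blast
    qed
  qed (simp_all add: sets_N)
  then have eq: "(\<integral>\<^sup>+x\<in>A. ennreal (w x) \<partial>?\<mu>) = (\<integral>\<^sup>+x\<in>A. ennreal (- w x) \<partial>?\<mu>)"
    if "A \<in> sets ?\<mu>" "A \<subseteq> ?O" for A
    using em_N[OF that, of w] em_N[OF that, of "\<lambda>x. - w x"] by simp
  have nonpos: "AE x in ?\<mu>. x \<in> ?O \<longrightarrow> f x \<le> 0"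
    if f [measurable]: "f \<in> borel_measurable ?\<mu>"
      and f_eq: "\<And>A. A \<in> sets ?\<mu> \<Longrightarrow> A \<subseteq> ?O \<Longrightarrow> (\<integral>\<^sup>+x\<in>A. ennreal (f x) \<partial>?\<mu>) = (\<integral>\<^sup>+x\<in>A. ennreal (- f x) \<partial>?\<mu>)" for f
  proof -
    let ?A = "{x \<in> space ?\<mu>. 0 < f x} \<inter> ?O"
    have A [measurable]: "?A \<in> sets ?\<mu>" using O_meas by measurable
    have "(\<integral>\<^sup>+x\<in>?A. ennreal (- f x) \<partial>?\<mu>) = (\<integral>\<^sup>+x. 0 \<partial>?\<mu>)"
      by (rule nn_integral_cong) (auto simp: indicator_def ennreal_neg)
    then have "(\<integral>\<^sup>+x\<in>?A. ennreal (f x) \<partial>?\<mu>) = 0" using f_eq[OF A] by simp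
    then have "AE x in ?\<mu>. ennreal (f x) * indicator ?A x = 0"
      by (subst (asm) nn_integral_0_iff_AE) measurable
    then show ?thesis
      by (rule AE_mp) (auto intro!: AE_I2 simp: indicator_def split: if_splits)
  qed
  have "AE x in ?\<mu>. x \<in> ?O \<longrightarrow> w x \<le> 0" using eq by (intro nonpos) auto
  moreover have "AE x in ?\<mu>. x \<in> ?O \<longrightarrow> - w x \<le> 0" using eq by (intro nonpos) auto
  ultimately show ?thesis using AE_unif_cube_open_cube[OF a, of n] by eventually_elim auto
qed

section \<open>Transport cost\<close>

text \<open>A test function vanishes off a compact set and is bounded on it by continuity. Its
  partial derivatives vanish off the same set because the complement is open.\<close>

lemma test_fun_bounded_measurable:
  assumes "test_fun n a \<eta>"
  shows "\<eta> \<in> borel_measurable (unif_cube n a)" "\<exists>B. \<forall>x\<in>Rn n. \<bar>\<eta> x\<bar> \<le> B"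
    and "i < n \<Longrightarrow> pd i \<eta> \<in> borel_measurable (unif_cube n a)"
    and "i < n \<Longrightarrow> \<exists>B. \<forall>x\<in>Rn n. \<bar>pd i \<eta> x\<bar> \<le> B"
proof -
  obtain K where K: "compact K" "K \<subseteq> open_cube n a" and out: "\<And>x. x \<in> Rn n \<Longrightarrow> x \<notin> K \<Longrightarrow> \<eta> x = 0"
    using assms unfolding test_fun_def by auto
  have C: "C_k_on k n (Rn n) \<eta>" for k using assms unfolding test_fun_def smooth_on_def by auto
  have meas: "f \<in> borel_measurable (unif_cube n a)" if "continuous_on (Rn n) f" for f :: "evec \<Rightarrow> real"
  proof -
    have "continuous_on (cube n a) f" using that by (rule continuous_on_subset) (auto simp: cube_def)
    then show ?thesis
      by (subst measurable_cong_sets[OF sets_unif_cube refl]) (rule borel_measurable_continuous_on_restrict)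
  qed
  have bdd: "\<exists>B. \<forall>x\<in>Rn n. \<bar>f x\<bar> \<le> B"
    if "continuous_on (Rn n) f" and "\<And>x. x \<in> Rn n \<Longrightarrow> x \<notin> K \<Longrightarrow> f x = 0" for f :: "evec \<Rightarrow> real"
  proof -
    have "continuous_on K f" using that(1) by (rule continuous_on_subset) (use K in \<open>auto simp: open_cube_def\<close>)
    then have "bounded (f ` K)" using K(1) compact_continuous_image compact_imp_bounded by blast
    then obtain B where B: "\<And>x. x \<in> K \<Longrightarrow> \<bar>f x\<bar> \<le> B" unfolding bounded_iff by auto
    have "\<bar>f x\<bar> \<le> max B 0" if "x \<in> Rn n" for x
      using B[of x] \<open>\<And>x. x \<in> Rn n \<Longrightarrow> x \<notin> K \<Longrightarrow> f x = 0\<close>[OF that] by (cases "x \<in> K") auto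
    then show ?thesis by blast
  qed
  have cont: "continuous_on (Rn n) \<eta>" using C[of 0] by simp
  show "\<eta> \<in> borel_measurable (unif_cube n a)" "\<exists>B. \<forall>x\<in>Rn n. \<bar>\<eta> x\<bar> \<le> B"
    using meas[OF cont] bdd[OF cont out] by auto
  assume i: "i < n"
  have cont': "continuous_on (Rn n) (pd i \<eta>)" using C[of "Suc 0"] i by simp
  have "pd i \<eta> x = 0" if x: "x \<in> Rn n" "x \<notin> K" for x
  proof -
    have "open (- K)" using K(1) by (simp add: compact_imp_closed open_Compl)
    then obtain e where e: "0 < e" "ball x e \<subseteq> - K" using x by (meson ComplI openE)
    have "\<eta> (x + t *\<^sub>R unit_evec i) = 0" if "t \<in> ball 0 e" for t
    proof (rule out)
      show "x + t *\<^sub>R unit_evec i \<in> Rn n" using x(1) i by (intro Rn_add Rn_scaleR unit_evec_Rn)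
      have "x + t *\<^sub>R unit_evec i \<in> ball x e" using that by (simp add: dist_norm)
      then show "x + t *\<^sub>R unit_evec i \<notin> K" using e by blast
    qed
    then have "((\<lambda>t. \<eta> (x + t *\<^sub>R unit_evec i)) has_vector_derivative 0) (at 0)"
      by (intro has_vector_derivative_transform_within_open[OF has_vector_derivative_const, of "ball 0 e"])
        (use e in auto)
    then show ?thesis unfolding pd_def by (rule vector_derivative_at)
  qed
  then show "pd i \<eta> \<in> borel_measurable (unif_cube n a)" "\<exists>B. \<forall>x\<in>Rn n. \<bar>pd i \<eta> x\<bar> \<le> B"
    using meas[OF cont'] bdd[OF cont'] by auto
qed

section \<open>Square-integrable functions and self-adjoint relations\<close>

lemma L2_integrable_mult:
  assumes "f \<in> L2 \<nu>" "g \<in> L2 \<nu>" shows "integrable \<nu> (\<lambda>x. f x * g x)"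
proof (rule Bochner_Integration.integrable_bound)
  show "integrable \<nu> (\<lambda>x. (f x)\<^sup>2 + (g x)\<^sup>2)" using assms by (auto simp: L2_def)
  have "norm (f x * g x) \<le> norm ((f x)\<^sup>2 + (g x)\<^sup>2)" for x
  proof -
    have "0 \<le> (\<bar>f x\<bar> - \<bar>g x\<bar>)\<^sup>2" by simp
    then have "2 * (\<bar>f x\<bar> * \<bar>g x\<bar>) \<le> (f x)\<^sup>2 + (g x)\<^sup>2" by (simp add: power2_diff)
    moreover have "0 \<le> \<bar>f x\<bar> * \<bar>g x\<bar>" by simp
    ultimately have "\<bar>f x\<bar> * \<bar>g x\<bar> \<le> (f x)\<^sup>2 + (g x)\<^sup>2" by linarith
    then show ?thesis by (simp add: abs_mult)
  qed
  then show "AE x in \<nu>. norm (f x * g x) \<le> norm ((f x)\<^sup>2 + (g x)\<^sup>2)" by simp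
qed (use assms in \<open>auto simp: L2_def\<close>)

lemma L2_lincomb:
  assumes "f \<in> L2 \<nu>" "g \<in> L2 \<nu>" shows "(\<lambda>x. c * f x + e * g x) \<in> L2 \<nu>"
proof -
  have "integrable \<nu> (\<lambda>x. c\<^sup>2 * (f x * f x) + 2 * c * e * (f x * g x) + e\<^sup>2 * (g x * g x))"
    using assms by (intro Bochner_Integration.integrable_add integrable_mult_right L2_integrable_mult)
  moreover have "c\<^sup>2 * (f x * f x) + 2 * c * e * (f x * g x) + e\<^sup>2 * (g x * g x) = (c * f x + e * g x)\<^sup>2" for x
    by (simp add: power2_eq_square algebra_simps)
  ultimately show ?thesis using assms by (auto simp: L2_def)
qed

lemma L2_integrable:
  assumes "finite_measure \<nu>" "f \<in> L2 \<nu>" shows "integrable \<nu> f"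
proof -
  interpret finite_measure \<nu> by fact
  have "(\<lambda>_. 1) \<in> L2 \<nu>" by (simp add: L2_def)
  from L2_integrable_mult[OF assms(2) this] show ?thesis by simp
qed

lemma ip_lincomb_left:
  assumes "f \<in> L2 \<nu>" "g \<in> L2 \<nu>" "h \<in> L2 \<nu>"
  shows "ip \<nu> h (\<lambda>x. c * f x + e * g x) = c * ip \<nu> h f + e * ip \<nu> h g"
proof -
  have "ip \<nu> h (\<lambda>x. c * f x + e * g x) = (LINT x|\<nu>. c * (h x * f x) + e * (h x * g x))"
    unfolding ip_def by (rule Bochner_Integration.integral_cong) (auto simp: algebra_simps)
  also have "\<dots> = c * ip \<nu> h f + e * ip \<nu> h g"
    unfolding ip_def
    by (subst Bochner_Integration.integral_add)
      (use assms in \<open>auto intro!: integrable_mult_right L2_integrable_mult\<close>)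
  finally show ?thesis .
qed

lemma selfadjoint_L2: "selfadjoint \<nu> B \<Longrightarrow> (f, g) \<in> B \<Longrightarrow> f \<in> L2 \<nu> \<and> g \<in> L2 \<nu>"
  unfolding selfadjoint_def adjoint_graph_def by blast

lemma selfadjoint_iff:
  "selfadjoint \<nu> B \<Longrightarrow> (u, v) \<in> B \<longleftrightarrow>
     u \<in> L2 \<nu> \<and> v \<in> L2 \<nu> \<and> (\<forall>f g. (f, g) \<in> B \<longrightarrow> ip \<nu> g u = ip \<nu> f v)"
  unfolding selfadjoint_def adjoint_graph_def by blast

text \<open>Linearity is not built into \<open>l2_graph\<close>. It is inherited from being its own
  adjoint: membership is a family of identities between inner products, each of them linear in the
  pair.\<close>

lemma selfadjoint_lincomb:
  assumes B: "selfadjoint \<nu> B" and "(u, v) \<in> B" "(u', v') \<in> B"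
  shows "((\<lambda>x. c * u x + e * u' x), (\<lambda>x. c * v x + e * v' x)) \<in> B"
proof -
  have L2: "u \<in> L2 \<nu>" "v \<in> L2 \<nu>" "u' \<in> L2 \<nu>" "v' \<in> L2 \<nu>"
    using selfadjoint_L2[OF B] assms by blast+
  have "ip \<nu> g (\<lambda>x. c * u x + e * u' x) = ip \<nu> f (\<lambda>x. c * v x + e * v' x)" if fg: "(f, g) \<in> B" for f g
  proof -
    have fg_L2: "f \<in> L2 \<nu>" "g \<in> L2 \<nu>" using selfadjoint_L2[OF B fg] by auto
    have "ip \<nu> g u = ip \<nu> f v" "ip \<nu> g u' = ip \<nu> f v'"
      using selfadjoint_iff[OF B, THEN iffD1, OF assms(2)] selfadjoint_iff[OF B, THEN iffD1, OF assms(3)] fg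
      by blast+
    then show ?thesis by (simp only: ip_lincomb_left[OF L2(1,3) fg_L2(2)] ip_lincomb_left[OF L2(2,4) fg_L2(1)])
  qed
  then show ?thesis
    by (intro selfadjoint_iff[OF B, THEN iffD2] conjI allI impI) (simp_all add: L2_lincomb L2)
qed

lemma selfadjoint_sum:
  assumes B: "selfadjoint \<nu> B" and "\<And>s. s < (r::nat) \<Longrightarrow> (u s, v s) \<in> B"
  shows "((\<lambda>x. \<Sum>s<r. c s * u s x), (\<lambda>x. \<Sum>s<r. c s * v s x)) \<in> B"
  using assms(2)
proof (induction r)
  case 0
  show ?case by (subst selfadjoint_iff[OF B]) (simp add: L2_def ip_def)
next
  case (Suc r)
  have "((\<lambda>x. 1 * (\<Sum>s<r. c s * u s x) + c r * u r x), (\<lambda>x. 1 * (\<Sum>s<r. c s * v s x) + c r * v r x)) \<in> B"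
    by (rule selfadjoint_lincomb[OF B]) (use Suc in auto)
  then show ?case by simp
qed

text \<open>\<open>grad\<close> is a choice among weak gradients, and nothing relates the choices
  made for different functions. Uniqueness up to null sets makes it additive almost everywhere: the
  discrepancy is orthogonal to all test functions.\<close>

lemma weak_gradient_diff_AE:
  assumes a: "0 < a" and L2: "f \<in> L2 (unif_cube n a)" "g \<in> L2 (unif_cube n a)"
    and F: "weak_gradient n a f F" and G: "weak_gradient n a g G"
    and H: "weak_gradient n a (\<lambda>x. f x - g x) H"
  shows "AE x in unif_cube n a. H x = F x - G x"
proof -
  let ?\<mu> = "unif_cube n a"
  interpret prob_space ?\<mu> by (rule prob_space_unif_cube[OF a])
  have fin: "finite_measure ?\<mu>" by (rule finite_measure_axioms)
  have meas [measurable]: "F \<in> borel_measurable ?\<mu>" "G \<in> borel_measurable ?\<mu>" "H \<in> borel_measurable ?\<mu>"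
    and Rn: "\<And>x. x \<in> cube n a \<Longrightarrow> F x \<in> Rn n \<and> G x \<in> Rn n \<and> H x \<in> Rn n"
    using F G H by (auto simp: weak_gradient_def)
  have int_pd: "integrable ?\<mu> (\<lambda>x. h x * pd i \<eta> x)"
    if h: "h \<in> L2 ?\<mu>" and \<eta>: "test_fun n a \<eta>" and i: "i < n" for h \<eta> i
  proof -
    obtain B where B: "\<And>x. x \<in> Rn n \<Longrightarrow> \<bar>pd i \<eta> x\<bar> \<le> B"
      using test_fun_bounded_measurable(4)[OF \<eta> i] by blast
    have [measurable]: "pd i \<eta> \<in> borel_measurable ?\<mu>" by (rule test_fun_bounded_measurable(3)[OF \<eta> i])
    have [measurable]: "h \<in> borel_measurable ?\<mu>" using h by (simp add: L2_def)
    show ?thesis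
    proof (rule Bochner_Integration.integrable_bound)
      show "integrable ?\<mu> (\<lambda>x. B * h x)" using L2_integrable[OF fin h] by simp
      show "AE x in ?\<mu>. norm (h x * pd i \<eta> x) \<le> norm (B * h x)"
      proof (rule AE_I2)
        fix x assume "x \<in> space ?\<mu>"
        then have "\<bar>pd i \<eta> x\<bar> \<le> \<bar>B\<bar>" using B[of x] by (auto simp: cube_def)
        then show "norm (h x * pd i \<eta> x) \<le> norm (B * h x)"
          using mult_left_mono[of "\<bar>pd i \<eta> x\<bar>" "\<bar>B\<bar>" "\<bar>h x\<bar>"] by (simp add: abs_mult mult.commute)
      qed
    qed measurable
  qed
  \<comment> \<open>A weak gradient is integrable on compact subsets only, so here the compact
    support of the test function is used and not merely its boundedness.\<close>
  have int_grad: "integrable ?\<mu> (\<lambda>x. coord (W x) i * \<eta> x)"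
    if W: "weak_gradient n a h W" and \<eta>: "test_fun n a \<eta>" and i: "i < n" for h W \<eta> i
  proof -
    obtain B where B: "\<And>x. x \<in> Rn n \<Longrightarrow> \<bar>\<eta> x\<bar> \<le> B"
      using test_fun_bounded_measurable(2)[OF \<eta>] by blast
    obtain K where K: "compact K" "K \<subseteq> open_cube n a" "\<And>x. x \<in> Rn n \<Longrightarrow> x \<notin> K \<Longrightarrow> \<eta> x = 0"
      using \<eta> unfolding test_fun_def by auto
    have [measurable]: "\<eta> \<in> borel_measurable ?\<mu>" by (rule test_fun_bounded_measurable(1)[OF \<eta>])
    have [measurable]: "W \<in> borel_measurable ?\<mu>" using W by (simp add: weak_gradient_def)
    show ?thesis
    proof (rule Bochner_Integration.integrable_bound)
      show "integrable ?\<mu> (\<lambda>x. B * (indicator K x * coord (W x) i))"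
        using W i K unfolding weak_gradient_def set_integrable_def by auto
      show "AE x in ?\<mu>. norm (coord (W x) i * \<eta> x) \<le> norm (B * (indicator K x * coord (W x) i))"
      proof (rule AE_I2)
        fix x assume "x \<in> space ?\<mu>"
        then have "x \<in> Rn n" by (auto simp: cube_def)
        then have "\<bar>\<eta> x\<bar> \<le> \<bar>B\<bar> * indicator K x" using B[of x] K(3)[of x] by (auto simp: indicator_def)
        then have "\<bar>coord (W x) i\<bar> * \<bar>\<eta> x\<bar> \<le> \<bar>coord (W x) i\<bar> * (\<bar>B\<bar> * indicator K x)"
          by (rule mult_left_mono) simp
        then show "norm (coord (W x) i * \<eta> x) \<le> norm (B * (indicator K x * coord (W x) i))"
          by (simp add: abs_mult mult_ac)
      qed
    qed measurable
  qed
  have "AE x in ?\<mu>. coord (H x) i - (coord (F x) i - coord (G x) i) = 0" if i: "i < n" for i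
  proof (rule AE_zero_if_orthogonal_to_bumps[OF a])
    fix K assume K: "compact K" "K \<subseteq> open_cube n a"
    have "set_integrable ?\<mu> K (\<lambda>x. coord (W x) i)" if "weak_gradient n a h W" for h W
      using that i K unfolding weak_gradient_def by auto
    from this[OF H] this[OF F] this[OF G]
    show "set_integrable ?\<mu> K (\<lambda>x. coord (H x) i - (coord (F x) i - coord (G x) i))"
      by (intro set_integral_diff)
  next
    fix \<eta> assume \<eta>: "test_fun n a \<eta>"
    have eq: "(LINT x|?\<mu>. coord (W x) i * \<eta> x) = - (LINT x|?\<mu>. h x * pd i \<eta> x)"
      if "weak_gradient n a h W" for h W using that i \<eta> unfolding weak_gradient_def by auto
    have "(LINT x|?\<mu>. (coord (H x) i - (coord (F x) i - coord (G x) i)) * \<eta> x)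
      = (LINT x|?\<mu>. coord (H x) i * \<eta> x - (coord (F x) i * \<eta> x - coord (G x) i * \<eta> x))"
      by (simp add: algebra_simps)
    also have "\<dots> = (LINT x|?\<mu>. coord (H x) i * \<eta> x)
        - ((LINT x|?\<mu>. coord (F x) i * \<eta> x) - (LINT x|?\<mu>. coord (G x) i * \<eta> x))"
      using int_grad[OF H \<eta> i] int_grad[OF F \<eta> i] int_grad[OF G \<eta> i] by simp
    also have "\<dots> = - (LINT x|?\<mu>. f x * pd i \<eta> x - g x * pd i \<eta> x)
        + ((LINT x|?\<mu>. f x * pd i \<eta> x) - (LINT x|?\<mu>. g x * pd i \<eta> x))"
      by (simp add: eq[OF F] eq[OF G] eq[OF H] left_diff_distrib)
    also have "\<dots> = 0" using int_pd[OF L2(1) \<eta> i] int_pd[OF L2(2) \<eta> i] by simp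
    finally show "(LINT x|?\<mu>. (coord (H x) i - (coord (F x) i - coord (G x) i)) * \<eta> x) = 0" .
  qed measurable
  then have "AE x in ?\<mu>. \<forall>i\<in>{..<n}. coord (H x) i - (coord (F x) i - coord (G x) i) = 0"
    by (subst AE_finite_all) auto
  then show ?thesis
  proof (rule AE_mp, intro AE_I2 impI evec_eqI)
    fix x j assume x: "x \<in> space ?\<mu>" and *: "\<forall>i\<in>{..<n}. coord (H x) i - (coord (F x) i - coord (G x) i) = 0"
    show "coord (H x) j = coord (F x - G x) j"
      using * Rn[of x] x by (cases "j < n") (auto simp: Rn_def)
  qed
qed

lemma row_sel_less:
  assumes "transport_setting P" "s < rnk P" shows "row_sel P s < skel_size P" "col_sel P s < grid_size P"
  using assms unfolding transport_setting_def max_volume_selection_def Let_def by auto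

lemma par_nodes_in_man: "transport_setting P \<Longrightarrow> s < rnk P \<Longrightarrow> par_nodes P s \<in> man P"
  using row_sel_less[of P s] unfolding transport_setting_def par_nodes_def by blast

lemma grad_weak_gradient: "weakly_differentiable n a f \<Longrightarrow> weak_gradient n a f (grad n a f)"
  using someI_ex[of "weak_gradient n a f"] unfolding weakly_differentiable_def grad_def .

text \<open>The joint law of \<open>T\<close> and \<open>T'\<close> is a coupling of the two image
  measures.\<close>

lemma W2_sq_distr_le:
  assumes [measurable]: "T \<in> borel_measurable \<alpha>" "T' \<in> borel_measurable \<alpha>"
  shows "W2_sq (distr \<alpha> borel T) (distr \<alpha> borel T') \<le> (\<integral>\<^sup>+x. ennreal ((dist (T x) (T' x))\<^sup>2) \<partial>\<alpha>)"
proof -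
  let ?\<pi> = "distr \<alpha> (borel \<Otimes>\<^sub>M borel) (\<lambda>x. (T x, T' x))"
  have "?\<pi> \<in> couplings (distr \<alpha> borel T) (distr \<alpha> borel T')"
    unfolding couplings_def by (auto simp: distr_distr o_def)
  then have "W2_sq (distr \<alpha> borel T) (distr \<alpha> borel T') \<le> (\<integral>\<^sup>+(x, y). ennreal ((dist x y)\<^sup>2) \<partial>?\<pi>)"
    unfolding W2_sq_def by (rule INF_lower)
  also have "\<dots> = (\<integral>\<^sup>+x. ennreal ((dist (T x) (T' x))\<^sup>2) \<partial>\<alpha>)"
    by (subst nn_integral_distr) (auto simp: case_prod_unfold)
  finally show ?thesis .
qed

text \<open>The isometry property of \<open>(I - L)^(1/2)\<close> turns the signature error into the transport cost
  between the two maps, which bounds the Wasserstein distance.\<close>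

lemma W2_sq_recon_le:
  assumes T: "transport_setting P" and \<mu>: "\<mu> \<in> man P"
  shows "W2_sq (target P \<mu>) (recon_measure P S \<mu>)
    \<le> ennreal (LINT x|dx P. (signature P \<mu> x - recon_signature P S \<mu> x)\<^sup>2)"
proof -
  let ?n = "space_dim P" and ?a = "half_width P" and ?\<alpha> = "ref_measure P" and ?B = "root_op P"
  have a: "0 < ?a" and div: "divergence_realization ?n ?a ?\<alpha> (gen_op P) ?B"
    and dens [measurable]: "ref_density P \<in> borel_measurable (dx P)"
    using T unfolding transport_setting_def by auto
  have in_B: "(potential P \<nu>, signature P \<nu>) \<in> ?B" if "\<nu> \<in> man P" for \<nu>
    using T that unfolding transport_setting_def by auto
  have opt: "optimal_map ?\<alpha> (target P \<mu>) (transport_map P (potential P \<mu>))"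
    using T \<mu> unfolding transport_setting_def by auto
  have sa: "selfadjoint (dx P) ?B" using div unfolding divergence_realization_def is_sqrt_def by auto
  \<comment> \<open>The same combination of the potentials of the nodes is a preimage of the
    reconstructed signature, so the choice made by \<open>op_inv\<close> lands in the graph of the
    root operator.\<close>
  have "((\<lambda>x. \<Sum>s<rnk P. coord (S \<mu>) s * potential P (par_nodes P s) x), recon_signature P S \<mu>) \<in> ?B"
    unfolding recon_signature_def[abs_def] basis_def
    by (rule selfadjoint_sum[OF sa]) (use par_nodes_in_man[OF T] in_B in auto)
  then have f: "(op_inv ?B (recon_signature P S \<mu>), recon_signature P S \<mu>) \<in> ?B"
    unfolding op_inv_def by (rule someI[where P = "\<lambda>f. (f, recon_signature P S \<mu>) \<in> ?B"])
  let ?f = "op_inv ?B (recon_signature P S \<mu>)" and ?u = "\<lambda>x. potential P \<mu> x - op_inv ?B (recon_signature P S \<mu>) x"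
    and ?g = "\<lambda>x. signature P \<mu> x - recon_signature P S \<mu> x"
  have ug: "(?u, ?g) \<in> ?B"
    using selfadjoint_lincomb[OF sa in_B[OF \<mu>] f, of 1 "-1"] by simp
  have diff: "weakly_differentiable ?n ?a h" "integrable ?\<alpha> (\<lambda>x. (norm (grad ?n ?a h x))\<^sup>2)"
    "ip (dx P) k k = ip (dx P) h h + (LINT x|?\<alpha>. (norm (grad ?n ?a h x))\<^sup>2)" if "(h, k) \<in> ?B" for h k
    using div that unfolding divergence_realization_def by auto
  note wg = grad_weak_gradient[OF diff(1)]
  have "AE x in dx P. grad ?n ?a ?u x = grad ?n ?a (potential P \<mu>) x - grad ?n ?a ?f x"
    by (rule weak_gradient_diff_AE[OF a _ _ wg[OF in_B[OF \<mu>]] wg[OF f] wg[OF ug]])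
      (use selfadjoint_L2[OF sa] in_B[OF \<mu>] f in auto)
  \<comment> \<open>The reference measure has a density with respect to \<open>dx P\<close>, so null
    sets transfer.\<close>
  then have AE: "AE x in ?\<alpha>. grad ?n ?a ?u x = grad ?n ?a (potential P \<mu>) x - grad ?n ?a ?f x"
    unfolding ref_measure_def by (subst AE_density) auto
  have meas1 [measurable]: "transport_map P (potential P \<mu>) \<in> borel_measurable ?\<alpha>"
    using opt unfolding optimal_map_def by auto
  have "grad ?n ?a ?f \<in> borel_measurable (dx P)" using wg[OF f] by (simp add: weak_gradient_def)
  moreover have "(\<lambda>x. x) \<in> borel_measurable (dx P)" by (rule borel_measurable_unif_cube) simp
  ultimately have meas2 [measurable]: "transport_map P ?f \<in> borel_measurable ?\<alpha>"
    unfolding transport_map_def[abs_def] ref_measure_def by (simp add: borel_measurable_diff)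
  have "W2_sq (target P \<mu>) (recon_measure P S \<mu>)
      \<le> (\<integral>\<^sup>+x. ennreal ((dist (transport_map P (potential P \<mu>) x) (transport_map P ?f x))\<^sup>2) \<partial>?\<alpha>)"
    using W2_sq_distr_le[OF meas1 meas2] opt unfolding optimal_map_def recon_measure_def by simp
  also have "\<dots> = (\<integral>\<^sup>+x. ennreal ((norm (grad ?n ?a ?u x))\<^sup>2) \<partial>?\<alpha>)"
    using AE by (intro nn_integral_cong_AE, eventually_elim)
      (simp add: transport_map_def dist_norm norm_minus_commute)
  also have "\<dots> = ennreal (LINT x|?\<alpha>. (norm (grad ?n ?a ?u x))\<^sup>2)"
    by (rule nn_integral_eq_integral) (use diff(2)[OF ug] in auto)
  \<comment> \<open>The graph norm identity: the squared signature error is the squared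
    \<open>L2\<close> norm of the potential error plus the gradient term, and the former is
    dropped.\<close>
  also have "\<dots> \<le> ennreal (LINT x|dx P. (?g x)\<^sup>2)"
  proof (rule ennreal_leI)
    have "0 \<le> ip (dx P) ?u ?u" unfolding ip_def by (rule integral_nonneg_AE) auto
    then show "(LINT x|?\<alpha>. (norm (grad ?n ?a ?u x))\<^sup>2) \<le> (LINT x|dx P. (?g x)\<^sup>2)"
      using diff(3)[OF ug] by (simp add: ip_def power2_eq_square)
  qed
  finally show ?thesis .
qed

section \<open>Determinants\<close>

text \<open>Rows kept as vectors of \<open>evec\<close> turn row operations into function updates
  and give access to the inner product.\<close>

definition rows_mat :: "nat \<Rightarrow> (nat \<Rightarrow> evec) \<Rightarrow> real Matrix.mat" where
  "rows_mat r u = Matrix.mat r r (\<lambda>(i, j). coord (u i) j)"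

lemma rows_mat_carrier [simp]: "rows_mat r u \<in> carrier_mat r r"
  and dim_rows_mat [simp]: "dim_row (rows_mat r u) = r" "dim_col (rows_mat r u) = r"
  by (simp_all add: rows_mat_def)

lemma det_rows_mat_addrow:
  assumes "k < r" "l < r" "k \<noteq> l"
  shows "Determinant.det (rows_mat r (u(k := u k + a *\<^sub>R u l))) = Determinant.det (rows_mat r u)"
proof -
  have "rows_mat r (u(k := u k + a *\<^sub>R u l)) = addrow a k l (rows_mat r u)"
    by (rule eq_matI) (use assms in \<open>auto simp: rows_mat_def\<close>)
  then show ?thesis using det_addrow[OF assms(2,3) rows_mat_carrier] by simp
qed

text \<open>Laplace expansion along row \<open>k\<close>: the cofactors of that row do not involve
  its entries, so the determinant is linear in it.\<close>

lemma det_rows_mat_diff: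
  assumes "k < r"
  shows "Determinant.det (rows_mat r (u(k := x))) - Determinant.det (rows_mat r (u(k := y)))
    = Determinant.det (rows_mat r (u(k := x - y)))"
proof -
  have "mat_delete (rows_mat r (u(k := z))) k j = mat_delete (rows_mat r u) k j" if "j < r" for z j
    by (rule eq_matI) (use assms that in \<open>auto simp: mat_delete_def rows_mat_def\<close>)
  then have cof: "cofactor (rows_mat r (u(k := z))) k j = cofactor (rows_mat r u) k j" if "j < r" for z j
    using that by (simp add: cofactor_def)
  have "Determinant.det (rows_mat r (u(k := z))) = (\<Sum>j<r. coord z j * cofactor (rows_mat r u) k j)" for z
    unfolding laplace_expansion_row[OF rows_mat_carrier assms]
    by (intro sum.cong refl) (use assms cof in \<open>auto simp: rows_mat_def\<close>)
  then show ?thesis by (simp add: sum_subtractf left_diff_distrib)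
qed

text \<open>The product of the matrix with its transpose is the Gram matrix of the rows, here
  diagonal, and its determinant is the square of the one sought.\<close>

lemma det_rows_mat_orthogonal:
  assumes "\<And>i. i < r \<Longrightarrow> u i \<in> Rn r"
    and "\<And>i j. i < r \<Longrightarrow> j < r \<Longrightarrow> i \<noteq> j \<Longrightarrow> inner (u i) (u j) = 0"
  shows "\<bar>Determinant.det (rows_mat r u)\<bar> = (\<Prod>i<r. norm (u i))"
proof -
  let ?M = "rows_mat r u"
  have M: "?M \<in> carrier_mat r r" "transpose_mat ?M \<in> carrier_mat r r" by auto
  have entry: "(?M * transpose_mat ?M) $$ (i, j) = inner (u i) (u j)" if "i < r" "j < r" for i j
    using that inner_Rn[OF assms(1), of i "u j"]
    by (simp add: rows_mat_def scalar_prod_def atLeast0LessThan)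
  have "Determinant.det (?M * transpose_mat ?M) = prod_list (diag_mat (?M * transpose_mat ?M))"
  proof (rule det_upper_triangular)
    show "upper_triangular (?M * transpose_mat ?M)"
      unfolding upper_triangular_def
    proof (intro allI impI)
      fix i j assume "i < dim_row (?M * transpose_mat ?M)" "j < i"
      then have "i < r" "j < r" "i \<noteq> j" by (auto simp: rows_mat_def)
      then show "(?M * transpose_mat ?M) $$ (i, j) = 0" by (simp only: entry) (rule assms(2))
    qed
  qed (use M in auto)
  also have "\<dots> = (\<Prod>i<r. inner (u i) (u i))"
    unfolding prod_list_diag_prod by (intro prod.cong) (auto simp: entry simp del: index_mult_mat(1))
  also have "\<dots> = (\<Prod>i<r. norm (u i))\<^sup>2"
    by (simp add: prod_power_distrib power2_norm_eq_inner)
  finally have "(Determinant.det ?M)\<^sup>2 = (\<Prod>i<r. norm (u i))\<^sup>2"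
    using det_mult[OF M] det_transpose[OF M(1)] by (simp add: power2_eq_square)
  then have "\<bar>Determinant.det ?M\<bar> = \<bar>\<Prod>i<r. norm (u i)\<bar>" by (simp add: power2_eq_iff abs_eq_iff)
  then show ?thesis by (simp add: prod_nonneg)
qed

lemma det_rows_mat_add_sum:
  assumes "k < r" "m \<le> k"
  shows "Determinant.det (rows_mat r (u(k := u k + (\<Sum>l<m. c l *\<^sub>R u l)))) = Determinant.det (rows_mat r u)"
  using assms(2)
proof (induction m)
  case (Suc m)
  let ?u = "u(k := u k + (\<Sum>l<m. c l *\<^sub>R u l))"
  have "?u(k := ?u k + c m *\<^sub>R ?u m) = u(k := u k + (\<Sum>l<Suc m. c l *\<^sub>R u l))"
    using Suc.prems by (auto simp: add.assoc)
  moreover have "Determinant.det (rows_mat r (?u(k := ?u k + c m *\<^sub>R ?u m))) = Determinant.det (rows_mat r ?u)"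
    by (rule det_rows_mat_addrow) (use assms(1) Suc.prems in auto)
  ultimately have "Determinant.det (rows_mat r (u(k := u k + (\<Sum>l<Suc m. c l *\<^sub>R u l))))
      = Determinant.det (rows_mat r ?u)" by (simp only:)
  also have "\<dots> = Determinant.det (rows_mat r u)" by (rule Suc.IH) (use Suc.prems in simp)
  finally show ?case .
qed simp

text \<open>Gram--Schmidt on the rows.\<close>

lemma rows_mat_orthogonalize:
  assumes "\<And>i. i < r \<Longrightarrow> u i \<in> Rn r" and "k \<le> r"
  shows "\<exists>v. (\<forall>i<r. v i \<in> Rn r \<and> norm (v i) \<le> norm (u i)) \<and>
    (\<forall>i<k. \<forall>j<k. i \<noteq> j \<longrightarrow> inner (v i) (v j) = 0) \<and>
    Determinant.det (rows_mat r v) = Determinant.det (rows_mat r u)"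
  using assms(2)
proof (induction k)
  case 0
  then show ?case using assms(1) by (intro exI[of _ u]) auto
next
  case (Suc k)
  then obtain v where v: "\<And>i. i < r \<Longrightarrow> v i \<in> Rn r" "\<And>i. i < r \<Longrightarrow> norm (v i) \<le> norm (u i)"
    and orth: "\<And>i j. i < k \<Longrightarrow> j < k \<Longrightarrow> i \<noteq> j \<Longrightarrow> inner (v i) (v j) = 0"
    and det: "Determinant.det (rows_mat r v) = Determinant.det (rows_mat r u)"
    by auto
  \<comment> \<open>If \<open>v l\<close> is the zero vector, division by zero makes
    \<open>c l\<close> zero, and orthogonality to \<open>v l\<close> is trivial; so dependent rows
    are covered as well.\<close>
  define c where "c l = - (inner (v k) (v l) / inner (v l) (v l))" for l
  define z where "z = v k + (\<Sum>l<k. c l *\<^sub>R v l)"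
  have sum_in: "(\<Sum>l<m. c l *\<^sub>R v l) \<in> Rn r" if "m \<le> k" for m
    using that Suc.prems by (induction m) (auto intro!: Rn_add Rn_scaleR v)
  have z_orth: "inner z (v j) = 0" if "j < k" for j
  proof -
    have "inner z (v j) = inner (v k) (v j) + (\<Sum>l<k. c l * inner (v l) (v j))"
      by (simp add: z_def inner_add_left inner_sum_left)
    also have "(\<Sum>l<k. c l * inner (v l) (v j)) = (\<Sum>l<k. if l = j then c j * inner (v j) (v j) else 0)"
      by (intro sum.cong refl) (use orth that in auto)
    also have "\<dots> = c j * inner (v j) (v j)" using that by simp
    also have "\<dots> = - inner (v k) (v j)" by (cases "v j = 0") (simp_all add: c_def)
    finally show ?thesis by simp
  qed
  \<comment> \<open>Pythagoras: the subtracted part is orthogonal to what remains, so the projection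
    does not lengthen the row.\<close>
  have "(norm (v k))\<^sup>2 = (norm z)\<^sup>2 + (norm (\<Sum>l<k. c l *\<^sub>R v l))\<^sup>2"
  proof -
    have "v k = z - (\<Sum>l<k. c l *\<^sub>R v l)" by (simp add: z_def)
    moreover have "inner z (\<Sum>l<k. c l *\<^sub>R v l) = 0" by (simp add: inner_sum_right z_orth)
    ultimately show ?thesis
      by (simp add: power2_norm_eq_inner inner_diff_left inner_diff_right inner_commute)
  qed
  then have "(norm z)\<^sup>2 \<le> (norm (v k))\<^sup>2" by simp
  then have z_norm: "norm z \<le> norm (v k)" by (rule power2_le_imp_le) simp
  have kr: "k < r" using Suc.prems by simp
  have "z \<in> Rn r" unfolding z_def using v(1)[OF kr] sum_in by (intro Rn_add) auto
  moreover have "inner (v j) z = 0" if "j < k" for j using z_orth[OF that] by (simp add: inner_commute)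
  moreover have det': "Determinant.det (rows_mat r (v(k := z))) = Determinant.det (rows_mat r u)"
    using det_rows_mat_add_sum[OF kr order_refl, of v c] det unfolding z_def[symmetric] by (simp only:)
  moreover have "norm z \<le> norm (u k)" using z_norm v(2)[OF kr] by (rule order_trans)
  ultimately show ?case
    using v z_orth orth kr
    by (intro exI[of _ "v(k := z)"] conjI) (simp_all add: less_Suc_eq det'[unfolded fun_upd_def])
qed

text \<open>Orthogonalizing keeps the determinant and does not lengthen any row, and for orthogonal
  rows equality holds.\<close>

lemma Hadamard_inequality:
  assumes "\<And>i. i < r \<Longrightarrow> u i \<in> Rn r"
  shows "\<bar>Determinant.det (rows_mat r u)\<bar> \<le> (\<Prod>i<r. norm (u i))"
proof -
  obtain v where v: "\<And>i. i < r \<Longrightarrow> v i \<in> Rn r" "\<And>i. i < r \<Longrightarrow> norm (v i) \<le> norm (u i)"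
    and orth: "\<And>i j. i < r \<Longrightarrow> j < r \<Longrightarrow> i \<noteq> j \<Longrightarrow> inner (v i) (v j) = 0"
    and det: "Determinant.det (rows_mat r v) = Determinant.det (rows_mat r u)"
    using rows_mat_orthogonalize[where u = u and k = r, OF assms] by auto
  have "\<bar>Determinant.det (rows_mat r v)\<bar> = (\<Prod>i<r. norm (v i))"
    by (rule det_rows_mat_orthogonal) (use v orth in auto)
  also have "\<dots> \<le> (\<Prod>i<r. norm (u i))" by (rule prod_mono) (use v in auto)
  finally show ?thesis by (simp add: det)
qed

lemma norm_le_sqrt_dim:
  assumes "x \<in> Rn r" "\<And>i. i < r \<Longrightarrow> \<bar>coord x i\<bar> \<le> e" "0 \<le> e"
  shows "norm x \<le> sqrt (real r) * e"
proof -
  have "(\<Sum>i<r. (coord x i)\<^sup>2) \<le> (\<Sum>i<r. e\<^sup>2)"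
    by (intro sum_mono) (use assms in \<open>auto simp: abs_le_square_iff[symmetric]\<close>)
  then have "norm x \<le> sqrt (real r * e\<^sup>2)" by (simp add: norm_Rn[OF assms(1)])
  also have "\<dots> = sqrt (real r) * e" using assms(3) by (simp add: real_sqrt_mult)
  finally show ?thesis .
qed

text \<open>The rows are exchanged one at a time, and each exchange is controlled by Hadamard's inequality.\<close>

lemma det_perturbation:
  fixes a b :: "nat \<Rightarrow> nat \<Rightarrow> real"
  assumes r: "1 \<le> r" and U: "0 \<le> U" "0 \<le> e"
    and a: "\<And>i j. i < r \<Longrightarrow> j < r \<Longrightarrow> \<bar>a i j\<bar> \<le> U"
    and b: "\<And>i j. i < r \<Longrightarrow> j < r \<Longrightarrow> \<bar>b i j\<bar> \<le> U"
    and ab: "\<And>i j. i < r \<Longrightarrow> j < r \<Longrightarrow> \<bar>a i j - b i j\<bar> \<le> e"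
  shows "\<bar>Determinant.det (Matrix.mat r r (\<lambda>(i, j). a i j)) - Determinant.det (Matrix.mat r r (\<lambda>(i, j). b i j))\<bar>
    \<le> real r powr (real r / 2 + 1) * U ^ (r - 1) * e"
proof -
  define A where "A i = of_coords r (a i)" for i
  define B where "B i = of_coords r (b i)" for i
  \<comment> \<open>\<open>H k\<close> has its first \<open>k\<close> rows from \<open>b\<close> and
    the others from \<open>a\<close>, so consecutive matrices differ in row \<open>k\<close>
    only.\<close>
  define H where "H k i = (if i < k then B i else A i)" for k i
  let ?d = "\<lambda>u. Determinant.det (rows_mat r u)"
  have AB: "A i \<in> Rn r" "B i \<in> Rn r" for i by (simp_all add: A_def B_def)
  have step: "\<bar>?d (H k) - ?d (H (Suc k))\<bar> \<le> sqrt (real r) ^ r * U ^ (r - 1) * e" if k: "k < r" for k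
  proof -
    have "H k = (H k)(k := A k)" "H (Suc k) = (H k)(k := B k)"
      by (auto simp: H_def less_Suc_eq)
    then have "?d (H k) - ?d (H (Suc k)) = ?d ((H k)(k := A k - B k))"
      using det_rows_mat_diff[OF k, of "H k" "A k" "B k"] by simp
    also have "\<bar>\<dots>\<bar> \<le> (\<Prod>i<r. norm (((H k)(k := A k - B k)) i))"
      by (rule Hadamard_inequality) (use AB in \<open>auto simp: H_def intro!: Rn_diff\<close>)
    also have "\<dots> = norm (A k - B k) * (\<Prod>i\<in>{..<r} - {k}. norm (H k i))"
      using k by (subst prod.remove[of _ k]) auto
    also have "\<dots> \<le> (sqrt (real r) * e) * (\<Prod>i\<in>{..<r} - {k}. sqrt (real r) * U)"
    proof (intro mult_mono prod_mono conjI)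
      show "norm (A k - B k) \<le> sqrt (real r) * e"
        by (rule norm_le_sqrt_dim) (use AB k ab U in \<open>auto simp: A_def B_def intro!: Rn_diff\<close>)
      fix i assume "i \<in> {..<r} - {k}"
      then show "norm (H k i) \<le> sqrt (real r) * U"
        by (intro norm_le_sqrt_dim) (use AB a b U in \<open>auto simp: A_def B_def H_def\<close>)
    qed (use U in \<open>auto intro!: prod_nonneg mult_nonneg_nonneg\<close>)
    also have "\<dots> = (sqrt (real r) * e) * (sqrt (real r) * U) ^ (r - 1)"
      using k by simp
    also have "\<dots> = sqrt (real r) ^ Suc (r - 1) * U ^ (r - 1) * e"
      by (simp add: power_mult_distrib mult_ac)
    finally show ?thesis using r by simp
  qed
  have "?d A - ?d B = (\<Sum>k<r. ?d (H k) - ?d (H (Suc k)))"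
  proof -
    have "rows_mat r (H 0) = rows_mat r A" "rows_mat r (H r) = rows_mat r B"
      by (auto simp: rows_mat_def H_def)
    then show ?thesis using sum_lessThan_telescope'[of "\<lambda>k. ?d (H k)" r] by simp
  qed
  also have "\<bar>\<dots>\<bar> \<le> (\<Sum>k<r. \<bar>?d (H k) - ?d (H (Suc k))\<bar>)" by (rule sum_abs)
  also have "\<dots> \<le> (\<Sum>k<r. sqrt (real r) ^ r * U ^ (r - 1) * e)"
    by (rule sum_mono) (use step in auto)
  \<comment> \<open>Origin of the constant: each of the \<open>r\<close> exchanges costs a factor
    \<open>sqrt r\<close> for every row, and \<open>r * sqrt r ^ r\<close> is
    \<open>r powr (r / 2 + 1)\<close>.\<close>
  also have "\<dots> = real r * sqrt (real r) ^ r * U ^ (r - 1) * e" by simp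
  also have "real r * sqrt (real r) ^ r = real r powr (real r / 2 + 1)"
  proof -
    have "sqrt (real r) ^ r = (real r powr (1 / 2)) powr real r"
      using r by (simp add: powr_half_sqrt powr_realpow)
    then show ?thesis using r by (simp add: powr_powr powr_add)
  qed
  finally have "\<bar>?d A - ?d B\<bar> \<le> real r powr (real r / 2 + 1) * U ^ (r - 1) * e" .
  moreover have "rows_mat r A = Matrix.mat r r (\<lambda>(i, j). a i j)" "rows_mat r B = Matrix.mat r r (\<lambda>(i, j). b i j)"
    by (auto simp: rows_mat_def A_def B_def)
  ultimately show ?thesis by simp
qed

section \<open>Quadratic forms\<close>

definition quad_form :: "nat \<Rightarrow> (nat \<Rightarrow> nat \<Rightarrow> real) \<Rightarrow> evec \<Rightarrow> real" where
  "quad_form r a x = (\<Sum>i<r. \<Sum>j<r. a i j * coord x i * coord x j)"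

lemma quad_form_eq: "quad_form r a x = (\<Sum>i<r. coord x i * (\<Sum>j<r. a i j * coord x j))"
  by (simp add: quad_form_def sum_distrib_left mult_ac)

lemma quad_form_scaleR: "quad_form r a (c *\<^sub>R x) = c\<^sup>2 * quad_form r a x"
  by (simp add: quad_form_def sum_distrib_left power2_eq_square mult_ac)

lemma quad_form_add:
  assumes sym: "\<And>i j. i < r \<Longrightarrow> j < r \<Longrightarrow> a i j = a j i"
  shows "quad_form r a (x + y) = quad_form r a x + 2 * (\<Sum>i<r. coord y i * (\<Sum>j<r. a i j * coord x j)) + quad_form r a y"
proof -
  have "(\<Sum>i<r. \<Sum>j<r. a i j * coord x i * coord y j) = (\<Sum>j<r. \<Sum>i<r. a i j * coord x i * coord y j)"
    by (rule sum.swap)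
  also have "\<dots> = (\<Sum>i<r. \<Sum>j<r. a i j * coord y i * coord x j)"
    by (intro sum.cong refl) (use sym in \<open>simp add: mult_ac\<close>)
  finally show ?thesis
    by (simp add: quad_form_def algebra_simps sum.distrib sum_distrib_left)
qed

text \<open>A minimizer of the Rayleigh quotient is an eigenvector.\<close>

lemma Rayleigh_minimum:
  assumes r: "1 \<le> r" and sym: "\<And>i j. i < r \<Longrightarrow> j < r \<Longrightarrow> a i j = a j i"
  shows "\<exists>x e. x \<in> Rn r \<and> x \<noteq> 0 \<and> (\<forall>i<r. (\<Sum>j<r. a i j * coord x j) = e * coord x i) \<and>
    (\<forall>y\<in>Rn r. e * (norm y)\<^sup>2 \<le> quad_form r a y)"
proof -
  let ?S = "{x \<in> Rn r. norm x = 1}"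
  have "?S = Rn r \<inter> {x. norm x = 1}" by auto
  moreover have "closed {x::evec. norm x = 1}" by (intro closed_Collect_eq continuous_intros)
  ultimately have "closed ?S" using closed_Rn by (simp add: closed_Int)
  moreover have "?S \<subseteq> cube r 1" using cball_Rn_subset_cube by auto
  ultimately have cpt: "compact ?S" by (rule compact_closed_subset_cube)
  have "unit_evec 0 \<in> ?S" using r by (simp add: unit_evec_Rn)
  then have ne: "?S \<noteq> {}" by blast
  have "continuous_on ?S (quad_form r a)"
    unfolding quad_form_def[abs_def] by (intro continuous_intros)
  from continuous_attains_inf[OF cpt ne this]
  obtain x where x: "x \<in> ?S" and "\<forall>y\<in>?S. quad_form r a x \<le> quad_form r a y" by blast
  then have min: "\<And>y. y \<in> ?S \<Longrightarrow> quad_form r a x \<le> quad_form r a y" by blast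
  define e where "e = quad_form r a x"
  have low: "e * (norm y)\<^sup>2 \<le> quad_form r a y" if y: "y \<in> Rn r" for y
  proof (cases "y = 0")
    case True
    then show ?thesis by (simp add: quad_form_def)
  next
    case False
    have "(1 / norm y) *\<^sub>R y \<in> ?S" using y False by (auto intro!: Rn_scaleR)
    from min[OF this] have "e \<le> (1 / norm y)\<^sup>2 * quad_form r a y" by (simp add: e_def quad_form_scaleR)
    then show ?thesis using False by (simp add: field_simps)
  qed
  have "(\<Sum>j<r. a i j * coord x j) = e * coord x i" if i: "i < r" for i
  proof -
    define g where "g = (\<Sum>j<r. a i j * coord x j) - e * coord x i"
    define h where "h = a i i - e"
    \<comment> \<open>First variation in direction \<open>unit_evec i\<close>: a quadratic
      polynomial in \<open>t\<close> without constant term that is nowhere negative has vanishing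
      linear coefficient, and \<open>g\<close> is the defect in the \<open>i\<close>-th component of
      the eigenvector equation.\<close>
    have *: "0 \<le> 2 * t * g + t\<^sup>2 * h" for t
    proof -
      let ?y = "x + t *\<^sub>R unit_evec i"
      have delta: "(\<Sum>k<r. (if k = i then 1 else 0) * f k) = f i" for f :: "nat \<Rightarrow> real"
        using i by (simp add: if_distrib[of "\<lambda>c. c * _"] cong: if_cong)
      have "(norm ?y)\<^sup>2 = 1 + 2 * t * coord x i + t\<^sup>2"
      proof -
        have "(norm ?y)\<^sup>2 = inner x x + 2 * t * inner (unit_evec i) x + t * t * inner (unit_evec i) (unit_evec i)"
          unfolding power2_norm_eq_inner
          by (simp add: inner_add_left inner_add_right inner_commute algebra_simps)
        moreover have "inner x x = 1" using x by (simp add: power2_norm_eq_inner[symmetric])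
        ultimately show ?thesis by (simp add: power2_eq_square)
      qed
      moreover have "quad_form r a ?y = e + 2 * t * (\<Sum>j<r. a i j * coord x j) + t\<^sup>2 * a i i"
      proof -
        have "quad_form r a (unit_evec i) = a i i"
          using i by (simp add: quad_form_eq delta if_distrib[of "\<lambda>c. _ * c"] cong: if_cong)
        then show ?thesis
          by (subst quad_form_add[OF sym])
            (simp_all add: quad_form_scaleR e_def mult.assoc sum_distrib_left[symmetric] delta)
      qed
      moreover have "e * (norm ?y)\<^sup>2 \<le> quad_form r a ?y"
        by (rule low) (use x i in \<open>auto intro!: Rn_add Rn_scaleR unit_evec_Rn\<close>)
      ultimately show ?thesis by (simp add: g_def h_def algebra_simps)
    qed
    have "g = 0"
    proof (rule ccontr)
      assume g: "g \<noteq> 0"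
      \<comment> \<open>A step against the sign of \<open>g\<close>, of a size for which the linear
        term wins; the summand one keeps the denominator positive when \<open>h\<close>
        vanishes.\<close>
      define t where "t = - g / (1 + \<bar>h\<bar>)"
      have "2 * t * g + t\<^sup>2 * h \<le> 2 * t * g + t\<^sup>2 * (1 + \<bar>h\<bar>)" by (intro add_left_mono mult_left_mono) auto
      also have "\<dots> = 2 * t * g + t * (t * (1 + \<bar>h\<bar>))" by (simp add: power2_eq_square)
      also have "t * (1 + \<bar>h\<bar>) = - g"
      proof -
        have "1 + \<bar>h\<bar> \<noteq> 0" by linarith
        then show ?thesis by (simp add: t_def)
      qed
      also have "2 * t * g + t * - g = - (g * g / (1 + \<bar>h\<bar>))" by (simp add: t_def)
      also have "\<dots> < 0"
      proof -
        have "0 < g * g" using g by (metis not_real_square_gt_zero)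
        moreover have "0 < 1 + \<bar>h\<bar>" by linarith
        ultimately show ?thesis by simp
      qed
      finally show False using *[of t] by simp
    qed
    then show ?thesis by (simp add: g_def)
  qed
  moreover have "x \<in> Rn r" "x \<noteq> 0" using x by auto
  ultimately show ?thesis using low by blast
qed

lemma mult_mat_vec_of_vec:
  assumes "A \<in> carrier_mat r r" "x \<in> Rn r"
  shows "A *\<^sub>v Matrix.vec r (coord x) = Matrix.vec r (\<lambda>i. \<Sum>j<r. A $$ (i, j) * coord x j)"
  by (rule eq_vecI) (use assms in \<open>auto simp: scalar_prod_def atLeast0LessThan\<close>)

lemma eigenvalueI:
  assumes A: "A \<in> carrier_mat r r" and x: "x \<in> Rn r" "x \<noteq> 0"
    and eq: "\<And>i. i < r \<Longrightarrow> (\<Sum>j<r. A $$ (i, j) * coord x j) = e * coord x i"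
  shows "eigenvalue A e"
  unfolding eigenvalue_def eigenvector_def
proof (intro exI conjI)
  let ?v = "Matrix.vec r (coord x)"
  show "?v \<in> carrier_vec (dim_row A)" using A by auto
  show "?v \<noteq> 0\<^sub>v (dim_row A)"
  proof
    assume v: "?v = 0\<^sub>v (dim_row A)"
    have "coord x i = coord 0 i" for i
    proof (cases "i < r")
      case True
      then have "vec_index ?v i = vec_index (0\<^sub>v (dim_row A)) i" by (simp add: v)
      then show ?thesis using True A by auto
    qed (use x in \<open>auto simp: Rn_def\<close>)
    then show False using x(2) by (auto intro: evec_eqI)
  qed
  show "A *\<^sub>v ?v = e \<cdot>\<^sub>v ?v"
    unfolding mult_mat_vec_of_vec[OF A x(1)] by (rule eq_vecI) (use eq in auto)
qed

lemma finite_eigenvalues: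
  assumes "(A :: real Matrix.mat) \<in> carrier_mat r r" shows "finite {e. eigenvalue A e}"
proof -
  have "char_poly A \<noteq> 0" using degree_monic_char_poly[OF assms] by auto
  then show ?thesis
    unfolding eigenvalue_root_char_poly[OF assms] by (rule poly_roots_finite)
qed

text \<open>The minimum of the Rayleigh quotient is itself an eigenvalue, hence at least
  \<open>lambda_min\<close>; the negated matrix gives the upper estimate. Finiteness of the spectrum
  makes \<open>Min\<close> and \<open>Max\<close> meaningful.\<close>

lemma lambda_min_max_quad_form:
  assumes r: "1 \<le> r" and A: "A = Matrix.mat r r (\<lambda>(i, j). a i j)"
    and sym: "\<And>i j. i < r \<Longrightarrow> j < r \<Longrightarrow> a i j = a j i" and y: "y \<in> Rn r"
  shows "lambda_min A * (norm y)\<^sup>2 \<le> quad_form r a y" "quad_form r a y \<le> lambda_max A * (norm y)\<^sup>2"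
proof -
  have Ac: "A \<in> carrier_mat r r" by (simp add: A)
  note fin = finite_eigenvalues[OF Ac]
  obtain x e where x: "x \<in> Rn r" "x \<noteq> 0" "\<And>i. i < r \<Longrightarrow> (\<Sum>j<r. a i j * coord x j) = e * coord x i"
    and low: "\<And>y. y \<in> Rn r \<Longrightarrow> e * (norm y)\<^sup>2 \<le> quad_form r a y"
    using Rayleigh_minimum[where r = r and a = a, OF r sym] by auto
  have "eigenvalue A e" by (rule eigenvalueI[OF Ac x(1,2)]) (use x(3) in \<open>simp add: A\<close>)
  then have "lambda_min A \<le> e" unfolding lambda_min_def using fin by (intro Min_le) auto
  then have "lambda_min A * (norm y)\<^sup>2 \<le> e * (norm y)\<^sup>2" by (rule mult_right_mono) simp
  then show "lambda_min A * (norm y)\<^sup>2 \<le> quad_form r a y" using low[OF y] by linarith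
  obtain x e where x: "x \<in> Rn r" "x \<noteq> 0" "\<And>i. i < r \<Longrightarrow> (\<Sum>j<r. - a i j * coord x j) = e * coord x i"
    and low: "\<And>y. y \<in> Rn r \<Longrightarrow> e * (norm y)\<^sup>2 \<le> quad_form r (\<lambda>i j. - a i j) y"
  proof -
    have "\<exists>x e. x \<in> Rn r \<and> x \<noteq> 0 \<and> (\<forall>i<r. (\<Sum>j<r. - a i j * coord x j) = e * coord x i) \<and>
        (\<forall>y\<in>Rn r. e * (norm y)\<^sup>2 \<le> quad_form r (\<lambda>i j. - a i j) y)"
      by (rule Rayleigh_minimum[OF r]) (use sym in simp)
    then show ?thesis using that by blast
  qed
  have "eigenvalue A (- e)"
  proof (rule eigenvalueI[OF Ac x(1,2)])
    fix i assume "i < r"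
    then show "(\<Sum>j<r. A $$ (i, j) * coord x j) = - e * coord x i"
      using x(3)[of i] by (simp add: A sum_negf)
  qed
  then have "- e \<le> lambda_max A" unfolding lambda_max_def using fin by (intro Max_ge) auto
  then have "- e * (norm y)\<^sup>2 \<le> lambda_max A * (norm y)\<^sup>2" by (rule mult_right_mono) simp
  moreover have "quad_form r (\<lambda>i j. - a i j) y = - quad_form r a y" by (simp add: quad_form_def sum_negf)
  ultimately show "quad_form r a y \<le> lambda_max A * (norm y)\<^sup>2" using low[OF y] by simp
qed

lemma mat_inverse_if_det_nonzero:
  assumes A: "(A :: real Matrix.mat) \<in> carrier_mat r r" and "Determinant.det A \<noteq> 0"
  obtains B where "mat_inverse A = Some B" "B \<in> carrier_mat r r" "A * B = 1\<^sub>m r" "B * A = 1\<^sub>m r"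
  using mat_inverse(1)[OF A, where b = "()"] mat_inverse(2)[OF A] det_non_zero_imp_unit[OF assms, where b = "()"]
  by (cases "mat_inverse A") auto

lemma coercive_det_nonzero:
  assumes A: "A = Matrix.mat r r (\<lambda>(i, j). a i j)" and c: "0 < c"
    and coer: "\<And>y. y \<in> Rn r \<Longrightarrow> c * (norm y)\<^sup>2 \<le> quad_form r a y"
  shows "Determinant.det A \<noteq> 0"
proof
  have Ac: "A \<in> carrier_mat r r" by (simp add: A)
  assume "Determinant.det A = 0"
  then obtain v where v: "v \<in> carrier_vec r" "v \<noteq> 0\<^sub>v r" "A *\<^sub>v v = 0\<^sub>v r"
    using det_0_iff_vec_prod_zero[OF Ac] by auto
  define x where "x = of_coords r (vec_index v)"
  have x: "x \<in> Rn r" by (simp add: x_def)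
  have vx: "v = Matrix.vec r (coord x)" by (rule eq_vecI) (use v in \<open>auto simp: x_def\<close>)
  have "(\<Sum>j<r. a i j * coord x j) = 0" if "i < r" for i
  proof -
    have "vec_index (A *\<^sub>v v) i = 0" using v(3) that by simp
    then show ?thesis using that unfolding vx mult_mat_vec_of_vec[OF Ac x] by (simp add: A)
  qed
  then have "quad_form r a x = 0" by (simp add: quad_form_eq)
  then have "c * (norm x)\<^sup>2 \<le> 0" using coer[OF x] by simp
  then have "x = 0" using c by (simp add: mult_le_0_iff)
  then have "v = 0\<^sub>v r" unfolding vx by (intro eq_vecI) auto
  then show False using v(2) by simp
qed

lemma inverse_solves:
  assumes A: "A = Matrix.mat r r (\<lambda>(i, j). a i j)" and B: "mat_inverse A = Some B"
    "B \<in> carrier_mat r r" "A * B = 1\<^sub>m r" and b: "b \<in> carrier_vec r" and i: "i < r"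
  shows "(\<Sum>j<r. a i j * coord (of_vec (the (mat_inverse A) *\<^sub>v b)) j) = vec_index b i"
    and "of_vec (the (mat_inverse A) *\<^sub>v b) \<in> Rn r"
proof -
  have Ac: "A \<in> carrier_mat r r" by (simp add: A)
  have "A *\<^sub>v (B *\<^sub>v b) = b" using assoc_mult_mat_vec[OF Ac B(2) b] B(3) b by simp
  moreover have "vec_index (A *\<^sub>v (B *\<^sub>v b)) i = (\<Sum>j<r. a i j * vec_index (B *\<^sub>v b) j)"
    using i B(2) b by (simp add: A scalar_prod_def atLeast0LessThan)
  moreover have dim: "dim_vec (B *\<^sub>v b) = r" using B(2) by simp
  ultimately show "(\<Sum>j<r. a i j * coord (of_vec (the (mat_inverse A) *\<^sub>v b)) j) = vec_index b i"
    by (simp add: B(1) of_vec_def dim)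
  show "of_vec (the (mat_inverse A) *\<^sub>v b) \<in> Rn r"
    unfolding B(1) option.sel of_vec_def dim by simp
qed

text \<open>The energy estimate: testing the system with its own solution bounds c |x|^2 by |x| |b|.
  It later supplies the size, the Lipschitz constant, the uniqueness and the quadrature stability of
  the coefficients.\<close>

lemma coercive_solution_bound:
  assumes c: "0 < c" and coer: "\<And>y. y \<in> Rn r \<Longrightarrow> c * (norm y)\<^sup>2 \<le> quad_form r a y"
    and x: "x \<in> Rn r" and eq: "\<And>i. i < r \<Longrightarrow> (\<Sum>j<r. a i j * coord x j) = b i"
    and b: "\<And>i. i < r \<Longrightarrow> \<bar>b i\<bar> \<le> e" "0 \<le> e"
  shows "norm x \<le> sqrt (real r) * e / c"
proof (cases "x = 0")
  case True
  then show ?thesis using c b by simp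
next
  case False
  have "c * (norm x)\<^sup>2 \<le> quad_form r a x" by (rule coer[OF x])
  also have "\<dots> = inner x (of_coords r b)"
    unfolding quad_form_eq inner_Rn[OF x] by (intro sum.cong refl) (simp add: eq)
  also have "\<dots> \<le> norm x * norm (of_coords r b)" by (rule norm_cauchy_schwarz)
  finally have le: "c * (norm x)\<^sup>2 \<le> norm x * norm (of_coords r b)" .
  have "norm (of_coords r b) \<le> sqrt (real r) * e"
  proof -
    have "(\<Sum>i<r. (coord (of_coords r b) i)\<^sup>2) \<le> (\<Sum>i<r. e\<^sup>2)"
      by (intro sum_mono) (use b in \<open>auto simp: abs_le_square_iff[symmetric]\<close>)
    then have "norm (of_coords r b) \<le> sqrt (real r * e\<^sup>2)" by (subst norm_Rn[of _ r]) simp_all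
    also have "\<dots> = sqrt (real r) * e" using b(2) by (simp add: real_sqrt_mult)
    finally show ?thesis .
  qed
  then have "norm x * norm (of_coords r b) \<le> norm x * (sqrt (real r) * e)" by (rule mult_left_mono) simp
  with le have "norm x * (c * norm x) \<le> norm x * (sqrt (real r) * e)"
    by (simp add: power2_eq_square mult_ac)
  then have "c * norm x \<le> sqrt (real r) * e" using False by simp
  then show ?thesis using c by (simp add: field_simps)
qed

section \<open>The volume condition\<close>

text \<open>What the proof uses about the geodesic distance; it is finite on \<open>M\<close> because \<open>M\<close> is
  connected and compact.\<close>

definition dist_regular :: "problem \<Rightarrow> bool" where
  "dist_regular P \<longleftrightarrow> (\<forall>p\<in>man P. par_dist P p p = 0) \<and> (\<forall>p\<in>man P. \<forall>q\<in>man P. 0 \<le> par_dist P p q) \<and>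
     (\<exists>B. \<forall>p\<in>man P. \<forall>q\<in>man P. par_dist P p q \<le> B)"

lemma signature_space_lipschitz:
  assumes "kernel_regular P Lip U" "dist_regular P" "\<mu> \<in> man P" "x \<in> Omega P" "y \<in> Omega P"
  shows "\<bar>signature P \<mu> x - signature P \<mu> y\<bar> \<le> Lip * norm (x - y)"
proof -
  have "\<bar>signature P \<mu> x - signature P \<mu> y\<bar> \<le> Lip * sqrt ((par_dist P \<mu> \<mu>)\<^sup>2 + (norm (x - y))\<^sup>2)"
    using assms unfolding kernel_regular_def by blast
  then show ?thesis using assms by (simp add: dist_regular_def)
qed

lemma signature_par_lipschitz:
  assumes "kernel_regular P Lip U" "dist_regular P" "\<mu> \<in> man P" "\<nu> \<in> man P" "x \<in> Omega P"
  shows "\<bar>signature P \<nu> x - signature P \<mu> x\<bar> \<le> Lip * par_dist P \<mu> \<nu>"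
proof -
  have "\<bar>signature P \<nu> x - signature P \<mu> x\<bar> \<le> Lip * sqrt ((par_dist P \<mu> \<nu>)\<^sup>2 + (norm (x - x))\<^sup>2)"
    using assms unfolding kernel_regular_def by blast
  then show ?thesis using assms by (simp add: dist_regular_def)
qed

lemma signature_bound:
  "kernel_regular P Lip U \<Longrightarrow> \<mu> \<in> man P \<Longrightarrow> x \<in> Omega P \<Longrightarrow> \<bar>signature P \<mu> x\<bar> \<le> U"
  unfolding kernel_regular_def by blast

text \<open>Both fill distances are suprema of minima. In the reals a supremum carries information
  only for bounded families, hence the common bound \<open>B\<close>.\<close>

lemma le_SUP_Min:
  assumes "\<And>x. x \<in> S \<Longrightarrow> \<forall>l<N. f x l \<le> (B::real)" "1 \<le> (N::nat)" "x \<in> S"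
  obtains l where "l < N" "f x l \<le> (SUP x\<in>S. Min (f x ` {..<N}))"
proof -
  have ne: "f x ` {..<N} \<noteq> {}" for x using assms(2) by (auto simp: lessThan_empty_iff)
  have "Min (f x ` {..<N}) \<in> f x ` {..<N}" by (rule Min_in) (use ne in auto)
  then obtain l where l: "l < N" "f x l = Min (f x ` {..<N})" by auto
  have "bdd_above ((\<lambda>x. Min (f x ` {..<N})) ` S)"
  proof (rule bdd_aboveI2)
    fix y assume y: "y \<in> S"
    have "Min (f y ` {..<N}) \<le> f y 0" by (rule Min_le) (use assms(2) in auto)
    also have "f y 0 \<le> B" using assms(1)[OF y] assms(2) by simp
    finally show "Min (f y ` {..<N}) \<le> B" .
  qed
  then have "Min (f x ` {..<N}) \<le> (SUP x\<in>S. Min (f x ` {..<N}))" using assms(3) by (intro cSUP_upper)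
  then show ?thesis using that l by simp
qed

lemma fill_par_nearest:
  assumes "transport_setting P" "dist_regular P" "\<mu> \<in> man P"
  obtains l where "l < skel_size P" "par_dist P \<mu> (skel_pt P l) \<le> fill_par P"
proof -
  have sk: "1 \<le> skel_size P" "\<And>l. l < skel_size P \<Longrightarrow> skel_pt P l \<in> man P"
    using assms(1) unfolding transport_setting_def by auto
  obtain B where "\<And>p q. p \<in> man P \<Longrightarrow> q \<in> man P \<Longrightarrow> par_dist P p q \<le> B"
    using assms(2) unfolding dist_regular_def by blast
  then have "\<forall>l<skel_size P. par_dist P p (skel_pt P l) \<le> B" if "p \<in> man P" for p using sk that by blast
  from le_SUP_Min[of "man P" "skel_size P" "\<lambda>\<mu> l. par_dist P \<mu> (skel_pt P l)", OF this sk(1) assms(3)]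
  show ?thesis using that unfolding fill_par_def by blast
qed

lemma fill_space_nearest:
  assumes "transport_setting P" "x \<in> Omega P"
  obtains l where "l < grid_size P" "norm (x - grid_pt P l) \<le> fill_space P"
proof -
  have sk: "1 \<le> grid_size P" "\<And>l. l < grid_size P \<Longrightarrow> grid_pt P l \<in> Omega P"
    using assms(1) unfolding transport_setting_def by auto
  obtain B where B: "\<And>y. y \<in> Omega P \<Longrightarrow> norm y \<le> B"
    using compact_imp_bounded[OF compact_cube] unfolding bounded_iff by blast
  have "\<forall>l<grid_size P. norm (y - grid_pt P l) \<le> B + B" if "y \<in> Omega P" for y
    using norm_triangle_ineq4[of y] B[OF that] B[OF sk(2)] by (meson add_mono order_trans)
  from le_SUP_Min[of "Omega P" "grid_size P" "\<lambda>x k. norm (x - grid_pt P k)", OF this sk(1) assms(2)]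
  show ?thesis using that unfolding fill_space_def by blast
qed

lemma man_nonempty: "transport_setting P \<Longrightarrow> man P \<noteq> {}"
  unfolding transport_setting_def by fastforce

lemma fill_nonneg:
  assumes "transport_setting P" "dist_regular P"
  shows "0 \<le> fill_par P" "0 \<le> fill_space P"
proof -
  obtain \<mu> where \<mu>: "\<mu> \<in> man P" using man_nonempty[OF assms(1)] by blast
  obtain l where l: "l < skel_size P" "par_dist P \<mu> (skel_pt P l) \<le> fill_par P"
    using fill_par_nearest[OF assms \<mu>] by blast
  have "skel_pt P l \<in> man P" using assms(1) l unfolding transport_setting_def by auto
  then have "0 \<le> par_dist P \<mu> (skel_pt P l)" using assms(2) \<mu> by (simp add: dist_regular_def)
  then show "0 \<le> fill_par P" using l by linarith
  have "grid_pt P 0 \<in> Omega P" using assms(1) unfolding transport_setting_def by auto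
  then obtain k where "norm (grid_pt P 0 - grid_pt P k) \<le> fill_space P"
    using fill_space_nearest[OF assms(1)] by blast
  then show "0 \<le> fill_space P" using norm_ge_zero order_trans by blast
qed

text \<open>The selection is maximal among injective index maps only. Nearest sample points of
  different points may coincide, but then a repeated row or column makes the determinant
  vanish.\<close>

lemma kernel_det_le_selected:
  assumes T: "transport_setting P" and i: "\<And>s. s < rnk P \<Longrightarrow> i s < skel_size P"
    and j: "\<And>t. t < rnk P \<Longrightarrow> j t < grid_size P"
  shows "\<bar>Determinant.det (kernel_mat P (\<lambda>s. skel_pt P (i s)) (\<lambda>t. grid_pt P (j t)))\<bar>
    \<le> \<bar>Determinant.det (kernel_mat P (par_nodes P) (space_nodes P))\<bar>"
proof -
  let ?r = "rnk P" and ?K = "kernel_mat P (\<lambda>s. skel_pt P (i s)) (\<lambda>t. grid_pt P (j t))"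
  have K: "?K \<in> carrier_mat ?r ?r" by (simp add: kernel_mat_def)
  consider "inj_on i {..<?r} \<and> inj_on j {..<?r}" | "\<not> inj_on i {..<?r}" | "\<not> inj_on j {..<?r}" by blast
  then show ?thesis
  proof cases
    case 1
    then have "i \<in> {f. inj_on f {..<?r} \<and> f ` {..<?r} \<subseteq> {..<skel_size P}}"
      "j \<in> {f. inj_on f {..<?r} \<and> f ` {..<?r} \<subseteq> {..<grid_size P}}" using i j by auto
    moreover have "max_volume_selection P" using T unfolding transport_setting_def by blast
    ultimately show ?thesis
      unfolding max_volume_selection_def Let_def par_nodes_def[abs_def] space_nodes_def[abs_def] by blast
  next
    case 2
    then obtain s t where st: "s < ?r" "t < ?r" "s \<noteq> t" "i s = i t" unfolding inj_on_def by auto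
    have "Matrix.row ?K s = Matrix.row ?K t" by (rule eq_vecI) (use st in \<open>auto simp: kernel_mat_def\<close>)
    then have "Determinant.det ?K = 0" using det_identical_rows[OF K st(3,1,2)] by blast
    then show ?thesis by simp
  next
    case 3
    then obtain s t where st: "s < ?r" "t < ?r" "s \<noteq> t" "j s = j t" unfolding inj_on_def by auto
    have "Matrix.row (transpose_mat ?K) s = Matrix.row (transpose_mat ?K) t"
      by (rule eq_vecI) (use st in \<open>auto simp: kernel_mat_def\<close>)
    then have "Determinant.det (transpose_mat ?K) = 0"
      using det_identical_rows[of "transpose_mat ?K" ?r s t] K st by auto
    then show ?thesis using det_transpose[OF K] by simp
  qed
qed

lemma volume_condition_of_fill:
  assumes T: "transport_setting P" and kr: "kernel_regular P Lip U" and dr: "dist_regular P"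
    and pos: "0 < 1 - real (rnk P) powr (real (rnk P) / 2 + 1) * U ^ (rnk P - 1) * Lip * (fill_par P + fill_space P) / Delta_cont P"
  shows "volume_condition P (1 - real (rnk P) powr (real (rnk P) / 2 + 1) * U ^ (rnk P - 1) * Lip
    * (fill_par P + fill_space P) / Delta_cont P)"
proof -
  let ?r = "rnk P"
  define c where "c = real ?r powr (real ?r / 2 + 1) * U ^ (?r - 1) * Lip * (fill_par P + fill_space P)"
  have U: "0 < U" "0 < Lip" and \<Delta>: "0 < Delta_cont P" using kr unfolding kernel_regular_def by auto
  have r: "1 \<le> ?r" using T unfolding transport_setting_def by blast
  note fill = fill_nonneg[OF T dr]
  have c: "0 \<le> c" unfolding c_def using U fill by (intro mult_nonneg_nonneg) auto
  let ?V = "\<bar>Determinant.det (kernel_mat P (par_nodes P) (space_nodes P))\<bar>"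
  \<comment> \<open>No maximizer is chosen: every admissible determinant is compared with the one at
    the nearest sample and grid points, which the selected volume dominates.\<close>
  have "Delta_cont P \<le> ?V + c"
    unfolding Delta_cont_def
  proof (rule cSup_least)
    obtain \<mu> where "\<mu> \<in> man P" using man_nonempty[OF T] by blast
    moreover have "grid_pt P 0 \<in> Omega P" using T unfolding transport_setting_def by auto
    ultimately have "\<bar>Determinant.det (kernel_mat P (\<lambda>_. \<mu>) (\<lambda>_. grid_pt P 0))\<bar>
      \<in> {\<bar>Determinant.det (kernel_mat P \<mu> x)\<bar> |\<mu> x. (\<forall>s<?r. \<mu> s \<in> man P) \<and> (\<forall>t<?r. x t \<in> Omega P)}" by blast
    then show "{\<bar>Determinant.det (kernel_mat P \<mu> x)\<bar> |\<mu> x. (\<forall>s<?r. \<mu> s \<in> man P) \<and> (\<forall>t<?r. x t \<in> Omega P)} \<noteq> {}"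
      by blast
    fix z assume "z \<in> {\<bar>Determinant.det (kernel_mat P \<mu> x)\<bar> |\<mu> x. (\<forall>s<?r. \<mu> s \<in> man P) \<and> (\<forall>t<?r. x t \<in> Omega P)}"
    then obtain \<mu> x where z: "z = \<bar>Determinant.det (kernel_mat P \<mu> x)\<bar>"
      and \<mu>: "\<And>s. s < ?r \<Longrightarrow> \<mu> s \<in> man P" and x: "\<And>t. t < ?r \<Longrightarrow> x t \<in> Omega P" by auto
    have "\<exists>l. l < skel_size P \<and> par_dist P (\<mu> s) (skel_pt P l) \<le> fill_par P" if "s < ?r" for s
      using fill_par_nearest[OF T dr \<mu>[OF that]] by blast
    then obtain i where i: "\<And>s. s < ?r \<Longrightarrow> i s < skel_size P \<and> par_dist P (\<mu> s) (skel_pt P (i s)) \<le> fill_par P"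
      by metis
    have "\<exists>l. l < grid_size P \<and> norm (x t - grid_pt P l) \<le> fill_space P" if "t < ?r" for t
      using fill_space_nearest[OF T x[OF that]] by blast
    then obtain j where j: "\<And>t. t < ?r \<Longrightarrow> j t < grid_size P \<and> norm (x t - grid_pt P (j t)) \<le> fill_space P"
      by metis
    have sk: "skel_pt P (i s) \<in> man P" if "s < ?r" for s using i[OF that] T unfolding transport_setting_def by auto
    have gr: "grid_pt P (j s) \<in> Omega P" if "s < ?r" for s using j[OF that] T unfolding transport_setting_def by auto
    have "\<bar>Determinant.det (kernel_mat P \<mu> x) - Determinant.det (kernel_mat P (\<lambda>s. skel_pt P (i s)) (\<lambda>t. grid_pt P (j t)))\<bar>
      \<le> real ?r powr (real ?r / 2 + 1) * U ^ (?r - 1) * (Lip * (fill_par P + fill_space P))"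
      unfolding kernel_mat_def
    proof (rule det_perturbation[OF r])
      fix s t assume st: "s < ?r" "t < ?r"
      show "\<bar>signature P (\<mu> s) (x t)\<bar> \<le> U" by (rule signature_bound[OF kr \<mu>[OF st(1)] x[OF st(2)]])
      show "\<bar>signature P (skel_pt P (i s)) (grid_pt P (j t))\<bar> \<le> U"
        by (rule signature_bound[OF kr sk[OF st(1)] gr[OF st(2)]])
      have "\<bar>signature P (skel_pt P (i s)) (grid_pt P (j t)) - signature P (\<mu> s) (x t)\<bar>
        \<le> Lip * sqrt ((par_dist P (\<mu> s) (skel_pt P (i s)))\<^sup>2 + (norm (grid_pt P (j t) - x t))\<^sup>2)"
        using kr \<mu>[OF st(1)] x[OF st(2)] sk[OF st(1)] gr[OF st(2)] unfolding kernel_regular_def by blast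
      also have "\<dots> \<le> Lip * (fill_par P + fill_space P)"
      proof (rule mult_left_mono)
        have "0 \<le> par_dist P (\<mu> s) (skel_pt P (i s))"
          using dr \<mu>[OF st(1)] sk[OF st(1)] by (simp add: dist_regular_def)
        then have "sqrt ((par_dist P (\<mu> s) (skel_pt P (i s)))\<^sup>2 + (norm (grid_pt P (j t) - x t))\<^sup>2)
          \<le> par_dist P (\<mu> s) (skel_pt P (i s)) + norm (grid_pt P (j t) - x t)"
          by (intro sqrt_sum_squares_le_sum) auto
        then show "sqrt ((par_dist P (\<mu> s) (skel_pt P (i s)))\<^sup>2 + (norm (grid_pt P (j t) - x t))\<^sup>2)
          \<le> fill_par P + fill_space P"
          using i[OF st(1)] j[OF st(2)] by (simp add: norm_minus_commute)
      qed (use U in simp)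
      finally show "\<bar>signature P (\<mu> s) (x t) - signature P (skel_pt P (i s)) (grid_pt P (j t))\<bar> \<le> Lip * (fill_par P + fill_space P)"
        by (simp add: abs_minus_commute)
    qed (use U fill in auto)
    then have "\<bar>Determinant.det (kernel_mat P \<mu> x) - Determinant.det (kernel_mat P (\<lambda>s. skel_pt P (i s)) (\<lambda>t. grid_pt P (j t)))\<bar> \<le> c"
      by (simp add: c_def mult.assoc)
    moreover have "\<bar>Determinant.det (kernel_mat P (\<lambda>s. skel_pt P (i s)) (\<lambda>t. grid_pt P (j t)))\<bar> \<le> ?V"
      by (rule kernel_det_le_selected[OF T]) (use i j in auto)
    ultimately show "z \<le> ?V + c" unfolding z by linarith
  qed
  then have "(1 - c / Delta_cont P) * Delta_cont P \<le> ?V" using \<Delta> by (simp add: left_diff_distrib)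
  moreover have "1 - c / Delta_cont P \<le> 1" using c \<Delta> by simp
  ultimately show ?thesis using pos unfolding volume_condition_def c_def[symmetric] by simp
qed

section \<open>The coefficient maps\<close>

lemma power2_sum_le: "(a + b)\<^sup>2 \<le> 2 * a\<^sup>2 + 2 * (b::real)\<^sup>2"
  using zero_le_power2[of "a - b"] by (simp add: power2_eq_square algebra_simps)

definition gram_fun :: "problem \<Rightarrow> nat \<Rightarrow> nat \<Rightarrow> real" where
  "gram_fun P s t = (LINT x|dx P. basis P s x * basis P t x)"

definition gram_grid_fun :: "problem \<Rightarrow> nat \<Rightarrow> nat \<Rightarrow> real" where
  "gram_grid_fun P s t =
     (\<Sum>k<grid_size P. basis P s (grid_pt P k) * basis P t (grid_pt P k)) / real (grid_size P)"

text \<open>The square of the factor of \<open>h\<close> in the estimate for the distance between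
  discrete and exact least-squares coefficients; it becomes \<open>C\<^sub>1\<close> of the
  theorem.\<close>

definition quad_const :: "nat \<Rightarrow> real \<Rightarrow> real \<Rightarrow> real \<Rightarrow> real \<Rightarrow> real" where
  "quad_const r \<gamma> U Lip Cq = (4 * sqrt (real r) * Cq * U * Lip * (1 + real r * U\<^sup>2 / \<gamma>) / \<gamma>)\<^sup>2"

text \<open>\<open>dr\<close> is discharged from \<open>T\<close> by \<open>dist_regularI\<close>,
  once lengths of curves on the manifold have been studied.\<close>

locale regular_problem =
  fixes P :: problem and Lip U Cq :: real
  assumes T: "transport_setting P" and kr: "kernel_regular P Lip U" and dr: "dist_regular P"
    and qr: "quadrature_regular P Lip U Cq"
begin

abbreviation "r \<equiv> rnk P"
abbreviation "\<gamma> \<equiv> lambda_min (gram P)"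
abbreviation "\<Gamma> \<equiv> lambda_max (gram P)"
abbreviation "h \<equiv> fill_space P"

lemma r: "1 \<le> r" using T unfolding transport_setting_def by blast
lemma pos: "0 < U" "0 < Lip" "0 < Cq" "0 < \<gamma>"
  using kr qr unfolding kernel_regular_def quadrature_regular_def by auto
lemma h: "0 \<le> h" by (rule fill_nonneg[OF T dr])
lemma half_width: "0 < half_width P" using T unfolding transport_setting_def by blast
lemma grid: "k < grid_size P \<Longrightarrow> grid_pt P k \<in> Omega P" "1 \<le> grid_size P"
  using T unfolding transport_setting_def by auto
lemma prob: "prob_space (dx P)" by (rule prob_space_unif_cube[OF half_width])

lemma signature_L2: assumes "\<mu> \<in> man P" shows "signature P \<mu> \<in> L2 (dx P)"
proof -
  have "selfadjoint (dx P) (root_op P)" "(potential P \<mu>, signature P \<mu>) \<in> root_op P"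
    using T assms unfolding transport_setting_def divergence_realization_def is_sqrt_def by auto
  then show ?thesis using selfadjoint_L2 by blast
qed

lemma basis_L2: "s < r \<Longrightarrow> basis P s \<in> L2 (dx P)"
  unfolding basis_def by (intro signature_L2 par_nodes_in_man[OF T])

text \<open>All entries of the Gram matrices and of the right-hand sides average products of two
  signatures. Such a product is Lipschitz with constant \<open>2 * U * Lip\<close>, and this is the
  only way in which quadrature enters the later estimates.\<close>

lemma quadrature_products:
  assumes "\<mu> \<in> man P" "\<nu> \<in> man P"
  shows "\<bar>(LINT x|dx P. signature P \<mu> x * signature P \<nu> x)
    - (\<Sum>k<grid_size P. signature P \<mu> (grid_pt P k) * signature P \<nu> (grid_pt P k)) / real (grid_size P)\<bar>
    \<le> 2 * Cq * U * Lip * h"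
proof -
  let ?f = "\<lambda>x. signature P \<mu> x * signature P \<nu> x"
  have lip: "\<bar>?f x - ?f y\<bar> \<le> 2 * U * Lip * dist x y" if x: "x \<in> Omega P" and y: "y \<in> Omega P" for x y
  proof -
    have "?f x - ?f y = (signature P \<mu> x - signature P \<mu> y) * signature P \<nu> x
      + signature P \<mu> y * (signature P \<nu> x - signature P \<nu> y)" by (simp add: algebra_simps)
    also have "\<bar>\<dots>\<bar> \<le> \<bar>signature P \<mu> x - signature P \<mu> y\<bar> * \<bar>signature P \<nu> x\<bar>
      + \<bar>signature P \<mu> y\<bar> * \<bar>signature P \<nu> x - signature P \<nu> y\<bar>"
      by (rule order_trans[OF abs_triangle_ineq]) (simp add: abs_mult)
    also have "\<dots> \<le> (Lip * norm (x - y)) * U + U * (Lip * norm (x - y))"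
      using assms x y pos
      by (intro add_mono mult_mono signature_space_lipschitz[OF kr dr] signature_bound[OF kr]) auto
    finally show ?thesis by (simp add: dist_norm algebra_simps)
  qed
  have "(2 * U * Lip)-lipschitz_on (Omega P) ?f"
    by (rule lipschitz_onI) (use lip pos in \<open>auto simp: dist_real_def\<close>)
  then have "\<bar>(LINT x|dx P. ?f x) - (\<Sum>k<grid_size P. ?f (grid_pt P k)) / real (grid_size P)\<bar>
    \<le> Cq * lip_const dist (Omega P) ?f * h"
    using qr unfolding quadrature_regular_def by blast
  also have "lip_const dist (Omega P) ?f \<le> 2 * U * Lip"
    unfolding lip_const_def
    by (rule cInf_lower) (use lip pos in \<open>auto intro!: bdd_belowI[of _ 0]\<close>)
  then have "Cq * lip_const dist (Omega P) ?f * h \<le> Cq * (2 * U * Lip) * h"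
    using pos h by (intro mult_right_mono mult_left_mono) auto
  finally show ?thesis by (simp add: mult_ac)
qed

lemma gram_sym: "gram_fun P s t = gram_fun P t s" "gram_grid_fun P s t = gram_grid_fun P t s"
  by (simp_all add: gram_fun_def gram_grid_fun_def mult.commute)

lemma gram_eq: "gram P = Matrix.mat r r (\<lambda>(s, t). gram_fun P s t)"
  "gram_grid P = Matrix.mat r r (\<lambda>(s, t). gram_grid_fun P s t)"
  by (simp_all add: gram_def gram_fun_def gram_grid_def gram_grid_fun_def)

lemma gram_quad:
  assumes "y \<in> Rn r"
  shows "\<gamma> * (norm y)\<^sup>2 \<le> quad_form r (gram_fun P) y" "quad_form r (gram_fun P) y \<le> \<Gamma> * (norm y)\<^sup>2"
  using lambda_min_max_quad_form[OF r gram_eq(1) gram_sym(1) assms] by auto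

lemma Gamma_pos: "0 < \<Gamma>"
proof -
  have "\<gamma> * (norm (unit_evec 0))\<^sup>2 \<le> \<Gamma> * (norm (unit_evec 0))\<^sup>2"
    using gram_quad[of "unit_evec 0"] r by (simp add: unit_evec_Rn)
  then show ?thesis using pos by simp
qed

lemma gram_diff:
  assumes "s < r" "t < r" shows "\<bar>gram_fun P s t - gram_grid_fun P s t\<bar> \<le> 2 * Cq * U * Lip * h"
  unfolding gram_fun_def gram_grid_fun_def basis_def
  using quadrature_products par_nodes_in_man[OF T] assms by blast

lemma sum_abs_coord_le: assumes "y \<in> Rn r" shows "(\<Sum>s<r. \<bar>coord y s\<bar>)\<^sup>2 \<le> real r * (norm y)\<^sup>2"
proof -
  have "(\<Sum>s<r. \<bar>coord y s\<bar>)\<^sup>2 \<le> real (card {..<r}) * (\<Sum>s<r. \<bar>coord y s\<bar>\<^sup>2)"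
    using Cauchy_Schwarz_ineq_sum[of "\<lambda>_. 1" "\<lambda>s. \<bar>coord y s\<bar>" "{..<r}"] by simp
  moreover have "(norm y)\<^sup>2 = (\<Sum>s<r. \<bar>coord y s\<bar>\<^sup>2)"
    unfolding power2_norm_eq_inner inner_Rn[OF assms] by (simp add: power2_eq_square)
  ultimately show ?thesis by simp
qed

text \<open>An entrywise error \<open>e\<close> changes the quadratic form by at most
  \<open>e * r * (norm y)\<^sup>2\<close>, by Cauchy-Schwarz. The mesh condition is calibrated so
  that this costs at most half of \<open>\<gamma>\<close>.\<close>

lemma gram_grid_quad:
  assumes y: "y \<in> Rn r" shows "\<gamma> / 2 * (norm y)\<^sup>2 \<le> quad_form r (gram_grid_fun P) y"
proof -
  define e where "e = 2 * Cq * U * Lip * h"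
  have "h \<le> \<gamma> / (4 * Cq * real r * U * Lip)" using qr unfolding quadrature_regular_def by blast
  then have e: "e * real r \<le> \<gamma> / 2" using pos r by (simp add: e_def field_simps)
  have "quad_form r (gram_fun P) y - quad_form r (gram_grid_fun P) y
    = (\<Sum>s<r. \<Sum>t<r. (gram_fun P s t - gram_grid_fun P s t) * (coord y s * coord y t))"
    by (simp add: quad_form_def sum_subtractf algebra_simps)
  also have "\<dots> \<le> (\<Sum>s<r. \<Sum>t<r. e * (\<bar>coord y s\<bar> * \<bar>coord y t\<bar>))"
  proof (intro sum_mono)
    fix s t assume st: "s \<in> {..<r}" "t \<in> {..<r}"
    have "(gram_fun P s t - gram_grid_fun P s t) * (coord y s * coord y t)
      \<le> \<bar>(gram_fun P s t - gram_grid_fun P s t) * (coord y s * coord y t)\<bar>" by simp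
    also have "\<dots> = \<bar>gram_fun P s t - gram_grid_fun P s t\<bar> * (\<bar>coord y s\<bar> * \<bar>coord y t\<bar>)" by (simp add: abs_mult)
    also have "\<dots> \<le> e * (\<bar>coord y s\<bar> * \<bar>coord y t\<bar>)"
      by (rule mult_right_mono) (use gram_diff st in \<open>auto simp: e_def\<close>)
    finally show "(gram_fun P s t - gram_grid_fun P s t) * (coord y s * coord y t) \<le> e * (\<bar>coord y s\<bar> * \<bar>coord y t\<bar>)" .
  qed
  also have "\<dots> = e * (\<Sum>s<r. \<bar>coord y s\<bar>)\<^sup>2"
    unfolding power2_eq_square sum_product sum_distrib_left[symmetric] ..
  also have "\<dots> \<le> e * (real r * (norm y)\<^sup>2)"
    by (rule mult_left_mono[OF sum_abs_coord_le[OF y]]) (use pos h in \<open>simp add: e_def\<close>)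
  also have "\<dots> \<le> \<gamma> / 2 * (norm y)\<^sup>2" using mult_right_mono[OF e, of "(norm y)\<^sup>2"] by (simp add: mult.assoc)
  finally show ?thesis using gram_quad(1)[OF y] by linarith
qed

lemma half_gamma_pos: "0 < \<gamma> / 2" using pos by simp

lemma coef_solves:
  shows "i < r \<Longrightarrow> (\<Sum>t<r. gram_grid_fun P i t * coord (coef P \<mu>) t)
      = (\<Sum>k<grid_size P. signature P \<mu> (grid_pt P k) * basis P i (grid_pt P k)) / real (grid_size P)"
    and "coef P \<mu> \<in> Rn r"
proof -
  have "Determinant.det (gram_grid P) \<noteq> 0"
    by (rule coercive_det_nonzero[OF gram_eq(2) half_gamma_pos gram_grid_quad])
  moreover have "gram_grid P \<in> carrier_mat r r" by (simp add: gram_eq)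
  ultimately obtain B where B: "mat_inverse (gram_grid P) = Some B" "B \<in> carrier_mat r r" "gram_grid P * B = 1\<^sub>m r"
    using mat_inverse_if_det_nonzero by blast
  have b: "rhs_grid P \<mu> \<in> carrier_vec r" by (simp add: rhs_grid_def)
  show "i < r \<Longrightarrow> (\<Sum>t<r. gram_grid_fun P i t * coord (coef P \<mu>) t)
      = (\<Sum>k<grid_size P. signature P \<mu> (grid_pt P k) * basis P i (grid_pt P k)) / real (grid_size P)"
    using inverse_solves(1)[OF gram_eq(2) B b] unfolding coef_def by (simp add: rhs_grid_def)
  show "coef P \<mu> \<in> Rn r"
    using inverse_solves(2)[OF gram_eq(2) B b, of 0] r unfolding coef_def by simp
qed

lemma solution_unique:
  assumes "x \<in> Rn r" "y \<in> Rn r"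
    "\<And>i. i < r \<Longrightarrow> (\<Sum>t<r. gram_grid_fun P i t * coord x t) = (\<Sum>t<r. gram_grid_fun P i t * coord y t)"
  shows "x = y"
proof -
  have "norm (x - y) \<le> sqrt (real r) * 0 / (\<gamma> / 2)"
    by (rule coercive_solution_bound[OF half_gamma_pos gram_grid_quad, where b = "\<lambda>_. 0"])
      (use assms in \<open>auto simp: right_diff_distrib sum_subtractf intro: Rn_diff\<close>)
  then show ?thesis by simp
qed

lemma avg_bound:
  assumes "\<And>k. k < grid_size P \<Longrightarrow> \<bar>f k\<bar> \<le> B"
  shows "\<bar>(\<Sum>k<grid_size P. f k) / real (grid_size P)\<bar> \<le> B"
proof -
  have "\<bar>\<Sum>k<grid_size P. f k\<bar> \<le> (\<Sum>k<grid_size P. \<bar>f k\<bar>)" by (rule sum_abs)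
  also have "\<dots> \<le> (\<Sum>k<grid_size P. B)" by (rule sum_mono) (use assms in auto)
  finally show ?thesis using grid(2) by (simp add: field_simps)
qed

lemma basis_bound: "s < r \<Longrightarrow> x \<in> Omega P \<Longrightarrow> \<bar>basis P s x\<bar> \<le> U"
  unfolding basis_def by (rule signature_bound[OF kr par_nodes_in_man[OF T]])

text \<open>Origin of \<open>R\<^sub>a\<close>: the right-hand side has entries at most
  \<open>U\<^sup>2\<close>, and the grid matrix is coercive with constant
  \<open>\<gamma> / 2\<close>.\<close>

lemma norm_coef_le:
  assumes \<mu>: "\<mu> \<in> man P" shows "norm (coef P \<mu>) \<le> 2 * sqrt (real r) * U\<^sup>2 / \<gamma>"
proof -
  have "norm (coef P \<mu>) \<le> sqrt (real r) * U\<^sup>2 / (\<gamma> / 2)"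
  proof (rule coercive_solution_bound[OF half_gamma_pos gram_grid_quad coef_solves(2) coef_solves(1)])
    fix i assume i: "i < r"
    show "\<bar>(\<Sum>k<grid_size P. signature P \<mu> (grid_pt P k) * basis P i (grid_pt P k)) / real (grid_size P)\<bar> \<le> U\<^sup>2"
      unfolding power2_eq_square abs_mult[symmetric]
      by (rule avg_bound) (use i \<mu> grid pos in \<open>auto simp: abs_mult intro!: mult_mono signature_bound[OF kr] basis_bound\<close>)
  qed auto
  then show ?thesis by (simp add: mult_ac)
qed

text \<open>The system is linear in its right-hand side, so differences of coefficients are
  controlled by differences of signatures. The constant is crude; its existence makes the set behind
  \<open>lip_const\<close> nonempty, so that \<open>coef_lip\<close> is a genuine Lipschitz
  constant.\<close>

lemma coef_lipschitz:
  assumes "\<mu> \<in> man P" "\<nu> \<in> man P"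
  shows "norm (coef P \<mu> - coef P \<nu>) \<le> 2 * sqrt (real r) * (Lip * U) / \<gamma> * par_dist P \<nu> \<mu>"
proof -
  have pd: "0 \<le> par_dist P \<nu> \<mu>" using dr assms by (simp add: dist_regular_def)
  have "norm (coef P \<mu> - coef P \<nu>) \<le> sqrt (real r) * (Lip * par_dist P \<nu> \<mu> * U) / (\<gamma> / 2)"
  proof (rule coercive_solution_bound[OF half_gamma_pos gram_grid_quad Rn_diff[OF coef_solves(2) coef_solves(2)],
      where b = "\<lambda>i. (\<Sum>k<grid_size P. (signature P \<mu> (grid_pt P k) - signature P \<nu> (grid_pt P k)) * basis P i (grid_pt P k)) / real (grid_size P)"])
    fix i assume i: "i < r"
    show "(\<Sum>t<r. gram_grid_fun P i t * coord (coef P \<mu> - coef P \<nu>) t)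
      = (\<Sum>k<grid_size P. (signature P \<mu> (grid_pt P k) - signature P \<nu> (grid_pt P k)) * basis P i (grid_pt P k)) / real (grid_size P)"
      using coef_solves(1)[OF i, of \<mu>] coef_solves(1)[OF i, of \<nu>]
      by (simp add: right_diff_distrib left_diff_distrib sum_subtractf diff_divide_distrib)
    show "\<bar>(\<Sum>k<grid_size P. (signature P \<mu> (grid_pt P k) - signature P \<nu> (grid_pt P k)) * basis P i (grid_pt P k)) / real (grid_size P)\<bar>
      \<le> Lip * par_dist P \<nu> \<mu> * U"
    proof (rule avg_bound)
      fix k assume "k < grid_size P"
      then have x: "grid_pt P k \<in> Omega P" using grid by blast
      show "\<bar>(signature P \<mu> (grid_pt P k) - signature P \<nu> (grid_pt P k)) * basis P i (grid_pt P k)\<bar> \<le> Lip * par_dist P \<nu> \<mu> * U"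
        unfolding abs_mult
        using signature_par_lipschitz[OF kr dr assms(2,1) x] basis_bound[OF i x] pos pd
        by (intro mult_mono) auto
    qed
  qed (use pd pos in \<open>auto intro!: mult_nonneg_nonneg\<close>)
  then show ?thesis by (simp add: mult_ac)
qed

text \<open>At a node the right-hand side is a column of the grid matrix itself, so the unique
  solution is a unit vector. This later bounds both the coefficients and the rank through the
  Lipschitz radius.\<close>

lemma coef_at_node:
  assumes "s < r" shows "coef P (par_nodes P s) = unit_evec s"
proof (rule solution_unique[OF coef_solves(2) unit_evec_Rn[OF assms]])
  fix i assume i: "i < r"
  have "(\<Sum>t<r. gram_grid_fun P i t * coord (unit_evec s) t) = gram_grid_fun P i s"
    using assms by (simp add: if_distrib[of "\<lambda>c. _ * c"] cong: if_cong)
  also have "\<dots> = (\<Sum>t<r. gram_grid_fun P i t * coord (coef P (par_nodes P s)) t)"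
    unfolding coef_solves(1)[OF i] by (simp add: gram_grid_fun_def basis_def mult.commute)
  finally show "(\<Sum>t<r. gram_grid_fun P i t * coord (coef P (par_nodes P s)) t) = (\<Sum>t<r. gram_grid_fun P i t * coord (unit_evec s) t)" ..
qed

definition expansion :: "evec \<Rightarrow> evec \<Rightarrow> real" where
  "expansion v x = (\<Sum>s<r. coord v s * basis P s x)"

lemma expansion_L2: "expansion v \<in> L2 (dx P)"
proof -
  have "(\<lambda>x. \<Sum>s<m. coord v s * basis P s x) \<in> L2 (dx P)" if "m \<le> r" for m
    using that
  proof (induction m)
    case (Suc m)
    then show ?case using L2_lincomb[of "\<lambda>x. \<Sum>s<m. coord v s * basis P s x" "dx P" "basis P m" 1 "coord v m"] basis_L2
      by simp
  qed (simp add: L2_def)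
  then show ?thesis unfolding expansion_def[abs_def] by blast
qed

lemma expansion_diff: "expansion (v - w) x = expansion v x - expansion w x"
  by (simp add: expansion_def left_diff_distrib sum_subtractf)

lemma integral_expansion_sq: "(LINT x|dx P. (expansion v x)\<^sup>2) = quad_form r (gram_fun P) v"
proof -
  have "(LINT x|dx P. (expansion v x)\<^sup>2)
    = (LINT x|dx P. (\<Sum>s<r. \<Sum>t<r. coord v s * coord v t * (basis P s x * basis P t x)))"
    by (simp add: expansion_def power2_eq_square sum_product mult_ac)
  also have "\<dots> = (\<Sum>s<r. LINT x|dx P. (\<Sum>t<r. coord v s * coord v t * (basis P s x * basis P t x)))"
    by (intro Bochner_Integration.integral_sum Bochner_Integration.integrable_sum integrable_mult_right L2_integrable_mult basis_L2) auto
  also have "\<dots> = (\<Sum>s<r. \<Sum>t<r. LINT x|dx P. coord v s * coord v t * (basis P s x * basis P t x))"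
    by (intro sum.cong refl Bochner_Integration.integral_sum integrable_mult_right L2_integrable_mult basis_L2) auto
  also have "\<dots> = quad_form r (gram_fun P) v"
    by (simp add: quad_form_def gram_fun_def mult_ac)
  finally show ?thesis .
qed

text \<open>Exact least squares: the coefficients of the orthogonal projection in
  \<open>L2 (dx P)\<close> onto the span of the basis.\<close>

definition proj :: "evec \<Rightarrow> evec" where
  "proj \<mu> = of_vec (the (mat_inverse (gram P)) *\<^sub>v
     Matrix.vec r (\<lambda>s. LINT x|dx P. signature P \<mu> x * basis P s x))"

lemma proj_solves:
  shows "i < r \<Longrightarrow> (\<Sum>t<r. gram_fun P i t * coord (proj \<mu>) t) = (LINT x|dx P. signature P \<mu> x * basis P i x)"
    and "proj \<mu> \<in> Rn r"
proof -
  have "Determinant.det (gram P) \<noteq> 0"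
    by (rule coercive_det_nonzero[OF gram_eq(1) pos(4) gram_quad(1)])
  moreover have "gram P \<in> carrier_mat r r" by (simp add: gram_eq)
  ultimately obtain B where B: "mat_inverse (gram P) = Some B" "B \<in> carrier_mat r r" "gram P * B = 1\<^sub>m r"
    using mat_inverse_if_det_nonzero by blast
  have b: "Matrix.vec r (\<lambda>s. LINT x|dx P. signature P \<mu> x * basis P s x) \<in> carrier_vec r" by simp
  show "i < r \<Longrightarrow> (\<Sum>t<r. gram_fun P i t * coord (proj \<mu>) t) = (LINT x|dx P. signature P \<mu> x * basis P i x)"
    using inverse_solves(1)[OF gram_eq(1) B b] unfolding proj_def by simp
  show "proj \<mu> \<in> Rn r" using inverse_solves(2)[OF gram_eq(1) B b, of 0] r unfolding proj_def by simp
qed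

text \<open>The normal equations make the residual of the projection orthogonal to every expansion,
  so the cross term vanishes.\<close>

lemma pythagoras:
  assumes \<mu>: "\<mu> \<in> man P"
  shows "(LINT x|dx P. (signature P \<mu> x - expansion v x)\<^sup>2)
    = (LINT x|dx P. (signature P \<mu> x - expansion (proj \<mu>) x)\<^sup>2) + quad_form r (gram_fun P) (v - proj \<mu>)"
proof -
  let ?e = "\<lambda>x. signature P \<mu> x - expansion (proj \<mu>) x"
  have e: "?e \<in> L2 (dx P)" using L2_lincomb[OF signature_L2[OF \<mu>] expansion_L2, of 1 "-1"] by simp
  note b = basis_L2
  have orth_basis: "(LINT x|dx P. ?e x * basis P s x) = 0" if s: "s < r" for s
  proof -
    have "(LINT x|dx P. ?e x * basis P s x) = (LINT x|dx P. signature P \<mu> x * basis P s x - expansion (proj \<mu>) x * basis P s x)"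
      by (simp add: left_diff_distrib)
    also have "\<dots> = (LINT x|dx P. signature P \<mu> x * basis P s x) - (LINT x|dx P. expansion (proj \<mu>) x * basis P s x)"
      by (intro Bochner_Integration.integral_diff L2_integrable_mult signature_L2 \<mu> b s expansion_L2)
    also have "(LINT x|dx P. expansion (proj \<mu>) x * basis P s x) = (LINT x|dx P. (\<Sum>t<r. coord (proj \<mu>) t * (basis P s x * basis P t x)))"
      unfolding expansion_def sum_distrib_right by (simp add: mult_ac)
    also have "\<dots> = (\<Sum>t<r. LINT x|dx P. coord (proj \<mu>) t * (basis P s x * basis P t x))"
      by (intro Bochner_Integration.integral_sum integrable_mult_right L2_integrable_mult b s) auto
    also have "\<dots> = (\<Sum>t<r. gram_fun P s t * coord (proj \<mu>) t)" by (simp add: gram_fun_def mult.commute)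
    finally show ?thesis using proj_solves(1)[OF s] by simp
  qed
  have orth: "(LINT x|dx P. ?e x * expansion w x) = 0" for w
  proof -
    have "(LINT x|dx P. ?e x * expansion w x) = (LINT x|dx P. (\<Sum>s<r. coord w s * (?e x * basis P s x)))"
      by (simp only: expansion_def[of w] sum_distrib_left mult.left_commute)
    also have "\<dots> = (\<Sum>s<r. LINT x|dx P. coord w s * (?e x * basis P s x))"
      by (intro Bochner_Integration.integral_sum integrable_mult_right L2_integrable_mult b e) auto
    also have "\<dots> = 0" by (simp add: orth_basis)
    finally show ?thesis .
  qed
  have "(LINT x|dx P. (signature P \<mu> x - expansion v x)\<^sup>2)
    = (LINT x|dx P. (?e x)\<^sup>2 - 2 * (?e x * expansion (v - proj \<mu>) x) + (expansion (v - proj \<mu>) x)\<^sup>2)"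
    by (intro Bochner_Integration.integral_cong refl) (simp add: expansion_diff power2_eq_square algebra_simps)
  also have "\<dots> = (LINT x|dx P. (?e x)\<^sup>2) - 2 * (LINT x|dx P. ?e x * expansion (v - proj \<mu>) x) + (LINT x|dx P. (expansion (v - proj \<mu>) x)\<^sup>2)"
    using e expansion_L2[of "v - proj \<mu>"] L2_integrable_mult[OF e expansion_L2, of "v - proj \<mu>"]
    by (subst Bochner_Integration.integral_add, simp_all add: L2_def)
  finally show ?thesis by (simp add: orth integral_expansion_sq)
qed

lemma norm_proj_le:
  assumes \<mu>: "\<mu> \<in> man P" shows "norm (proj \<mu>) \<le> sqrt (real r) * U\<^sup>2 / \<gamma>"
proof (rule coercive_solution_bound[OF pos(4) gram_quad(1) proj_solves(2) proj_solves(1)])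
  interpret prob_space "dx P" by (rule prob)
  fix i assume i: "i < r"
  have "\<bar>LINT x|dx P. signature P \<mu> x * basis P i x\<bar> \<le> (LINT x|dx P. \<bar>signature P \<mu> x * basis P i x\<bar>)"
    by (rule integral_abs_bound)
  also have "\<dots> \<le> (LINT x|dx P. U\<^sup>2)"
  proof (rule integral_mono)
    show "integrable (dx P) (\<lambda>x. \<bar>signature P \<mu> x * basis P i x\<bar>)"
      by (intro integrable_abs L2_integrable_mult signature_L2 \<mu> basis_L2 i)
    fix x assume "x \<in> space (dx P)"
    then have x: "x \<in> Omega P" by simp
    show "\<bar>signature P \<mu> x * basis P i x\<bar> \<le> U\<^sup>2"
      unfolding power2_eq_square abs_mult
      using signature_bound[OF kr \<mu> x] basis_bound[OF i x] by (intro mult_mono) auto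
  qed simp
  finally show "\<bar>LINT x|dx P. signature P \<mu> x * basis P i x\<bar> \<le> U\<^sup>2" using prob_space by simp
qed auto

lemma coef_proj_diff:
  assumes \<mu>: "\<mu> \<in> man P"
  shows "(norm (coef P \<mu> - proj \<mu>))\<^sup>2 \<le> quad_const r \<gamma> U Lip Cq * h\<^sup>2"
proof -
  define e where "e = 2 * Cq * U * Lip * h"
  have e: "0 \<le> e" using pos h by (simp add: e_def)
  \<comment> \<open>Subtracting the two normal equations: the difference of the coefficients solves
    the grid system, with the quadrature error of the right-hand side plus the matrix error applied
    to \<open>proj \<mu>\<close>.\<close>
  define b where "b i = (\<Sum>k<grid_size P. signature P \<mu> (grid_pt P k) * basis P i (grid_pt P k)) / real (grid_size P)
    - (LINT x|dx P. signature P \<mu> x * basis P i x)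
    + (\<Sum>t<r. (gram_fun P i t - gram_grid_fun P i t) * coord (proj \<mu>) t)" for i
  have "norm (coef P \<mu> - proj \<mu>) \<le> sqrt (real r) * (e * (1 + real r * U\<^sup>2 / \<gamma>)) / (\<gamma> / 2)"
  proof (rule coercive_solution_bound[OF half_gamma_pos gram_grid_quad Rn_diff[OF coef_solves(2) proj_solves(2)], where b = b])
    fix i assume i: "i < r"
    show "(\<Sum>t<r. gram_grid_fun P i t * coord (coef P \<mu> - proj \<mu>) t) = b i"
      using coef_solves(1)[OF i, of \<mu>] proj_solves(1)[OF i, of \<mu>]
      by (simp add: b_def right_diff_distrib left_diff_distrib sum_subtractf)
    have "\<bar>\<Sum>t<r. (gram_fun P i t - gram_grid_fun P i t) * coord (proj \<mu>) t\<bar>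
      \<le> (\<Sum>t<r. \<bar>(gram_fun P i t - gram_grid_fun P i t) * coord (proj \<mu>) t\<bar>)" by (rule sum_abs)
    also have "\<dots> \<le> (\<Sum>t<r. e * \<bar>coord (proj \<mu>) t\<bar>)"
      unfolding abs_mult by (intro sum_mono mult_right_mono) (use gram_diff i in \<open>auto simp: e_def\<close>)
    also have "\<dots> = e * (\<Sum>t<r. \<bar>coord (proj \<mu>) t\<bar>)" by (simp add: sum_distrib_left)
    also have "\<dots> \<le> e * (real r * U\<^sup>2 / \<gamma>)"
    proof (rule mult_left_mono[OF _ e])
      have "(\<Sum>t<r. \<bar>coord (proj \<mu>) t\<bar>) \<le> sqrt (real r * (norm (proj \<mu>))\<^sup>2)"
        by (rule real_le_rsqrt[OF sum_abs_coord_le[OF proj_solves(2)]])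
      also have "\<dots> = sqrt (real r) * norm (proj \<mu>)" by (simp add: real_sqrt_mult)
      also have "\<dots> \<le> sqrt (real r) * (sqrt (real r) * U\<^sup>2 / \<gamma>)"
        by (rule mult_left_mono[OF norm_proj_le[OF \<mu>]]) simp
      also have "\<dots> = real r * U\<^sup>2 / \<gamma>" by (simp add: mult.assoc[symmetric])
      finally show "(\<Sum>t<r. \<bar>coord (proj \<mu>) t\<bar>) \<le> real r * U\<^sup>2 / \<gamma>" .
    qed
    finally have 1: "\<bar>\<Sum>t<r. (gram_fun P i t - gram_grid_fun P i t) * coord (proj \<mu>) t\<bar> \<le> e * (real r * U\<^sup>2 / \<gamma>)" .
    have "\<bar>(LINT x|dx P. signature P \<mu> x * basis P i x)
      - (\<Sum>k<grid_size P. signature P \<mu> (grid_pt P k) * basis P i (grid_pt P k)) / real (grid_size P)\<bar> \<le> e"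
      unfolding basis_def e_def by (rule quadrature_products[OF \<mu> par_nodes_in_man[OF T i]])
    with 1 show "\<bar>b i\<bar> \<le> e * (1 + real r * U\<^sup>2 / \<gamma>)"
      unfolding b_def distrib_left mult_1_right by linarith
  qed (use pos e in \<open>auto intro!: mult_nonneg_nonneg add_nonneg_nonneg\<close>)
  also have "\<dots> = 4 * sqrt (real r) * Cq * U * Lip * (1 + real r * U\<^sup>2 / \<gamma>) / \<gamma> * h"
    by (simp add: e_def)
  finally have "(norm (coef P \<mu> - proj \<mu>))\<^sup>2 \<le> (4 * sqrt (real r) * Cq * U * Lip * (1 + real r * U\<^sup>2 / \<gamma>) / \<gamma> * h)\<^sup>2"
    by (rule power_mono) simp
  then show ?thesis unfolding quad_const_def by (simp only: power_mult_distrib)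
qed

text \<open>For fixed \<open>\<mu>\<close> the skeleton approximation lies in the span of the basis,
  so it competes with the projection. The volume condition and the positivity of
  \<open>Delta_cont\<close> make the cross matrix invertible, which gives
  \<open>the (mat_inverse _)\<close> its meaning.\<close>

lemma skeleton_kernel_expansion:
  assumes "volume_condition P \<theta>"
  obtains v where "\<And>x. skeleton_kernel P \<mu> x = expansion v x"
proof -
  let ?K = "kernel_mat P (par_nodes P) (space_nodes P)"
  have K: "?K \<in> carrier_mat r r" by (simp add: kernel_mat_def)
  have "0 < \<theta> * Delta_cont P" using assms kr unfolding volume_condition_def kernel_regular_def by simp
  then have "Determinant.det ?K \<noteq> 0" using assms unfolding volume_condition_def by auto
  then obtain B where B: "mat_inverse ?K = Some B" "B \<in> carrier_mat r r"
    using mat_inverse_if_det_nonzero[OF K] by metis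
  define v where "v = of_coords r (\<lambda>s. \<Sum>t<r. signature P \<mu> (space_nodes P t) * B $$ (t, s))"
  have "skeleton_kernel P \<mu> x = expansion v x" for x
  proof -
    have "skeleton_kernel P \<mu> x = (\<Sum>t<r. signature P \<mu> (space_nodes P t) * (\<Sum>s<r. B $$ (t, s) * basis P s x))"
      unfolding skeleton_kernel_def using B
      by (auto simp: scalar_prod_def basis_def atLeast0LessThan intro!: sum.cong)
    also have "\<dots> = (\<Sum>t<r. \<Sum>s<r. signature P \<mu> (space_nodes P t) * B $$ (t, s) * basis P s x)"
      by (simp add: sum_distrib_left mult.assoc)
    also have "\<dots> = (\<Sum>s<r. \<Sum>t<r. signature P \<mu> (space_nodes P t) * B $$ (t, s) * basis P s x)"
      by (rule sum.swap)
    also have "\<dots> = expansion v x" by (simp add: expansion_def v_def sum_distrib_right)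
    finally show ?thesis .
  qed
  then show ?thesis using that by blast
qed

text \<open>The exact projection beats the skeleton approximation, and quadrature perturbs it by \<open>O(h)\<close>.\<close>

lemma signature_error:
  assumes \<mu>: "\<mu> \<in> man P" and vc: "volume_condition P \<theta>" and sa: "skeleton_accurate P \<theta> C"
  shows "(LINT x|dx P. (signature P \<mu> x - expansion (coef P \<mu>) x)\<^sup>2)
    \<le> (C * (real r + 1) / \<theta> * sing_val P (r + 1))\<^sup>2 + \<Gamma> * (quad_const r \<gamma> U Lip Cq * h\<^sup>2)"
proof -
  interpret prob_space "dx P" by (rule prob)
  define E where "E = C * (real r + 1) / \<theta> * sing_val P (r + 1)"
  obtain v where v: "\<And>x. skeleton_kernel P \<mu> x = expansion v x" using skeleton_kernel_expansion[OF vc] by blast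
  have ev: "\<bar>signature P \<mu> x - expansion v x\<bar> \<le> E" if "x \<in> Omega P" for x
    using sa \<mu> that unfolding skeleton_accurate_def E_def v[symmetric] by blast
  have "(LINT x|dx P. (signature P \<mu> x - expansion v x)\<^sup>2) \<le> (LINT x|dx P. E\<^sup>2)"
  proof (rule integral_mono)
    show "integrable (dx P) (\<lambda>x. (signature P \<mu> x - expansion v x)\<^sup>2)"
      using L2_lincomb[OF signature_L2[OF \<mu>] expansion_L2, of 1 "-1" v] by (simp add: L2_def)
    fix x assume "x \<in> space (dx P)"
    then have "\<bar>signature P \<mu> x - expansion v x\<bar> \<le> \<bar>E\<bar>" using ev[of x] by simp
    then show "(signature P \<mu> x - expansion v x)\<^sup>2 \<le> E\<^sup>2" by (simp only: abs_le_square_iff)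
  qed simp
  also have "\<dots> = E\<^sup>2" using prob_space by simp
  finally have "(LINT x|dx P. (signature P \<mu> x - expansion v x)\<^sup>2) \<le> E\<^sup>2" .
  moreover have "0 \<le> quad_form r (gram_fun P) (v - proj \<mu>)"
    unfolding integral_expansion_sq[symmetric] by simp
  ultimately have 1: "(LINT x|dx P. (signature P \<mu> x - expansion (proj \<mu>) x)\<^sup>2) \<le> E\<^sup>2"
    using pythagoras[OF \<mu>, of v] by linarith
  have "quad_form r (gram_fun P) (coef P \<mu> - proj \<mu>) \<le> \<Gamma> * (norm (coef P \<mu> - proj \<mu>))\<^sup>2"
    by (rule gram_quad(2)[OF Rn_diff[OF coef_solves(2) proj_solves(2)]])
  also have "\<dots> \<le> \<Gamma> * (quad_const r \<gamma> U Lip Cq * h\<^sup>2)"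
    by (rule mult_left_mono[OF coef_proj_diff[OF \<mu>]]) (use Gamma_pos in simp)
  finally show ?thesis using pythagoras[OF \<mu>, of "coef P \<mu>"] 1 unfolding E_def by linarith
qed

text \<open>Replacing the discrete coefficients by \<open>a\<close> adds an expansion whose squared
  norm is bounded through \<open>\<Gamma>\<close>; splitting the square of the sum doubles both
  parts.\<close>

lemma signature_error_estimator:
  assumes \<mu>: "\<mu> \<in> man P" and vc: "volume_condition P \<theta>" and sa: "skeleton_accurate P \<theta> C"
    and a: "a \<in> Rn r"
  shows "(LINT x|dx P. (signature P \<mu> x - expansion a x)\<^sup>2)
    \<le> 2 * (C * (real r + 1) / \<theta> * sing_val P (r + 1))\<^sup>2 + 2 * (\<Gamma> * (quad_const r \<gamma> U Lip Cq * h\<^sup>2))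
      + 2 * \<Gamma> * (norm (a - coef P \<mu>))\<^sup>2"
proof -
  let ?f = "\<lambda>x. signature P \<mu> x - expansion (coef P \<mu>) x" and ?g = "expansion (coef P \<mu> - a)"
  have f: "integrable (dx P) (\<lambda>x. (?f x)\<^sup>2)"
    using L2_lincomb[OF signature_L2[OF \<mu>] expansion_L2, of 1 "-1" "coef P \<mu>"] by (simp add: L2_def)
  have g: "integrable (dx P) (\<lambda>x. (?g x)\<^sup>2)" using expansion_L2 by (simp add: L2_def)
  have "(LINT x|dx P. (signature P \<mu> x - expansion a x)\<^sup>2) \<le> (LINT x|dx P. 2 * (?f x)\<^sup>2 + 2 * (?g x)\<^sup>2)"
  proof (rule integral_mono)
    show "integrable (dx P) (\<lambda>x. (signature P \<mu> x - expansion a x)\<^sup>2)"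
      using L2_lincomb[OF signature_L2[OF \<mu>] expansion_L2, of 1 "-1" a] by (simp add: L2_def)
    show "integrable (dx P) (\<lambda>x. 2 * (?f x)\<^sup>2 + 2 * (?g x)\<^sup>2)" using f g by simp
    fix x
    have "(?f x + ?g x)\<^sup>2 \<le> 2 * (?f x)\<^sup>2 + 2 * (?g x)\<^sup>2" by (rule power2_sum_le)
    then show "(signature P \<mu> x - expansion a x)\<^sup>2 \<le> 2 * (?f x)\<^sup>2 + 2 * (?g x)\<^sup>2" by (simp add: expansion_diff)
  qed
  also have "\<dots> = 2 * (LINT x|dx P. (?f x)\<^sup>2) + 2 * quad_form r (gram_fun P) (coef P \<mu> - a)"
    using f g by (simp add: integral_expansion_sq)
  also have "quad_form r (gram_fun P) (coef P \<mu> - a) \<le> \<Gamma> * (norm (a - coef P \<mu>))\<^sup>2"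
    using gram_quad(2)[OF Rn_diff[OF coef_solves(2) a], of \<mu>] by (simp add: norm_minus_commute)
  finally show ?thesis using signature_error[OF \<mu> vc sa] by simp
qed

end

section \<open>Submanifolds\<close>

text \<open>Separates the existence of a curve from its length: \<open>geodesic_dist\<close> is an
  infimum of reals and means something only where the set of lengths is nonempty.\<close>

definition joined_by :: "evec set \<Rightarrow> evec \<Rightarrow> evec \<Rightarrow> real \<Rightarrow> bool" where
  "joined_by M p q l \<longleftrightarrow> (\<exists>g. g piecewise_C1_differentiable_on {0..1} \<and> speed g integrable_on {0..1} \<and>
     path_image g \<subseteq> M \<and> pathstart g = p \<and> pathfinish g = q \<and> integral {0..1} (speed g) = l)"

lemma geodesic_dist_joined_by: "geodesic_dist M p q = Inf {l. joined_by M p q l}"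
  unfolding geodesic_dist_def joined_by_def by (rule arg_cong[where f = Inf]) auto

lemma speed_nonneg: "0 \<le> speed g t"
  by (simp add: speed_def)

lemma joined_by_nonneg: "joined_by M p q l \<Longrightarrow> 0 \<le> l"
  unfolding joined_by_def by (auto intro!: integral_nonneg speed_nonneg)

lemma joined_by_refl: "p \<in> M \<Longrightarrow> joined_by M p p 0"
  unfolding joined_by_def
  by (intro exI[of _ "\<lambda>_. p"]) (auto simp: speed_def[abs_def] path_image_def pathstart_def pathfinish_def
      piecewise_C1_differentiable_on_def)

lemma has_vector_derivative_affine:
  fixes f :: "real \<Rightarrow> 'a::real_normed_vector"
  assumes "(f has_vector_derivative v) (at (m * t + c))"
  shows "((\<lambda>t. f (m * t + c)) has_vector_derivative m *\<^sub>R v) (at t)"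
proof -
  have "((\<lambda>t. m * t + c) has_vector_derivative m) (at t)"
    by (auto intro!: derivative_eq_intros)
  from vector_diff_chain_at[OF this assms] show ?thesis by (simp add: o_def)
qed

text \<open>Concatenation runs both curves at double speed over half the time. The speeds agree with
  the rescaled ones off the break points and the ends, a finite set that integrals ignore.\<close>

lemma joined_by_trans:
  assumes "joined_by M p q l" "joined_by M q z l'" shows "joined_by M p z (l + l')"
proof -
  obtain g where g: "g piecewise_C1_differentiable_on {0..1}" "speed g integrable_on {0..1}"
    "path_image g \<subseteq> M" "pathstart g = p" "pathfinish g = q" "integral {0..1} (speed g) = l"
    using assms(1) unfolding joined_by_def by blast
  obtain k where k: "k piecewise_C1_differentiable_on {0..1}" "speed k integrable_on {0..1}"
    "path_image k \<subseteq> M" "pathstart k = q" "pathfinish k = z" "integral {0..1} (speed k) = l'"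
    using assms(2) unfolding joined_by_def by blast
  have im: "(\<lambda>x. 2 * x + 0) ` {0..1/2} = {0..1::real}" "(\<lambda>x. 2 * x + - 1) ` {1/2..1} = {0..1::real}"
    unfolding image_affinity_atLeastAtMost by auto
  have "(\<lambda>x. g (2 * x)) piecewise_C1_differentiable_on {0..1/2}"
    using piecewise_C1_differentiable_affine[of g 2 0 "{0..1/2}"] g(1) unfolding im by (simp add: o_def)
  moreover have "(\<lambda>x. k (2 * x - 1)) piecewise_C1_differentiable_on {1/2..1}"
    using piecewise_C1_differentiable_affine[of k 2 "-1" "{1/2..1}"] k(1) unfolding im by (simp add: o_def)
  moreover have "g (2 * (1/2)) = k (2 * (1/2) - 1)"
    using g k by (simp add: pathfinish_def pathstart_def)
  ultimately have pc: "(g +++ k) piecewise_C1_differentiable_on {0..1}"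
    unfolding joinpaths_def
    using piecewise_C1_differentiable_cases[of "\<lambda>x. g (2 * x)" 0 "1/2" "\<lambda>x. k (2 * x - 1)" 1] by simp
  obtain S where S: "finite S" "g C1_differentiable_on ({0..1} - S)"
    using g(1) unfolding piecewise_C1_differentiable_on_def by blast
  obtain S' where S': "finite S'" "k C1_differentiable_on ({0..1} - S')"
    using k(1) unfolding piecewise_C1_differentiable_on_def by blast
  have 1: "(speed (g +++ k) has_integral l) {0..1/2}"
  proof (rule has_integral_spike_finite)
    have "(speed g has_integral l) (cbox 0 1)" using g by (auto simp: has_integral_integrable_integral)
    from has_integral_mult_right[OF has_integral_affinity'[OF this, of 2 0], of 2]
    show "((\<lambda>t. 2 * speed g (2 * t)) has_integral l) {0..1/2}" by simp
    show "finite ((\<lambda>x. x / 2) ` S \<union> {0, 1/2})" using S by simp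
    fix t :: real assume t: "t \<in> {0..1/2} - ((\<lambda>x. x / 2) ` S \<union> {0, 1/2})"
    have "2 * t \<notin> S"
    proof
      assume "2 * t \<in> S"
      then have "2 * t / 2 \<in> (\<lambda>x. x / 2) ` S" by (rule imageI)
      then show False using t by simp
    qed
    then have "2 * t \<in> {0..1} - S" using t by auto
    then have "g differentiable (at (2 * t))" using S(2) by (simp add: C1_differentiable_on_eq)
    then obtain v where v: "(g has_vector_derivative v) (at (2 * t + 0))"
      unfolding vector_derivative_works by simp
    have "((\<lambda>t. g (2 * t)) has_vector_derivative 2 *\<^sub>R v) (at t)"
      using has_vector_derivative_affine[OF v] by simp
    then have "((g +++ k) has_vector_derivative 2 *\<^sub>R v) (at t)"
      by (rule has_vector_derivative_transform_within_open[of _ _ _ "{..<1/2}"])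
        (use t in \<open>auto simp: joinpaths_def\<close>)
    then show "speed (g +++ k) t = 2 * speed g (2 * t)"
      using v by (simp add: speed_def vector_derivative_at)
  qed
  have 2: "(speed (g +++ k) has_integral l') {1/2..1}"
  proof (rule has_integral_spike_finite)
    have "(speed k has_integral l') (cbox 0 1)" using k by (auto simp: has_integral_integrable_integral)
    from has_integral_mult_right[OF has_integral_affinity'[OF this, of 2 "-1"], of 2]
    show "((\<lambda>t. 2 * speed k (2 * t - 1)) has_integral l') {1/2..1}" by simp
    show "finite ((\<lambda>x. (x + 1) / 2) ` S' \<union> {1, 1/2})" using S' by simp
    fix t :: real assume t: "t \<in> {1/2..1} - ((\<lambda>x. (x + 1) / 2) ` S' \<union> {1, 1/2})"
    have "2 * t - 1 \<notin> S'"
    proof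
      assume "2 * t - 1 \<in> S'"
      then have "(2 * t - 1 + 1) / 2 \<in> (\<lambda>x. (x + 1) / 2) ` S'" by (rule imageI)
      then show False using t by simp
    qed
    then have "2 * t - 1 \<in> {0..1} - S'" using t by auto
    then have "k differentiable (at (2 * t - 1))" using S'(2) by (simp add: C1_differentiable_on_eq)
    then obtain v where v: "(k has_vector_derivative v) (at (2 * t + - 1))"
      unfolding vector_derivative_works by simp
    have "((\<lambda>t. k (2 * t - 1)) has_vector_derivative 2 *\<^sub>R v) (at t)"
      using has_vector_derivative_affine[OF v] by simp
    then have "((g +++ k) has_vector_derivative 2 *\<^sub>R v) (at t)"
      by (rule has_vector_derivative_transform_within_open[of _ _ _ "{1/2<..}"])
        (use t in \<open>auto simp: joinpaths_def\<close>)
    then show "speed (g +++ k) t = 2 * speed k (2 * t - 1)"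
      using v by (simp add: speed_def vector_derivative_at)
  qed
  have "(speed (g +++ k) has_integral (l + l')) {0..1}"
    by (rule has_integral_combine[OF _ _ 1 2]) auto
  moreover have "path_image (g +++ k) \<subseteq> M"
    using g k by (intro subset_path_image_join)
  ultimately show ?thesis
    unfolding joined_by_def using pc g k
    by (intro exI[of _ "g +++ k"]) (auto simp: has_integral_integrable_integral)
qed

lemma geodesic_dist_le: "joined_by M p q l \<Longrightarrow> geodesic_dist M p q \<le> l"
  unfolding geodesic_dist_joined_by
  by (rule cInf_lower) (auto intro: joined_by_nonneg)

lemma geodesic_dist_nonneg: "joined_by M p q l \<Longrightarrow> 0 \<le> geodesic_dist M p q"
  unfolding geodesic_dist_joined_by by (rule cInf_greatest) (auto intro: joined_by_nonneg)

lemma geodesic_dist_refl: "p \<in> M \<Longrightarrow> geodesic_dist M p p = 0"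
  using geodesic_dist_le[OF joined_by_refl] geodesic_dist_nonneg[OF joined_by_refl] by force

section \<open>Axis-parallel paths in a chart\<close>

lemma pd_line:
  assumes sm: "smooth_on d U \<phi>" and i: "i < d" and x: "x + t *\<^sub>R unit_evec i \<in> U"
  shows "((\<lambda>t. \<phi> (x + t *\<^sub>R unit_evec i)) has_vector_derivative pd i \<phi> (x + t *\<^sub>R unit_evec i)) (at t)"
proof -
  let ?y = "x + t *\<^sub>R unit_evec i"
  have "C_k_on (Suc 0) d U \<phi>" using sm by (simp add: smooth_on_def)
  then have "(\<lambda>u. \<phi> (?y + u *\<^sub>R unit_evec i)) differentiable (at 0)" using i x by simp
  then have "((\<lambda>u. \<phi> (?y + u *\<^sub>R unit_evec i)) has_vector_derivative pd i \<phi> ?y) (at (1 * t + - t))"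
    by (simp add: vector_derivative_works pd_def)
  from has_vector_derivative_affine[OF this] show ?thesis
    by (simp add: scaleR_diff_left algebra_simps)
qed

lemma pd_continuous: "smooth_on d U \<phi> \<Longrightarrow> i < d \<Longrightarrow> continuous_on U (pd i \<phi>)"
  using smooth_on_def[of d U \<phi>] by (metis C_k_on.simps)

lemma norm_diff_coord_le: "x \<in> Rn d \<Longrightarrow> y \<in> Rn d \<Longrightarrow> (\<Sum>i<d. \<bar>coord x i - coord y i\<bar>) \<le> real d * dist x y"
  using sum_bounded_above[of "{..<d}" "\<lambda>i. \<bar>coord x i - coord y i\<bar>" "dist x y"] abs_coord_le_norm[of "x - y"]
  by (simp add: dist_norm)

definition coord_cube :: "nat \<Rightarrow> evec \<Rightarrow> real \<Rightarrow> evec set" where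
  "coord_cube d x s = {y \<in> Rn d. \<forall>i<d. \<bar>coord y i - coord x i\<bar> < s}"

text \<open>The corners of a path from \<open>x\<close> to \<open>y\<close> that moves along one
  axis at a time: after \<open>k\<close> moves the first \<open>k\<close> coordinates have been
  exchanged.\<close>

definition hybrid :: "evec \<Rightarrow> evec \<Rightarrow> nat \<Rightarrow> nat \<Rightarrow> evec" where
  "hybrid x y d k = of_coords d (\<lambda>i. if i < k then coord y i else coord x i)"

lemma hybrid_props:
  assumes "x \<in> coord_cube d z s" "y \<in> coord_cube d z s"
  shows "hybrid x y d k \<in> coord_cube d z s" "hybrid x y d 0 = x" "hybrid x y d d = y"
    and "k < d \<Longrightarrow> hybrid x y d (Suc k) = hybrid x y d k + (coord y k - coord x k) *\<^sub>R unit_evec k"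
    and "k < d \<Longrightarrow> 0 \<le> t \<Longrightarrow> t \<le> 1 \<Longrightarrow> hybrid x y d k + (t * (coord y k - coord x k)) *\<^sub>R unit_evec k \<in> coord_cube d z s"
proof -
  have xy: "x \<in> Rn d" "y \<in> Rn d" "\<And>i. i < d \<Longrightarrow> \<bar>coord x i - coord z i\<bar> < s" "\<And>i. i < d \<Longrightarrow> \<bar>coord y i - coord z i\<bar> < s"
    using assms by (auto simp: coord_cube_def)
  show "hybrid x y d k \<in> coord_cube d z s" using xy by (auto simp: hybrid_def coord_cube_def)
  show "hybrid x y d 0 = x" "hybrid x y d d = y"
    using xy(1,2) by (auto simp: hybrid_def Rn_def intro!: evec_eqI)
  show "k < d \<Longrightarrow> hybrid x y d (Suc k) = hybrid x y d k + (coord y k - coord x k) *\<^sub>R unit_evec k"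
    by (rule evec_eqI) (auto simp: hybrid_def less_Suc_eq)
  assume k: "k < d" and t: "0 \<le> t" "t \<le> 1"
  have conv: "\<bar>coord x k + t * (coord y k - coord x k) - coord z k\<bar> < s"
  proof -
    have "coord x k + t * (coord y k - coord x k) - coord z k
      = (1 - t) * (coord x k - coord z k) + t * (coord y k - coord z k)" by (simp add: algebra_simps)
    also have "\<bar>\<dots>\<bar> \<le> (1 - t) * \<bar>coord x k - coord z k\<bar> + t * \<bar>coord y k - coord z k\<bar>"
      using t by (intro order_trans[OF abs_triangle_ineq]) (simp add: abs_mult)
    also have "\<dots> \<le> (1 - t) * max \<bar>coord x k - coord z k\<bar> \<bar>coord y k - coord z k\<bar> + t * max \<bar>coord x k - coord z k\<bar> \<bar>coord y k - coord z k\<bar>"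
      using t by (intro add_mono mult_left_mono) auto
    also have "\<dots> < s" using xy(3,4)[OF k] by (simp add: algebra_simps)
    finally show ?thesis .
  qed
  show "hybrid x y d k + (t * (coord y k - coord x k)) *\<^sub>R unit_evec k \<in> coord_cube d z s"
    unfolding coord_cube_def
  proof (intro CollectI conjI allI impI)
    show "hybrid x y d k + (t * (coord y k - coord x k)) *\<^sub>R unit_evec k \<in> Rn d"
      unfolding hybrid_def using k by (intro Rn_add Rn_scaleR unit_evec_Rn of_coords_Rn)
    fix i assume i: "i < d"
    show "\<bar>coord (hybrid x y d k + (t * (coord y k - coord x k)) *\<^sub>R unit_evec k) i - coord z i\<bar> < s"
      using xy(3,4)[OF i] conv i by (cases "i = k") (auto simp: hybrid_def)
  qed
qed

text \<open>The norm of the linear image attains a positive minimum on the compact unit sphere;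
  homogeneity does the rest.\<close>

lemma linear_injective_lower_bound:
  fixes v :: "nat \<Rightarrow> evec"
  assumes "\<And>a. (\<Sum>i<d. a i *\<^sub>R v i) = 0 \<Longrightarrow> \<forall>i<d. a i = 0"
  shows "\<exists>c>0. \<forall>x\<in>Rn d. c * norm x \<le> norm (\<Sum>i<d. coord x i *\<^sub>R v i)"
proof -
  let ?f = "\<lambda>x. norm (\<Sum>i<d. coord x i *\<^sub>R v i)"
  let ?S = "{x \<in> Rn d. norm x = 1}"
  have "?S = Rn d \<inter> {x. norm x = 1}" by auto
  moreover have "closed {x::evec. norm x = 1}" by (intro closed_Collect_eq continuous_intros)
  ultimately have "closed ?S" using closed_Rn by (simp add: closed_Int)
  moreover have "?S \<subseteq> cube d 1" using cball_Rn_subset_cube by auto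
  ultimately have cpt: "compact ?S" by (rule compact_closed_subset_cube)
  have cont: "continuous_on ?S ?f" by (intro continuous_intros)
  have "\<exists>c>0. \<forall>x\<in>?S. c \<le> ?f x"
  proof (cases "?S = {}")
    \<comment> \<open>Dimension zero: the unit sphere is empty and any positive constant
      serves.\<close>
    case True
    then show ?thesis by (intro exI[of _ 1]) (simp only: ball_empty, simp)
  next
    case False
    from continuous_attains_inf[OF cpt False cont] obtain x where x: "x \<in> ?S" "\<forall>y\<in>?S. ?f x \<le> ?f y" by blast
    have "?f x \<noteq> 0"
    proof
      assume "?f x = 0"
      then have "\<forall>i<d. coord x i = 0" using assms[of "coord x"] by simp
      then have "x = 0" using x by (intro evec_eqI) (auto simp: Rn_def not_less[symmetric])
      then show False using x by simp
    qed
    then have "0 < ?f x" by simp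
    then show ?thesis using x(2) by (intro exI[of _ "?f x"]) simp
  qed
  then obtain c where c: "0 < c" "\<And>x. x \<in> ?S \<Longrightarrow> c \<le> ?f x" by auto
  have "c * norm x \<le> ?f x" if x: "x \<in> Rn d" for x
  proof (cases "x = 0")
    case False
    have "(1 / norm x) *\<^sub>R x \<in> ?S" using x False by (auto intro!: Rn_scaleR)
    from c(2)[OF this] have "c \<le> norm (\<Sum>i<d. (1 / norm x) *\<^sub>R (coord x i *\<^sub>R v i))" by simp
    also have "\<dots> = (1 / norm x) * ?f x" by (simp add: scaleR_sum_right[symmetric] del: scaleR_scaleR)
    finally show ?thesis using False by (simp add: field_simps)
  qed simp
  then show ?thesis using c(1) by blast
qed

text \<open>Mean value inequality along one axis for the map minus the linear part
  \<open>t *\<^sub>R v\<close>. With \<open>v\<close> a derivative at the centre of the chart it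
  measures the deviation from linearity, with \<open>v = 0\<close> the growth.\<close>

lemma axis_step_bound:
  assumes sm: "smooth_on d U \<phi>" and k: "k < d"
    and inU: "\<And>t. t \<in> closed_segment 0 b \<Longrightarrow> x + t *\<^sub>R unit_evec k \<in> U"
    and close: "\<And>t. t \<in> closed_segment 0 b \<Longrightarrow> norm (pd k \<phi> (x + t *\<^sub>R unit_evec k) - v) \<le> \<eta>"
    and \<eta>: "0 \<le> \<eta>"
  shows "norm (\<phi> (x + b *\<^sub>R unit_evec k) - \<phi> x - b *\<^sub>R v) \<le> \<eta> * \<bar>b\<bar>"
proof -
  define f where "f t = \<phi> (x + t *\<^sub>R unit_evec k) - t *\<^sub>R v" for t
  have "norm (f b - f 0) \<le> \<eta> * norm (b - 0)"
  proof (rule differentiable_bound[of "closed_segment 0 b"])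
    fix t assume t: "t \<in> closed_segment 0 b"
    let ?w = "pd k \<phi> (x + t *\<^sub>R unit_evec k) - v"
    have "(f has_vector_derivative ?w) (at t)"
      unfolding f_def[abs_def]
      by (intro has_vector_derivative_diff pd_line[OF sm k inU[OF t]]) (auto intro!: derivative_eq_intros)
    then show "(f has_derivative (\<lambda>h. h *\<^sub>R ?w)) (at t within closed_segment 0 b)"
      unfolding has_vector_derivative_def by (rule has_derivative_at_withinI)
    show "onorm (\<lambda>h. h *\<^sub>R ?w) \<le> \<eta>"
    proof (rule onorm_bound)
      fix h show "norm (h *\<^sub>R ?w) \<le> \<eta> * norm h"
        using mult_left_mono[OF close[OF t], of "\<bar>h\<bar>"] by (simp add: mult.commute)
    qed (use \<eta> in simp)
  qed auto
  then show ?thesis unfolding f_def by (simp add: algebra_simps)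
qed

text \<open>Moving along the coordinate axes one at a time needs partial derivatives only, neither the
  chain rule nor Frechet differentiability of the chart.\<close>

lemma chart_cube:
  assumes lp: "local_param d M U \<phi>" and x0: "x0 \<in> U"
  obtains s B c where "0 < s" "0 \<le> B" "0 < c" "coord_cube d x0 s \<subseteq> U"
    "\<And>x i. x \<in> coord_cube d x0 s \<Longrightarrow> i < d \<Longrightarrow> norm (pd i \<phi> x) \<le> B"
    "\<And>x y. x \<in> coord_cube d x0 s \<Longrightarrow> y \<in> coord_cube d x0 s \<Longrightarrow> c * dist x y \<le> dist (\<phi> x) (\<phi> y)"
proof -
  have U: "openin (top_of_set (Rn d)) U" and sm: "smooth_on d U \<phi>"
    and inj: "\<And>x a. x \<in> U \<Longrightarrow> (\<Sum>i<d. a i *\<^sub>R pd i \<phi> x) = 0 \<Longrightarrow> \<forall>i<d. a i = 0"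
    using lp unfolding local_param_def by auto
  obtain c where c: "0 < c" "\<And>x. x \<in> Rn d \<Longrightarrow> c * norm x \<le> norm (\<Sum>i<d. coord x i *\<^sub>R pd i \<phi> x0)"
    using linear_injective_lower_bound[where d = d and v = "\<lambda>i. pd i \<phi> x0"] inj[OF x0] by blast
  \<comment> \<open>The \<open>d\<close> axis steps together deviate from the linear map by at most
    \<open>\<eta> * d\<close> times the distance; this choice keeps half of the lower bound
    \<open>c\<close>.\<close>
  define \<eta> where "\<eta> = c / (2 * (real d + 1))"
  have \<eta>: "0 < \<eta>" using c by (simp add: \<eta>_def)
  have U_sub: "U \<subseteq> Rn d" using U openin_imp_subset by blast
  obtain e where e: "0 < e" "\<And>x. x \<in> Rn d \<Longrightarrow> dist x x0 < e \<Longrightarrow> x \<in> U"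
    using U x0 unfolding openin_euclidean_subtopology_iff by blast
  have "\<exists>\<delta>>0. \<forall>x\<in>U. dist x x0 < \<delta> \<longrightarrow> dist (pd i \<phi> x) (pd i \<phi> x0) < \<eta>" if "i < d" for i
    using pd_continuous[OF sm that] x0 \<eta> unfolding continuous_on_iff by blast
  then obtain \<delta> where \<delta>: "\<And>i. i < d \<Longrightarrow> 0 < \<delta> i"
    "\<And>i x. i < d \<Longrightarrow> x \<in> U \<Longrightarrow> dist x x0 < \<delta> i \<Longrightarrow> dist (pd i \<phi> x) (pd i \<phi> x0) < \<eta>" by metis
  define m where "m = Min (insert e (\<delta> ` {..<d}))"
  have m: "0 < m" "m \<le> e" "\<And>i. i < d \<Longrightarrow> m \<le> \<delta> i" using e(1) \<delta>(1) by (auto simp: m_def)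
  \<comment> \<open>A half-side for which the coordinate cube lies in the ball of radius
    \<open>m\<close>.\<close>
  define s where "s = m / (real d + 1)"
  have s: "0 < s" using m by (simp add: s_def)
  let ?Q = "coord_cube d x0 s"
  have near: "dist x x0 < m" if "x \<in> ?Q" for x
  proof -
    have "dist x x0 \<le> (\<Sum>i<d. \<bar>coord (x - x0) i\<bar>)"
      unfolding dist_norm using that U_sub x0 by (intro norm_le_sum_coord Rn_diff) (auto simp: coord_cube_def)
    also have "\<dots> \<le> (\<Sum>i<d. s)" by (intro sum_mono) (use that in \<open>auto simp: coord_cube_def less_imp_le\<close>)
    also have "\<dots> = real d * s" by simp
    also have "\<dots> < m" using m(1) by (simp add: s_def field_simps)
    finally show ?thesis .
  qed
  have Q_sub: "?Q \<subseteq> U"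
  proof
    fix x assume x: "x \<in> ?Q"
    show "x \<in> U" by (rule e(2)) (use near[OF x] m x in \<open>auto simp: coord_cube_def\<close>)
  qed
  have close: "norm (pd i \<phi> x - pd i \<phi> x0) \<le> \<eta>" if "x \<in> ?Q" "i < d" for x i
    using \<delta>(2)[of i x] near[OF that(1)] m(3)[OF that(2)] Q_sub that by (force simp: dist_norm)
  define B where "B = \<eta> + (\<Sum>i<d. norm (pd i \<phi> x0))"
  have B: "norm (pd i \<phi> x) \<le> B" if "x \<in> ?Q" "i < d" for x i
  proof -
    have "norm (pd i \<phi> x) \<le> norm (pd i \<phi> x - pd i \<phi> x0) + norm (pd i \<phi> x0)"
      using norm_triangle_ineq[of "pd i \<phi> x - pd i \<phi> x0" "pd i \<phi> x0"] by simp
    also have "norm (pd i \<phi> x0) \<le> (\<Sum>i<d. norm (pd i \<phi> x0))"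
      using that(2) by (intro member_le_sum) auto
    finally show ?thesis using close[OF that] by (simp add: B_def)
  qed
  have lower: "c / 2 * dist x y \<le> dist (\<phi> x) (\<phi> y)" if x: "x \<in> ?Q" and y: "y \<in> ?Q" for x y
  proof -
    let ?h = "hybrid x y d"
    have step: "norm (\<phi> (?h (Suc k)) - \<phi> (?h k) - (coord y k - coord x k) *\<^sub>R pd k \<phi> x0) \<le> \<eta> * \<bar>coord y k - coord x k\<bar>"
      if k: "k < d" for k
    proof -
      let ?b = "coord y k - coord x k"
      have inQ: "?h k + t *\<^sub>R unit_evec k \<in> ?Q" if "t \<in> closed_segment 0 ?b" for t
      proof -
        from that obtain u where "0 \<le> u" "u \<le> 1" "t = u * ?b" by (auto simp: in_segment)
        then show ?thesis using hybrid_props(5)[OF x y k] by simp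
      qed
      show ?thesis
        unfolding hybrid_props(4)[OF x y k]
        by (rule axis_step_bound[OF sm k]) (use inQ Q_sub close k \<eta> in auto)
    qed
    have tel: "(\<Sum>k<d. \<phi> (?h (Suc k)) - \<phi> (?h k)) = \<phi> y - \<phi> x"
      using sum_lessThan_telescope[of "\<lambda>k. \<phi> (?h k)" d] hybrid_props(2,3)[OF x y] by simp
    have xy: "x \<in> Rn d" "y \<in> Rn d" using x y by (auto simp: coord_cube_def)
    have "norm ((\<phi> y - \<phi> x) - (\<Sum>k<d. coord (y - x) k *\<^sub>R pd k \<phi> x0))
      = norm (\<Sum>k<d. \<phi> (?h (Suc k)) - \<phi> (?h k) - (coord y k - coord x k) *\<^sub>R pd k \<phi> x0)"
      unfolding tel[symmetric] by (simp add: sum_subtractf)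
    also have "\<dots> \<le> (\<Sum>k<d. \<eta> * \<bar>coord y k - coord x k\<bar>)"
      by (rule order_trans[OF norm_sum sum_mono]) (use step in auto)
    also have "\<dots> \<le> \<eta> * (real d * dist y x)"
      unfolding sum_distrib_left[symmetric]
      by (rule mult_left_mono[OF norm_diff_coord_le[OF xy(2,1)]]) (use \<eta> in simp)
    also have "\<dots> \<le> c / 2 * dist y x"
    proof -
      have "\<eta> * real d \<le> c / 2" using c(1) by (simp add: \<eta>_def field_simps)
      from mult_right_mono[OF this, of "dist y x"] show ?thesis by (simp add: mult.assoc)
    qed
    finally have 1: "norm ((\<phi> y - \<phi> x) - (\<Sum>k<d. coord (y - x) k *\<^sub>R pd k \<phi> x0)) \<le> c / 2 * dist y x" .
    have 2: "c * dist y x \<le> norm (\<Sum>k<d. coord (y - x) k *\<^sub>R pd k \<phi> x0)"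
      unfolding dist_norm by (rule c(2)[OF Rn_diff[OF xy(2,1)]])
    have 3: "norm (\<Sum>k<d. coord (y - x) k *\<^sub>R pd k \<phi> x0) \<le> norm (\<phi> y - \<phi> x)
      + norm ((\<phi> y - \<phi> x) - (\<Sum>k<d. coord (y - x) k *\<^sub>R pd k \<phi> x0))"
      using norm_triangle_ineq4[of "\<phi> y - \<phi> x" "(\<phi> y - \<phi> x) - (\<Sum>k<d. coord (y - x) k *\<^sub>R pd k \<phi> x0)"] by simp
    have "c * dist y x = c / 2 * dist y x + c / 2 * dist y x" by simp
    then have "c / 2 * dist y x \<le> norm (\<phi> y - \<phi> x)" using 1 2 3 by linarith
    then show ?thesis by (simp add: dist_norm norm_minus_commute)
  qed
  have "0 \<le> B" unfolding B_def using \<eta> by (intro add_nonneg_nonneg sum_nonneg) auto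
  moreover have "0 < c / 2" using c by simp
  ultimately show ?thesis using that[of s B "c / 2"] s Q_sub B lower by blast
qed

lemma hybrid_segment:
  assumes x: "x \<in> coord_cube d z s" and y: "y \<in> coord_cube d z s" and k: "k < d"
    and t: "t \<in> closed_segment 0 (coord y k - coord x k)"
  shows "hybrid x y d k + t *\<^sub>R unit_evec k \<in> coord_cube d z s"
proof -
  from t obtain u where "0 \<le> u" "u \<le> 1" "t = u * (coord y k - coord x k)" by (auto simp: in_segment)
  then show ?thesis using hybrid_props(5)[OF x y k] by simp
qed

lemma chart_dist_le:
  assumes sm: "smooth_on d U \<phi>" and Q: "coord_cube d x0 s \<subseteq> U" and B0: "0 \<le> B"
    and B: "\<And>x i. x \<in> coord_cube d x0 s \<Longrightarrow> i < d \<Longrightarrow> norm (pd i \<phi> x) \<le> B"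
    and x: "x \<in> coord_cube d x0 s" and y: "y \<in> coord_cube d x0 s"
  shows "dist (\<phi> x) (\<phi> y) \<le> B * (\<Sum>i<d. \<bar>coord y i - coord x i\<bar>)"
proof -
  let ?h = "hybrid x y d"
  have step: "norm (\<phi> (?h (Suc k)) - \<phi> (?h k)) \<le> B * \<bar>coord y k - coord x k\<bar>" if k: "k < d" for k
  proof -
    have "norm (\<phi> (?h k + (coord y k - coord x k) *\<^sub>R unit_evec k) - \<phi> (?h k) - (coord y k - coord x k) *\<^sub>R 0)
      \<le> B * \<bar>coord y k - coord x k\<bar>"
      by (rule axis_step_bound[OF sm k]) (use hybrid_segment[OF x y k] Q B k B0 in auto)
    then show ?thesis unfolding hybrid_props(4)[OF x y k] by simp
  qed
  have "\<phi> y - \<phi> x = (\<Sum>k<d. \<phi> (?h (Suc k)) - \<phi> (?h k))"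
    using sum_lessThan_telescope[of "\<lambda>k. \<phi> (?h k)" d] hybrid_props(2,3)[OF x y] by simp
  then have "norm (\<phi> y - \<phi> x) \<le> (\<Sum>k<d. B * \<bar>coord y k - coord x k\<bar>)"
    by (simp only:) (rule order_trans[OF norm_sum sum_mono], use step in auto)
  then show ?thesis by (simp add: dist_norm norm_minus_commute sum_distrib_left)
qed

text \<open>The image of the axis-parallel path is a concatenation of \<open>d\<close> continuously
  differentiable curves inside \<open>M\<close>. Together with the lower bound of
  \<open>chart_cube\<close> it compares curve length with Euclidean distance.\<close>

lemma chart_joined_by:
  assumes sm: "smooth_on d U \<phi>" and Q: "coord_cube d x0 s \<subseteq> U" and M: "\<phi> ` U \<subseteq> M"
    and B: "\<And>x i. x \<in> coord_cube d x0 s \<Longrightarrow> i < d \<Longrightarrow> norm (pd i \<phi> x) \<le> B"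
    and x: "x \<in> coord_cube d x0 s" and y: "y \<in> coord_cube d x0 s"
  shows "\<exists>l. joined_by M (\<phi> x) (\<phi> y) l \<and> l \<le> B * (\<Sum>i<d. \<bar>coord y i - coord x i\<bar>)"
proof -
  let ?h = "hybrid x y d"
  have step: "\<exists>l. joined_by M (\<phi> (?h k)) (\<phi> (?h (Suc k))) l \<and> l \<le> B * \<bar>coord y k - coord x k\<bar>"
    if k: "k < d" for k
  proof -
    let ?b = "coord y k - coord x k"
    define g where "g t = \<phi> (?h k + (?b * t) *\<^sub>R unit_evec k)" for t
    have inQ: "?h k + (?b * t) *\<^sub>R unit_evec k \<in> coord_cube d x0 s" if "t \<in> {0..1}" for t
      using hybrid_props(5)[OF x y k, of t] that by (simp add: mult.commute)
    have der: "(g has_vector_derivative ?b *\<^sub>R pd k \<phi> (?h k + (?b * t) *\<^sub>R unit_evec k)) (at t)"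
      if t: "t \<in> {0..1}" for t
    proof -
      have "((\<lambda>u. \<phi> (?h k + u *\<^sub>R unit_evec k)) has_vector_derivative pd k \<phi> (?h k + (?b * t + 0) *\<^sub>R unit_evec k)) (at (?b * t + 0))"
        by (rule pd_line[OF sm k]) (use inQ[OF t] Q in auto)
      from has_vector_derivative_affine[OF this] show ?thesis unfolding g_def[abs_def] by simp
    qed
    have cont: "continuous_on {0..1} (\<lambda>t. ?b *\<^sub>R pd k \<phi> (?h k + (?b * t) *\<^sub>R unit_evec k))"
      by (intro continuous_intros continuous_on_compose2[OF pd_continuous[OF sm k]]) (use inQ Q in auto)
    have "g C1_differentiable_on {0..1}"
      unfolding C1_differentiable_on_def
      by (intro exI[of _ "\<lambda>t. ?b *\<^sub>R pd k \<phi> (?h k + (?b * t) *\<^sub>R unit_evec k)"] conjI ballI der cont)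
    then have pc: "g piecewise_C1_differentiable_on {0..1}" by (rule C1_differentiable_imp_piecewise)
    have sp: "speed g t = norm (?b *\<^sub>R pd k \<phi> (?h k + (?b * t) *\<^sub>R unit_evec k))" if "t \<in> {0..1}" for t
      unfolding speed_def using vector_derivative_at[OF der[OF that]] by simp
    have "continuous_on {0..1} (\<lambda>t. norm (?b *\<^sub>R pd k \<phi> (?h k + (?b * t) *\<^sub>R unit_evec k)))"
      by (rule continuous_on_norm[OF cont])
    then have "(\<lambda>t. norm (?b *\<^sub>R pd k \<phi> (?h k + (?b * t) *\<^sub>R unit_evec k))) integrable_on {0..1}"
      by (rule integrable_continuous_real)
    then have int: "speed g integrable_on {0..1}" by (rule integrable_eq) (use sp in auto)
    have "integral {0..1} (speed g) \<le> integral {0..1} (\<lambda>_::real. B * \<bar>?b\<bar>)"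
    proof (rule integral_le[OF int])
      fix t :: real assume t: "t \<in> {0..1}"
      show "speed g t \<le> B * \<bar>?b\<bar>"
        unfolding sp[OF t] using mult_right_mono[OF B[OF inQ[OF t] k], of "\<bar>?b\<bar>"] by (simp add: mult.commute)
    qed (rule integrable_const_ivl)
    then have "integral {0..1} (speed g) \<le> B * \<bar>?b\<bar>" by simp
    moreover have "path_image g \<subseteq> M"
      unfolding path_image_def g_def using inQ Q M by blast
    moreover have "pathstart g = \<phi> (?h k)" "pathfinish g = \<phi> (?h (Suc k))"
      by (simp_all add: pathstart_def pathfinish_def g_def hybrid_props(4)[OF x y k])
    ultimately show ?thesis
      unfolding joined_by_def
      by (intro exI[of _ "integral {0..1} (speed g)"] conjI exI[of _ g] pc int) simp_all
  qed
  have "\<exists>l. joined_by M (\<phi> (?h 0)) (\<phi> (?h k)) l \<and> l \<le> B * (\<Sum>i<k. \<bar>coord y i - coord x i\<bar>)" if "k \<le> d" for k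
    using that
  proof (induction k)
    case 0
    have "\<phi> (?h 0) \<in> M" using hybrid_props(1)[OF x y, of 0] Q M by blast
    then show ?case using joined_by_refl by (intro exI[of _ 0]) simp
  next
    case (Suc k)
    obtain l where l: "joined_by M (\<phi> (?h 0)) (\<phi> (?h k)) l" "l \<le> B * (\<Sum>i<k. \<bar>coord y i - coord x i\<bar>)"
      using Suc.IH Suc.prems by auto
    obtain l' where l': "joined_by M (\<phi> (?h k)) (\<phi> (?h (Suc k))) l'" "l' \<le> B * \<bar>coord y k - coord x k\<bar>"
      using step[of k] Suc.prems by auto
    show ?case using joined_by_trans[OF l(1) l'(1)] l(2) l'(2)
      by (intro exI[of _ "l + l'"]) (simp add: distrib_left)
  qed
  from this[OF order_refl] show ?thesis unfolding hybrid_props(2,3)[OF x y] .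
qed

text \<open>The cube is cut into \<open>k ^ d\<close> equal cells and one of its points is chosen in
  each occupied cell; points of the same cell differ by at most \<open>2 * s / k\<close> in every
  coordinate.\<close>

lemma coord_cube_net:
  assumes k: "1 \<le> k" and s: "0 < s"
  obtains Z where "finite Z" "Z \<subseteq> coord_cube d x0 s" "card Z \<le> k ^ d"
    "\<And>x. x \<in> coord_cube d x0 s \<Longrightarrow> \<exists>z\<in>Z. (\<Sum>i<d. \<bar>coord z i - coord x i\<bar>) \<le> real d * (2 * s / real k)"
proof -
  let ?Q = "coord_cube d x0 s"
  \<comment> \<open>\<open>restrict\<close> makes the cell labels extensional functions, so that
    \<open>card_PiE\<close> counts them.\<close>
  define cell where "cell x = restrict (\<lambda>i. nat \<lfloor>(coord x i - coord x0 i + s) * real k / (2 * s)\<rfloor>) {..<d}" for x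
  define Z where "Z = (\<lambda>c. SOME x. x \<in> ?Q \<and> cell x = c) ` (cell ` ?Q)"
  have cell_in: "cell x \<in> PiE {..<d} (\<lambda>_. {..<k})" if "x \<in> ?Q" for x
  proof -
    have "nat \<lfloor>(coord x i - coord x0 i + s) * real k / (2 * s)\<rfloor> < k" if "i < d" for i
    proof -
      have "\<bar>coord x i - coord x0 i\<bar> < s" using \<open>x \<in> ?Q\<close> that by (auto simp: coord_cube_def)
      then have "coord x i - coord x0 i + s < 2 * s" by linarith
      then have "(coord x i - coord x0 i + s) * real k < 2 * s * real k" using k by simp
      then have "(coord x i - coord x0 i + s) * real k / (2 * s) < real k"
        using s by (simp add: divide_less_eq mult.commute)
      then have "\<lfloor>(coord x i - coord x0 i + s) * real k / (2 * s)\<rfloor> < int k" by (simp add: floor_less_iff)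
      then show ?thesis using k by linarith
    qed
    then show ?thesis by (auto simp: cell_def)
  qed
  have fin: "finite (cell ` ?Q)" by (rule finite_subset[of _ "PiE {..<d} (\<lambda>_. {..<k})"]) (use cell_in in \<open>auto intro!: finite_PiE\<close>)
  have rep: "(SOME y. y \<in> ?Q \<and> cell y = cell x) \<in> ?Q \<and> cell (SOME y. y \<in> ?Q \<and> cell y = cell x) = cell x"
    if "x \<in> ?Q" for x
    by (rule someI[of "\<lambda>y. y \<in> ?Q \<and> cell y = cell x" x]) (use that in simp)
  have "card Z \<le> card (cell ` ?Q)" unfolding Z_def by (rule card_image_le[OF fin])
  also have "\<dots> \<le> card (PiE {..<d} (\<lambda>_. {..<k}))"
    by (rule card_mono) (use cell_in in \<open>auto intro!: finite_PiE\<close>)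
  also have "\<dots> = k ^ d" by (simp add: card_PiE)
  finally have card: "card Z \<le> k ^ d" .
  have near: "\<exists>z\<in>Z. (\<Sum>i<d. \<bar>coord z i - coord x i\<bar>) \<le> real d * (2 * s / real k)" if x: "x \<in> ?Q" for x
  proof -
    define z where "z = (SOME y. y \<in> ?Q \<and> cell y = cell x)"
    have z: "z \<in> ?Q" "cell z = cell x" using rep[OF x] by (simp_all add: z_def)
    have "z \<in> Z" unfolding Z_def z_def using x by blast
    have "\<bar>coord z i - coord x i\<bar> \<le> 2 * s / real k" if i: "i < d" for i
    proof -
      define u where "u = (coord x i - coord x0 i + s) * real k / (2 * s)"
      define w where "w = (coord z i - coord x0 i + s) * real k / (2 * s)"
      have "\<bar>coord x i - coord x0 i\<bar> < s" "\<bar>coord z i - coord x0 i\<bar> < s" using x z(1) i by (auto simp: coord_cube_def)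
      then have pos: "0 \<le> u" "0 \<le> w" using s unfolding u_def w_def by (auto intro!: divide_nonneg_pos mult_nonneg_nonneg)
      have "nat \<lfloor>u\<rfloor> = nat \<lfloor>w\<rfloor>"
        using fun_cong[OF z(2), of i] i by (simp add: cell_def u_def w_def)
      then have "\<lfloor>u\<rfloor> = \<lfloor>w\<rfloor>" using pos by (metis nat_eq_iff2 zero_le_floor nat_0_le)
      then have "\<bar>w - u\<bar> < 1" by linarith
      moreover have "coord z i - coord x i = (w - u) * (2 * s / real k)"
        using s k by (simp add: u_def w_def field_simps)
      moreover have "\<bar>w - u\<bar> * (2 * s / real k) \<le> 1 * (2 * s / real k)"
        by (rule mult_right_mono) (use s k \<open>\<bar>w - u\<bar> < 1\<close> in auto)
      ultimately show ?thesis using s by (simp add: abs_mult)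
    qed
    then have "(\<Sum>i<d. \<bar>coord z i - coord x i\<bar>) \<le> (\<Sum>i<d. 2 * s / real k)" by (intro sum_mono) auto
    then show ?thesis using \<open>z \<in> Z\<close> by (intro bexI[of _ z]) simp_all
  qed
  show ?thesis
    by (rule that[of Z]) (use fin card near rep in \<open>auto simp: Z_def\<close>)
qed

text \<open>The two local facts that compactness will globalize, curve length against Euclidean
  distance and covering numbers. A single constant governs both, so a finite cover can take one for
  all; nets inside \<open>V\<close> stay on the manifold.\<close>

definition good_nbhd :: "nat \<Rightarrow> evec set \<Rightarrow> evec set \<Rightarrow> real \<Rightarrow> bool" where
  "good_nbhd d M V C \<longleftrightarrow> openin (top_of_set M) V \<and> 0 \<le> C \<and>
     (\<forall>x\<in>V. \<forall>y\<in>V. \<exists>l. joined_by M x y l \<and> l \<le> C * dist x y) \<and>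
     (\<forall>e. 0 < e \<longrightarrow> e \<le> 1 \<longrightarrow>
       (\<exists>Z. finite Z \<and> Z \<subseteq> V \<and> real (card Z) \<le> C * (1 / e) ^ d \<and> (\<forall>x\<in>V. \<exists>z\<in>Z. dist x z \<le> e)))"

lemma good_nbhdD:
  assumes "good_nbhd d M V C"
  shows "openin (top_of_set M) V" "0 \<le> C"
    and "x \<in> V \<Longrightarrow> y \<in> V \<Longrightarrow> \<exists>l. joined_by M x y l \<and> l \<le> C * dist x y"
    and "0 < e \<Longrightarrow> e \<le> 1 \<Longrightarrow>
      \<exists>Z. finite Z \<and> Z \<subseteq> V \<and> real (card Z) \<le> C * (1 / e) ^ d \<and> (\<forall>x\<in>V. \<exists>z\<in>Z. dist x z \<le> e)"
  using assms by (simp_all add: good_nbhd_def)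

lemma good_nbhd_exists:
  assumes "submanifold D d M" "p \<in> M" shows "\<exists>V C. p \<in> V \<and> good_nbhd d M V C"
proof -
  obtain U \<phi> where lp: "local_param d M U \<phi>" and p: "p \<in> \<phi> ` U"
    using assms unfolding submanifold_def by blast
  then obtain x0 where x0: "x0 \<in> U" "p = \<phi> x0" by blast
  have sm: "smooth_on d U \<phi>" and opM: "openin (top_of_set M) (\<phi> ` U)" and U: "U \<subseteq> Rn d"
    using lp openin_imp_subset unfolding local_param_def by auto
  obtain g where hom: "homeomorphism U (\<phi> ` U) \<phi> g" using lp unfolding local_param_def by blast
  obtain s B c where s: "0 < s" and B0: "0 \<le> B" and c: "0 < c" and Q: "coord_cube d x0 s \<subseteq> U"
    and B: "\<And>x i. x \<in> coord_cube d x0 s \<Longrightarrow> i < d \<Longrightarrow> norm (pd i \<phi> x) \<le> B"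
    and low: "\<And>x y. x \<in> coord_cube d x0 s \<Longrightarrow> y \<in> coord_cube d x0 s \<Longrightarrow> c * dist x y \<le> dist (\<phi> x) (\<phi> y)"
    by (rule chart_cube[OF lp x0(1)]) blast
  let ?Q = "coord_cube d x0 s"
  let ?V = "\<phi> ` ?Q"
  have M: "\<phi> ` U \<subseteq> M" using opM openin_imp_subset by blast
  have "?Q = U \<inter> (\<Inter>i\<in>{..<d}. {y. \<bar>coord y i - coord x0 i\<bar> < s})" using Q U by (auto simp: coord_cube_def)
  moreover have "open (\<Inter>i\<in>{..<d}. {y. \<bar>coord y i - coord x0 i\<bar> < s})"
    by (intro open_INT finite_lessThan ballI open_Collect_less continuous_intros)
  ultimately have "openin (top_of_set U) ?Q" by (simp only: openin_open_Int)
  then have "openin (top_of_set (\<phi> ` U)) ?V" by (rule homeomorphism_imp_open_map[OF hom])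
  then have op: "openin (top_of_set M) ?V" using opM by (rule openin_trans)
  have len: "\<exists>l. joined_by M (\<phi> x) (\<phi> y) l \<and> l \<le> B * real d / c * dist (\<phi> x) (\<phi> y)"
    if x: "x \<in> ?Q" and y: "y \<in> ?Q" for x y
  proof -
    obtain l where l: "joined_by M (\<phi> x) (\<phi> y) l" "l \<le> B * (\<Sum>i<d. \<bar>coord y i - coord x i\<bar>)"
      using chart_joined_by[OF sm Q M B x y] by blast
    have "(\<Sum>i<d. \<bar>coord y i - coord x i\<bar>) \<le> real d * dist y x"
      by (rule norm_diff_coord_le) (use x y in \<open>auto simp: coord_cube_def\<close>)
    also have "\<dots> \<le> real d * (dist (\<phi> x) (\<phi> y) / c)"
      using low[OF x y] c by (intro mult_left_mono) (simp_all add: field_simps dist_commute)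
    finally have "B * (\<Sum>i<d. \<bar>coord y i - coord x i\<bar>) \<le> B * (real d * (dist (\<phi> x) (\<phi> y) / c))"
      using B0 by (rule mult_left_mono)
    then show ?thesis using l by (intro exI[of _ l]) simp
  qed
  \<comment> \<open>With about \<open>2 * s * B * d / e\<close> cells per axis the image of the net
    is \<open>e\<close>-dense; for \<open>e \<le> 1\<close> the rounding up is absorbed by the
    summand two.\<close>
  define a where "a = 2 * s * B * real d + 2"
  have a: "2 \<le> a" using s B0 by (simp add: a_def)
  have net: "\<exists>Z. finite Z \<and> Z \<subseteq> ?V \<and> real (card Z) \<le> a ^ d * (1 / e) ^ d \<and> (\<forall>x\<in>?V. \<exists>z\<in>Z. dist x z \<le> e)"
    if e: "0 < e" "e \<le> 1" for e
  proof -
    define k where "k = nat \<lceil>2 * s * B * real d / e\<rceil> + 1"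
    have k: "1 \<le> k" by (simp add: k_def)
    have nn: "0 \<le> 2 * s * B * real d / e" using s B0 e by simp
    have k_low: "2 * s * B * real d / e \<le> real k" unfolding k_def using nn by linarith
    have "real k \<le> 2 * s * B * real d / e + 2" unfolding k_def using nn by linarith
    also have "\<dots> \<le> 2 * s * B * real d / e + 2 / e" using e by (simp add: field_simps)
    also have "\<dots> = a * (1 / e)" by (simp add: a_def add_divide_distrib)
    finally have k_up: "real k \<le> a * (1 / e)" .
    obtain Z where Z: "finite Z" "Z \<subseteq> ?Q" "card Z \<le> k ^ d"
      "\<And>x. x \<in> ?Q \<Longrightarrow> \<exists>z\<in>Z. (\<Sum>i<d. \<bar>coord z i - coord x i\<bar>) \<le> real d * (2 * s / real k)"
      using coord_cube_net[OF k s] by blast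
    have "real (card (\<phi> ` Z)) \<le> real (k ^ d)" using card_image_le[OF Z(1), of \<phi>] Z(3) by linarith
    also have "\<dots> \<le> (a * (1 / e)) ^ d" using k_up by (simp add: power_mono)
    also have "\<dots> = a ^ d * (1 / e) ^ d" by (rule power_mult_distrib)
    finally have card: "real (card (\<phi> ` Z)) \<le> a ^ d * (1 / e) ^ d" .
    have "\<exists>z\<in>\<phi> ` Z. dist (\<phi> x) z \<le> e" if x: "x \<in> ?Q" for x
    proof -
      obtain z where z: "z \<in> Z" "(\<Sum>i<d. \<bar>coord z i - coord x i\<bar>) \<le> real d * (2 * s / real k)"
        using Z(4)[OF x] by blast
      have "dist (\<phi> x) (\<phi> z) \<le> B * (\<Sum>i<d. \<bar>coord z i - coord x i\<bar>)"
        by (rule chart_dist_le[OF sm Q B0 B x]) (use z Z in auto)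
      also have "\<dots> \<le> B * (real d * (2 * s / real k))" by (rule mult_left_mono[OF z(2) B0])
      also have "\<dots> \<le> e" using k_low e k by (simp add: field_simps)
      finally show ?thesis using z(1) by blast
    qed
    then show ?thesis using Z card by (intro exI[of _ "\<phi> ` Z"]) auto
  qed
  define C where "C = max (B * real d / c) (a ^ d)"
  have "good_nbhd d M ?V C"
    unfolding good_nbhd_def
  proof (intro conjI ballI allI impI)
    show "openin (top_of_set M) ?V" by (rule op)
    show "0 \<le> C" using a by (simp add: C_def le_max_iff_disj)
    fix x y assume "x \<in> ?V" "y \<in> ?V"
    then obtain l where "joined_by M x y l" "l \<le> B * real d / c * dist x y" using len by blast
    moreover have "B * real d / c * dist x y \<le> C * dist x y" by (rule mult_right_mono) (simp_all add: C_def)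
    ultimately show "\<exists>l. joined_by M x y l \<and> l \<le> C * dist x y" by force
  next
    fix e :: real assume e: "0 < e" "e \<le> 1"
    have "a ^ d * (1 / e) ^ d \<le> C * (1 / e) ^ d" by (rule mult_right_mono) (use e in \<open>simp_all add: C_def\<close>)
    then show "\<exists>Z. finite Z \<and> Z \<subseteq> ?V \<and> real (card Z) \<le> C * (1 / e) ^ d \<and> (\<forall>x\<in>?V. \<exists>z\<in>Z. dist x z \<le> e)"
      using net[OF e] by force
  qed
  moreover have "p \<in> ?V" using x0 s U by (auto simp: coord_cube_def)
  ultimately show ?thesis by blast
qed

text \<open>The curves in the hypotheses ensure that both infima are taken over nonempty
  sets.\<close>

lemma geodesic_dist_triangle:
  assumes "joined_by M p q l" "joined_by M q z l'"
  shows "geodesic_dist M p z \<le> geodesic_dist M p q + geodesic_dist M q z"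
proof -
  have "geodesic_dist M p z - m \<le> geodesic_dist M p q" if m: "joined_by M q z m" for m
    unfolding geodesic_dist_joined_by[of M p q]
  proof (rule cInf_greatest)
    fix k assume "k \<in> {l. joined_by M p q l}"
    then show "geodesic_dist M p z - m \<le> k" using geodesic_dist_le[OF joined_by_trans[OF _ m]] by force
  qed (use assms in auto)
  then have "geodesic_dist M p z - geodesic_dist M p q \<le> geodesic_dist M q z"
    unfolding geodesic_dist_joined_by[of M q z]
    by (intro cInf_greatest) (use assms in \<open>auto simp: algebra_simps\<close>)
  then show ?thesis by simp
qed

lemma submanifold_finite_cover:
  assumes M: "submanifold D d M" "compact M"
  shows "\<exists>T V C. finite T \<and> 0 \<le> (C::real) \<and> (\<forall>t\<in>T. t \<in> V t \<and> good_nbhd d M (V t) C) \<and>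
    M \<subseteq> (\<Union>t\<in>T. V t) \<and> T \<subseteq> M"
proof -
  obtain V Cf where VC: "\<And>p. p \<in> M \<Longrightarrow> p \<in> V p \<and> good_nbhd d M (V p) (Cf p)"
    using good_nbhd_exists[OF M(1)] by metis
  have "\<exists>O'. open O' \<and> V p = M \<inter> O'" if "p \<in> M" for p
    using good_nbhdD(1)[OF conjunct2[OF VC[OF that]]] unfolding openin_open by blast
  then obtain O' where O': "\<And>p. p \<in> M \<Longrightarrow> open (O' p) \<and> V p = M \<inter> O' p" by metis
  have "M \<subseteq> (\<Union>p\<in>M. O' p)" using VC O' by blast
  then obtain T where T: "T \<subseteq> M" "finite T" "M \<subseteq> (\<Union>p\<in>T. O' p)"
    using compactE_image[OF M(2), of M O'] O' by metis
  define C where "C = (\<Sum>t\<in>T. Cf t)"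
  have Cf: "0 \<le> Cf t" if "t \<in> T" for t using VC T that unfolding good_nbhd_def by blast
  have le: "Cf t \<le> C" if "t \<in> T" for t unfolding C_def using that Cf T(2) by (intro member_le_sum) auto
  have "good_nbhd d M (V t) C" if t: "t \<in> T" for t
  proof -
    have g: "good_nbhd d M (V t) (Cf t)" using VC T t by blast
    have 1: "l \<le> C * dist x y" if "l \<le> Cf t * dist x y" for l x y
      using that mult_right_mono[OF le[OF t], of "dist x y"] by simp
    have 2: "m \<le> C * (1 / e) ^ d" if m: "m \<le> Cf t * (1 / e) ^ d" and e: "0 < e" for m e
    proof -
      have "Cf t * (1 / e) ^ d \<le> C * (1 / e) ^ d" by (rule mult_right_mono[OF le[OF t]]) (use e in simp)
      with m show ?thesis by linarith
    qed
    have "0 \<le> C" using Cf[OF t] le[OF t] by simp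
    then show ?thesis using g unfolding good_nbhd_def by (meson 1 2)
  qed
  moreover have "M \<subseteq> (\<Union>t\<in>T. V t)" using T O' by blast
  moreover have "0 \<le> C" unfolding C_def using Cf by (rule sum_nonneg)
  moreover have "\<forall>t\<in>T. t \<in> V t" using T VC by blast
  ultimately show ?thesis using T by (intro exI[of _ T] exI[of _ V] exI[of _ C]) simp
qed

lemma submanifold_covering_number:
  assumes M: "submanifold D d M" "compact M"
  obtains C where "0 \<le> C" "\<And>e. 0 < e \<Longrightarrow> e \<le> 1 \<Longrightarrow>
    \<exists>Z. finite Z \<and> Z \<subseteq> M \<and> real (card Z) \<le> C * (1 / e) ^ d \<and> (\<forall>x\<in>M. \<exists>z\<in>Z. dist x z \<le> e)"
proof -
  obtain T V C where T: "finite (T :: evec set)" "0 \<le> (C::real)" "\<And>t. t \<in> T \<Longrightarrow> good_nbhd d M (V t) C"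
    "M \<subseteq> (\<Union>t\<in>T. V t)"
    using submanifold_finite_cover[OF M] by blast
  have "\<exists>Z. finite Z \<and> Z \<subseteq> M \<and> real (card Z) \<le> (real (card T) * C) * (1 / e) ^ d \<and> (\<forall>x\<in>M. \<exists>z\<in>Z. dist x z \<le> e)"
    if e: "0 < e" "e \<le> 1" for e
  proof -
    have "\<exists>Z. finite Z \<and> Z \<subseteq> V t \<and> real (card Z) \<le> C * (1 / e) ^ d \<and> (\<forall>x\<in>V t. \<exists>z\<in>Z. dist x z \<le> e)"
      if "t \<in> T" for t by (rule good_nbhdD(4)[OF T(3)[OF that] e])
    then obtain Z where Z: "\<And>t. t \<in> T \<Longrightarrow> finite (Z t) \<and> Z t \<subseteq> V t \<and> real (card (Z t)) \<le> C * (1 / e) ^ d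
      \<and> (\<forall>x\<in>V t. \<exists>z\<in>Z t. dist x z \<le> e)" by metis
    have "card (\<Union>t\<in>T. Z t) \<le> (\<Sum>t\<in>T. card (Z t))" by (rule card_UN_le[OF T(1)])
    then have "real (card (\<Union>t\<in>T. Z t)) \<le> (\<Sum>t\<in>T. real (card (Z t)))" by (metis of_nat_le_iff of_nat_sum)
    also have "\<dots> \<le> (\<Sum>t\<in>T. C * (1 / e) ^ d)" using Z by (intro sum_mono) auto
    finally have card: "real (card (\<Union>t\<in>T. Z t)) \<le> (real (card T) * C) * (1 / e) ^ d" by (simp add: mult_ac)
    have sub: "V t \<subseteq> M" if "t \<in> T" for t
      by (rule openin_imp_subset[OF good_nbhdD(1)[OF T(3)[OF that]]])
    show ?thesis
    proof (intro exI[of _ "\<Union>t\<in>T. Z t"] conjI ballI)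
      show "finite (\<Union>t\<in>T. Z t)" using T(1) Z by blast
      show "(\<Union>t\<in>T. Z t) \<subseteq> M" using Z sub by blast
      show "real (card (\<Union>t\<in>T. Z t)) \<le> (real (card T) * C) * (1 / e) ^ d" by (rule card)
      fix x assume "x \<in> M"
      then obtain t where "t \<in> T" "x \<in> V t" using T(4) by blast
      then show "\<exists>z\<in>(\<Union>t\<in>T. Z t). dist x z \<le> e" using Z by blast
    qed
  qed
  then show ?thesis using that[of "real (card T) * C"] T(2) by simp
qed

text \<open>Curves exist between all points because being joined is an equivalence relation with
  open classes on a connected set. Close points lie in a common good neighbourhood by the Lebesgue
  number \<open>\<delta>\<close>; for the others a bound on the geodesic diameter, divided by
  \<open>\<delta>\<close>, suffices.\<close>

lemma geodesic_dist_lipschitz: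
  assumes M: "submanifold D d M" "compact M" "connected M"
  obtains \<Lambda> where "0 \<le> \<Lambda>" "\<And>p q. p \<in> M \<Longrightarrow> q \<in> M \<Longrightarrow> (\<exists>l. joined_by M p q l) \<and> geodesic_dist M p q \<le> \<Lambda> * dist p q"
proof -
  have joined: "\<exists>l. joined_by M p q l" if pq: "p \<in> M" "q \<in> M" for p q
  proof -
    have "(\<exists>l. joined_by M p q l) \<and> (\<exists>l. joined_by M q p l)"
    proof (rule connected_equivalence_relation[OF M(3) pq, where R = "\<lambda>p q. (\<exists>l. joined_by M p q l) \<and> (\<exists>l. joined_by M q p l)"])
      fix a assume a: "a \<in> M"
      obtain V C where V: "a \<in> V" "good_nbhd d M V C" using good_nbhd_exists[OF M(1) a] by blast
      have "(\<exists>l. joined_by M a x l) \<and> (\<exists>l. joined_by M x a l)" if "x \<in> V" for x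
        using good_nbhdD(3)[OF V(2) V(1) that] good_nbhdD(3)[OF V(2) that V(1)] by blast
      then show "\<exists>T. openin (top_of_set M) T \<and> a \<in> T \<and> (\<forall>x\<in>T. (\<exists>l. joined_by M a x l) \<and> (\<exists>l. joined_by M x a l))"
        using good_nbhdD(1)[OF V(2)] V(1) by (intro exI[of _ V] conjI ballI) auto
    next
      fix x y z
      assume "(\<exists>l. joined_by M x y l) \<and> (\<exists>l. joined_by M y x l)" "(\<exists>l. joined_by M y z l) \<and> (\<exists>l. joined_by M z y l)"
      then show "(\<exists>l. joined_by M x z l) \<and> (\<exists>l. joined_by M z x l)"
        using joined_by_trans[of M x y _ z] joined_by_trans[of M z y _ x] by blast
    qed simp
    then show ?thesis by blast
  qed
  obtain T V C where T: "finite T" "0 \<le> (C::real)" "\<And>t. t \<in> T \<Longrightarrow> t \<in> V t" "\<And>t. t \<in> T \<Longrightarrow> good_nbhd d M (V t) C"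
    "M \<subseteq> (\<Union>t\<in>T. V t)" "T \<subseteq> M"
    using submanifold_finite_cover[OF M(1,2)] by blast
  have local: "geodesic_dist M x y \<le> C * dist x y" if t: "t \<in> T" and xy: "x \<in> V t" "y \<in> V t" for t x y
  proof -
    obtain l where l: "joined_by M x y l" "l \<le> C * dist x y"
      using good_nbhdD(3)[OF T(4)[OF t] xy] by blast
    show ?thesis using geodesic_dist_le[OF l(1)] l(2) by linarith
  qed
  obtain m where m: "\<And>x y. x \<in> M \<Longrightarrow> y \<in> M \<Longrightarrow> dist x y \<le> m"
    using compact_imp_bounded[OF M(2)] diameter_bounded_bound by blast
  \<comment> \<open>Two points are linked through the centres of neighbourhoods containing them; the
    double sum dominates every distance between two of the finitely many centres.\<close>
  define B where "B = C * m + (\<Sum>s\<in>T. \<Sum>t\<in>T. geodesic_dist M s t) + C * m"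
  have gnn: "0 \<le> geodesic_dist M x y" if "x \<in> M" "y \<in> M" for x y
    using joined[OF that] geodesic_dist_nonneg by blast
  have B: "geodesic_dist M p q \<le> B" if pq: "p \<in> M" "q \<in> M" for p q
  proof -
    obtain s where s: "s \<in> T" "p \<in> V s" using T(5) pq by blast
    obtain t where t: "t \<in> T" "q \<in> V t" using T(5) pq by blast
    have st: "s \<in> M" "t \<in> M" using s t T(6) by auto
    obtain l1 l2 l3 where l: "joined_by M p s l1" "joined_by M s t l2" "joined_by M t q l3"
      using joined pq st by metis
    have "geodesic_dist M p q \<le> geodesic_dist M p s + geodesic_dist M s q"
      by (rule geodesic_dist_triangle[OF l(1) joined_by_trans[OF l(2,3)]])
    also have "geodesic_dist M s q \<le> geodesic_dist M s t + geodesic_dist M t q"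
      by (rule geodesic_dist_triangle[OF l(2,3)])
    also have "geodesic_dist M p s \<le> C * m"
      using local[OF s(1) s(2) T(3)[OF s(1)]] mult_left_mono[OF m[OF pq(1) st(1)] T(2)] by simp
    also have "geodesic_dist M t q \<le> C * m"
      using local[OF t(1) T(3)[OF t(1)] t(2)] mult_left_mono[OF m[OF st(2) pq(2)] T(2)] by simp
    also have "geodesic_dist M s t \<le> (\<Sum>t\<in>T. geodesic_dist M s t)"
      by (rule member_le_sum[OF t(1)]) (use gnn st T(1,6) in auto)
    also have "(\<Sum>t\<in>T. geodesic_dist M s t) \<le> (\<Sum>s\<in>T. \<Sum>t\<in>T. geodesic_dist M s t)"
      by (rule member_le_sum[OF s(1), of "\<lambda>s. \<Sum>t\<in>T. geodesic_dist M s t"]) (use gnn T(1,6) in \<open>auto intro!: sum_nonneg\<close>)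
    finally show ?thesis by (simp add: B_def)
  qed
  have "\<exists>O'. open O' \<and> V t = M \<inter> O'" if "t \<in> T" for t
    using good_nbhdD(1)[OF T(4)[OF that]] unfolding openin_open by blast
  then obtain O' where O': "\<And>t. t \<in> T \<Longrightarrow> open (O' t) \<and> V t = M \<inter> O' t" by metis
  show ?thesis
  proof (cases "M = {}")
    case True
    then show ?thesis using that[of 0] by simp
  next
    case False
    then have "O' ` T \<noteq> {}" using T(5) by auto
    moreover have "M \<subseteq> \<Union> (O' ` T)" using T(5) O' by blast
    ultimately obtain \<delta> where \<delta>: "0 < \<delta>" "\<And>S. S \<subseteq> M \<Longrightarrow> diameter S < \<delta> \<Longrightarrow> \<exists>B\<in>O' ` T. S \<subseteq> B"
      using Lebesgue_number_lemma[OF M(2), of "O' ` T"] O' by (metis imageE)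
    define \<Lambda> where "\<Lambda> = max C (\<bar>B\<bar> / \<delta>)"
    have "geodesic_dist M p q \<le> \<Lambda> * dist p q" if pq: "p \<in> M" "q \<in> M" for p q
    proof (cases "dist p q < \<delta>")
      case True
      have "diameter {p, q} \<le> dist p q"
        by (rule diameter_le) (auto simp: dist_norm norm_minus_commute)
      then obtain t where t: "t \<in> T" "{p, q} \<subseteq> O' t" using \<delta>(2)[of "{p, q}"] True pq by auto
      then have "geodesic_dist M p q \<le> C * dist p q" using local[OF t(1), of p q] O'[OF t(1)] pq by auto
      also have "\<dots> \<le> \<Lambda> * dist p q" by (rule mult_right_mono) (simp_all add: \<Lambda>_def)
      finally show ?thesis .
    next
      case False
      have "geodesic_dist M p q \<le> \<bar>B\<bar> / \<delta> * \<delta>" using B[OF pq] \<delta>(1) by simp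
      also have "\<dots> \<le> \<Lambda> * dist p q"
        by (rule mult_mono) (use False \<delta>(1) in \<open>auto simp: \<Lambda>_def le_max_iff_disj\<close>)
      finally show ?thesis .
    qed
    moreover have "0 \<le> \<Lambda>" using T(2) by (simp add: \<Lambda>_def le_max_iff_disj)
    ultimately show ?thesis using that[of \<Lambda>] joined by blast
  qed
qed

section \<open>Networks\<close>

definition weights_le :: "real \<Rightarrow> net \<Rightarrow> bool" where
  "weights_le \<kappa> net \<longleftrightarrow> (\<forall>(W, v)\<in>set net.
     (\<forall>i<dim_row W. \<forall>j<dim_col W. \<bar>index_mat W (i, j)\<bar> \<le> \<kappa>) \<and> (\<forall>i<dim_vec v. \<bar>vec_index v i\<bar> \<le> \<kappa>))"

definition net_nnz :: "net \<Rightarrow> nat" where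
  "net_nnz net = (\<Sum>(W, v)\<leftarrow>net. mat_nnz W + vec_nnz v)"

lemma net_eval_append:
  "A \<noteq> [] \<Longrightarrow> B \<noteq> [] \<Longrightarrow> net_eval (A @ B) x = net_eval B (map_vec (max 0) (net_eval A x))"
proof (induction A x rule: net_eval.induct)
  case (2 W v x)
  then show ?case by (cases B) auto
qed auto

lemma wf_net_nonempty: "wf_net p k r net \<Longrightarrow> net \<noteq> []"
  by auto

lemma wf_net_append: "wf_net p k h A \<Longrightarrow> h \<le> p \<Longrightarrow> wf_net p h r B \<Longrightarrow> wf_net p k r (A @ B)"
proof (induction p k h A rule: wf_net.induct)
  case (2 p k r' W v)
  then obtain l ls where "B = l # ls" by (cases B) auto
  then show ?case using 2 by auto
next
  case (3 p k r' W v l ls)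
  then show ?case by auto
qed simp

text \<open>Depth and sparsity are upper bounds, so they simply add under composition. The predicate
  \<open>X\<close> records the admissible inputs, such as the nonnegative ones, on which an
  intermediate rectification changes nothing.\<close>

definition realizable ::
    "real \<Rightarrow> nat \<Rightarrow> nat \<Rightarrow> nat \<Rightarrow> nat \<Rightarrow> nat \<Rightarrow> ((nat \<Rightarrow> real) \<Rightarrow> bool) \<Rightarrow> ((nat \<Rightarrow> real) \<Rightarrow> nat \<Rightarrow> real) \<Rightarrow> bool" where
  "realizable \<kappa> p k r L K X f \<longleftrightarrow> (\<exists>net. wf_net p k r net \<and> length net \<le> L \<and> weights_le \<kappa> net \<and>
     net_nnz net \<le> K \<and> (\<forall>x. X x \<longrightarrow> net_eval net (Matrix.vec k x) = Matrix.vec r (f x)))"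

lemma realizable_cong:
  "realizable \<kappa> p k r L K X f \<Longrightarrow> L \<le> L' \<Longrightarrow> K \<le> K' \<Longrightarrow> (\<And>x. X' x \<Longrightarrow> X x) \<Longrightarrow>
   (\<And>x i. X' x \<Longrightarrow> i < r \<Longrightarrow> f x i = g x i) \<Longrightarrow> realizable \<kappa> p k r L' K' X' g"
proof -
  assume *: "realizable \<kappa> p k r L K X f" "L \<le> L'" "K \<le> K'" "\<And>x. X' x \<Longrightarrow> X x"
    "\<And>x i. X' x \<Longrightarrow> i < r \<Longrightarrow> f x i = g x i"
  then obtain net where net: "wf_net p k r net" "length net \<le> L" "weights_le \<kappa> net" "net_nnz net \<le> K"
    "\<And>x. X x \<Longrightarrow> net_eval net (Matrix.vec k x) = Matrix.vec r (f x)"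
    unfolding realizable_def by blast
  have "net_eval net (Matrix.vec k x) = Matrix.vec r (g x)" if "X' x" for x
    using net(5)[OF *(4)[OF that]] *(5)[OF that] by (auto intro!: eq_vecI)
  then show ?thesis unfolding realizable_def using net *(2,3) by (intro exI[of _ net]) auto
qed

text \<open>\<open>net_eval\<close> applies no rectification after the last layer, so joining two
  networks inserts one between them; hence the \<open>max 0\<close> in the result.\<close>

lemma realizable_compose:
  assumes f: "realizable \<kappa> p k h L K X f" and g: "realizable \<kappa> p h r L' K' Y g" and hp: "h \<le> p"
    and XY: "\<And>x. X x \<Longrightarrow> Y (\<lambda>i. max 0 (f x i))"
  shows "realizable \<kappa> p k r (L + L') (K + K') X (\<lambda>x. g (\<lambda>i. max 0 (f x i)))"
proof -
  obtain A where A: "wf_net p k h A" "length A \<le> L" "weights_le \<kappa> A" "net_nnz A \<le> K"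
    "\<And>x. X x \<Longrightarrow> net_eval A (Matrix.vec k x) = Matrix.vec h (f x)"
    using f unfolding realizable_def by blast
  obtain B where B: "wf_net p h r B" "length B \<le> L'" "weights_le \<kappa> B" "net_nnz B \<le> K'"
    "\<And>x. Y x \<Longrightarrow> net_eval B (Matrix.vec h x) = Matrix.vec r (g x)"
    using g unfolding realizable_def by blast
  have "net_eval (A @ B) (Matrix.vec k x) = Matrix.vec r (g (\<lambda>i. max 0 (f x i)))" if "X x" for x
  proof -
    have "map_vec (max 0) (Matrix.vec h (f x)) = Matrix.vec h (\<lambda>i. max 0 (f x i))" by (rule eq_vecI) auto
    then show ?thesis
      using net_eval_append[OF wf_net_nonempty[OF A(1)] wf_net_nonempty[OF B(1)]] A(5)[OF that] B(5)[OF XY[OF that]]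
      by simp
  qed
  moreover have "wf_net p k r (A @ B)" by (rule wf_net_append[OF A(1) hp B(1)])
  ultimately show ?thesis
    unfolding realizable_def using A B
    by (intro exI[of _ "A @ B"]) (auto simp: weights_le_def net_nnz_def)
qed

lemma realizable_affine:
  assumes w: "\<And>i j. i < r \<Longrightarrow> j < k \<Longrightarrow> \<bar>w i j\<bar> \<le> \<kappa>" and u: "\<And>i. i < r \<Longrightarrow> \<bar>u i\<bar> \<le> \<kappa>"
    and S: "\<And>i. i < r \<Longrightarrow> finite (S i) \<and> card (S i) \<le> m"
    and supp: "\<And>i j. i < r \<Longrightarrow> j < k \<Longrightarrow> w i j \<noteq> 0 \<Longrightarrow> j \<in> S i"
  shows "realizable \<kappa> p k r 1 (r * (m + 1)) X (\<lambda>x i. (\<Sum>j<k. w i j * x j) + u i)"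
proof -
  let ?W = "Matrix.mat r k (\<lambda>(i, j). w i j)" and ?v = "Matrix.vec r u"
  have "mat_nnz ?W \<le> card (SIGMA i:{..<r}. S i)"
    unfolding mat_nnz_def
  proof (rule card_mono)
    show "finite (SIGMA i:{..<r}. S i)" using S by (intro finite_SigmaI) auto
    show "{(i, j). i < dim_row ?W \<and> j < dim_col ?W \<and> ?W $$ (i, j) \<noteq> 0} \<subseteq> (SIGMA i:{..<r}. S i)"
      using supp by auto
  qed
  also have "\<dots> = (\<Sum>i<r. card (S i))" by (rule card_SigmaI) (use S in auto)
  also have "\<dots> \<le> (\<Sum>i<r. m)" by (rule sum_mono) (use S in auto)
  finally have 1: "mat_nnz ?W \<le> r * m" by simp
  have 2: "vec_nnz ?v \<le> r"
    unfolding vec_nnz_def using card_mono[of "{..<r}" "{i. i < dim_vec ?v \<and> vec_index ?v i \<noteq> 0}"] by auto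
  have ev: "?W *\<^sub>v Matrix.vec k x + ?v = Matrix.vec r (\<lambda>i. (\<Sum>j<k. w i j * x j) + u i)" for x
    by (rule eq_vecI) (auto simp: scalar_prod_def atLeast0LessThan)
  show ?thesis
    unfolding realizable_def
  proof (intro exI[of _ "[(?W, ?v)]"] conjI allI impI)
    show "weights_le \<kappa> [(?W, ?v)]" using w u by (simp add: weights_le_def)
    show "net_nnz [(?W, ?v)] \<le> r * (m + 1)" using 1 2 by (simp add: net_nnz_def)
  qed (simp_all add: ev)
qed

section \<open>Network blocks for minima, scaling and distances\<close>

lemma sum_delta_mult:
  fixes c :: real and k :: nat
  assumes "i < k" shows "(\<Sum>j<k. (if j = i then c else 0) * x j) = c * x i"
proof -
  have "(\<Sum>j<k. (if j = i then c else 0) * x j) = (\<Sum>j<k. if j = i then c * x j else 0)"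
    by (intro sum.cong refl) auto
  also have "\<dots> = c * x i" using assms by (subst sum.delta) auto
  finally show ?thesis .
qed

lemma sum_two_delta_mult:
  fixes c e :: real and k :: nat
  assumes "i < k" "i' < k" "i \<noteq> i'"
  shows "(\<Sum>j<k. (if j = i then c else if j = i' then e else 0) * x j) = c * x i + e * x i'"
proof -
  have "(\<Sum>j<k. (if j = i then c else if j = i' then e else 0) * x j)
    = (\<Sum>j<k. (if j = i then c else 0) * x j + (if j = i' then e else 0) * x j)"
    by (intro sum.cong refl) (use assms in auto)
  then show ?thesis using assms by (simp only: sum.distrib sum_delta_mult)
qed

text \<open>\<open>min a b = a - max 0 (a - b)\<close> for \<open>a \<ge> 0\<close>.\<close>

lemma realizable_pair_min:
  assumes \<kappa>: "1 \<le> \<kappa>" and p: "2 * m \<le> p"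
  shows "realizable \<kappa> p (2 * m) m 2 (9 * m) (\<lambda>x. \<forall>i. 0 \<le> x i) (\<lambda>x j. min (x (2 * j)) (x (2 * j + 1)))"
proof -
  \<comment> \<open>Even neurons carry \<open>x (2 * j)\<close>, odd ones the difference of the
    pair; the second layer subtracts them.\<close>
  define w where "w q i = (if i = 2 * (q div 2) then 1 else if i = 2 * (q div 2) + 1 then (if even q then 0 else -1) else 0 :: real)" for q i :: nat
  define w' where "w' j i = (if i = 2 * j then 1 else if i = 2 * j + 1 then -1 else 0 :: real)" for j i :: nat
  have 1: "realizable \<kappa> p (2 * m) (2 * m) 1 (2 * m * (2 + 1)) (\<lambda>x. \<forall>i. 0 \<le> x i) (\<lambda>x q. (\<Sum>j<2 * m. w q j * x j) + 0)"
    by (rule realizable_affine[where S = "\<lambda>q. {2 * (q div 2), 2 * (q div 2) + 1}"])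
      (use \<kappa> in \<open>auto simp: w_def card_insert_if split: if_splits\<close>)
  have 2: "realizable \<kappa> p (2 * m) m 1 (m * (2 + 1)) (\<lambda>_. True) (\<lambda>x j. (\<Sum>i<2 * m. w' j i * x i) + 0)"
    by (rule realizable_affine[where S = "\<lambda>j. {2 * j, 2 * j + 1}"])
      (use \<kappa> in \<open>auto simp: w'_def card_insert_if split: if_splits\<close>)
  show ?thesis
  proof (rule realizable_cong[OF realizable_compose[OF 1 2 p]])
    fix x :: "nat \<Rightarrow> real" and j assume x: "\<forall>i. 0 \<le> x i" and j: "j < m"
    have h0: "(\<Sum>i<2 * m. w (2 * j) i * x i) = x (2 * j)"
      unfolding w_def using j by (subst sum_two_delta_mult) auto
    have h1: "(\<Sum>i<2 * m. w (2 * j + 1) i * x i) = x (2 * j) - x (2 * j + 1)"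
      unfolding w_def using j by (subst sum_two_delta_mult) auto
    have "(\<Sum>i<2 * m. w' j i * max 0 ((\<Sum>j<2 * m. w i j * x j) + 0)) + 0
      = 1 * max 0 ((\<Sum>i<2 * m. w (2 * j) i * x i) + 0) + (-1) * max 0 ((\<Sum>i<2 * m. w (2 * j + 1) i * x i) + 0)"
      unfolding w'_def using j by (subst sum_two_delta_mult) auto
    also have "\<dots> = min (x (2 * j)) (x (2 * j + 1))" unfolding h0 h1 using x[rule_format, of "2 * j"] by auto
    finally show "(\<Sum>i<2 * m. w' j i * max 0 ((\<Sum>j<2 * m. w i j * x j) + 0)) + 0 = min (x (2 * j)) (x (2 * j + 1))" .
  qed auto
qed

text \<open>A tournament: the result is the minimum of the block of \<open>2 ^ t\<close> entries
  that starts at \<open>s * 2 ^ t\<close>, so all blocks are reduced at once.\<close>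

primrec tree_min :: "nat \<Rightarrow> (nat \<Rightarrow> real) \<Rightarrow> nat \<Rightarrow> real" where
  "tree_min 0 x s = x s"
| "tree_min (Suc t) x s = tree_min t (\<lambda>j. min (x (2 * j)) (x (2 * j + 1))) s"

lemma tree_min_le: "k < 2 ^ t \<Longrightarrow> tree_min t x s \<le> x (s * 2 ^ t + k)"
proof (induction t arbitrary: x k)
  case (Suc t)
  have "k div 2 < 2 ^ t" using Suc.prems by auto
  from Suc.IH[OF this, of "\<lambda>j. min (x (2 * j)) (x (2 * j + 1))"]
  have "tree_min (Suc t) x s \<le> min (x (2 * (s * 2 ^ t + k div 2))) (x (2 * (s * 2 ^ t + k div 2) + 1))" by simp
  also have "\<dots> \<le> x (s * 2 ^ Suc t + k)"
  proof -
    define h where "h = k div 2"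
    have "k = 2 * h \<or> k = 2 * h + 1" unfolding h_def by presburger
    then have "s * 2 ^ Suc t + k = 2 * (s * 2 ^ t + h) \<or> s * 2 ^ Suc t + k = 2 * (s * 2 ^ t + h) + 1"
      by (elim disjE) (simp_all add: algebra_simps)
    then have "s * 2 ^ Suc t + k = 2 * (s * 2 ^ t + k div 2) \<or> s * 2 ^ Suc t + k = 2 * (s * 2 ^ t + k div 2) + 1"
      unfolding h_def .
    then show ?thesis by (elim disjE) (simp_all only: min.cobounded1 min.cobounded2)
  qed
  finally show ?case .
qed simp

lemma tree_min_attained: "\<exists>k<2 ^ t. tree_min t x s = x (s * 2 ^ t + k)"
proof (induction t arbitrary: x)
  case (Suc t)
  obtain k where k: "k < 2 ^ t" "tree_min t (\<lambda>j. min (x (2 * j)) (x (2 * j + 1))) s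
    = min (x (2 * (s * 2 ^ t + k))) (x (2 * (s * 2 ^ t + k) + 1))"
    using Suc.IH[of "\<lambda>j. min (x (2 * j)) (x (2 * j + 1))"] by blast
  have eq: "2 * (s * 2 ^ t + k) = s * 2 ^ Suc t + 2 * k" "2 * (s * 2 ^ t + k) + 1 = s * 2 ^ Suc t + (2 * k + 1)"
    by (simp_all add: algebra_simps)
  have lt: "2 * k < 2 ^ Suc t" "2 * k + 1 < 2 ^ Suc t" using k(1) by auto
  have "x (2 * (s * 2 ^ t + k)) = x (s * 2 ^ Suc t + 2 * k)"
    "x (2 * (s * 2 ^ t + k) + 1) = x (s * 2 ^ Suc t + (2 * k + 1))"
    by (rule arg_cong[OF eq(1)], rule arg_cong[OF eq(2)])
  then have m: "tree_min (Suc t) x s = min (x (s * 2 ^ Suc t + 2 * k)) (x (s * 2 ^ Suc t + (2 * k + 1)))"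
    using k(2) by (simp only: tree_min.simps)
  show ?case
    unfolding m
  proof (cases "x (s * 2 ^ Suc t + 2 * k) \<le> x (s * 2 ^ Suc t + (2 * k + 1))")
    case True
    then have "min (x (s * 2 ^ Suc t + 2 * k)) (x (s * 2 ^ Suc t + (2 * k + 1))) = x (s * 2 ^ Suc t + 2 * k)"
      by (rule min_absorb1)
    then show "\<exists>k'<2 ^ Suc t. min (x (s * 2 ^ Suc t + 2 * k)) (x (s * 2 ^ Suc t + (2 * k + 1))) = x (s * 2 ^ Suc t + k')"
      using lt(1) by blast
  next
    case False
    then have "min (x (s * 2 ^ Suc t + 2 * k)) (x (s * 2 ^ Suc t + (2 * k + 1))) = x (s * 2 ^ Suc t + (2 * k + 1))"
      by (intro min_absorb2) simp
    then show "\<exists>k'<2 ^ Suc t. min (x (s * 2 ^ Suc t + 2 * k)) (x (s * 2 ^ Suc t + (2 * k + 1))) = x (s * 2 ^ Suc t + k')"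
      using lt(2) by blast
  qed
qed simp

text \<open>Each round halves the number of entries, so the sparsity is a geometric sum and stays
  linear: \<open>9 * m + 11 * m \<le> 11 * (2 * m)\<close>.\<close>

lemma realizable_tree_min:
  assumes \<kappa>: "1 \<le> \<kappa>" and p: "r * 2 ^ t \<le> p"
  shows "realizable \<kappa> p (r * 2 ^ t) r (2 * t + 1) (11 * (r * 2 ^ t)) (\<lambda>x. \<forall>i. 0 \<le> x i) (tree_min t)"
  using p
proof (induction t)
  case 0
  have "realizable \<kappa> p r r 1 (r * (1 + 1)) (\<lambda>x. \<forall>i. 0 \<le> x i) (\<lambda>x i. (\<Sum>j<r. (if j = i then 1 else 0) * x j) + 0)"
    by (rule realizable_affine[where S = "\<lambda>i. {i}"]) (use \<kappa> in \<open>auto split: if_splits\<close>)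
  then have "realizable \<kappa> p r r 1 (11 * r) (\<lambda>x. \<forall>i. 0 \<le> x i) (tree_min 0)"
    by (rule realizable_cong) (auto simp: sum_delta_mult)
  then show ?case by (simp only: power_0 mult_1_right mult_0_right add_0)
next
  case (Suc t)
  let ?m = "r * 2 ^ t"
  have 1: "realizable \<kappa> p (2 * ?m) ?m 2 (9 * ?m) (\<lambda>x. \<forall>i. 0 \<le> x i) (\<lambda>x j. min (x (2 * j)) (x (2 * j + 1)))"
    by (rule realizable_pair_min[OF \<kappa>]) (use Suc.prems in \<open>simp add: mult_ac\<close>)
  have 2: "realizable \<kappa> p ?m r (2 * t + 1) (11 * ?m) (\<lambda>x. \<forall>i. 0 \<le> x i) (tree_min t)"
    by (rule Suc.IH) (use Suc.prems in simp)
  have "realizable \<kappa> p (2 * ?m) r (2 * Suc t + 1) (11 * (2 * ?m)) (\<lambda>x. \<forall>i. 0 \<le> x i) (tree_min (Suc t))"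
  proof (rule realizable_cong[OF realizable_compose[OF 1 2]])
    show "?m \<le> p" using Suc.prems by simp
    fix x :: "nat \<Rightarrow> real" and s assume "\<forall>i. 0 \<le> x i"
    then have "(\<lambda>j. max 0 (min (x (2 * j)) (x (2 * j + 1)))) = (\<lambda>j. min (x (2 * j)) (x (2 * j + 1)))"
      by (auto simp: max_def)
    then show "tree_min t (\<lambda>i. max 0 (min (x (2 * i)) (x (2 * i + 1)))) s = tree_min (Suc t) x s" by simp
  qed auto
  moreover have "r * 2 ^ Suc t = 2 * ?m" by simp
  ultimately show ?case by (simp only:)
qed

text \<open>The weight bound does not grow with the Lipschitz constant, so a large factor has to be
  produced by depth, one doubling per layer.\<close>

lemma realizable_scale:
  assumes \<kappa>: "2 \<le> \<kappa>" and p: "m \<le> p"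
  shows "realizable \<kappa> p m m (T + 1) (2 * m * (T + 1)) (\<lambda>x. \<forall>i. 0 \<le> x i) (\<lambda>x i. 2 ^ T * x i)"
proof (induction T)
  case 0
  have "realizable \<kappa> p m m 1 (m * (1 + 1)) (\<lambda>x. \<forall>i. 0 \<le> x i) (\<lambda>x i. (\<Sum>j<m. (if j = i then 1 else 0) * x j) + 0)"
    by (rule realizable_affine[where S = "\<lambda>i. {i}"]) (use \<kappa> in \<open>auto split: if_splits\<close>)
  then show ?case by (rule realizable_cong) (auto simp: sum_delta_mult)
next
  case (Suc T)
  have 1: "realizable \<kappa> p m m 1 (m * (1 + 1)) (\<lambda>x. \<forall>i. 0 \<le> x i) (\<lambda>x i. (\<Sum>j<m. (if j = i then 2 else 0) * x j) + 0)"
    by (rule realizable_affine[where S = "\<lambda>i. {i}"]) (use \<kappa> in \<open>auto split: if_splits\<close>)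
  show ?case
  proof (rule realizable_cong[OF realizable_compose[OF Suc.IH 1 p]])
    fix x :: "nat \<Rightarrow> real" and i assume x: "\<forall>i. 0 \<le> x i" and i: "i < m"
    show "(\<Sum>j<m. (if j = i then 2 else 0) * max 0 (2 ^ T * x j)) + 0 = 2 ^ Suc T * x i"
      unfolding sum_delta_mult[OF i] using x by (simp add: max_absorb2)
  qed auto
qed

text \<open>Scaling passes through rectifications, so the positive and the negative part of
  \<open>x s - 1\<close> are scaled separately and subtracted at the end. The shift by one undoes
  the offset that keeps the entries of the minimum nonnegative.\<close>

lemma realizable_shift_scale:
  assumes \<kappa>: "2 \<le> \<kappa>" and p: "2 * r \<le> p"
  shows "realizable \<kappa> p r r (T + 3) (r * (4 * T + 11)) (\<lambda>x. True) (\<lambda>x s. 2 ^ T * (x s - 1))"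
proof -
  define w where "w q i = (if i = q div 2 then (if even q then 1 else -1) else 0 :: real)" for q i :: nat
  define u where "u q = (if even q then -1 else 1 :: real)" for q :: nat
  define w' where "w' j i = (if i = 2 * j then 1 else if i = 2 * j + 1 then -1 else 0 :: real)" for j i :: nat
  have 1: "realizable \<kappa> p r (2 * r) 1 (2 * r * (1 + 1)) (\<lambda>_. True) (\<lambda>x q. (\<Sum>j<r. w q j * x j) + u q)"
    by (rule realizable_affine[where S = "\<lambda>q. {q div 2}"])
      (use \<kappa> in \<open>auto simp: w_def u_def split: if_splits\<close>)
  have 2: "realizable \<kappa> p (2 * r) r 1 (r * (2 + 1)) (\<lambda>_. True) (\<lambda>x j. (\<Sum>i<2 * r. w' j i * x i) + 0)"
    by (rule realizable_affine[where S = "\<lambda>j. {2 * j, 2 * j + 1}"])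
      (use \<kappa> in \<open>auto simp: w'_def card_insert_if split: if_splits\<close>)
  note 3 = realizable_scale[OF \<kappa> p, of T]
  show ?thesis
  proof (rule realizable_cong[OF realizable_compose[OF realizable_compose[OF 1 3 p] 2 p]])
    fix x :: "nat \<Rightarrow> real" and s assume s: "s < r"
    let ?h = "\<lambda>i. 2 ^ T * max 0 ((\<Sum>j<r. w i j * x j) + u i)"
    have h0: "(\<Sum>j<r. w (2 * s) j * x j) + u (2 * s) = x s - 1"
      unfolding w_def u_def using s by (subst sum_delta_mult) auto
    have h1: "(\<Sum>j<r. w (2 * s + 1) j * x j) + u (2 * s + 1) = 1 - x s"
      unfolding w_def u_def using s by (subst sum_delta_mult) auto
    have "(\<Sum>i<2 * r. w' s i * max 0 (?h i)) + 0 = 1 * max 0 (?h (2 * s)) + (-1) * max 0 (?h (2 * s + 1))"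
      unfolding w'_def using s by (subst sum_two_delta_mult) auto
    also have "\<dots> = 2 ^ T * (x s - 1)"
      unfolding h0 h1 by (cases "1 \<le> x s") (auto simp: max_def algebra_simps)
    finally show "(\<Sum>i<2 * r. w' s i * max 0 (?h i)) + 0 = 2 ^ T * (x s - 1)" .
  qed (auto simp: algebra_simps)
qed

lemma sum_block:
  fixes g :: "nat \<Rightarrow> real"
  assumes "k < N" "0 < B"
  shows "(\<Sum>q<N * B. (if q div B = k then 1 else 0) * g q) = (\<Sum>e<B. g (k * B + e))"
proof -
  have "(\<Sum>q<N * B. (if q div B = k then 1 else 0) * g q)
    = (\<Sum>m<N. \<Sum>q\<in>{m * B..<m * B + B}. (if q div B = k then 1 else 0) * g q)"
    by (rule sum.nat_group[symmetric])
  also have "\<dots> = (\<Sum>m<N. if m = k then \<Sum>q\<in>{k * B..<k * B + B}. g q else 0)"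
  proof (intro sum.cong refl)
    fix m
    have "q div B = m" if "q \<in> {m * B..<m * B + B}" for q
      using that by (intro div_nat_eqI) (auto simp: mult.commute)
    then show "(\<Sum>q\<in>{m * B..<m * B + B}. (if q div B = k then 1 else 0) * g q)
      = (if m = k then \<Sum>q\<in>{k * B..<k * B + B}. g q else 0)" by auto
  qed
  also have "\<dots> = (\<Sum>q\<in>{k * B..<k * B + B}. g q)" using assms(1) by simp
  also have "\<dots> = (\<Sum>e<B. g (k * B + e))"
    using sum.shift_bounds_nat_ivl[of g 0 "k * B" B] by (simp add: atLeast0LessThan add.commute)
  finally show ?thesis .
qed

lemma sum_pairs: "(\<Sum>e<2 * n. g e) = (\<Sum>i<n. g (2 * i) + g (2 * i + 1 :: nat) :: real)"
  by (induction n) auto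

text \<open>Two neurons per coordinate and centre give
  \<open>\<bar>u\<bar> = max 0 u + max 0 (- u)\<close>. They are computed once per centre; output
  \<open>q\<close> sums the block of centre \<open>c q\<close> and adds its own bias
  \<open>y q\<close>.\<close>

lemma realizable_distances:
  fixes z :: "nat \<Rightarrow> nat \<Rightarrow> real"
  assumes \<kappa>: "1 \<le> \<kappa>" and D: "0 < D" and z: "\<And>k i. k < N \<Longrightarrow> i < D \<Longrightarrow> \<bar>z k i\<bar> \<le> \<kappa>"
    and y: "\<And>q. q < M \<Longrightarrow> \<bar>y q\<bar> \<le> \<kappa>" and c: "\<And>q. q < M \<Longrightarrow> c q < N" and p: "N * (2 * D) \<le> p"
  shows "realizable \<kappa> p D M 2 (N * (2 * D) * 2 + M * (2 * D + 1)) (\<lambda>_. True)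
    (\<lambda>x q. (\<Sum>i<D. \<bar>x i - z (c q) i\<bar>) + y q)"
proof -
  let ?B = "2 * D"
  define w where "w q j = (if j = (q mod ?B) div 2 then (if even q then 1 else -1) else 0 :: real)" for q j :: nat
  define u where "u q = (if even q then -1 else 1) * z (q div ?B) ((q mod ?B) div 2)" for q :: nat
  define w' where "w' q j = (if j div ?B = c q then 1 else 0 :: real)" for q j :: nat
  have ib: "(q mod ?B) div 2 < D" for q using D pos_mod_bound[of ?B q] by (simp add: less_mult_imp_div_less mult.commute)
  have 1: "realizable \<kappa> p D (N * ?B) 1 (N * ?B * (1 + 1)) (\<lambda>_. True) (\<lambda>x q. (\<Sum>j<D. w q j * x j) + u q)"
  proof (rule realizable_affine[where S = "\<lambda>q. {(q mod ?B) div 2}"])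
    fix q assume "q < N * ?B"
    then have "q div ?B < N" by (simp add: less_mult_imp_div_less)
    then show "\<bar>u q\<bar> \<le> \<kappa>" using z ib by (simp add: u_def abs_mult)
  qed (use \<kappa> in \<open>auto simp: w_def split: if_splits\<close>)
  have 2: "realizable \<kappa> p (N * ?B) M 1 (M * (?B + 1)) (\<lambda>_. True) (\<lambda>x q. (\<Sum>j<N * ?B. w' q j * x j) + y q)"
  proof (rule realizable_affine[where S = "\<lambda>q. {c q * ?B..<c q * ?B + ?B}"])
    fix q j assume "w' q j \<noteq> 0"
    then have "j div ?B = c q" by (auto simp: w'_def split: if_splits)
    then have "j = c q * ?B + j mod ?B" using div_mult_mod_eq[of j ?B] by simp
    moreover have "j mod ?B < ?B" using D by simp
    ultimately show "j \<in> {c q * ?B..<c q * ?B + ?B}" unfolding atLeastLessThan_iff by linarith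
  qed (use \<kappa> y in \<open>auto simp: w'_def\<close>)
  show ?thesis
  proof (rule realizable_cong[OF realizable_compose[OF 1 2 p]])
    fix x :: "nat \<Rightarrow> real" and q assume q: "q < M"
    let ?h = "\<lambda>q. max 0 ((\<Sum>j<D. w q j * x j) + u q)"
    have h: "?h (c q * ?B + (2 * i)) + ?h (c q * ?B + (2 * i + 1)) = \<bar>x i - z (c q) i\<bar>" if i: "i < D" for i
    proof -
      have m: "(c q * ?B + 2 * i) mod ?B = 2 * i" "(c q * ?B + (2 * i + 1)) mod ?B = 2 * i + 1" using i by auto
      have d: "(c q * ?B + 2 * i) div ?B = c q" "(c q * ?B + (2 * i + 1)) div ?B = c q"
        using i by (intro div_nat_eqI; simp add: algebra_simps)+
      have par: "even (c q * ?B + 2 * i)" "odd (c q * ?B + (2 * i + 1))" by auto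
      have v0: "(\<Sum>j<D. w (c q * ?B + 2 * i) j * x j) + u (c q * ?B + 2 * i) = x i - z (c q) i"
        unfolding w_def u_def m d using par(1) i by (subst sum_delta_mult) auto
      have v1: "(\<Sum>j<D. w (c q * ?B + (2 * i + 1)) j * x j) + u (c q * ?B + (2 * i + 1)) = z (c q) i - x i"
        unfolding w_def u_def m d using par(2) i by (subst sum_delta_mult) auto
      show ?thesis unfolding v0 v1 by auto
    qed
    have "(\<Sum>j<N * ?B. w' q j * ?h j) + y q = (\<Sum>e<?B. ?h (c q * ?B + e)) + y q"
      unfolding w'_def using sum_block[OF c[OF q], of ?B ?h] D by simp
    also have "(\<Sum>e<?B. ?h (c q * ?B + e)) = (\<Sum>i<D. ?h (c q * ?B + 2 * i) + ?h (c q * ?B + (2 * i + 1)))"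
      by (rule sum_pairs)
    also have "\<dots> = (\<Sum>i<D. \<bar>x i - z (c q) i\<bar>)" by (intro sum.cong refl) (use h in simp)
    finally show "(\<Sum>j<N * ?B. w' q j * ?h j) + y q = (\<Sum>i<D. \<bar>x i - z (c q) i\<bar>) + y q" .
  qed auto
qed

text \<open>The McShane extension \<open>min\<^sub>k (a\<^sub>s(z\<^sub>k) + 2^T |x - z\<^sub>k|\<^sub>1)\<close> is piecewise linear, hence a network.\<close>

lemma realizable_McShane:
  fixes z :: "nat \<Rightarrow> nat \<Rightarrow> real" and y :: "nat \<Rightarrow> real"
  assumes \<kappa>: "2 \<le> \<kappa>" and D: "0 < D" and z: "\<And>k i. k < 2 ^ t \<Longrightarrow> i < D \<Longrightarrow> \<bar>z k i\<bar> \<le> \<kappa>"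
    and y: "\<And>q. 0 \<le> y q \<and> y q \<le> 2" and p: "2 ^ t * (2 * D + 2 * r) \<le> p"
  shows "realizable \<kappa> p D r (2 * t + T + 6) (2 ^ t * (4 * D + r * (2 * D + 4 * T + 23))) (\<lambda>_. True)
    (\<lambda>x s. 2 ^ T * (tree_min t (\<lambda>q. (\<Sum>i<D. \<bar>x i - z (q mod 2 ^ t) i\<bar>) + y q) s - 1))"
proof -
  have pt: "(1::nat) \<le> 2 ^ t" by simp
  have p1: "2 ^ t * (2 * D) \<le> p" "2 ^ t * (2 * r) \<le> p" using p by (simp_all add: distrib_left)
  have p2: "r * 2 ^ t \<le> p" using p1(2) by (simp add: mult.commute)
  have "2 * r \<le> 2 ^ t * (2 * r)" using pt by simp
  then have p3: "2 * r \<le> p" using p1(2) by linarith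
  \<comment> \<open>Output \<open>q\<close> stands for component \<open>q div 2 ^ t\<close> and
    centre \<open>q mod 2 ^ t\<close>; the hidden layer is shared by all \<open>r\<close>
    components.\<close>
  have 1: "realizable \<kappa> p D (r * 2 ^ t) 2 (2 ^ t * (2 * D) * 2 + (r * 2 ^ t) * (2 * D + 1)) (\<lambda>_. True)
    (\<lambda>x q. (\<Sum>i<D. \<bar>x i - z (q mod 2 ^ t) i\<bar>) + y q)"
    by (rule realizable_distances) (use \<kappa> D z y p1 in \<open>auto intro: order_trans\<close>)
  have 2: "realizable \<kappa> p (r * 2 ^ t) r (2 * t + 1) (11 * (r * 2 ^ t)) (\<lambda>x. \<forall>i. 0 \<le> x i) (tree_min t)"
    by (rule realizable_tree_min) (use \<kappa> p2 in auto)
  note 3 = realizable_shift_scale[OF \<kappa> p3, of T]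
  have rp: "r \<le> p" using p3 by simp
  show ?thesis
  proof (rule realizable_cong[OF realizable_compose[OF realizable_compose[OF 1 2 p2] 3 rp]])
    have "r * (4 * T + 11) \<le> 2 ^ t * (r * (4 * T + 11))" using pt by simp
    then show "2 ^ t * (2 * D) * 2 + (r * 2 ^ t) * (2 * D + 1) + 11 * (r * 2 ^ t) + r * (4 * T + 11)
      \<le> 2 ^ t * (4 * D + r * (2 * D + 4 * T + 23))" by (simp add: algebra_simps)
    fix x :: "nat \<Rightarrow> real" and s assume "s < r"
    let ?v = "\<lambda>q. (\<Sum>i<D. \<bar>x i - z (q mod 2 ^ t) i\<bar>) + y q"
    have v: "0 \<le> ?v q" for q using y by (intro add_nonneg_nonneg sum_nonneg) auto
    then have "(\<lambda>q. max 0 (?v q)) = ?v" by (auto simp: max_def)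
    moreover have "0 \<le> tree_min t ?v s" using tree_min_attained[of t ?v s] v by metis
    ultimately show "2 ^ T * (max 0 (tree_min t (\<lambda>q. max 0 (?v q)) s) - 1) = 2 ^ T * (tree_min t ?v s - 1)"
      by (simp only: max_absorb2)
  qed auto
qed

section \<open>Covering numbers of network classes\<close>

definition aff :: "nat \<Rightarrow> (nat \<Rightarrow> nat \<Rightarrow> real) \<Rightarrow> (nat \<Rightarrow> real) \<Rightarrow> nat \<Rightarrow> real" where
  "aff w \<theta> x i = (\<Sum>j<w. \<theta> i j * x j) + \<theta> i w"

text \<open>Networks with all layers padded to width \<open>w\<close>; the biases sit in column \<open>w\<close>.\<close>

fun pnet :: "nat \<Rightarrow> (nat \<Rightarrow> nat \<Rightarrow> real) list \<Rightarrow> (nat \<Rightarrow> real) \<Rightarrow> nat \<Rightarrow> real" where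
  "pnet w [] x = x"
| "pnet w [\<theta>] x = aff w \<theta> x"
| "pnet w (\<theta> # \<theta>' # ls) x = pnet w (\<theta>' # ls) (\<lambda>i. max 0 (aff w \<theta> x i))"

text \<open>Zero padding gives all layers the same shape, so a weight is addressed by a triple of
  numbers within fixed bounds, whatever the architecture.\<close>

definition pad_layer :: "nat \<Rightarrow> real Matrix.mat \<times> real Matrix.vec \<Rightarrow> nat \<Rightarrow> nat \<Rightarrow> real" where
  "pad_layer w l i j = (if i < dim_row (fst l) then
     if j < dim_col (fst l) then fst l $$ (i, j) else if j = w then vec_index (snd l) i else 0 else 0)"

lemma aff_pad_layer:
  assumes "W \<in> carrier_mat h k" "v \<in> carrier_vec h" "x \<in> carrier_vec k" "k \<le> w"
    and x': "\<And>i. x' i = (if i < k then vec_index x i else 0)"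
  shows "aff w (pad_layer w (W, v)) x' i = (if i < h then vec_index (W *\<^sub>v x + v) i else 0)"
proof (cases "i < h")
  case True
  have "(\<Sum>j<w. pad_layer w (W, v) i j * x' j) = (\<Sum>j<k. W $$ (i, j) * vec_index x j)"
    by (rule sum.mono_neutral_cong_right) (use assms True in \<open>auto simp: pad_layer_def\<close>)
  moreover have "pad_layer w (W, v) i w = vec_index v i"
    using assms True by (auto simp: pad_layer_def)
  ultimately show ?thesis
    using assms True by (auto simp: aff_def scalar_prod_def atLeast0LessThan)
next
  case False
  then show ?thesis using assms by (simp add: aff_def pad_layer_def)
qed

lemma pnet_pad:
  assumes "wf_net p k r net" "p \<le> w" "k \<le> w" "x \<in> carrier_vec k"
    and "\<And>i. x' i = (if i < k then vec_index x i else 0)"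
  shows "net_eval net x \<in> carrier_vec r \<and>
    (\<forall>i. pnet w (map (pad_layer w) net) x' i = (if i < r then vec_index (net_eval net x) i else 0))"
  using assms
proof (induction net x arbitrary: k x' rule: net_eval.induct)
  case (2 W v x)
  then have W: "W \<in> carrier_mat r k" "v \<in> carrier_vec r" by auto
  then have "W *\<^sub>v x + v \<in> carrier_vec r" by (intro carrier_vecI) simp
  then show ?case using aff_pad_layer[OF W 2(4,3) 2(5)] by (simp only: list.map pnet.simps net_eval.simps) blast
next
  case (3 W v l ls x)
  then obtain h where h: "h \<le> p" "W \<in> carrier_mat h k" "v \<in> carrier_vec h" "wf_net p h r (l # ls)" by auto
  let ?y = "map_vec (max 0) (W *\<^sub>v x + v)" and ?y' = "\<lambda>i. max 0 (aff w (pad_layer w (W, v)) x' i)"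
  have y: "?y \<in> carrier_vec h" using h by (intro carrier_vecI) simp
  have y': "?y' i = (if i < h then vec_index ?y i else 0)" for i
    using aff_pad_layer[OF h(2,3) 3(5,4) 3(6), of i] h(2,3) by simp
  have "h \<le> w" using h(1) 3(3) by simp
  from 3(1)[OF h(4) 3(3) this y y'] show ?case by simp
qed simp

lemma aff_bound:
  assumes \<theta>: "\<And>j. \<bar>\<theta> i j\<bar> \<le> \<kappa>" and x: "\<And>j. \<bar>x j\<bar> \<le> X" and X: "1 \<le> X"
  shows "\<bar>aff w \<theta> x i\<bar> \<le> real (w + 1) * max 1 \<kappa> * X"
proof -
  have "\<bar>aff w \<theta> x i\<bar> \<le> (\<Sum>j<w. \<bar>\<theta> i j * x j\<bar>) + \<bar>\<theta> i w\<bar>"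
    unfolding aff_def by (rule order_trans[OF abs_triangle_ineq add_right_mono[OF sum_abs]])
  also have "\<dots> \<le> (\<Sum>j<w. max 1 \<kappa> * X) + max 1 \<kappa> * X"
  proof (rule add_mono[OF sum_mono])
    fix j show "\<bar>\<theta> i j * x j\<bar> \<le> max 1 \<kappa> * X"
      unfolding abs_mult using \<theta>[of j] x[of j] by (intro mult_mono) auto
  next
    have "\<bar>\<theta> i w\<bar> \<le> max 1 \<kappa> * 1" using \<theta>[of w] by simp
    also have "\<dots> \<le> max 1 \<kappa> * X" by (rule mult_left_mono[OF X]) simp
    finally show "\<bar>\<theta> i w\<bar> \<le> max 1 \<kappa> * X" .
  qed
  also have "\<dots> = real (w + 1) * max 1 \<kappa> * X" by (simp add: algebra_simps)
  finally show ?thesis .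
qed

lemma aff_perturb:
  assumes \<theta>: "\<And>j. \<bar>\<theta> i j\<bar> \<le> \<kappa>" and d: "\<And>j. \<bar>\<theta> i j - \<theta>' i j\<bar> \<le> \<eta>" and x': "\<And>j. \<bar>x' j\<bar> \<le> X" and X: "1 \<le> X"
    and e: "\<And>j. \<bar>x j - x' j\<bar> \<le> e"
  shows "\<bar>aff w \<theta> x i - aff w \<theta>' x' i\<bar> \<le> real (w + 1) * max 1 \<kappa> * e + real (w + 1) * max 1 \<kappa> * \<eta> * X"
proof -
  have \<eta>: "0 \<le> \<eta>" using d[of 0] by linarith
  have e0: "0 \<le> e" using e[of 0] by linarith
  let ?k = "max 1 \<kappa>"
  have "aff w \<theta> x i - aff w \<theta>' x' i = (\<Sum>j<w. \<theta> i j * (x j - x' j) + (\<theta> i j - \<theta>' i j) * x' j) + (\<theta> i w - \<theta>' i w)"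
    by (simp add: aff_def sum_subtractf[symmetric] algebra_simps)
  also have "\<bar>\<dots>\<bar> \<le> (\<Sum>j<w. \<bar>\<theta> i j * (x j - x' j) + (\<theta> i j - \<theta>' i j) * x' j\<bar>) + \<bar>\<theta> i w - \<theta>' i w\<bar>"
    by (rule order_trans[OF abs_triangle_ineq add_right_mono[OF sum_abs]])
  also have "\<dots> \<le> (\<Sum>j<w. ?k * e + \<eta> * X) + \<eta> * X"
  proof (rule add_mono[OF sum_mono])
    fix j
    have "\<bar>\<theta> i j * (x j - x' j) + (\<theta> i j - \<theta>' i j) * x' j\<bar> \<le> \<bar>\<theta> i j\<bar> * \<bar>x j - x' j\<bar> + \<bar>\<theta> i j - \<theta>' i j\<bar> * \<bar>x' j\<bar>"
      by (rule order_trans[OF abs_triangle_ineq]) (simp add: abs_mult)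
    also have "\<dots> \<le> ?k * e + \<eta> * X"
      using \<theta>[of j] d[of j] x'[of j] e[of j] \<eta> by (intro add_mono mult_mono) auto
    finally show "\<bar>\<theta> i j * (x j - x' j) + (\<theta> i j - \<theta>' i j) * x' j\<bar> \<le> ?k * e + \<eta> * X" .
  next
    have "\<bar>\<theta> i w - \<theta>' i w\<bar> \<le> \<eta> * 1" using d[of w] by simp
    also have "\<dots> \<le> \<eta> * X" by (rule mult_left_mono[OF X \<eta>])
    finally show "\<bar>\<theta> i w - \<theta>' i w\<bar> \<le> \<eta> * X" .
  qed
  also have "\<dots> = real w * (?k * e) + real (w + 1) * 1 * \<eta> * X" by (simp add: algebra_simps)
  also have "\<dots> \<le> real (w + 1) * (?k * e) + real (w + 1) * ?k * \<eta> * X"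
    using e0 \<eta> X by (intro add_mono mult_right_mono mult_left_mono mult_nonneg_nonneg) auto
  finally show ?thesis by (simp add: mult.assoc)
qed

text \<open>Let q be \<open>(w + 1) * max 1 \<kappa>\<close>. One layer multiplies both the bound on
  the activations and the error by at most q, and the changed weights add q times
  \<open>\<eta>\<close> times the former; unrolling gives the number of layers times a power of q.
  The bound \<open>1 \<le> X\<close> accounts for the biases.\<close>

lemma pnet_perturb:
  assumes "length \<Theta>' = length \<Theta>"
    and "\<And>l i j. l < length \<Theta> \<Longrightarrow> \<bar>(\<Theta> ! l) i j\<bar> \<le> \<kappa> \<and> \<bar>(\<Theta>' ! l) i j\<bar> \<le> \<kappa> \<and> \<bar>(\<Theta> ! l) i j - (\<Theta>' ! l) i j\<bar> \<le> \<eta>"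
    and "\<And>j. \<bar>x j\<bar> \<le> X \<and> \<bar>x' j\<bar> \<le> X \<and> \<bar>x j - x' j\<bar> \<le> e" and "1 \<le> X" and "0 \<le> \<eta>"
  shows "\<bar>pnet w \<Theta> x i - pnet w \<Theta>' x' i\<bar>
    \<le> (real (w + 1) * max 1 \<kappa>) ^ length \<Theta> * e + real (length \<Theta>) * (real (w + 1) * max 1 \<kappa>) ^ length \<Theta> * \<eta> * X"
  using assms
proof (induction w \<Theta> x arbitrary: \<Theta>' x' X e rule: pnet.induct)
  case (1 w x)
  then show ?case by simp
next
  case (2 w \<theta> x)
  then obtain \<theta>' where \<Theta>': "\<Theta>' = [\<theta>']" by (cases \<Theta>') auto
  have "\<bar>aff w \<theta> x i - aff w \<theta>' x' i\<bar> \<le> real (w + 1) * max 1 \<kappa> * e + real (w + 1) * max 1 \<kappa> * \<eta> * X"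
    by (rule aff_perturb) (use 2(2)[of 0] 2(3) 2(4) in \<open>auto simp: \<Theta>'\<close>)
  then show ?case by (simp add: \<Theta>')
next
  case (3 w \<theta> \<theta>2 ls x)
  then obtain \<theta>' L' where \<Theta>': "\<Theta>' = \<theta>' # L'" and L': "length L' = length (\<theta>2 # ls)" by (cases \<Theta>') auto
  then obtain \<theta>2' ls' where L'2: "L' = \<theta>2' # ls'" by (cases L') auto
  let ?q = "real (w + 1) * max 1 \<kappa>"
  have q: "1 \<le> ?q"
    using mult_mono[of 1 "real (w + 1)" 1 "max 1 \<kappa>"] by simp
  have \<theta>: "\<bar>\<theta> i j\<bar> \<le> \<kappa>" "\<bar>\<theta>' i j\<bar> \<le> \<kappa>" "\<bar>\<theta> i j - \<theta>' i j\<bar> \<le> \<eta>" for i j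
    using 3(3)[of 0 i j] by (auto simp: \<Theta>')
  let ?y = "\<lambda>i. max 0 (aff w \<theta> x i)" and ?y' = "\<lambda>i. max 0 (aff w \<theta>' x' i)"
  have y: "\<bar>?y j\<bar> \<le> ?q * X \<and> \<bar>?y' j\<bar> \<le> ?q * X \<and> \<bar>?y j - ?y' j\<bar> \<le> ?q * e + ?q * \<eta> * X" for j
  proof -
    have "\<bar>aff w \<theta> x j\<bar> \<le> ?q * X" by (rule aff_bound) (use \<theta> 3(4,5) in auto)
    moreover have "\<bar>aff w \<theta>' x' j\<bar> \<le> ?q * X" by (rule aff_bound) (use \<theta> 3(4,5) in auto)
    moreover have "\<bar>aff w \<theta> x j - aff w \<theta>' x' j\<bar> \<le> ?q * e + ?q * \<eta> * X"
      by (rule aff_perturb) (use \<theta> 3(4,5) in auto)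
    ultimately show ?thesis by (auto simp: max_def)
  qed
  have "1 \<le> ?q * X" using mult_mono[OF q 3(5)] q by simp
  have "\<bar>pnet w (\<theta>2 # ls) ?y i - pnet w L' ?y' i\<bar>
    \<le> ?q ^ length (\<theta>2 # ls) * (?q * e + ?q * \<eta> * X) + real (length (\<theta>2 # ls)) * ?q ^ length (\<theta>2 # ls) * \<eta> * (?q * X)"
  proof (rule 3(1)[OF L' _ y \<open>1 \<le> ?q * X\<close> 3(6)])
    fix l i j assume "l < length (\<theta>2 # ls)"
    then show "\<bar>((\<theta>2 # ls) ! l) i j\<bar> \<le> \<kappa> \<and> \<bar>(L' ! l) i j\<bar> \<le> \<kappa> \<and> \<bar>((\<theta>2 # ls) ! l) i j - (L' ! l) i j\<bar> \<le> \<eta>"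
      using 3(3)[of "Suc l" i j] by (simp add: \<Theta>')
  qed
  also have "\<dots> = ?q ^ length (\<theta> # \<theta>2 # ls) * e + real (length (\<theta> # \<theta>2 # ls)) * ?q ^ length (\<theta> # \<theta>2 # ls) * \<eta> * X"
    by (simp add: algebra_simps)
  finally show ?case by (simp add: \<Theta>' L'2)
qed

section \<open>Rounded networks and their codes\<close>

definition round_code :: "real \<Rightarrow> real \<Rightarrow> int" where
  "round_code \<eta> v = (if 0 \<le> v then \<lfloor>v / \<eta>\<rfloor> else - \<lfloor>- v / \<eta>\<rfloor>)"

lemma round_code_props:
  assumes \<eta>: "0 < \<eta>" and v: "\<bar>v\<bar> \<le> \<kappa>"
  shows "\<bar>v - \<eta> * real_of_int (round_code \<eta> v)\<bar> \<le> \<eta>" "\<bar>\<eta> * real_of_int (round_code \<eta> v)\<bar> \<le> \<kappa>"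
    "round_code \<eta> v \<in> {- \<lfloor>\<kappa> / \<eta>\<rfloor>..\<lfloor>\<kappa> / \<eta>\<rfloor>}" "round_code \<eta> 0 = 0"
proof -
  have *: "0 \<le> u - \<eta> * real_of_int \<lfloor>u / \<eta>\<rfloor> \<and> u - \<eta> * real_of_int \<lfloor>u / \<eta>\<rfloor> \<le> \<eta> \<and> 0 \<le> \<lfloor>u / \<eta>\<rfloor>" if "0 \<le> u" for u
  proof -
    have "real_of_int \<lfloor>u / \<eta>\<rfloor> \<le> u / \<eta>" "u / \<eta> \<le> real_of_int \<lfloor>u / \<eta>\<rfloor> + 1" by linarith+
    then have "\<eta> * real_of_int \<lfloor>u / \<eta>\<rfloor> \<le> \<eta> * (u / \<eta>)" "\<eta> * (u / \<eta>) \<le> \<eta> * (real_of_int \<lfloor>u / \<eta>\<rfloor> + 1)"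
      using \<eta> by (intro mult_left_mono; simp)+
    moreover have "\<eta> * (u / \<eta>) = u" using \<eta> by simp
    ultimately have "\<eta> * real_of_int \<lfloor>u / \<eta>\<rfloor> \<le> u" "u \<le> \<eta> * (real_of_int \<lfloor>u / \<eta>\<rfloor> + 1)"
      by (simp_all only:)
    moreover from this(2) have "u \<le> \<eta> * real_of_int \<lfloor>u / \<eta>\<rfloor> + \<eta>" by (simp only: distrib_left mult_1_right)
    moreover have "0 \<le> \<lfloor>u / \<eta>\<rfloor>" using \<eta> that by simp
    ultimately show ?thesis by linarith
  qed
  have mono: "\<lfloor>u / \<eta>\<rfloor> \<le> \<lfloor>\<kappa> / \<eta>\<rfloor>" if "u \<le> \<kappa>" for u
    using that \<eta> by (intro floor_mono divide_right_mono) auto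
  have nn: "0 \<le> \<eta> * real_of_int \<lfloor>u / \<eta>\<rfloor>" if "0 \<le> u" for u using *[OF that] \<eta> by simp
  show "\<bar>v - \<eta> * real_of_int (round_code \<eta> v)\<bar> \<le> \<eta>" "\<bar>\<eta> * real_of_int (round_code \<eta> v)\<bar> \<le> \<kappa>"
    using *[of v] *[of "-v"] nn[of v] nn[of "-v"] v unfolding round_code_def by (auto split: if_splits)
  show "round_code \<eta> v \<in> {- \<lfloor>\<kappa> / \<eta>\<rfloor>..\<lfloor>\<kappa> / \<eta>\<rfloor>}"
  proof (cases "0 \<le> v")
    case True
    then have "0 \<le> \<lfloor>v / \<eta>\<rfloor>" "\<lfloor>v / \<eta>\<rfloor> \<le> \<lfloor>\<kappa> / \<eta>\<rfloor>" using *[of v] mono[of v] v by auto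
    then have "\<lfloor>v / \<eta>\<rfloor> \<in> {- \<lfloor>\<kappa> / \<eta>\<rfloor>..\<lfloor>\<kappa> / \<eta>\<rfloor>}" unfolding atLeastAtMost_iff by linarith
    then show ?thesis using True by (simp only: round_code_def if_True)
  next
    case False
    then have "0 \<le> \<lfloor>- v / \<eta>\<rfloor>" "\<lfloor>- v / \<eta>\<rfloor> \<le> \<lfloor>\<kappa> / \<eta>\<rfloor>" using *[of "-v"] mono[of "-v"] v by auto
    then have "- \<lfloor>- v / \<eta>\<rfloor> \<in> {- \<lfloor>\<kappa> / \<eta>\<rfloor>..\<lfloor>\<kappa> / \<eta>\<rfloor>}" unfolding atLeastAtMost_iff by linarith
    then show ?thesis using False by (simp only: round_code_def if_False)
  qed
  show "round_code \<eta> 0 = 0" by (simp add: round_code_def)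
qed

text \<open>A code is the number of layers with a list of entries \<open>((layer, row, column), k)\<close>, each standing for the
  weight \<open>\<eta> * k\<close>; weights without an entry are zero.\<close>

definition decode :: "real \<Rightarrow> nat \<Rightarrow> ((nat \<times> nat \<times> nat) \<times> int) list \<Rightarrow> (nat \<Rightarrow> nat \<Rightarrow> real) list" where
  "decode \<eta> m es = map (\<lambda>l i j. \<eta> * real_of_int (case map_of es (l, i, j) of Some c \<Rightarrow> c | None \<Rightarrow> 0)) [0..<m]"

definition code_entries :: "nat \<Rightarrow> nat \<Rightarrow> real \<Rightarrow> ((nat \<times> nat \<times> nat) \<times> int) set" where
  "code_entries L w Z = ({..<L} \<times> {..<w} \<times> {..w}) \<times> {- \<lfloor>Z\<rfloor>..\<lfloor>Z\<rfloor>}"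

text \<open>Lists of length exactly \<open>K\<close>, since these are counted by a power; sparser
  networks are padded with repeated entries.\<close>

definition codes :: "nat \<Rightarrow> nat \<Rightarrow> real \<Rightarrow> nat \<Rightarrow> (nat \<times> ((nat \<times> nat \<times> nat) \<times> int) list) set" where
  "codes L w Z K = {1..L} \<times> {es. set es \<subseteq> code_entries L w Z \<and> length es = K}"

lemma finite_codes: "finite (codes L w Z K)"
  by (auto simp: codes_def code_entries_def intro!: finite_lists_length_eq)

lemma card_codes_le:
  assumes "0 \<le> Z"
  shows "real (card (codes L w Z K)) \<le> real L * (real L * real w * real (w + 1) * (2 * Z + 1)) ^ K"
proof -
  have fin: "finite (code_entries L w Z)" by (simp add: code_entries_def)
  have "card (codes L w Z K) = L * card (code_entries L w Z) ^ K"
    by (simp add: codes_def card_cartesian_product card_lists_length_eq[OF fin])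
  moreover have "real (card (code_entries L w Z)) \<le> real L * real w * real (w + 1) * (2 * Z + 1)"
  proof -
    have "card (code_entries L w Z) = L * (w * (w + 1)) * nat (\<lfloor>Z\<rfloor> + 1 + \<lfloor>Z\<rfloor>)"
      by (simp add: code_entries_def card_cartesian_product)
    moreover have "real (nat (\<lfloor>Z\<rfloor> + 1 + \<lfloor>Z\<rfloor>)) \<le> 2 * Z + 1" using assms by (simp add: of_nat_nat)
    ultimately show ?thesis
      by (simp only: of_nat_mult mult.assoc) (intro mult_left_mono, auto)
  qed
  ultimately show ?thesis by (simp add: mult_left_mono power_mono)
qed

lemma codes_cover:
  assumes len: "1 \<le> length \<Theta>" "length \<Theta> \<le> L" and w: "1 \<le> w" and \<eta>: "0 < \<eta>"
    and bd: "\<And>l i j. l < length \<Theta> \<Longrightarrow> \<bar>(\<Theta> ! l) i j\<bar> \<le> \<kappa>"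
    and supp: "\<And>l i j. l < length \<Theta> \<Longrightarrow> (\<Theta> ! l) i j \<noteq> 0 \<Longrightarrow> i < w \<and> j \<le> w"
    and card: "card {(l, i, j). l < length \<Theta> \<and> (\<Theta> ! l) i j \<noteq> 0} \<le> K"
  shows "\<exists>es. (length \<Theta>, es) \<in> codes L w (\<kappa> / \<eta>) K \<and> length (decode \<eta> (length \<Theta>) es) = length \<Theta> \<and>
    (\<forall>l<length \<Theta>. \<forall>i j. decode \<eta> (length \<Theta>) es ! l = (\<lambda>i j. \<eta> * real_of_int (round_code \<eta> ((\<Theta> ! l) i j))))"
proof -
  let ?S = "{(l, i, j). l < length \<Theta> \<and> (\<Theta> ! l) i j \<noteq> 0}"
  have "?S \<subseteq> {..<length \<Theta>} \<times> {..<w} \<times> {..w}" using supp by auto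
  then have "finite ?S" by (rule finite_subset) auto
  then obtain xs0 where xs0: "set xs0 = ?S" "length xs0 = card ?S"
    using finite_distinct_list[of ?S] distinct_card by metis
  \<comment> \<open>Padding with the key \<open>(0, 0, 0)\<close> is harmless: its entry stores the
    rounded weight at that position, zero or not, so \<open>map_of\<close> stays consistent under
    repetition.\<close>
  define xs where "xs = xs0 @ replicate (K - card ?S) (0, 0, 0)"
  define f where "f p = (case p of (l, i, j) \<Rightarrow> round_code \<eta> ((\<Theta> ! l) i j))" for p
  define es where "es = map (\<lambda>p. (p, f p)) xs"
  have xs: "length xs = K" "?S \<subseteq> set xs" "set xs \<subseteq> {..<length \<Theta>} \<times> {..<w} \<times> {..w}"
    using xs0 card len w supp by (auto simp: xs_def)
  have "f p \<in> {- \<lfloor>\<kappa> / \<eta>\<rfloor>..\<lfloor>\<kappa> / \<eta>\<rfloor>}" if "p \<in> set xs" for p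
  proof -
    obtain l i j where p: "p = (l, i, j)" by (cases p)
    then have "l < length \<Theta>" using xs(3) that by auto
    then show ?thesis unfolding p f_def prod.case using round_code_props(3)[OF \<eta> bd] by blast
  qed
  moreover have "p \<in> {..<L} \<times> {..<w} \<times> {..w}" if "p \<in> set xs" for p
  proof -
    have "p \<in> {..<length \<Theta>} \<times> {..<w} \<times> {..w}" by (rule subsetD[OF xs(3) that])
    then show ?thesis using len(2) by (cases p) simp
  qed
  ultimately have "(p, f p) \<in> code_entries L w (\<kappa> / \<eta>)" if "p \<in> set xs" for p
    unfolding code_entries_def using that by (intro SigmaI)
  then have "set es \<subseteq> code_entries L w (\<kappa> / \<eta>)" unfolding es_def by auto
  then have "(length \<Theta>, es) \<in> codes L w (\<kappa> / \<eta>) K"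
    using len xs(1) by (simp add: codes_def es_def)
  moreover have "map_of es p = (if p \<in> set xs then Some (f p) else None)" for p
    unfolding es_def by (simp add: map_of_map_restrict restrict_map_def)
  then have "decode \<eta> (length \<Theta>) es ! l = (\<lambda>i j. \<eta> * real_of_int (round_code \<eta> ((\<Theta> ! l) i j)))"
    if l: "l < length \<Theta>" for l
  proof -
    assume m: "\<And>p. map_of es p = (if p \<in> set xs then Some (f p) else None)"
    have "round_code \<eta> ((\<Theta> ! l) i j) = 0" if "(l, i, j) \<notin> set xs" for i j
    proof -
      have "(\<Theta> ! l) i j = 0" using that xs(2) l by auto
      then show ?thesis by (simp add: round_code_def)
    qed
    then have "real_of_int (case map_of es (l, i, j) of Some c \<Rightarrow> c | None \<Rightarrow> 0) = real_of_int (round_code \<eta> ((\<Theta> ! l) i j))" for i j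
      by (cases "(l, i, j) \<in> set xs") (simp_all add: m f_def)
    then show ?thesis using l by (simp add: decode_def)
  qed
  ultimately show ?thesis by (intro exI[of _ es]) (simp add: decode_def)
qed

lemma card_support_pad:
  assumes "\<And>W v. (W, v) \<in> set net \<Longrightarrow> dim_vec v = dim_row W"
  shows "finite {(l, i, j). l < length net \<and> pad_layer w (net ! l) i j \<noteq> 0} \<and>
    card {(l, i, j). l < length net \<and> pad_layer w (net ! l) i j \<noteq> 0} \<le> net_nnz net"
  using assms
proof (induction net)
  case Nil
  then show ?case by (simp add: net_nnz_def)
next
  case (Cons a net)
  obtain W v where a: "a = (W, v)" by (cases a)
  let ?S = "\<lambda>net. {(l, i, j). l < length net \<and> pad_layer w (net ! l) i j \<noteq> 0}"
  let ?A = "{(i, j). i < dim_row W \<and> j < dim_col W \<and> W $$ (i, j) \<noteq> 0}"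
  let ?B = "{i. i < dim_vec v \<and> vec_index v i \<noteq> 0}"
  have fin: "finite ?A" "finite ?B" by (auto intro: finite_subset[of _ "{..<dim_row W} \<times> {..<dim_col W}"])
  have dv: "dim_vec v = dim_row W" using Cons.prems a by simp
  have "?S (a # net) \<subseteq> (\<lambda>(i, j). (0, i, j)) ` ?A \<union> (\<lambda>i. (0, i, w)) ` ?B \<union> (\<lambda>(l, i, j). (Suc l, i, j)) ` ?S net"
  proof
    fix t assume t: "t \<in> ?S (a # net)"
    obtain l i j where tl: "t = (l, i, j)" by (cases t)
    show "t \<in> (\<lambda>(i, j). (0, i, j)) ` ?A \<union> (\<lambda>i. (0, i, w)) ` ?B \<union> (\<lambda>(l, i, j). (Suc l, i, j)) ` ?S net"
    proof (cases l)
      case 0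
      then show ?thesis using t dv unfolding tl a by (auto simp: pad_layer_def split: if_splits)
    next
      case (Suc l')
      then have "(l', i, j) \<in> ?S net" using t unfolding tl by simp
      then show ?thesis unfolding tl Suc by (intro UnI2 rev_image_eqI) auto
    qed
  qed
  moreover have IH: "finite (?S net)" "card (?S net) \<le> net_nnz net" using Cons by auto
  have finU: "finite ((\<lambda>(i, j). (0, i, j)) ` ?A \<union> (\<lambda>i. (0, i, w)) ` ?B \<union> (\<lambda>(l, i, j). (Suc l, i, j)) ` ?S net)"
    using fin IH by simp
  ultimately have "finite (?S (a # net))" "card (?S (a # net))
    \<le> card ((\<lambda>(i, j). (0, i, j)) ` ?A \<union> (\<lambda>i. (0, i, w)) ` ?B \<union> (\<lambda>(l, i, j). (Suc l, i, j)) ` ?S net)"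
    by (rule finite_subset, intro card_mono)
  note this(2)
  also have "card ((\<lambda>(i, j). (0, i, j)) ` ?A \<union> (\<lambda>i. (0, i, w)) ` ?B \<union> (\<lambda>(l, i, j). (Suc l, i, j)) ` ?S net)
    \<le> card ((\<lambda>(i, j). (0::nat, i, j)) ` ?A) + card ((\<lambda>i. (0::nat, i, w)) ` ?B) + card ((\<lambda>(l, i, j). (Suc l, i, j)) ` ?S net)"
    by (rule order_trans[OF card_Un_le add_right_mono[OF card_Un_le]])
  also have "\<dots> \<le> card ?A + card ?B + card (?S net)"
    by (intro add_mono card_image_le fin IH)
  also have "\<dots> \<le> mat_nnz W + vec_nnz v + net_nnz net"
    using IH unfolding mat_nnz_def vec_nnz_def by (intro add_mono) auto
  also have "\<dots> = net_nnz (a # net)" by (simp add: net_nnz_def a)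
  finally show ?case using \<open>finite (?S (a # net))\<close> by simp
qed

lemma wf_net_dims:
  "wf_net p k r net \<Longrightarrow> (W, v) \<in> set net \<Longrightarrow> dim_vec v = dim_row W \<and> dim_row W \<le> max p r \<and> dim_col W \<le> max p k"
proof (induction p k r net rule: wf_net.induct)
  case (3 p k r W' v' l ls)
  then obtain h where h: "h \<le> p" "W' \<in> carrier_mat h k" "v' \<in> carrier_vec h" "wf_net p h r (l # ls)" by auto
  show ?case
  proof (cases "(W, v) = (W', v')")
    case True
    then show ?thesis using h by auto
  next
    case False
    then have "(W, v) \<in> set (l # ls)" using 3(3) by auto
    from 3(1)[OF h(4) this] show ?thesis using h(1) by auto
  qed
qed auto

definition code_map :: "nat \<Rightarrow> nat \<Rightarrow> real \<Rightarrow> nat \<times> ((nat \<times> nat \<times> nat) \<times> int) list \<Rightarrow> evec \<Rightarrow> evec" where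
  "code_map w r \<eta> c \<mu> = of_coords r (pnet w (decode \<eta> (fst c) (snd c)) (coord \<mu>))"

text \<open>Rounding the weights towards zero preserves the sparsity and the weight bound.\<close>

lemma net_class_cover:
  assumes M: "M \<subseteq> cube D b" and S: "S \<in> net_class D M r R \<kappa> L p K" and \<kappa>: "0 \<le> \<kappa>" and \<eta>: "0 < \<eta>"
    and w: "1 \<le> w" "p \<le> w" "D \<le> w" "r \<le> w" and X: "1 \<le> X" "b \<le> X"
  shows "\<exists>c\<in>codes L w (\<kappa> / \<eta>) K. \<forall>\<mu>\<in>M. norm (S \<mu> - code_map w r \<eta> c \<mu>)
    \<le> sqrt (real r) * (real L * (real (w + 1) * max 1 \<kappa>) ^ L * \<eta> * X)"
proof -
  obtain net where net: "wf_net p D r net" "length net \<le> L"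
    and wt: "\<And>W v. (W, v) \<in> set net \<Longrightarrow> (\<forall>i<dim_row W. \<forall>j<dim_col W. \<bar>index_mat W (i, j)\<bar> \<le> \<kappa>) \<and> (\<forall>i<dim_vec v. \<bar>vec_index v i\<bar> \<le> \<kappa>)"
    and nnz: "net_nnz net \<le> K" and Sv: "\<And>\<mu>. \<mu> \<in> M \<Longrightarrow> S \<mu> = of_vec (net_eval net (to_vec D \<mu>))"
    using S unfolding net_class_def net_nnz_def by blast
  have dims: "dim_vec v = dim_row W" "dim_row W \<le> w" "dim_col W \<le> w" if "(W, v) \<in> set net" for W v
    using wf_net_dims[OF net(1) that] w by auto
  define \<Theta> where "\<Theta> = map (pad_layer w) net"
  have len: "length \<Theta> = length net" "1 \<le> length \<Theta>"
    using wf_net_nonempty[OF net(1)] by (auto simp: \<Theta>_def Suc_le_eq)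
  have nth: "\<Theta> ! l = pad_layer w (net ! l)" "net ! l \<in> set net" if "l < length \<Theta>" for l
    using that len by (auto simp: \<Theta>_def)
  have bd: "\<bar>(\<Theta> ! l) i j\<bar> \<le> \<kappa>" if "l < length \<Theta>" for l i j
    unfolding nth(1)[OF that] pad_layer_def
    using wt[of "fst (net ! l)" "snd (net ! l)"] nth(2)[OF that] dims(1)[of "fst (net ! l)" "snd (net ! l)"] \<kappa> by auto
  have supp: "i < w \<and> j \<le> w" if "l < length \<Theta>" "(\<Theta> ! l) i j \<noteq> 0" for l i j
    using that(2) dims(2,3)[of "fst (net ! l)" "snd (net ! l)"] nth(2)[OF that(1)]
    unfolding nth(1)[OF that(1)] pad_layer_def by (auto split: if_splits)
  have card: "card {(l, i, j). l < length \<Theta> \<and> (\<Theta> ! l) i j \<noteq> 0} \<le> K"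
  proof -
    have "{(l, i, j). l < length \<Theta> \<and> (\<Theta> ! l) i j \<noteq> 0} = {(l, i, j). l < length net \<and> pad_layer w (net ! l) i j \<noteq> 0}"
      using len nth by auto
    then show ?thesis using card_support_pad[of net w] dims(1) nnz by auto
  qed
  obtain es where es: "(length \<Theta>, es) \<in> codes L w (\<kappa> / \<eta>) K" "length (decode \<eta> (length \<Theta>) es) = length \<Theta>"
    "\<forall>l<length \<Theta>. decode \<eta> (length \<Theta>) es ! l = (\<lambda>i j. \<eta> * real_of_int (round_code \<eta> ((\<Theta> ! l) i j)))"
    using codes_cover[of \<Theta> L w \<eta> \<kappa> K] len net(2) w(1) \<eta> bd supp card by auto
  let ?c = "(length \<Theta>, es)" and ?q = "real (w + 1) * max 1 \<kappa>"
  have q: "1 \<le> ?q" using mult_mono[of 1 "real (w + 1)" 1 "max 1 \<kappa>"] by simp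
  have "norm (S \<mu> - code_map w r \<eta> ?c \<mu>) \<le> sqrt (real r) * (real L * ?q ^ L * \<eta> * X)" if \<mu>: "\<mu> \<in> M" for \<mu>
  proof -
    have \<mu>c: "\<mu> \<in> Rn D" "\<And>i. i < D \<Longrightarrow> \<bar>coord \<mu> i\<bar> \<le> b" using M \<mu> by (auto simp: cube_def)
    have x: "\<bar>coord \<mu> j\<bar> \<le> X" for j
    proof (cases "j < D")
      case True
      then show ?thesis using \<mu>c(2)[of j] X by linarith
    next
      case False
      then show ?thesis using \<mu>c(1) X by (simp add: Rn_def)
    qed
    have xx: "coord \<mu> i = (if i < D then vec_index (to_vec D \<mu>) i else 0)" for i
      using \<mu>c(1) by (auto simp: to_vec_def Rn_def)
    have "to_vec D \<mu> \<in> carrier_vec D" by (simp add: to_vec_def)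
    from pnet_pad[OF net(1) w(2,3) this xx]
    have pn: "net_eval net (to_vec D \<mu>) \<in> carrier_vec r"
      "\<And>i. pnet w \<Theta> (coord \<mu>) i = (if i < r then vec_index (net_eval net (to_vec D \<mu>)) i else 0)"
      by (auto simp: \<Theta>_def)
    have S_eq: "S \<mu> = of_coords r (pnet w \<Theta> (coord \<mu>))"
      unfolding Sv[OF \<mu>] of_vec_def using pn by (intro evec_eqI) auto
    have diff: "\<bar>pnet w \<Theta> (coord \<mu>) i - pnet w (decode \<eta> (length \<Theta>) es) (coord \<mu>) i\<bar> \<le> real L * ?q ^ L * \<eta> * X" for i
    proof -
      have "\<bar>pnet w \<Theta> (coord \<mu>) i - pnet w (decode \<eta> (length \<Theta>) es) (coord \<mu>) i\<bar>
        \<le> ?q ^ length \<Theta> * 0 + real (length \<Theta>) * ?q ^ length \<Theta> * \<eta> * X"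
      proof (rule pnet_perturb[OF es(2)])
        fix l i j assume l: "l < length \<Theta>"
        show "\<bar>(\<Theta> ! l) i j\<bar> \<le> \<kappa> \<and> \<bar>(decode \<eta> (length \<Theta>) es ! l) i j\<bar> \<le> \<kappa> \<and>
          \<bar>(\<Theta> ! l) i j - (decode \<eta> (length \<Theta>) es ! l) i j\<bar> \<le> \<eta>"
          using es(3) l bd[OF l, of i j] round_code_props(1,2)[OF \<eta> bd[OF l, of i j]] by simp
      qed (use x X \<eta> in auto)
      also have "\<dots> \<le> real L * ?q ^ L * \<eta> * X"
      proof -
        have "real (length \<Theta>) * ?q ^ length \<Theta> \<le> real L * ?q ^ L"
          using len net(2) q by (intro mult_mono power_increasing) auto
        then have "real (length \<Theta>) * ?q ^ length \<Theta> * (\<eta> * X) \<le> real L * ?q ^ L * (\<eta> * X)"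
          using \<eta> X by (intro mult_right_mono) auto
        then show ?thesis by (simp add: mult.assoc)
      qed
      finally show ?thesis .
    qed
    have "norm (S \<mu> - code_map w r \<eta> ?c \<mu>) \<le> sqrt (\<Sum>i<r. (real L * ?q ^ L * \<eta> * X)\<^sup>2)"
    proof (subst norm_Rn[of _ r])
      show "S \<mu> - code_map w r \<eta> ?c \<mu> \<in> Rn r" unfolding S_eq code_map_def by (rule Rn_diff) simp_all
      have "(coord (S \<mu> - code_map w r \<eta> ?c \<mu>) i)\<^sup>2 \<le> (real L * ?q ^ L * \<eta> * X)\<^sup>2" if "i < r" for i
      proof (subst abs_le_square_iff[symmetric])
        have "\<bar>coord (S \<mu> - code_map w r \<eta> ?c \<mu>) i\<bar> \<le> real L * ?q ^ L * \<eta> * X"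
          using diff[of i] that by (simp add: S_eq code_map_def)
        then show "\<bar>coord (S \<mu> - code_map w r \<eta> ?c \<mu>) i\<bar> \<le> \<bar>real L * ?q ^ L * \<eta> * X\<bar>" by linarith
      qed
      then show "sqrt (\<Sum>i<r. (coord (S \<mu> - code_map w r \<eta> ?c \<mu>) i)\<^sup>2) \<le> sqrt (\<Sum>i<r. (real L * ?q ^ L * \<eta> * X)\<^sup>2)"
        by (intro real_sqrt_le_mono sum_mono) auto
    qed
    also have "\<dots> = sqrt (real r) * (real L * ?q ^ L * \<eta> * X)"
      using \<eta> X q by (simp add: real_sqrt_mult)
    finally show ?thesis .
  qed
  then show ?thesis using es(1) by blast
qed

lemma pnet_measurable:
  "(\<And>i. (\<lambda>\<mu>. f \<mu> i) \<in> borel_measurable N) \<Longrightarrow> (\<lambda>\<mu>. pnet w \<Theta> (f \<mu>) i) \<in> borel_measurable N"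
proof (induction \<Theta> arbitrary: f i rule: induct_list012)
  case (3 \<theta> \<theta>' ls)
  have "(\<lambda>\<mu>. max 0 (aff w \<theta> (f \<mu>) i)) \<in> borel_measurable N" for i
    unfolding aff_def using 3(3) by (intro borel_measurable_max borel_measurable_const borel_measurable_add
        borel_measurable_sum borel_measurable_times) auto
  from 3(2)[OF this] show ?case by simp
qed (auto simp: aff_def intro!: borel_measurable_add borel_measurable_sum borel_measurable_times)

lemma code_map_measurable: "code_map w r \<eta> c \<in> borel_measurable borel"
  unfolding code_map_def[abs_def] of_coords_eq_sum
  by (intro borel_measurable_sum borel_measurable_scaleR pnet_measurable) auto

section \<open>Empirical risk minimization\<close>

text \<open>A linear upper bound on the unit interval; its slope one half is why empirical averages
  are later compared with half of the mean.\<close>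

lemma exp_neg_le:
  assumes "0 \<le> t" "t \<le> (1::real)" shows "exp (- t) \<le> 1 - t / 2"
proof -
  have "1 \<le> (1 + t) * (1 - t / 2)"
  proof -
    have "t * t \<le> t * 1" using assms by (intro mult_left_mono) auto
    then show ?thesis by (simp add: algebra_simps)
  qed
  also have "\<dots> \<le> exp t * (1 - t / 2)" using assms by (intro mult_right_mono) auto
  finally have "exp (- t) * 1 \<le> exp (- t) * (exp t * (1 - t / 2))" by (intro mult_left_mono) auto
  then show ?thesis by (simp add: mult.assoc[symmetric] exp_minus_inverse[symmetric] exp_minus)
qed

text \<open>One-sided deviations of an average of nonnegative bounded variables below half of its mean need
  no variance term; this yields the fast rate.\<close>

lemma exponential_moment:
  fixes Z :: "'a \<Rightarrow> real" and n :: nat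
  assumes Q: "prob_space Q" and Z [measurable]: "Z \<in> borel_measurable Q"
    and B: "0 < B" and Zb: "\<And>\<mu>. \<mu> \<in> space Q \<Longrightarrow> 0 \<le> Z \<mu> \<and> Z \<mu> \<le> B"
  shows "(\<integral>\<^sup>+X. ennreal (exp ((real n * (LINT \<mu>|Q. Z \<mu>) / 2 - (\<Sum>j<n. Z (X j))) / B)) \<partial>PiM {..<n} (\<lambda>_. Q)) \<le> 1"
proof -
  interpret prob_space Q by (rule Q)
  interpret product_sigma_finite "\<lambda>_::nat. Q" by standard
  define E where "E = (LINT \<mu>|Q. Z \<mu>)"
  have intZ: "integrable Q Z"
    by (rule integrable_const_bound[where B = B]) (use Zb in \<open>auto intro!: AE_I2\<close>)
  have int1: "integrable Q (\<lambda>\<mu>. exp (- (Z \<mu> / B)))"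
    by (rule integrable_const_bound[where B = 1]) (use Zb B in \<open>auto intro!: AE_I2\<close>)
  \<comment> \<open>For one sample, \<open>exp (- z) \<le> 1 - z / 2\<close> is integrated and then
    \<open>1 - x \<le> exp (- x)\<close> is applied. By independence the product of \<open>n\<close>
    such factors cancels the prefactor exactly.\<close>
  have "(LINT \<mu>|Q. exp (- (Z \<mu> / B))) \<le> (LINT \<mu>|Q. 1 - Z \<mu> / B / 2)"
  proof (rule integral_mono[OF int1])
    show "integrable Q (\<lambda>\<mu>. 1 - Z \<mu> / B / 2)" using intZ by simp
    fix \<mu> assume "\<mu> \<in> space Q"
    then show "exp (- (Z \<mu> / B)) \<le> 1 - Z \<mu> / B / 2" using Zb B by (intro exp_neg_le) auto
  qed
  also have "\<dots> = 1 - E / B / 2" using intZ prob_space by (simp add: E_def)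
  also have "\<dots> \<le> exp (- (E / B / 2))" using exp_ge_add_one_self[of "- (E / B / 2)"] by simp
  finally have le: "(LINT \<mu>|Q. exp (- (Z \<mu> / B))) \<le> exp (- (E / B / 2))" .
  have "(\<integral>\<^sup>+X. ennreal (exp ((real n * E / 2 - (\<Sum>j<n. Z (X j))) / B)) \<partial>PiM {..<n} (\<lambda>_. Q))
    = (\<integral>\<^sup>+X. ennreal (exp (real n * E / 2 / B)) * (\<Prod>j<n. ennreal (exp (- (Z (X j) / B)))) \<partial>PiM {..<n} (\<lambda>_. Q))"
  proof (rule nn_integral_cong)
    fix X
    have "exp ((real n * E / 2 - (\<Sum>j<n. Z (X j))) / B) = exp (real n * E / 2 / B) * (\<Prod>j<n. exp (- (Z (X j) / B)))"
      by (simp add: exp_sum[symmetric] exp_add[symmetric] diff_divide_distrib sum_negf sum_divide_distrib)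
    then show "ennreal (exp ((real n * E / 2 - (\<Sum>j<n. Z (X j))) / B))
      = ennreal (exp (real n * E / 2 / B)) * (\<Prod>j<n. ennreal (exp (- (Z (X j) / B))))"
      by (simp add: ennreal_mult prod_ennreal prod_nonneg)
  qed
  also have "\<dots> = ennreal (exp (real n * E / 2 / B)) * (\<integral>\<^sup>+X. (\<Prod>j<n. ennreal (exp (- (Z (X j) / B)))) \<partial>PiM {..<n} (\<lambda>_. Q))"
    by (rule nn_integral_cmult) measurable
  also have "(\<integral>\<^sup>+X. (\<Prod>j<n. ennreal (exp (- (Z (X j) / B)))) \<partial>PiM {..<n} (\<lambda>_. Q))
    = (\<Prod>j<n. \<integral>\<^sup>+\<mu>. ennreal (exp (- (Z \<mu> / B))) \<partial>Q)"
    by (rule product_nn_integral_prod) auto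
  also have "(\<integral>\<^sup>+\<mu>. ennreal (exp (- (Z \<mu> / B))) \<partial>Q) = ennreal (LINT \<mu>|Q. exp (- (Z \<mu> / B)))"
    by (rule nn_integral_eq_integral[OF int1]) simp
  also have "ennreal (exp (real n * E / 2 / B)) * (\<Prod>j<n. ennreal (LINT \<mu>|Q. exp (- (Z \<mu> / B))))
    \<le> ennreal (exp (real n * E / 2 / B)) * (\<Prod>j<n. ennreal (exp (- (E / B / 2))))"
    by (intro mult_left_mono prod_mono_ennreal ennreal_leI le) auto
  also have "\<dots> = ennreal (exp (real n * E / 2 / B) * (\<Prod>j<n. exp (- (E / B / 2))))"
    by (simp add: ennreal_mult ennreal_power)
  also have "exp (real n * E / 2 / B) * (\<Prod>j<n. exp (- (E / B / 2))) = 1"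
    by (simp add: exp_of_nat_mult[symmetric] exp_add[symmetric] mult.commute)
  finally show ?thesis by (simp add: E_def)
qed

lemma norm_power2_diff_le:
  fixes u v :: "'a::real_normed_vector"
  assumes "norm u \<le> s" "norm v \<le> s" shows "(norm u)\<^sup>2 \<le> (norm v)\<^sup>2 + 2 * s * norm (u - v)"
proof -
  have s: "0 \<le> s" using assms(1) norm_ge_zero[of u] by linarith
  have "(norm u)\<^sup>2 - (norm v)\<^sup>2 = (norm u + norm v) * (norm u - norm v)" by (simp add: power2_eq_square algebra_simps)
  also have "\<dots> \<le> (norm u + norm v) * norm (u - v)" by (rule mult_left_mono[OF norm_triangle_ineq2]) simp
  also have "\<dots> \<le> (2 * s) * norm (u - v)" by (rule mult_right_mono) (use assms in auto)
  finally show ?thesis by simp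
qed

text \<open>The estimator depends on the data, and so does the member of the finite family close to
  it. Dominating the exponential variable of that member by the sum over the family removes this
  dependence, and \<open>ln y \<le> y - 1\<close> turns the logarithm of the sum into a quantity
  with controlled expectation.\<close>

lemma erm_oracle_bound:
  fixes a :: "'a \<Rightarrow> 'b::{second_countable_topology, real_normed_vector}"
    and T :: "'i \<Rightarrow> 'a \<Rightarrow> 'b" and ahat :: "(nat \<Rightarrow> 'a) \<Rightarrow> 'a \<Rightarrow> 'b" and n :: nat
  assumes Q: "prob_space Q" and a [measurable]: "a \<in> borel_measurable Q"
    and I: "finite I" and T [measurable]: "\<And>i. i \<in> I \<Longrightarrow> T i \<in> borel_measurable Q"
    and ahat: "\<And>X. X \<in> space (PiM {..<n} (\<lambda>_. Q)) \<Longrightarrow> ahat X \<in> borel_measurable Q"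
    and s: "0 < s" and Tb: "\<And>i \<mu>. i \<in> I \<Longrightarrow> \<mu> \<in> space Q \<Longrightarrow> norm (T i \<mu> - a \<mu>) \<le> s"
    and ab: "\<And>X \<mu>. X \<in> space (PiM {..<n} (\<lambda>_. Q)) \<Longrightarrow> \<mu> \<in> space Q \<Longrightarrow> norm (ahat X \<mu> - a \<mu>) \<le> s"
    and \<delta>: "0 \<le> \<delta>" and cov: "\<And>X. X \<in> space (PiM {..<n} (\<lambda>_. Q)) \<Longrightarrow> \<exists>i\<in>I. \<forall>\<mu>\<in>space Q. norm (ahat X \<mu> - T i \<mu>) \<le> \<delta>"
    and \<epsilon>: "\<And>X. X \<in> space (PiM {..<n} (\<lambda>_. Q)) \<Longrightarrow> (\<Sum>j<n. (norm (ahat X (X j) - a (X j)))\<^sup>2) / real n \<le> \<epsilon>"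
    and n: "1 \<le> n"
  shows "(\<integral>\<^sup>+X. ennreal (LINT \<mu>|Q. (norm (ahat X \<mu> - a \<mu>))\<^sup>2) \<partial>PiM {..<n} (\<lambda>_. Q))
    \<le> ennreal (2 * \<epsilon> + 6 * s * \<delta> + 2 * s\<^sup>2 / real n * (ln (real (card I)) + 1))"
proof -
  interpret prob_space Q by (rule Q)
  let ?P = "PiM {..<n} (\<lambda>_. Q)"
  interpret PP: prob_space ?P by (rule prob_space_PiM) (rule Q)
  define Z where "Z i \<mu> = (norm (T i \<mu> - a \<mu>))\<^sup>2" for i \<mu>
  have Zm [measurable]: "Z i \<in> borel_measurable Q" if "i \<in> I" for i unfolding Z_def[abs_def] using that by measurable
  have s2: "0 < s\<^sup>2" using s by simp
  have Zb: "0 \<le> Z i \<mu> \<and> Z i \<mu> \<le> s\<^sup>2" if "i \<in> I" "\<mu> \<in> space Q" for i \<mu>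
    unfolding Z_def using Tb[OF that] by (simp add: power_mono)
  define Y where "Y i X = exp ((real n * (LINT \<mu>|Q. Z i \<mu>) / 2 - (\<Sum>j<n. Z i (X j))) / s\<^sup>2)" for i X
  have Ym [measurable]: "(\<lambda>X. ennreal (Y i X)) \<in> borel_measurable ?P" if "i \<in> I" for i
    unfolding Y_def using Zm[OF that] by measurable
  have Y1: "(\<integral>\<^sup>+X. ennreal (Y i X) \<partial>?P) \<le> 1" if "i \<in> I" for i
    unfolding Y_def by (rule exponential_moment[OF Q Zm[OF that] s2 Zb[OF that]])
  obtain X0 where X0: "X0 \<in> space ?P" using PP.not_empty by blast
  have "I \<noteq> {}" using cov[OF X0] by blast
  then have N: "1 \<le> card I" using I by (simp add: Suc_le_eq card_gt_0_iff)
  have \<epsilon>0: "0 \<le> \<epsilon>" using \<epsilon>[OF X0] by (meson divide_nonneg_nonneg of_nat_0_le_iff order_trans sum_nonneg zero_le_power2)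
  \<comment> \<open>Accounting for \<open>\<delta>\<close>: passing between the estimator and its
    neighbour costs \<open>2 * s * \<delta>\<close> in the true risk and again in the empirical
    risk; the latter is doubled by the comparison with half of the mean, which makes six.\<close>
  define k0 where "k0 = 2 * \<epsilon> + 6 * s * \<delta> + 2 * s\<^sup>2 / real n * ln (real (card I))"
  define k1 where "k1 = 2 * s\<^sup>2 / real n / real (card I)"
  have k: "0 \<le> k0" "0 \<le> k1" unfolding k0_def k1_def using \<epsilon>0 s \<delta> N by (auto intro!: add_nonneg_nonneg mult_nonneg_nonneg)
  have main: "(LINT \<mu>|Q. (norm (ahat X \<mu> - a \<mu>))\<^sup>2) \<le> k0 + k1 * (\<Sum>i\<in>I. Y i X)" if X: "X \<in> space ?P" for X
  proof -
    have Xj: "X j \<in> space Q" if "j < n" for j using X that by (auto simp: space_PiM PiE_def Pi_def)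
    obtain i where i: "i \<in> I" "\<And>\<mu>. \<mu> \<in> space Q \<Longrightarrow> norm (ahat X \<mu> - T i \<mu>) \<le> \<delta>" using cov[OF X] by blast
    have [measurable]: "ahat X \<in> borel_measurable Q" by (rule ahat[OF X])
    have c1: "(norm (ahat X \<mu> - a \<mu>))\<^sup>2 \<le> Z i \<mu> + 2 * s * \<delta>" if "\<mu> \<in> space Q" for \<mu>
    proof -
      have "(norm (ahat X \<mu> - a \<mu>))\<^sup>2 \<le> Z i \<mu> + 2 * s * norm ((ahat X \<mu> - a \<mu>) - (T i \<mu> - a \<mu>))"
        unfolding Z_def by (rule norm_power2_diff_le[OF ab[OF X that] Tb[OF i(1) that]])
      also have "\<dots> \<le> Z i \<mu> + 2 * s * \<delta>" using i(2)[OF that] s by simp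
      finally show ?thesis .
    qed
    have c2: "Z i \<mu> \<le> (norm (ahat X \<mu> - a \<mu>))\<^sup>2 + 2 * s * \<delta>" if "\<mu> \<in> space Q" for \<mu>
    proof -
      have "Z i \<mu> \<le> (norm (ahat X \<mu> - a \<mu>))\<^sup>2 + 2 * s * norm ((T i \<mu> - a \<mu>) - (ahat X \<mu> - a \<mu>))"
        unfolding Z_def by (rule norm_power2_diff_le[OF Tb[OF i(1) that] ab[OF X that]])
      also have "\<dots> \<le> (norm (ahat X \<mu> - a \<mu>))\<^sup>2 + 2 * s * \<delta>" using i(2)[OF that] s by (simp add: norm_minus_commute)
      finally show ?thesis .
    qed
    have intZ: "integrable Q (Z i)"
      by (rule integrable_const_bound[where B = "s\<^sup>2"]) (use Zb[OF i(1)] Zm[OF i(1)] in \<open>auto intro!: AE_I2\<close>)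
    have "(LINT \<mu>|Q. (norm (ahat X \<mu> - a \<mu>))\<^sup>2) \<le> (LINT \<mu>|Q. Z i \<mu> + 2 * s * \<delta>)"
    proof (rule integral_mono)
      show "integrable Q (\<lambda>\<mu>. (norm (ahat X \<mu> - a \<mu>))\<^sup>2)"
        by (rule integrable_const_bound[where B = "s\<^sup>2"]) (use ab[OF X] in \<open>auto intro!: AE_I2 power_mono\<close>)
      show "integrable Q (\<lambda>\<mu>. Z i \<mu> + 2 * s * \<delta>)" using intZ by simp
    qed (use c1 in auto)
    also have "\<dots> = (LINT \<mu>|Q. Z i \<mu>) + 2 * s * \<delta>" using intZ prob_space by simp
    finally have 1: "(LINT \<mu>|Q. (norm (ahat X \<mu> - a \<mu>))\<^sup>2) \<le> (LINT \<mu>|Q. Z i \<mu>) + 2 * s * \<delta>" .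
    have "(\<Sum>j<n. Z i (X j)) \<le> (\<Sum>j<n. (norm (ahat X (X j) - a (X j)))\<^sup>2 + 2 * s * \<delta>)"
      by (rule sum_mono) (use c2 Xj in auto)
    also have "\<dots> = real n * ((\<Sum>j<n. (norm (ahat X (X j) - a (X j)))\<^sup>2) / real n + 2 * s * \<delta>)"
      using n by (simp add: sum.distrib field_simps)
    also have "\<dots> \<le> real n * (\<epsilon> + 2 * s * \<delta>)" by (intro mult_left_mono add_right_mono \<epsilon>[OF X]) simp
    finally have 2: "(\<Sum>j<n. Z i (X j)) \<le> real n * (\<epsilon> + 2 * s * \<delta>)" .
    have Ypos: "0 < (\<Sum>i\<in>I. Y i X)" by (rule sum_pos) (use I \<open>I \<noteq> {}\<close> in \<open>auto simp: Y_def\<close>)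
    have "(real n * (LINT \<mu>|Q. Z i \<mu>) / 2 - (\<Sum>j<n. Z i (X j))) / s\<^sup>2 = ln (Y i X)" by (simp add: Y_def)
    also have "\<dots> \<le> ln (\<Sum>i\<in>I. Y i X)"
      using i(1) I Ypos by (subst ln_le_cancel_iff) (auto simp: Y_def intro!: member_le_sum)
    \<comment> \<open>Dividing by the number of members before linearizing: the remaining average of
      the \<open>Y i X\<close> has expectation at most one.\<close>
    also have "ln (\<Sum>i\<in>I. Y i X) = ln (real (card I)) + ln ((\<Sum>i\<in>I. Y i X) / real (card I))"
      using Ypos N by (simp add: ln_div)
    also have "\<dots> \<le> ln (real (card I)) + (\<Sum>i\<in>I. Y i X) / real (card I)"
      using ln_le_minus_one[of "(\<Sum>i\<in>I. Y i X) / real (card I)"] Ypos N by simp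
    finally have "(real n * (LINT \<mu>|Q. Z i \<mu>) / 2 - (\<Sum>j<n. Z i (X j))) / s\<^sup>2
      \<le> ln (real (card I)) + (\<Sum>i\<in>I. Y i X) / real (card I)" .
    then have "real n * (LINT \<mu>|Q. Z i \<mu>) / 2 - (\<Sum>j<n. Z i (X j))
      \<le> (ln (real (card I)) + (\<Sum>i\<in>I. Y i X) / real (card I)) * s\<^sup>2"
      using s2 by (simp add: divide_le_eq)
    then have "real n * (LINT \<mu>|Q. Z i \<mu>)
      \<le> real n * (2 * (\<epsilon> + 2 * s * \<delta>)) + 2 * s\<^sup>2 * (ln (real (card I)) + (\<Sum>i\<in>I. Y i X) / real (card I))"
      using 2 by (simp add: algebra_simps)
    also have "\<dots> = real n * (2 * (\<epsilon> + 2 * s * \<delta>) + 2 * s\<^sup>2 / real n * ln (real (card I)) + k1 * (\<Sum>i\<in>I. Y i X))"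
      using n by (simp add: k1_def distrib_left)
    finally have "(LINT \<mu>|Q. Z i \<mu>)
      \<le> 2 * (\<epsilon> + 2 * s * \<delta>) + 2 * s\<^sup>2 / real n * ln (real (card I)) + k1 * (\<Sum>i\<in>I. Y i X)"
      using n by (simp add: mult_le_cancel_left)
    then show ?thesis using 1 unfolding k0_def by (simp add: algebra_simps)
  qed
  have "(\<integral>\<^sup>+X. ennreal (LINT \<mu>|Q. (norm (ahat X \<mu> - a \<mu>))\<^sup>2) \<partial>?P)
    \<le> (\<integral>\<^sup>+X. ennreal k0 + ennreal k1 * (\<Sum>i\<in>I. ennreal (Y i X)) \<partial>?P)"
  proof (rule nn_integral_mono)
    fix X assume "X \<in> space ?P"
    have "0 \<le> (\<Sum>i\<in>I. Y i X)" by (rule sum_nonneg) (simp add: Y_def)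
    moreover have "(\<Sum>i\<in>I. ennreal (Y i X)) = ennreal (\<Sum>i\<in>I. Y i X)" by (rule sum_ennreal) (simp add: Y_def)
    ultimately show "ennreal (LINT \<mu>|Q. (norm (ahat X \<mu> - a \<mu>))\<^sup>2) \<le> ennreal k0 + ennreal k1 * (\<Sum>i\<in>I. ennreal (Y i X))"
      using main[OF \<open>X \<in> space ?P\<close>] k by (simp add: ennreal_mult[symmetric] ennreal_plus[symmetric] ennreal_leI del: ennreal_plus)
  qed
  also have "\<dots> = ennreal k0 + ennreal k1 * (\<Sum>i\<in>I. \<integral>\<^sup>+X. ennreal (Y i X) \<partial>?P)"
    by (subst nn_integral_add, simp, use Ym in measurable, simp add: nn_integral_cmult nn_integral_sum PP.emeasure_space_1 Ym)
  also have "\<dots> \<le> ennreal k0 + ennreal k1 * (\<Sum>i\<in>I. 1)"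
    by (intro add_left_mono mult_left_mono sum_mono Y1) auto
  also have "\<dots> = ennreal (k0 + k1 * real (card I))"
    using k by (simp add: ennreal_mult ennreal_plus ennreal_of_nat_eq_real_of_nat)
  also have "k0 + k1 * real (card I) = 2 * \<epsilon> + 6 * s * \<delta> + 2 * s\<^sup>2 / real n * (ln (real (card I)) + 1)"
    using N by (simp add: k0_def k1_def distrib_left)
  finally show ?thesis .
qed

section \<open>Approximation and estimation of the coefficient maps\<close>

lemma transport_settingD:
  assumes "transport_setting P"
  shows "man_dim P < amb_dim P" "0 < amb_bound P" "submanifold (amb_dim P) (man_dim P) (man P)"
    "compact (man P)" "connected (man P)" "man P \<subseteq> cube (amb_dim P) (amb_bound P)" "prob_space (par_law P)" "1 \<le> rnk P"
    "sets (par_law P) = sets (restrict_space borel (man P))"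
  using assms unfolding transport_setting_def riemannian_volume_def by auto

lemma space_par_law: "transport_setting P \<Longrightarrow> space (par_law P) = man P"
  using sets_eq_imp_space_eq[OF transport_settingD(9)] by (simp add: space_restrict_space)

lemma dist_regularI:
  assumes "transport_setting P" shows "dist_regular P"
proof -
  note T = transport_settingD[OF assms]
  obtain \<Lambda> where \<Lambda>: "0 \<le> \<Lambda>" "\<And>p q. p \<in> man P \<Longrightarrow> q \<in> man P \<Longrightarrow> (\<exists>l. joined_by (man P) p q l) \<and> geodesic_dist (man P) p q \<le> \<Lambda> * dist p q"
    by (rule geodesic_dist_lipschitz[OF T(3,4,5)]) blast
  have "bounded (man P)" using T(4) by (rule compact_imp_bounded)
  have "geodesic_dist (man P) p q \<le> \<Lambda> * diameter (man P)" if "p \<in> man P" "q \<in> man P" for p q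
  proof -
    have "\<Lambda> * dist p q \<le> \<Lambda> * diameter (man P)"
      by (rule mult_left_mono[OF diameter_bounded_bound[OF \<open>bounded (man P)\<close> that] \<Lambda>(1)])
    then show ?thesis using \<Lambda>(2)[OF that] by linarith
  qed
  moreover have "0 \<le> geodesic_dist (man P) p q" if "p \<in> man P" "q \<in> man P" for p q
    using \<Lambda>(2)[OF that] geodesic_dist_nonneg by blast
  ultimately show ?thesis
    unfolding dist_regular_def par_dist_def using geodesic_dist_refl by blast
qed

text \<open>The infimum of the admissible constants is itself admissible, provided there is one.
  Pairs with \<open>\<delta> x y = 0\<close> are treated apart, as \<open>\<delta>\<close> is not
  known to separate points.\<close>

lemma le_lip_const:
  assumes l: "0 \<le> l" "\<And>x y. x \<in> S \<Longrightarrow> y \<in> S \<Longrightarrow> \<bar>f x - f y\<bar> \<le> l * \<delta> x y"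
    and xy: "x \<in> S" "y \<in> S" and \<delta>: "0 \<le> \<delta> x y"
  shows "\<bar>f x - f y\<bar> \<le> lip_const \<delta> S f * \<delta> x y" and "0 \<le> lip_const \<delta> S f"
proof -
  let ?A = "{l. 0 \<le> l \<and> (\<forall>x\<in>S. \<forall>y\<in>S. \<bar>f x - f y\<bar> \<le> l * \<delta> x y)}"
  have ne: "?A \<noteq> {}" using l by blast
  show "0 \<le> lip_const \<delta> S f" unfolding lip_const_def by (rule cInf_greatest[OF ne]) simp
  show "\<bar>f x - f y\<bar> \<le> lip_const \<delta> S f * \<delta> x y"
  proof (cases "\<delta> x y = 0")
    case True
    then show ?thesis using l(2)[OF xy] by simp
  next
    case False
    then have pos: "0 < \<delta> x y" using \<delta> by simp
    have "\<bar>f x - f y\<bar> / \<delta> x y \<le> lip_const \<delta> S f"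
      unfolding lip_const_def
      by (rule cInf_greatest[OF ne]) (use xy pos in \<open>auto simp: pos_divide_le_eq\<close>)
    then show ?thesis using pos by (simp add: pos_divide_le_eq)
  qed
qed

text \<open>Pads a net by repetition to exactly \<open>2 ^ t\<close> centres, the number that the
  tournament of minima expects.\<close>

lemma ex_surj_lessThan:
  assumes "finite Z" "Z \<noteq> {}" "card Z \<le> m" shows "\<exists>f. f ` {..<m::nat} = Z"
proof -
  obtain g where g: "bij_betw g {0..<card Z} Z" using ex_bij_betw_nat_finite[OF assms(1)] by blast
  have c: "0 < card Z" using assms by (simp add: card_gt_0_iff)
  define f where "f k = (if k < card Z then g k else g 0)" for k
  have gi: "g ` {0..<card Z} = Z" using g by (simp add: bij_betw_def)
  have "f ` {..<m} = Z"
  proof (intro equalityI subsetI)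
    fix z assume "z \<in> f ` {..<m}"
    then show "z \<in> Z" using gi c by (auto simp: f_def)
  next
    fix z assume "z \<in> Z"
    then have "z \<in> g ` {0..<card Z}" using gi by simp
    then obtain k where "k < card Z" "z = g k" by auto
    then show "z \<in> f ` {..<m}" using assms(3) by (intro image_eqI[of _ _ k]) (auto simp: f_def)
  qed
  then show ?thesis by blast
qed

context regular_problem
begin

abbreviation "R\<^sub>a \<equiv> 2 * sqrt (real r) * U\<^sup>2 / \<gamma>"
abbreviation "D \<equiv> amb_dim P"

text \<open>At a unit vector the Gram form is the squared norm of one basis function. The bound
  makes \<open>U ^ 4 / \<gamma>\<^sup>2\<close> at least one, so that terms without this factor can
  be absorbed, and makes \<open>R\<^sub>a\<close> large enough for the shrinking in
  \<open>approximant\<close>.\<close>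

lemma gamma_le: "\<gamma> \<le> U\<^sup>2"
proof -
  interpret prob_space "dx P" by (rule prob)
  have r0: "0 < r" using r by simp
  have "\<gamma> * (norm (unit_evec 0))\<^sup>2 \<le> (LINT x|dx P. (expansion (unit_evec 0) x)\<^sup>2)"
    unfolding integral_expansion_sq by (rule gram_quad(1)[OF unit_evec_Rn[OF r0]])
  also have "\<dots> \<le> (LINT x|dx P. U\<^sup>2)"
  proof (rule integral_mono)
    show "integrable (dx P) (\<lambda>x. (expansion (unit_evec 0) x)\<^sup>2)" using expansion_L2 by (simp add: L2_def)
    fix x assume "x \<in> space (dx P)"
    then have "\<bar>basis P 0 x\<bar> \<le> U" using basis_bound[OF r0] by simp
    moreover have "expansion (unit_evec 0) x = basis P 0 x"
      unfolding expansion_def using r0 sum_delta_mult[of 0 r 1 "\<lambda>s. basis P s x"] by simp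
    ultimately show "(expansion (unit_evec 0) x)\<^sup>2 \<le> U\<^sup>2" by (metis abs_le_square_iff abs_of_pos pos(1))
  qed simp
  finally show ?thesis using prob_space by simp
qed

lemma R_a_ge: "2 * sqrt (real r) \<le> R\<^sub>a"
proof -
  have "1 \<le> U\<^sup>2 / \<gamma>" using gamma_le pos by simp
  from mult_left_mono[OF this, of "2 * sqrt (real r)"] show ?thesis by simp
qed

lemma R_a_ge_2: "2 \<le> R\<^sub>a"
proof -
  have "1 \<le> sqrt (real r)" using r by simp
  then show ?thesis using R_a_ge by linarith
qed

lemma par_dist_nonneg: "\<mu> \<in> man P \<Longrightarrow> \<nu> \<in> man P \<Longrightarrow> 0 \<le> par_dist P \<mu> \<nu>"
  using dr by (simp add: dist_regular_def)

lemma coord_coef_lipschitz: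
  assumes s: "s < r" and "\<mu> \<in> man P" "\<nu> \<in> man P"
  shows "\<bar>coord (coef P \<mu>) s - coord (coef P \<nu>) s\<bar> \<le> coef_lip P * par_dist P \<mu> \<nu>" "0 \<le> coef_lip P"
proof -
  let ?l = "2 * sqrt (real r) * (Lip * U) / \<gamma>" and ?f = "\<lambda>\<mu>. coord (coef P \<mu>) s"
  have l: "0 \<le> ?l" using pos by simp
  have lip: "\<bar>?f x - ?f y\<bar> \<le> ?l * par_dist P x y" if "x \<in> man P" "y \<in> man P" for x y
  proof -
    have "\<bar>?f x - ?f y\<bar> \<le> norm (coef P y - coef P x)"
      using abs_coord_le_norm[of "coef P y - coef P x" s] by simp
    also have "\<dots> \<le> ?l * par_dist P x y" by (rule coef_lipschitz[OF that(2,1)])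
    finally show ?thesis .
  qed
  note ll = le_lip_const[of ?l "man P" ?f "par_dist P", OF l lip assms(2,3) par_dist_nonneg[OF assms(2,3)]]
  have le: "lip_const (par_dist P) (man P) ?f \<le> coef_lip P"
    unfolding coef_lip_def by (rule Max_ge) (use s in auto)
  show "0 \<le> coef_lip P" using ll(2) le by linarith
  show "\<bar>?f \<mu> - ?f \<nu>\<bar> \<le> coef_lip P * par_dist P \<mu> \<nu>"
    using ll(1) mult_right_mono[OF le par_dist_nonneg[OF assms(2,3)]] by linarith
qed

text \<open>The coefficient maps take the values \<open>0\<close> and \<open>1\<close> at the nodes, so their Lipschitz constant
  separates the nodes; this is why the constant of the theorem need not depend on \<open>r\<close>.\<close>

lemma nodes_separated:
  assumes "s < r" "t < r" "s \<noteq> t" shows "1 \<le> coef_lip P * par_dist P (par_nodes P s) (par_nodes P t)"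
  using coord_coef_lipschitz(1)[OF assms(1) par_nodes_in_man[OF T assms(1)] par_nodes_in_man[OF T assms(2)]] assms
  by (simp add: coef_at_node)

text \<open>The output bound \<open>R\<close> may equal the bound \<open>R\<^sub>a\<close> on the
  coefficients, so an approximation of the coefficients themselves might leave the class. The map is
  first shrunk by \<open>1 - \<eta>\<close>, which doubles the error bound but leaves room for the
  approximation.\<close>

lemma approximant:
  assumes L1: "\<And>s \<mu> \<nu>. s < r \<Longrightarrow> \<mu> \<in> man P \<Longrightarrow> \<nu> \<in> man P \<Longrightarrow> \<bar>coord (coef P \<mu>) s - coord (coef P \<nu>) s\<bar> \<le> 2 ^ T * dist \<mu> \<nu>"
    and A1: "\<And>s \<mu>. s < r \<Longrightarrow> \<mu> \<in> man P \<Longrightarrow> \<bar>coord (coef P \<mu>) s\<bar> \<le> 2 ^ T"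
    and Z: "finite Z" "Z \<subseteq> man P" "card Z \<le> 2 ^ t" "\<And>\<mu>. \<mu> \<in> man P \<Longrightarrow> \<exists>z\<in>Z. dist \<mu> z \<le> \<epsilon>"
    and e1: "e1 = 2 ^ (T + 1) * real D * \<epsilon>" "0 \<le> e1" "e1 \<le> 2"
    and R: "R\<^sub>a \<le> R" and \<kappa>: "2 \<le> \<kappa>" "amb_bound P \<le> \<kappa>"
  shows "\<exists>S\<in>net_class D (man P) r R \<kappa> (2 * t + T + 6) (2 ^ t * (2 * D + 2 * r)) (2 ^ t * (4 * D + r * (2 * D + 4 * T + 23))).
    \<forall>\<mu>\<in>man P. norm (S \<mu> - coef P \<mu>) \<le> 2 * sqrt (real r) * e1"
proof -
  note TD = transport_settingD[OF T]
  have D: "0 < D" using TD(1) by simp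
  have "Z \<noteq> {}" using Z(4) man_nonempty[OF T] by blast
  then obtain z where z: "z ` {..<(2::nat) ^ t} = Z" using ex_surj_lessThan[OF Z(1) _ Z(3)] by blast
  have zM: "z k \<in> man P" if "k < 2 ^ t" for k using z Z(2) that by blast
  have R0: "0 < R\<^sub>a" using R_a_ge_2 by linarith
  \<comment> \<open>Shrinking lowers the norm bound by \<open>\<eta> * R\<^sub>a\<close>, chosen to
    be exactly the approximation error \<open>sqrt r * e1\<close>.\<close>
  define \<eta> where "\<eta> = sqrt (real r) * e1 / R\<^sub>a"
  have "x / c * c = x" if "0 < c" for x c :: real using that by simp
  then have \<eta>R: "\<eta> * R\<^sub>a = sqrt (real r) * e1" unfolding \<eta>_def using R0 by blast
  have \<eta>0: "0 \<le> \<eta>" unfolding \<eta>_def using e1(2) R0 by (intro divide_nonneg_pos mult_nonneg_nonneg) auto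
  have "sqrt (real r) * e1 \<le> sqrt (real r) * 2" by (rule mult_left_mono[OF e1(3)]) simp
  also have "\<dots> \<le> R\<^sub>a" using R_a_ge by linarith
  finally have \<eta>1: "\<eta> \<le> 1" unfolding \<eta>_def using R0 by (subst divide_le_eq_1_pos) auto
  define a' where "a' \<mu> = (1 - \<eta>) *\<^sub>R coef P \<mu>" for \<mu>
  have a'_le: "\<bar>coord (a' \<mu>) s\<bar> \<le> 2 ^ T" if "\<mu> \<in> man P" for \<mu> s
  proof (cases "s < r")
    case True
    have "\<bar>coord (a' \<mu>) s\<bar> = (1 - \<eta>) * \<bar>coord (coef P \<mu>) s\<bar>" using \<eta>1 by (simp add: a'_def abs_mult)
    also have "\<dots> \<le> 1 * 2 ^ T" using \<eta>0 \<eta>1 A1[OF True that] by (intro mult_mono) auto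
    finally show ?thesis by simp
  next
    case False
    then show ?thesis using coef_solves(2)[of \<mu>] by (simp add: a'_def Rn_def)
  qed
  have a'_lip: "\<bar>coord (a' \<mu>) s - coord (a' \<nu>) s\<bar> \<le> 2 ^ T * dist \<mu> \<nu>" if "s < r" "\<mu> \<in> man P" "\<nu> \<in> man P" for s \<mu> \<nu>
  proof -
    have "coord (a' \<mu>) s - coord (a' \<nu>) s = (1 - \<eta>) * (coord (coef P \<mu>) s - coord (coef P \<nu>) s)"
      by (simp add: a'_def right_diff_distrib)
    then have "\<bar>coord (a' \<mu>) s - coord (a' \<nu>) s\<bar> = (1 - \<eta>) * \<bar>coord (coef P \<mu>) s - coord (coef P \<nu>) s\<bar>"
      using \<eta>1 by (simp add: abs_mult)
    also have "\<dots> \<le> 1 * (2 ^ T * dist \<mu> \<nu>)" using \<eta>0 \<eta>1 L1[OF that] by (intro mult_mono) auto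
    finally show ?thesis by simp
  qed
  \<comment> \<open>Values are divided by the slope and shifted by one: they become biases between
    zero and two, and all entries of the minimum are nonnegative. The last layers undo this.\<close>
  define y where "y q = 1 + coord (a' (z (q mod 2 ^ t))) (q div 2 ^ t) / 2 ^ T" for q
  have yb: "0 \<le> y q \<and> y q \<le> 2" for q
  proof -
    have "q mod 2 ^ t < 2 ^ t" by simp
    from a'_le[OF zM[OF this], of "q div 2 ^ t"]
    have "\<bar>coord (a' (z (q mod 2 ^ t))) (q div 2 ^ t) / 2 ^ T\<bar> \<le> 1" by simp
    then show ?thesis unfolding y_def by linarith
  qed
  have zc: "\<bar>coord (z k) i\<bar> \<le> \<kappa>" if "k < 2 ^ t" "i < D" for k i
  proof -
    have "\<bar>coord (z k) i\<bar> \<le> amb_bound P" using zM[OF that(1)] TD(6) that(2) by (auto simp: cube_def)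
    then show ?thesis using \<kappa>(2) by linarith
  qed
  define f where "f x s = 2 ^ T * (tree_min t (\<lambda>q. (\<Sum>i<D. \<bar>x i - coord (z (q mod 2 ^ t)) i\<bar>) + y q) s - 1)" for x s
  have "realizable \<kappa> (2 ^ t * (2 * D + 2 * r)) D r (2 * t + T + 6) (2 ^ t * (4 * D + r * (2 * D + 4 * T + 23))) (\<lambda>_. True) f"
    unfolding f_def[abs_def]
    by (rule realizable_McShane[where z = "\<lambda>k. coord (z k)"]) (use \<kappa>(1) D zc yb in auto)
  then obtain net where net: "wf_net (2 ^ t * (2 * D + 2 * r)) D r net" "length net \<le> 2 * t + T + 6" "weights_le \<kappa> net"
    "net_nnz net \<le> 2 ^ t * (4 * D + r * (2 * D + 4 * T + 23))"
    and ev: "\<And>x. net_eval net (Matrix.vec D x) = Matrix.vec r (f x)"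
    unfolding realizable_def by blast
  define S where "S \<mu> = of_coords r (f (coord \<mu>))" for \<mu>
  have S_Rn: "S \<mu> \<in> Rn r" for \<mu> by (simp add: S_def)
  have S_close: "\<bar>coord (S \<mu> - a' \<mu>) s\<bar> \<le> e1" if \<mu>: "\<mu> \<in> man P" and s: "s < r" for \<mu> s
  proof -
    let ?x = "\<lambda>q. (\<Sum>i<D. \<bar>coord \<mu> i - coord (z (q mod 2 ^ t)) i\<bar>) + y q"
    have val: "2 ^ T * (?x (s * 2 ^ t + k) - 1) = 2 ^ T * (\<Sum>i<D. \<bar>coord \<mu> i - coord (z k) i\<bar>) + coord (a' (z k)) s"
      if "k < 2 ^ t" for k
      using that by (simp add: y_def algebra_simps)
    have fs: "coord (S \<mu>) s = 2 ^ T * (tree_min t ?x s - 1)" using s by (simp add: S_def f_def)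
    have \<mu>D: "\<mu> \<in> Rn D" using \<mu> TD(6) by (auto simp: cube_def)
    have zD: "z k \<in> Rn D" if "k < 2 ^ t" for k using zM[OF that] TD(6) by (auto simp: cube_def)
    have l1: "dist \<mu> (z k) \<le> (\<Sum>i<D. \<bar>coord \<mu> i - coord (z k) i\<bar>)" if "k < 2 ^ t" for k
      using norm_le_sum_coord[OF Rn_diff[OF \<mu>D zD[OF that]]] by (simp add: dist_norm)
    obtain k where k: "k < 2 ^ t" "tree_min t ?x s = ?x (s * 2 ^ t + k)" using tree_min_attained[of t ?x s] by blast
    have "coord (S \<mu>) s = 2 ^ T * (\<Sum>i<D. \<bar>coord \<mu> i - coord (z k) i\<bar>) + coord (a' (z k)) s"
      unfolding fs k(2) by (rule val[OF k(1)])
    moreover have "2 ^ T * dist \<mu> (z k) \<le> 2 ^ T * (\<Sum>i<D. \<bar>coord \<mu> i - coord (z k) i\<bar>)"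
      by (rule mult_left_mono[OF l1[OF k(1)]]) simp
    \<comment> \<open>By its Lipschitz bound the map lies below every entry of the minimum, hence
      below the extension; the nearest centre limits the excess.\<close>
    ultimately have low: "coord (a' \<mu>) s \<le> coord (S \<mu>) s" using a'_lip[OF s \<mu> zM[OF k(1)]] by linarith
    obtain j where j: "j < 2 ^ t" "dist \<mu> (z j) \<le> \<epsilon>" using Z(4)[OF \<mu>] z by fastforce
    have "coord (S \<mu>) s \<le> 2 ^ T * (?x (s * 2 ^ t + j) - 1)" unfolding fs using tree_min_le[OF j(1), of ?x s] by simp
    also have "\<dots> = 2 ^ T * (\<Sum>i<D. \<bar>coord \<mu> i - coord (z j) i\<bar>) + coord (a' (z j)) s" by (rule val[OF j(1)])
    finally have up: "coord (S \<mu>) s \<le> 2 ^ T * (\<Sum>i<D. \<bar>coord \<mu> i - coord (z j) i\<bar>) + coord (a' (z j)) s" .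
    have "(\<Sum>i<D. \<bar>coord \<mu> i - coord (z j) i\<bar>) \<le> real D * dist \<mu> (z j)" by (rule norm_diff_coord_le[OF \<mu>D zD[OF j(1)]])
    also have "\<dots> \<le> real D * \<epsilon>" by (rule mult_left_mono[OF j(2)]) simp
    finally have "2 ^ T * (\<Sum>i<D. \<bar>coord \<mu> i - coord (z j) i\<bar>) \<le> 2 ^ T * (real D * \<epsilon>)" by simp
    moreover have "2 ^ T * dist \<mu> (z j) \<le> 2 ^ T * (real D * \<epsilon>)"
    proof (rule mult_left_mono)
      have "0 \<le> \<epsilon>" using j(2) zero_le_dist[of \<mu> "z j"] by linarith
      then have "1 * \<epsilon> \<le> real D * \<epsilon>" using D by (intro mult_right_mono) auto
      then show "dist \<mu> (z j) \<le> real D * \<epsilon>" using j(2) by simp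
    qed simp
    \<comment> \<open>One half of \<open>e1\<close> pays for the distance term of the nearest
      centre, the other for the change of the map between the two points.\<close>
    moreover have "e1 = 2 ^ T * (real D * \<epsilon>) + 2 ^ T * (real D * \<epsilon>)" by (simp add: e1(1))
    ultimately have "coord (S \<mu>) s \<le> coord (a' \<mu>) s + e1" using up a'_lip[OF s \<mu> zM[OF j(1)]] by linarith
    with low show ?thesis by simp
  qed
  have close: "norm (S \<mu> - a' \<mu>) \<le> sqrt (real r) * e1" if \<mu>: "\<mu> \<in> man P" for \<mu>
    by (rule norm_le_sqrt_dim[OF Rn_diff[OF S_Rn]]) (use S_close[OF \<mu>] e1(2) coef_solves(2) in \<open>auto simp: a'_def intro!: Rn_scaleR\<close>)
  have na: "\<eta> * norm (coef P \<mu>) \<le> sqrt (real r) * e1" if \<mu>: "\<mu> \<in> man P" for \<mu>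
  proof -
    have "\<eta> * norm (coef P \<mu>) \<le> \<eta> * R\<^sub>a" by (rule mult_left_mono[OF norm_coef_le[OF \<mu>] \<eta>0])
    also have "\<dots> = sqrt (real r) * e1" by (rule \<eta>R)
    finally show ?thesis .
  qed
  have "norm (S \<mu>) \<le> R" if \<mu>: "\<mu> \<in> man P" for \<mu>
  proof -
    have "norm (S \<mu>) \<le> norm (S \<mu> - a' \<mu>) + norm (a' \<mu>)" using norm_triangle_ineq[of "S \<mu> - a' \<mu>" "a' \<mu>"] by simp
    also have "norm (a' \<mu>) = (1 - \<eta>) * norm (coef P \<mu>)" using \<eta>1 by (simp add: a'_def)
    also have "\<dots> \<le> (1 - \<eta>) * R\<^sub>a" by (rule mult_left_mono[OF norm_coef_le[OF \<mu>]]) (use \<eta>1 in simp)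
    also have "\<dots> = R\<^sub>a - \<eta> * R\<^sub>a" by (simp only: left_diff_distrib mult_1_left)
    also have "\<eta> * R\<^sub>a = sqrt (real r) * e1" by (rule \<eta>R)
    finally show ?thesis using close[OF \<mu>] R by linarith
  qed
  moreover have "S \<mu> = of_vec (net_eval net (to_vec D \<mu>))" for \<mu>
    unfolding to_vec_def ev of_vec_def S_def by (rule evec_eqI) simp
  ultimately have "S \<in> net_class D (man P) r R \<kappa> (2 * t + T + 6) (2 ^ t * (2 * D + 2 * r)) (2 ^ t * (4 * D + r * (2 * D + 4 * T + 23)))"
    unfolding net_class_def using net
    by (intro CollectI conjI exI[of _ net]) (simp_all add: weights_le_def net_nnz_def)
  moreover have "norm (S \<mu> - coef P \<mu>) \<le> 2 * sqrt (real r) * e1" if \<mu>: "\<mu> \<in> man P" for \<mu>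
  proof -
    have "S \<mu> - coef P \<mu> = (S \<mu> - a' \<mu>) - \<eta> *\<^sub>R coef P \<mu>" by (simp add: a'_def algebra_simps)
    then have "norm (S \<mu> - coef P \<mu>) \<le> norm (S \<mu> - a' \<mu>) + norm (\<eta> *\<^sub>R coef P \<mu>)"
      by (simp only: norm_triangle_ineq4)
    then show ?thesis using close[OF \<mu>] na[OF \<mu>] \<eta>0 by simp
  qed
  ultimately show ?thesis by blast
qed

text \<open>The coefficients are Lipschitz for the geodesic distance, while the Borel sets come from
  the Euclidean topology; the bound of the former distance by the latter gives continuity.\<close>

lemma coef_measurable: "coef P \<in> borel_measurable (par_law P)"
proof -
  note TD = transport_settingD[OF T]
  obtain \<Lambda> where \<Lambda>: "0 \<le> \<Lambda>" "\<And>p q. p \<in> man P \<Longrightarrow> q \<in> man P \<Longrightarrow> (\<exists>l. joined_by (man P) p q l) \<and> geodesic_dist (man P) p q \<le> \<Lambda> * dist p q"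
    by (rule geodesic_dist_lipschitz[OF TD(3,4,5)]) blast
  let ?l = "2 * sqrt (real r) * (Lip * U) / \<gamma>"
  have l: "0 \<le> ?l" using pos by simp
  have "(?l * \<Lambda>)-lipschitz_on (man P) (coef P)"
  proof (rule lipschitz_onI)
    fix x y assume xy: "x \<in> man P" "y \<in> man P"
    have "dist (coef P x) (coef P y) \<le> ?l * par_dist P y x" unfolding dist_norm by (rule coef_lipschitz[OF xy])
    also have "\<dots> \<le> ?l * (\<Lambda> * dist y x)" using \<Lambda>(2)[OF xy(2,1)] l unfolding par_dist_def by (intro mult_left_mono) auto
    finally show "dist (coef P x) (coef P y) \<le> ?l * \<Lambda> * dist x y" by (simp add: dist_commute mult.assoc)
  qed (use l \<Lambda>(1) in \<open>rule mult_nonneg_nonneg\<close>)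
  then have "continuous_on (man P) (coef P)" by (rule lipschitz_on_continuous_on)
  then show ?thesis
    by (subst measurable_cong_sets[OF TD(9) refl]) (rule borel_measurable_continuous_on_restrict)
qed

text \<open>The rounding step \<open>\<eta>\<close> is chosen so that the radius of the cover equals
  \<open>1 / n\<close>, which does not exceed the rate; it enters the cardinality of the cover only
  through a logarithm.\<close>

lemma erm_expected_error:
  assumes erm: "erm_estimator P n (net_class D (man P) r R \<kappa> L p K) ahat"
    and R: "R\<^sub>a \<le> R" and \<kappa>: "0 \<le> \<kappa>" and n: "1 \<le> n" and L: "1 \<le> L" and w: "1 \<le> w" "p \<le> w" "D \<le> w" "r \<le> w"
    and S: "S \<in> net_class D (man P) r R \<kappa> L p K" "\<And>\<mu>. \<mu> \<in> man P \<Longrightarrow> norm (S \<mu> - coef P \<mu>) \<le> e0"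
    and X: "1 \<le> X" "amb_bound P \<le> X"
    and \<eta>: "\<eta> = 1 / (real n * sqrt (real r) * real L * (real (w + 1) * max 1 \<kappa>) ^ L * X)"
  shows "(\<integral>\<^sup>+X. ennreal (LINT \<mu>|par_law P. (norm (ahat X \<mu> - coef P \<mu>))\<^sup>2) \<partial>sample_law P n)
    \<le> ennreal (2 * e0\<^sup>2 + 6 * (R + 1 + R\<^sub>a) / real n + 2 * (R + 1 + R\<^sub>a)\<^sup>2 / real n *
        (ln (real L * (real L * real w * real (w + 1) * (2 * (\<kappa> / \<eta>) + 1)) ^ K) + 1))"
proof -
  note TD = transport_settingD[OF T]
  note sp = space_par_law[OF T]
  let ?F = "net_class D (man P) r R \<kappa> L p K" and ?q = "real (w + 1) * max 1 \<kappa>"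
  have q: "1 \<le> ?q" using mult_mono[of 1 "real (w + 1)" 1 "max 1 \<kappa>"] by simp
  have den: "0 < real n * sqrt (real r) * real L * ?q ^ L * X"
    using n r L q X by (intro mult_pos_pos) (auto intro: zero_less_power)
  then have \<eta>0: "0 < \<eta>" unfolding \<eta> by (simp only: zero_less_divide_1_iff)
  have \<delta>: "sqrt (real r) * (real L * ?q ^ L * \<eta> * X) = 1 / real n"
  proof -
    have "real n * (sqrt (real r) * (real L * ?q ^ L * \<eta> * X)) = (real n * sqrt (real r) * real L * ?q ^ L * X) * \<eta>"
      by (simp only: mult_ac)
    also have "\<dots> = 1" unfolding \<eta> using den by (simp only: mult_1_right times_divide_eq_right divide_self less_imp_neq[symmetric] not_False_eq_True)
    finally show ?thesis using n by (simp add: field_simps)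
  qed
  \<comment> \<open>Rounded networks may exceed the output bound. Codes with values bounded by
    \<open>R + 1\<close> are kept: this loses none within distance one of the class and gives the
    uniform range that the deviation bound needs.\<close>
  define I where "I = {c \<in> codes L w (\<kappa> / \<eta>) K. \<forall>\<mu>\<in>man P. norm (code_map w r \<eta> c \<mu>) \<le> R + 1}"
  have finI: "finite I" unfolding I_def using finite_codes by simp
  have Rpos: "2 \<le> R" using R R_a_ge_2 by linarith
  have SX: "ahat X \<in> ?F" "\<And>S. S \<in> ?F \<Longrightarrow> emp_risk P n X (ahat X) \<le> emp_risk P n X S"
    if "X \<in> space (sample_law P n)" for X
    using erm that unfolding erm_estimator_def by blast+
  have norm_F: "norm (S \<mu>) \<le> R" if "S \<in> ?F" "\<mu> \<in> man P" for S \<mu> using that unfolding net_class_def by blast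
  have cover: "\<exists>c\<in>I. \<forall>\<mu>\<in>man P. norm (S \<mu> - code_map w r \<eta> c \<mu>) \<le> 1 / real n" if S: "S \<in> ?F" for S
  proof -
    obtain c where c: "c \<in> codes L w (\<kappa> / \<eta>) K" "\<forall>\<mu>\<in>man P. norm (S \<mu> - code_map w r \<eta> c \<mu>) \<le> 1 / real n"
      using net_class_cover[OF TD(6) S \<kappa> \<eta>0 w X] unfolding \<delta> by blast
    have "norm (code_map w r \<eta> c \<mu>) \<le> R + 1" if \<mu>: "\<mu> \<in> man P" for \<mu>
    proof -
      have "norm (code_map w r \<eta> c \<mu>) \<le> norm (S \<mu>) + norm (S \<mu> - code_map w r \<eta> c \<mu>)"
        using norm_triangle_ineq4[of "S \<mu>" "S \<mu> - code_map w r \<eta> c \<mu>"] by simp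
      moreover have "1 / real n \<le> 1" using n by simp
      ultimately show ?thesis using norm_F[OF S \<mu>] c(2) \<mu> by fastforce
    qed
    then show ?thesis using c unfolding I_def by blast
  qed
  have card: "ln (real (card I)) \<le> ln (real L * (real L * real w * real (w + 1) * (2 * (\<kappa> / \<eta>) + 1)) ^ K)"
  proof -
    have "I \<noteq> {}" using cover[OF S(1)] by blast
    then have 1: "0 < card I" using finI by (simp add: card_gt_0_iff)
    have "card I \<le> card (codes L w (\<kappa> / \<eta>) K)" unfolding I_def by (rule card_mono[OF finite_codes]) blast
    moreover have "0 \<le> \<kappa> / \<eta>" using \<kappa> \<eta>0 by simp
    ultimately have "real (card I) \<le> real L * (real L * real w * real (w + 1) * (2 * (\<kappa> / \<eta>) + 1)) ^ K"
      using card_codes_le[of "\<kappa> / \<eta>" L w K] by linarith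
    then show ?thesis using 1 by (intro ln_mono) auto
  qed
  have "(\<integral>\<^sup>+X. ennreal (LINT \<mu>|par_law P. (norm (ahat X \<mu> - coef P \<mu>))\<^sup>2) \<partial>PiM {..<n} (\<lambda>_. par_law P))
    \<le> ennreal (2 * e0\<^sup>2 + 6 * (R + 1 + R\<^sub>a) * (1 / real n) + 2 * (R + 1 + R\<^sub>a)\<^sup>2 / real n * (ln (real (card I)) + 1))"
  proof (rule erm_oracle_bound[where T = "code_map w r \<eta>" and I = I])
    show "prob_space (par_law P)" by (rule TD(7))
    show "coef P \<in> borel_measurable (par_law P)" by (rule coef_measurable)
    show "finite I" by (rule finI)
    show "code_map w r \<eta> c \<in> borel_measurable (par_law P)" for c
      by (subst measurable_cong_sets[OF TD(9) refl]) (rule measurable_restrict_space1[OF code_map_measurable])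
    show "0 < R + 1 + R\<^sub>a" using Rpos R_a_ge_2 by linarith
    show "0 \<le> 1 / real n" by simp
    show "1 \<le> n" by (rule n)
    fix c \<mu> assume c: "c \<in> I" and "\<mu> \<in> space (par_law P)"
    then have \<mu>: "\<mu> \<in> man P" by (simp add: sp)
    have "norm (code_map w r \<eta> c \<mu> - coef P \<mu>) \<le> norm (code_map w r \<eta> c \<mu>) + norm (coef P \<mu>)" by (rule norm_triangle_ineq4)
    moreover have "norm (code_map w r \<eta> c \<mu>) \<le> R + 1" using c \<mu> unfolding I_def by blast
    ultimately show "norm (code_map w r \<eta> c \<mu> - coef P \<mu>) \<le> R + 1 + R\<^sub>a" using norm_coef_le[OF \<mu>] by linarith
  next
    fix X assume X: "X \<in> space (PiM {..<n} (\<lambda>_. par_law P))"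
    then have XS: "X \<in> space (sample_law P n)" by (simp add: sample_law_def)
    have "(\<lambda>(X, \<mu>). ahat X \<mu>) \<in> borel_measurable (sample_law P n \<Otimes>\<^sub>M par_law P)"
      using erm unfolding erm_estimator_def by blast
    from measurable_compose[OF measurable_Pair1'[OF XS] this]
    show "ahat X \<in> borel_measurable (par_law P)" by simp
    show "\<exists>c\<in>I. \<forall>\<mu>\<in>space (par_law P). norm (ahat X \<mu> - code_map w r \<eta> c \<mu>) \<le> 1 / real n"
      unfolding sp by (rule cover[OF SX(1)[OF XS]])
    have "(\<Sum>j<n. (norm (ahat X (X j) - coef P (X j)))\<^sup>2) / real n \<le> (\<Sum>j<n. (norm (S (X j) - coef P (X j)))\<^sup>2) / real n"
      using SX(2)[OF XS S(1)] unfolding emp_risk_def .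
    also have "\<dots> \<le> (\<Sum>j<n. e0\<^sup>2) / real n"
    proof (intro divide_right_mono sum_mono power_mono S(2))
      fix j assume "j \<in> {..<n}"
      then show "X j \<in> man P" using X by (auto simp: space_PiM PiE_def Pi_def sp)
    qed auto
    also have "\<dots> = e0\<^sup>2" using n by simp
    finally show "(\<Sum>j<n. (norm (ahat X (X j) - coef P (X j)))\<^sup>2) / real n \<le> e0\<^sup>2" .
    fix \<mu> assume "\<mu> \<in> space (par_law P)"
    then have \<mu>: "\<mu> \<in> man P" by (simp add: sp)
    have "norm (ahat X \<mu> - coef P \<mu>) \<le> norm (ahat X \<mu>) + norm (coef P \<mu>)" by (rule norm_triangle_ineq4)
    then show "norm (ahat X \<mu> - coef P \<mu>) \<le> R + 1 + R\<^sub>a" using norm_F[OF SX(1)[OF XS] \<mu>] norm_coef_le[OF \<mu>] by linarith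
  qed
  also have "\<dots> \<le> ennreal (2 * e0\<^sup>2 + 6 * (R + 1 + R\<^sub>a) / real n + 2 * (R + 1 + R\<^sub>a)\<^sup>2 / real n *
        (ln (real L * (real L * real w * real (w + 1) * (2 * (\<kappa> / \<eta>) + 1)) ^ K) + 1))"
    by (rule ennreal_leI) (use card in \<open>intro add_mono mult_left_mono, auto\<close>)
  finally show ?thesis unfolding sample_law_def .
qed

text \<open>Serves the finitely many small \<open>n\<close> that lie below the threshold of the
  approximation argument.\<close>

lemma erm_trivial_error:
  assumes erm: "erm_estimator P n (net_class D (man P) r R \<kappa> L p K) ahat" and R: "R\<^sub>a \<le> R"
  shows "(\<integral>\<^sup>+X. ennreal (LINT \<mu>|par_law P. (norm (ahat X \<mu> - coef P \<mu>))\<^sup>2) \<partial>sample_law P n) \<le> ennreal ((R + 1 + R\<^sub>a)\<^sup>2)"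
proof -
  note TD = transport_settingD[OF T]
  interpret prob_space "par_law P" by (rule TD(7))
  interpret S: prob_space "sample_law P n" unfolding sample_law_def by (rule prob_space_PiM) (rule TD(7))
  have "(LINT \<mu>|par_law P. (norm (ahat X \<mu> - coef P \<mu>))\<^sup>2) \<le> (R + 1 + R\<^sub>a)\<^sup>2" if X: "X \<in> space (sample_law P n)" for X
  proof -
    have "(LINT \<mu>|par_law P. (norm (ahat X \<mu> - coef P \<mu>))\<^sup>2) \<le> (LINT \<mu>|par_law P. (R + 1 + R\<^sub>a)\<^sup>2)"
    proof (rule integral_mono')
      fix \<mu> assume "\<mu> \<in> space (par_law P)"
      then have \<mu>: "\<mu> \<in> man P" by (simp add: space_par_law[OF T])
      have "ahat X \<in> net_class D (man P) r R \<kappa> L p K" using erm X unfolding erm_estimator_def by blast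
      then have "norm (ahat X \<mu>) \<le> R" using \<mu> unfolding net_class_def by blast
      then have "norm (ahat X \<mu> - coef P \<mu>) \<le> R + 1 + R\<^sub>a"
        using norm_triangle_ineq4[of "ahat X \<mu>" "coef P \<mu>"] norm_coef_le[OF \<mu>] by linarith
      then show "(norm (ahat X \<mu> - coef P \<mu>))\<^sup>2 \<le> (R + 1 + R\<^sub>a)\<^sup>2" by (rule power_mono) simp
    qed auto
    then show ?thesis using prob_space by simp
  qed
  then have "(\<integral>\<^sup>+X. ennreal (LINT \<mu>|par_law P. (norm (ahat X \<mu> - coef P \<mu>))\<^sup>2) \<partial>sample_law P n)
    \<le> (\<integral>\<^sup>+X. ennreal ((R + 1 + R\<^sub>a)\<^sup>2) \<partial>sample_law P n)" by (intro nn_integral_mono ennreal_leI)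
  then show ?thesis by (simp add: S.emeasure_space_1)
qed

lemma expected_error_le:
  assumes erm: "erm_estimator P n (net_class D (man P) r R \<kappa> L p K) ahat"
    and vc: "volume_condition P \<theta>" and sa: "skeleton_accurate P \<theta> C" and B: "0 \<le> B"
    and V: "(\<integral>\<^sup>+X. ennreal (LINT \<mu>|par_law P. (norm (ahat X \<mu> - coef P \<mu>))\<^sup>2) \<partial>sample_law P n) \<le> ennreal B"
  shows "expected_error P n ahat \<le> ennreal (2 * (C * (real r + 1) / \<theta> * sing_val P (r + 1))\<^sup>2
    + 2 * (\<Gamma> * (quad_const r \<gamma> U Lip Cq * h\<^sup>2)) + 2 * \<Gamma> * B)"
proof -
  note TD = transport_settingD[OF T]
  interpret prob_space "par_law P" by (rule TD(7))
  interpret S: prob_space "sample_law P n" unfolding sample_law_def by (rule prob_space_PiM) (rule TD(7))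
  define k0 where "k0 = 2 * (C * (real r + 1) / \<theta> * sing_val P (r + 1))\<^sup>2 + 2 * (\<Gamma> * (quad_const r \<gamma> U Lip Cq * h\<^sup>2))"
  have k0: "0 \<le> k0" unfolding k0_def using Gamma_pos by (simp add: quad_const_def)
  let ?V = "\<lambda>X. LINT \<mu>|par_law P. (norm (ahat X \<mu> - coef P \<mu>))\<^sup>2"
  have inner: "(\<integral>\<^sup>+\<mu>. W2_sq (target P \<mu>) (recon_measure P (ahat X) \<mu>) \<partial>par_law P) \<le> ennreal k0 + ennreal (2 * \<Gamma>) * ennreal (?V X)"
    if X: "X \<in> space (sample_law P n)" for X
  proof -
    have F: "ahat X \<in> net_class D (man P) r R \<kappa> L p K" using erm X unfolding erm_estimator_def by blast
    have meas: "ahat X \<in> borel_measurable (par_law P)"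
    proof -
      have "(\<lambda>(X, \<mu>). ahat X \<mu>) \<in> borel_measurable (sample_law P n \<Otimes>\<^sub>M par_law P)"
        using erm unfolding erm_estimator_def by blast
      from measurable_compose[OF measurable_Pair1'[OF X] this] show ?thesis by simp
    qed
    have [measurable]: "(\<lambda>\<mu>. (norm (ahat X \<mu> - coef P \<mu>))\<^sup>2) \<in> borel_measurable (par_law P)"
      using meas coef_measurable by measurable
    have bd: "norm (ahat X \<mu> - coef P \<mu>) \<le> R + R\<^sub>a" if \<mu>: "\<mu> \<in> man P" for \<mu>
    proof -
      have "norm (ahat X \<mu>) \<le> R" using F \<mu> unfolding net_class_def by blast
      then show ?thesis using norm_triangle_ineq4[of "ahat X \<mu>" "coef P \<mu>"] norm_coef_le[OF \<mu>] by linarith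
    qed
    have int: "integrable (par_law P) (\<lambda>\<mu>. (norm (ahat X \<mu> - coef P \<mu>))\<^sup>2)"
      by (rule integrable_const_bound[where B = "(R + R\<^sub>a)\<^sup>2"])
        (use bd in \<open>auto intro!: AE_I2 power_mono simp: space_par_law[OF T]\<close>)
    have "(\<integral>\<^sup>+\<mu>. W2_sq (target P \<mu>) (recon_measure P (ahat X) \<mu>) \<partial>par_law P)
      \<le> (\<integral>\<^sup>+\<mu>. ennreal k0 + ennreal (2 * \<Gamma>) * ennreal ((norm (ahat X \<mu> - coef P \<mu>))\<^sup>2) \<partial>par_law P)"
    proof (rule nn_integral_mono)
      fix \<mu> assume "\<mu> \<in> space (par_law P)"
      then have \<mu>: "\<mu> \<in> man P" by (simp add: space_par_law[OF T])
      \<comment> \<open>Membership in the class fixes the output dimension, which the Gram estimate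
        for the coefficient error presupposes.\<close>
      have "ahat X \<mu> \<in> Rn r"
      proof -
        obtain net where "wf_net p D r net" "ahat X \<mu> = of_vec (net_eval net (to_vec D \<mu>))"
          using F \<mu> unfolding net_class_def by blast
        moreover have "net_eval net (to_vec D \<mu>) \<in> carrier_vec r"
          using pnet_pad[OF \<open>wf_net p D r net\<close>, of "max p D" "to_vec D \<mu>" "\<lambda>i. if i < D then vec_index (to_vec D \<mu>) i else 0"]
          by (simp add: to_vec_def)
        ultimately show ?thesis by (simp add: of_vec_def)
      qed
      from signature_error_estimator[OF \<mu> vc sa this]
      have "(LINT x|dx P. (signature P \<mu> x - expansion (ahat X \<mu>) x)\<^sup>2) \<le> k0 + 2 * \<Gamma> * (norm (ahat X \<mu> - coef P \<mu>))\<^sup>2"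
        unfolding k0_def .
      moreover have "recon_signature P (ahat X) \<mu> = expansion (ahat X \<mu>)"
        by (auto simp: recon_signature_def expansion_def)
      ultimately have "W2_sq (target P \<mu>) (recon_measure P (ahat X) \<mu>) \<le> ennreal (k0 + 2 * \<Gamma> * (norm (ahat X \<mu> - coef P \<mu>))\<^sup>2)"
        using W2_sq_recon_le[OF T \<mu>, of "ahat X"] by (simp add: order_trans[OF _ ennreal_leI])
      also have "\<dots> = ennreal k0 + ennreal (2 * \<Gamma>) * ennreal ((norm (ahat X \<mu> - coef P \<mu>))\<^sup>2)"
        using k0 Gamma_pos by (simp add: ennreal_plus ennreal_mult)
      finally show "W2_sq (target P \<mu>) (recon_measure P (ahat X) \<mu>)
        \<le> ennreal k0 + ennreal (2 * \<Gamma>) * ennreal ((norm (ahat X \<mu> - coef P \<mu>))\<^sup>2)" .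
    qed
    also have "\<dots> = ennreal k0 + ennreal (2 * \<Gamma>) * (\<integral>\<^sup>+\<mu>. ennreal ((norm (ahat X \<mu> - coef P \<mu>))\<^sup>2) \<partial>par_law P)"
      by (simp add: nn_integral_add nn_integral_cmult emeasure_space_1)
    also have "(\<integral>\<^sup>+\<mu>. ennreal ((norm (ahat X \<mu> - coef P \<mu>))\<^sup>2) \<partial>par_law P) = ennreal (?V X)"
      by (rule nn_integral_eq_integral[OF int]) simp
    finally show ?thesis .
  qed
  have Vm: "(\<lambda>X. ennreal (?V X)) \<in> borel_measurable (sample_law P n)"
  proof -
    have [measurable]: "(\<lambda>(X, \<mu>). ahat X \<mu>) \<in> borel_measurable (sample_law P n \<Otimes>\<^sub>M par_law P)"
      using erm unfolding erm_estimator_def by blast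
    note [measurable] = coef_measurable
    have "(\<lambda>(X, \<mu>). (norm (ahat X \<mu> - coef P \<mu>))\<^sup>2) \<in> borel_measurable (sample_law P n \<Otimes>\<^sub>M par_law P)"
      unfolding case_prod_unfold by measurable
    from borel_measurable_lebesgue_integral[OF this] show ?thesis by measurable
  qed
  have "expected_error P n ahat \<le> (\<integral>\<^sup>+X. ennreal k0 + ennreal (2 * \<Gamma>) * ennreal (?V X) \<partial>sample_law P n)"
    unfolding expected_error_def by (rule nn_integral_mono[OF inner])
  also have "\<dots> = ennreal k0 + ennreal (2 * \<Gamma>) * (\<integral>\<^sup>+X. ennreal (?V X) \<partial>sample_law P n)"
    by (subst nn_integral_add) (use Vm in \<open>simp_all add: nn_integral_cmult S.emeasure_space_1\<close>)
  also have "\<dots> \<le> ennreal k0 + ennreal (2 * \<Gamma>) * ennreal B" by (intro add_left_mono mult_left_mono V) simp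
  also have "\<dots> = ennreal (k0 + 2 * \<Gamma> * B)" using k0 B Gamma_pos by (simp add: ennreal_plus ennreal_mult)
  finally show ?thesis unfolding k0_def .
qed

end

text \<open>Depth and logarithmic width are both of order \<open>g\<close>, the size of
  \<open>ln n\<close>. The amplification factor of the cover is a power with the depth as exponent,
  so its logarithm is of order \<open>g\<^sup>2\<close>; multiplied by the sparsity this is the
  entropy.\<close>

lemma log_code_bound:
  fixes g aL a1 X \<kappa> :: real and n r w L K :: nat
  assumes g: "1 \<le> g" "ln (real n) \<le> g" and n: "1 \<le> n" and L: "1 \<le> L" "real L \<le> aL * g"
    and w: "1 \<le> w" "ln (real (w + 1)) \<le> a1 * g" and \<kappa>: "1 \<le> \<kappa>" and X: "1 \<le> X" and r: "1 \<le> r"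
    and \<eta>: "\<eta> = 1 / (real n * sqrt (real r) * real L * (real (w + 1) * max 1 \<kappa>) ^ L * X)"
  shows "ln (real L * (real L * real w * real (w + 1) * (2 * (\<kappa> / \<eta>) + 1)) ^ K) + 1
    \<le> aL * g + real K * ((2 * aL + 2 * a1 + 2 * \<kappa> + 2 + real r + aL * (a1 + \<kappa>) + X) * g\<^sup>2) + 1"
proof -
  define E where "E = real n * sqrt (real r) * real L * (real (w + 1) * \<kappa>) ^ L * X"
  have E: "\<eta> = 1 / E" using \<kappa> unfolding \<eta> E_def by (simp add: max_absorb2)
  have wk: "1 \<le> real (w + 1) * \<kappa>" using mult_mono[of 1 "real (w + 1)" 1 \<kappa>] \<kappa> by simp
  have "1 * 1 * 1 * 1 * 1 \<le> E" unfolding E_def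
    by (intro mult_mono) (use n r L X one_le_power[OF wk, of L] wk \<kappa> in \<open>auto intro: mult_nonneg_nonneg\<close>)
  then have E1: "1 \<le> E" by simp
  have lnle: "ln x \<le> x" if "0 < x" for x :: real using ln_le_minus_one[OF that] by simp
  have pw: "0 < (real (w + 1) * \<kappa>) ^ L" using wk by (intro zero_less_power) linarith
  have lnE: "ln E = ln (real n) + ln (sqrt (real r)) + ln (real L) + real L * (ln (real (w + 1)) + ln \<kappa>) + ln X"
  proof -
    have p: "0 < real n" "0 < sqrt (real r)" "0 < real L" "0 < X" "0 < real (w + 1)" "0 < \<kappa>" using n r L X \<kappa> by auto
    have "ln E = ln (real n) + ln (sqrt (real r)) + ln (real L) + ln ((real (w + 1) * \<kappa>) ^ L) + ln X"
      unfolding E_def using p pw by (simp only: ln_mult_pos mult_pos_pos)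
    also have "ln ((real (w + 1) * \<kappa>) ^ L) = real L * (ln (real (w + 1)) + ln \<kappa>)"
      using p by (simp only: ln_realpow ln_mult_pos mult_pos_pos)
    finally show ?thesis .
  qed
  have sr: "sqrt (real r) \<le> real r" using r by (intro real_le_lsqrt) (auto simp: power2_eq_square)
  have gg: "g \<le> g\<^sup>2" "1 \<le> g\<^sup>2" using g(1) by (auto simp: power2_eq_square intro: mult_le_one mult_mono[of 1 g 1 g, simplified])
  have aL: "0 \<le> aL * g" using L by linarith
  then have aL0: "0 \<le> aL" using g(1) by (simp add: zero_le_mult_iff)
  have lw: "0 \<le> ln (real (w + 1))" by simp
  then have "0 \<le> a1 * g" using w by linarith
  then have a10: "0 \<le> a1" using g(1) by (simp add: zero_le_mult_iff)
  have "ln (sqrt (real r)) \<le> real r" using lnle[of "sqrt (real r)"] sr r by simp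
  moreover have "ln (real L) \<le> aL * g" using lnle[of "real L"] L by linarith
  moreover have "real L * (ln (real (w + 1)) + ln \<kappa>) \<le> (aL * g) * (a1 * g + \<kappa>)"
    using L w lnle[of \<kappa>] \<kappa> lw by (intro mult_mono add_mono) auto
  moreover have "(aL * g) * (a1 * g + \<kappa>) \<le> aL * (a1 + \<kappa>) * g\<^sup>2"
  proof -
    have "a1 * g + \<kappa> \<le> (a1 + \<kappa>) * g" using mult_left_mono[OF g(1), of \<kappa>] \<kappa> by (simp add: distrib_right)
    from mult_left_mono[OF this aL] show ?thesis by (simp add: power2_eq_square mult_ac)
  qed
  moreover have "ln X \<le> X" using lnle X by simp
  ultimately have lnE_le: "ln E \<le> g + real r + aL * g + aL * (a1 + \<kappa>) * g\<^sup>2 + X"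
    unfolding lnE using g(2) by linarith
  have "2 * (\<kappa> / \<eta>) + 1 \<le> (2 * \<kappa> + 1) * E" using E1 unfolding E by (simp add: distrib_right)
  moreover have "0 < 2 * (\<kappa> / \<eta>) + 1" using \<kappa> E1 unfolding E by (simp add: add_nonneg_pos)
  ultimately have "ln (2 * (\<kappa> / \<eta>) + 1) \<le> ln ((2 * \<kappa> + 1) * E)" by (intro ln_mono) auto
  also have "\<dots> = ln (2 * \<kappa> + 1) + ln E" using \<kappa> E1 by (simp add: ln_mult_pos)
  finally have l3: "ln (2 * (\<kappa> / \<eta>) + 1) \<le> 2 * \<kappa> + 1 + ln E" using lnle[of "2 * \<kappa> + 1"] \<kappa> by linarith
  have "ln (real w) \<le> ln (real (w + 1))" using w by (intro ln_mono) auto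
  then have lw1: "ln (real w) \<le> a1 * g" using w by linarith
  have pos: "0 < real L" "0 < real w" "0 < real (w + 1)" "0 < 2 * (\<kappa> / \<eta>) + 1"
    using L w \<open>0 < 2 * (\<kappa> / \<eta>) + 1\<close> by auto
  have inner: "ln (real L * real w * real (w + 1) * (2 * (\<kappa> / \<eta>) + 1))
     = ln (real L) + ln (real w) + ln (real (w + 1)) + ln (2 * (\<kappa> / \<eta>) + 1)"
    using pos by (simp only: ln_mult_pos mult_pos_pos)
  define Z where "Z = 2 * aL + 2 * a1 + 2 * \<kappa> + 2 + real r + aL * (a1 + \<kappa>) + X"
  have "ln (real L * real w * real (w + 1) * (2 * (\<kappa> / \<eta>) + 1))
     \<le> aL * g + 2 * (a1 * g) + (2 * \<kappa> + 1 + (g + real r + aL * g + aL * (a1 + \<kappa>) * g\<^sup>2 + X))"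
    unfolding inner using lnE_le l3 lw1 w(2) \<open>ln (real L) \<le> aL * g\<close> by linarith
  also have "\<dots> \<le> Z * g\<^sup>2"
  proof -
    have "aL * g \<le> aL * g\<^sup>2" "a1 * g \<le> a1 * g\<^sup>2" using gg aL0 a10 by (auto intro: mult_left_mono)
    moreover have "2 * \<kappa> \<le> (2 * \<kappa>) * g\<^sup>2" "real r \<le> real r * g\<^sup>2" "X \<le> X * g\<^sup>2" using gg \<kappa> X by (simp_all add: mult_le_cancel_left1)
    ultimately show ?thesis using gg unfolding Z_def distrib_right by linarith
  qed
  finally have "real K * ln (real L * real w * real (w + 1) * (2 * (\<kappa> / \<eta>) + 1)) \<le> real K * (Z * g\<^sup>2)"
    by (rule mult_left_mono) simp
  moreover have "ln (real L * (real L * real w * real (w + 1) * (2 * (\<kappa> / \<eta>) + 1)) ^ K)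
    = ln (real L) + real K * ln (real L * real w * real (w + 1) * (2 * (\<kappa> / \<eta>) + 1))"
    using pos by (simp only: ln_mult_pos mult_pos_pos zero_less_power ln_realpow)
  ultimately show ?thesis using \<open>ln (real L) \<le> aL * g\<close> unfolding Z_def by linarith
qed

lemma ex_dyadic_between:
  fixes x :: real assumes "1 \<le> x" shows "\<exists>t::nat. x \<le> 2 ^ t \<and> 2 ^ t \<le> 2 * x"
proof -
  obtain m :: nat where m: "x < 2 ^ m" using real_arch_pow[of 2 x] by auto
  define t where "t = (LEAST t. x \<le> 2 ^ t)"
  have t: "x \<le> 2 ^ t" unfolding t_def by (rule LeastI[of _ m]) (use m in simp)
  have "2 ^ t \<le> 2 * x"
  proof (cases t)
    case (Suc k)
    then have "\<not> x \<le> 2 ^ k" using not_less_Least[of k "\<lambda>t. x \<le> 2 ^ t"] unfolding t_def by simp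
    then show ?thesis using Suc by simp
  qed (use assms in simp)
  with t show ?thesis by blast
qed

lemma dyadic_exponent_le:
  fixes t :: nat assumes "2 ^ t \<le> (y::real)" "0 < y" shows "real t \<le> 2 * ln y"
proof -
  have "real t * ln 2 = ln (2 ^ t)" by (simp add: ln_realpow)
  also have "\<dots> \<le> ln y" using assms by (intro ln_mono) auto
  finally have "real t * ln 2 \<le> ln y" .
  moreover have "real t * (1 / 2) \<le> real t * ln 2" using ln2_ge_two_thirds by (intro mult_left_mono) auto
  ultimately show ?thesis by linarith
qed

text \<open>The accuracy \<open>n powr (-1/(2+d))\<close> balances the squared approximation error against the ratio of
  the number \<open>n powr (d/(2+d))\<close> of network parameters to the sample size.\<close>

lemma ex_network_sizes:
  fixes D r d T :: nat and C b :: real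
  assumes D: "1 \<le> D" and r: "1 \<le> r" and C: "1 \<le> C" and b: "0 < b"
  shows "\<exists>n0 c (t :: nat \<Rightarrow> nat). 3 \<le> n0 \<and> 0 \<le> c \<and> (\<forall>n\<ge>n0.
    let g = ln (real n); u = real n powr (real d / (2 + real d)); \<epsilon> = real n powr (- 1 / (2 + real d));
        L = 2 * t n + T + 6; p = 2 ^ t n * (2 * D + 2 * r); K = 2 ^ t n * (4 * D + r * (2 * D + 4 * T + 23));
        \<kappa> = 2 * max 1 b; X = max 1 b;
        \<eta> = 1 / (real n * sqrt (real r) * real L * (real (p + 1) * max 1 \<kappa>) ^ L * X)
    in C * u \<le> 2 ^ t n \<and> 2 ^ (T + 1) * real D * \<epsilon> \<le> 2 \<and>
      real L \<le> g\<^sup>2 \<and> real p \<le> g * u \<and> real K \<le> g * u \<and>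
      ln (real L * (real L * real p * real (p + 1) * (2 * (\<kappa> / \<eta>) + 1)) ^ K) + 1 \<le> c * u * g\<^sup>2)"
proof -
  define \<kappa> where "\<kappa> = 2 * max 1 b"
  define X where "X = max 1 b"
  have \<kappa>: "2 \<le> \<kappa>" and X: "1 \<le> X" by (auto simp: \<kappa>_def X_def)
  define aL where "aL = 4 * ln (2 * C) + 4 + real T + 6"
  define aw where "aw = 2 * C * (2 * real D + 2 * real r)"
  define a1 where "a1 = ln (aw + 1) + 1"
  define aK where "aK = 2 * C * (4 * real D + real r * (2 * real D + 4 * real T + 23))"
  define Z where "Z = 2 * aL + 2 * a1 + 2 * \<kappa> + 2 + real r + aL * (a1 + \<kappa>) + X"
  have lnC: "0 \<le> ln (2 * C)" using C by simp
  have aL: "0 \<le> aL" using lnC by (simp add: aL_def)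
  have aw: "0 \<le> aw" using C by (simp add: aw_def)
  have a1: "0 \<le> a1" using aw by (simp add: a1_def)
  have aK: "0 \<le> aK" using C by (simp add: aK_def)
  have Z: "0 \<le> Z" unfolding Z_def using aL a1 \<kappa> X by (intro add_nonneg_nonneg mult_nonneg_nonneg) auto
  \<comment> \<open>The number of centres is a power of two within a factor of two of
    \<open>C * u\<close>, the bound on the covering number.\<close>
  define t where "t n = (SOME t::nat. C * real n powr (real d / (2 + real d)) \<le> 2 ^ t \<and> 2 ^ t \<le> 2 * (C * real n powr (real d / (2 + real d))))" for n
  \<comment> \<open>All constants that involve \<open>C\<close>, \<open>D\<close>, \<open>r\<close>
    or \<open>T\<close> are swallowed by one factor \<open>ln n\<close>, at the price of a threshold
    for \<open>n\<close>. This is how the size bounds get by with factors depending on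
    \<open>d\<close> and logarithms.\<close>
  have "filterlim (\<lambda>n::nat. ln (real n)) at_top sequentially" by real_asymp
  then have ev1: "\<forall>\<^sub>F n in sequentially. Max {1, aL, aw, aK} \<le> ln (real n)" unfolding filterlim_at_top by blast
  have "((\<lambda>n::nat. real n powr (- 1 / (2 + real d))) \<longlongrightarrow> 0) sequentially"
    by (rule tendsto_neg_powr[OF _ filterlim_real_sequentially]) (simp add: divide_neg_pos)
  then have "((\<lambda>n::nat. 2 ^ (T + 1) * real D * real n powr (- 1 / (2 + real d))) \<longlongrightarrow> 2 ^ (T + 1) * real D * 0) sequentially"
    by (intro tendsto_intros)
  then have ev2: "\<forall>\<^sub>F n in sequentially. 2 ^ (T + 1) * real D * real n powr (- 1 / (2 + real d)) < 2"
    by (rule order_tendstoD) simp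
  obtain n0 where n0: "\<And>n. n \<ge> n0 \<Longrightarrow> Max {1, aL, aw, aK} \<le> ln (real n) \<and> 2 ^ (T + 1) * real D * real n powr (- 1 / (2 + real d)) < 2"
    using eventually_conj[OF ev1 ev2] unfolding eventually_sequentially by blast
  have main: "C * u \<le> 2 ^ t n \<and> 2 ^ (T + 1) * real D * real n powr (- 1 / (2 + real d)) \<le> 2 \<and>
      real L \<le> g\<^sup>2 \<and> real p \<le> g * u \<and> real K \<le> g * u \<and>
      ln (real L * (real L * real p * real (p + 1) * (2 * (\<kappa> / \<eta>) + 1)) ^ K) + 1 \<le> (aL + aK * Z + 1) * u * g\<^sup>2"
    if n: "n \<ge> max 3 n0" and g_def: "g = ln (real n)" and u_def: "u = real n powr (real d / (2 + real d))"
      and L: "L = 2 * t n + T + 6" and p: "p = 2 ^ t n * (2 * D + 2 * r)" and K: "K = 2 ^ t n * (4 * D + r * (2 * D + 4 * T + 23))"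
      and \<eta>: "\<eta> = 1 / (real n * sqrt (real r) * real L * (real (p + 1) * max 1 \<kappa>) ^ L * X)"
    for n g u L p K \<eta>
  proof -
    have n3: "3 \<le> n" and g: "1 \<le> g" "aL \<le> g" "aw \<le> g" "aK \<le> g"
      and e1: "2 ^ (T + 1) * real D * real n powr (- 1 / (2 + real d)) \<le> 2"
      using n n0[of n] unfolding g_def by auto
    have u1: "1 \<le> u" unfolding u_def using n3 by (intro ge_one_powr_ge_zero) auto
    have un: "u \<le> real n"
    proof -
      have "u \<le> real n powr 1" unfolding u_def using n3 by (intro powr_mono) auto
      then show ?thesis using n3 by simp
    qed
    have "1 * 1 \<le> C * u" using C u1 by (intro mult_mono) auto
    then have "\<exists>t::nat. C * u \<le> 2 ^ t \<and> 2 ^ t \<le> 2 * (C * u)" by (intro ex_dyadic_between) simp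
    then have t: "C * u \<le> 2 ^ t n" "2 ^ t n \<le> 2 * (C * u)" unfolding t_def u_def by (rule someI2_ex, simp)+
    have lnu: "ln u \<le> g" unfolding g_def using un u1 by (intro ln_mono) auto
    have "real (t n) \<le> 2 * ln (2 * (C * u))" by (rule dyadic_exponent_le[OF t(2)]) (use C u1 in auto)
    also have "\<dots> = 2 * (ln (2 * C) + ln u)"
      using C u1 ln_mult_pos[of "2 * C" u] by (simp add: mult.assoc)
    also have "\<dots> \<le> 2 * (ln (2 * C) + g)" by (intro mult_left_mono add_left_mono lnu) simp
    finally have tn: "real (t n) \<le> 2 * (ln (2 * C) + g)" .
    have LaL: "real L \<le> aL * g"
    proof -
      have "real L \<le> (4 * ln (2 * C) + real T + 6) + 4 * g" using tn unfolding L by simp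
      also have "4 * ln (2 * C) + real T + 6 \<le> (4 * ln (2 * C) + real T + 6) * g"
        using mult_left_mono[OF g(1), of "4 * ln (2 * C) + real T + 6"] lnC by simp
      finally show ?thesis by (simp add: aL_def algebra_simps)
    qed
    also have "\<dots> \<le> g * g" using g by (intro mult_right_mono) auto
    finally have Lg: "real L \<le> g\<^sup>2" by (simp add: power2_eq_square)
    have paw: "real p \<le> aw * u"
    proof -
      have "real p = 2 ^ t n * (2 * real D + 2 * real r)" unfolding p by simp
      also have "\<dots> \<le> 2 * (C * u) * (2 * real D + 2 * real r)" by (rule mult_right_mono[OF t(2)]) simp
      finally show ?thesis by (simp add: aw_def mult_ac)
    qed
    also have "\<dots> \<le> g * u" using g u1 by (intro mult_right_mono) auto
    finally have pg: "real p \<le> g * u" .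
    have KaK: "real K \<le> aK * u"
    proof -
      have "real K = 2 ^ t n * (4 * real D + real r * (2 * real D + 4 * real T + 23))" unfolding K by simp
      also have "\<dots> \<le> 2 * (C * u) * (4 * real D + real r * (2 * real D + 4 * real T + 23))" by (rule mult_right_mono[OF t(2)]) simp
      finally show ?thesis by (simp add: aK_def mult_ac)
    qed
    also have "\<dots> \<le> g * u" using g u1 by (intro mult_right_mono) auto
    finally have Kg: "real K \<le> g * u" .
    have "real (p + 1) \<le> aw * u + 1 * u" using paw u1 by simp
    also have "\<dots> = (aw + 1) * u" by (simp add: distrib_right)
    also have "\<dots> \<le> (aw + 1) * real n" using un aw by (intro mult_left_mono) auto
    finally have "ln (real (p + 1)) \<le> ln ((aw + 1) * real n)" by (intro ln_mono) auto
    also have "\<dots> = ln (aw + 1) + g" unfolding g_def using aw n3 by (simp add: ln_mult_pos)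
    also have "\<dots> \<le> a1 * g" using mult_left_mono[OF g(1), of "ln (aw + 1)"] aw unfolding a1_def by (simp add: distrib_right)
    finally have lp: "ln (real (p + 1)) \<le> a1 * g" .
    have "1 \<le> p" "1 \<le> L" unfolding p L using D by auto
    then have "ln (real L * (real L * real p * real (p + 1) * (2 * (\<kappa> / \<eta>) + 1)) ^ K) + 1 \<le> aL * g + real K * (Z * g\<^sup>2) + 1"
      unfolding Z_def using g \<kappa> X r n3 LaL lp \<eta> by (intro log_code_bound) (auto simp: g_def)
    also have "\<dots> \<le> aL * (u * g\<^sup>2) + (aK * u) * (Z * g\<^sup>2) + 1 * (u * g\<^sup>2)"
    proof (intro add_mono mult_left_mono mult_right_mono KaK aL)
      have gg: "g \<le> g\<^sup>2" using mult_left_mono[OF g(1), of g] g(1) by (simp add: power2_eq_square)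
      have "g\<^sup>2 \<le> u * g\<^sup>2" using mult_right_mono[OF u1, of "g\<^sup>2"] by simp
      with gg show "g \<le> u * g\<^sup>2" by linarith
      with g(1) show "1 \<le> 1 * (u * g\<^sup>2)" by linarith
      show "0 \<le> Z * g\<^sup>2" using Z by simp
    qed
    also have "\<dots> = (aL + aK * Z + 1) * u * g\<^sup>2" by (simp add: algebra_simps)
    finally show ?thesis using t e1 Lg pg Kg by blast
  qed
  show ?thesis
  proof (intro exI[of _ "max 3 n0"] exI[of _ "aL + aK * Z + 1"] exI[of _ t] conjI allI impI)
    show "0 \<le> aL + aK * Z + 1" using aL aK Z by (intro add_nonneg_nonneg mult_nonneg_nonneg) auto
    fix n assume "n \<ge> max 3 n0"
    show "let g = ln (real n); u = real n powr (real d / (2 + real d)); \<epsilon> = real n powr (- 1 / (2 + real d));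
        L = 2 * t n + T + 6; p = 2 ^ t n * (2 * D + 2 * r); K = 2 ^ t n * (4 * D + r * (2 * D + 4 * T + 23));
        \<kappa> = 2 * max 1 b; X = max 1 b;
        \<eta> = 1 / (real n * sqrt (real r) * real L * (real (p + 1) * max 1 \<kappa>) ^ L * X)
    in C * u \<le> 2 ^ t n \<and> 2 ^ (T + 1) * real D * \<epsilon> \<le> 2 \<and>
      real L \<le> g\<^sup>2 \<and> real p \<le> g * u \<and> real K \<le> g * u \<and>
      ln (real L * (real L * real p * real (p + 1) * (2 * (\<kappa> / \<eta>) + 1)) ^ K) + 1 \<le> (aL + aK * Z + 1) * u * g\<^sup>2"
      unfolding Let_def using main[OF \<open>n \<ge> max 3 n0\<close> refl refl refl refl refl refl] unfolding \<kappa>_def X_def .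
  qed simp
qed

section \<open>Rates\<close>

definition (in regular_problem) est_error :: "nat \<Rightarrow> ((nat \<Rightarrow> evec) \<Rightarrow> evec \<Rightarrow> evec) \<Rightarrow> ennreal" where
  "est_error n ahat = (\<integral>\<^sup>+X. ennreal (LINT \<mu>|par_law P. (norm (ahat X \<mu> - coef P \<mu>))\<^sup>2) \<partial>sample_law P n)"

text \<open>\<open>R\<close> enters the constant only through its ratio \<open>\<rho>\<close> to
  \<open>R\<^sub>a\<close>; what remains of \<open>U\<close>, \<open>\<gamma>\<close> and
  \<open>r\<close> is part of the explicit factor of the theorem.\<close>

lemma (in regular_problem) sq_range_le:
  assumes "R = \<rho> * R\<^sub>a" "R\<^sub>a \<le> R"
  shows "1 \<le> R + 1 + R\<^sub>a" "(R + 1 + R\<^sub>a)\<^sup>2 \<le> 4 * (\<rho> + 2)\<^sup>2 * real r * (U ^ 4 / \<gamma>\<^sup>2)" "1 \<le> U ^ 4 / \<gamma>\<^sup>2"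
proof -
  show 1: "1 \<le> R + 1 + R\<^sub>a" using assms R_a_ge_2 by linarith
  have "R + 1 + R\<^sub>a \<le> \<rho> * R\<^sub>a + 2 * R\<^sub>a" unfolding assms(1) using R_a_ge_2 by linarith
  also have "\<dots> = (\<rho> + 2) * R\<^sub>a" by (simp only: distrib_right)
  finally have "(R + 1 + R\<^sub>a)\<^sup>2 \<le> ((\<rho> + 2) * R\<^sub>a)\<^sup>2" using 1 by (intro power_mono) auto
  also have "\<dots> = 4 * (\<rho> + 2)\<^sup>2 * real r * (U ^ 4 / \<gamma>\<^sup>2)"
    by (simp add: power_mult_distrib power_divide power_mult[symmetric])
  finally show "(R + 1 + R\<^sub>a)\<^sup>2 \<le> 4 * (\<rho> + 2)\<^sup>2 * real r * (U ^ 4 / \<gamma>\<^sup>2)" .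
  have "1 \<le> U\<^sup>2 / \<gamma>" using gamma_le pos by simp
  then have "1 \<le> (U\<^sup>2 / \<gamma>)\<^sup>2" by (rule one_le_power)
  then show "1 \<le> U ^ 4 / \<gamma>\<^sup>2" by (simp add: power_divide power_mult[symmetric])
qed

lemma powr_rate:
  fixes d :: nat assumes "1 \<le> (n::real)"
  shows "(n powr (- 1 / (2 + real d)))\<^sup>2 = n powr (- 2 / (2 + real d))"
    "n powr (real d / (2 + real d)) / n = n powr (- 2 / (2 + real d))"
    "(1 / n powr (- 1 / (2 + real d))) ^ d = n powr (real d / (2 + real d))"
    "1 / n \<le> n powr (- 2 / (2 + real d))"
proof -
  have n: "0 < n" using assms by simp
  show "(n powr (- 1 / (2 + real d)))\<^sup>2 = n powr (- 2 / (2 + real d))"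
    using n by (simp add: powr_power)
  have "n powr (real d / (2 + real d)) / n = n powr (real d / (2 + real d) - 1)"
    using n by (simp add: powr_diff)
  also have "real d / (2 + real d) - 1 = - 2 / (2 + real d)" by (simp add: field_simps)
  finally show "n powr (real d / (2 + real d)) / n = n powr (- 2 / (2 + real d))" .
  have "1 / n powr (- 1 / (2 + real d)) = n powr (1 / (2 + real d))"
    by (simp add: powr_minus_divide)
  then show "(1 / n powr (- 1 / (2 + real d))) ^ d = n powr (real d / (2 + real d))"
    using n by (simp add: powr_power)
  have "1 / n = n powr (-1)" using n by (simp add: powr_minus_divide)
  also have "\<dots> \<le> n powr (- 2 / (2 + real d))" using assms by (intro powr_mono) (auto simp: field_simps)
  finally show "1 / n \<le> n powr (- 2 / (2 + real d))" .
qed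

text \<open>The size bounds of the theorem with one logarithm hidden in the soft order. The
  prefactor \<open>2 + d\<close> compensates the divisions by it.\<close>

definition sizes_admissible :: "nat \<Rightarrow> nat \<Rightarrow> nat \<Rightarrow> nat \<Rightarrow> nat \<Rightarrow> nat \<Rightarrow> bool" where
  "sizes_admissible d r n L p K \<longleftrightarrow>
    1 \<le> L \<and> real L \<le> 4 * (2 + real d) * ln (real n) ^ 1 * (ln (real n) / (2 + real d)) \<and>
    1 \<le> p \<and> real p \<le> 4 * (2 + real d) * ln (real n) ^ 1 * (real r * real n powr (real d / (2 + real d))) \<and>
    1 \<le> K \<and> real K \<le> 4 * (2 + real d) * ln (real n) ^ 1 * (real r / (2 + real d) * real n powr (real d / (2 + real d)) * ln (real n))"

lemma sizes_admissibleI: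
  assumes n: "2 \<le> n" and r: "1 \<le> r" and "1 \<le> L" "1 \<le> p" "1 \<le> K"
    and "real L \<le> 4 * (ln (real n))\<^sup>2" "real p \<le> 4 * ln (real n) * real n powr (real d / (2 + real d))"
      "real K \<le> 4 * (ln (real n))\<^sup>2 * real n powr (real d / (2 + real d))"
  shows "sizes_admissible d r n L p K"
proof -
  let ?u = "real n powr (real d / (2 + real d))" and ?g = "ln (real n)"
  have u: "1 \<le> ?u" using n by (intro ge_one_powr_ge_zero) auto
  have g: "0 \<le> ?g" using n by simp
  have "4 * ?g * ?u * 1 \<le> 4 * ?g * ?u * ((2 + real d) * real r)"
    using mult_mono[of 1 "2 + real d" 1 "real r"] r g u by (intro mult_left_mono) auto
  also have "\<dots> = 4 * (2 + real d) * ?g ^ 1 * (real r * ?u)" by (simp only: power_one_right mult_ac)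
  finally have "real p \<le> 4 * (2 + real d) * ?g ^ 1 * (real r * ?u)" using assms(7) by simp
  moreover have q: "(2 + real d) * (x / (2 + real d)) = x" for x by simp
  have "4 * (2 + real d) * ?g ^ 1 * (?g / (2 + real d)) = 4 * ?g * ((2 + real d) * (?g / (2 + real d)))"
    by (simp only: power_one_right mult_ac)
  then have "real L \<le> 4 * (2 + real d) * ?g ^ 1 * (?g / (2 + real d))"
    using assms(6) unfolding q by (simp only: power2_eq_square mult.assoc)
  moreover have "4 * ?g\<^sup>2 * ?u * 1 \<le> 4 * ?g\<^sup>2 * ?u * real r" using r g u by (intro mult_left_mono) auto
  then have "real K \<le> 4 * ?g\<^sup>2 * ?u * ((2 + real d) * (real r / (2 + real d)))" using assms(8) unfolding q by linarith
  then have "real K \<le> 4 * (2 + real d) * ?g ^ 1 * (real r / (2 + real d) * ?u * ?g)"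
    by (simp only: power2_eq_square power_one_right mult_ac)
  ultimately show ?thesis unfolding sizes_admissible_def using assms(3-5) by blast
qed

text \<open>For a fixed rank the constant and the sizes are chosen before the problem, from
  \<open>M\<close>, \<open>D\<close>, \<open>d\<close>, \<open>b\<close>, the Lipschitz radius, the
  ratio \<open>\<rho>\<close> and \<open>r\<close>. The dependence of the constant on
  \<open>r\<close> is removed afterwards.\<close>

lemma ex_estimation_rate_rank:
  fixes M :: "evec set" and D d r :: nat and b lip \<rho> :: real
  assumes M: "submanifold D d M" "compact M" "connected M" and D: "1 \<le> D" and r1: "1 \<le> r" and b: "0 < b" and lip: "0 \<le> lip"
  shows "\<exists>c L p K. 0 \<le> c \<and> (\<forall>n\<ge>2. sizes_admissible d r n (L n) (p n) (K n) \<and>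
    (\<forall>P Lip U Cq R ahat. regular_problem P Lip U Cq \<longrightarrow> amb_dim P = D \<longrightarrow> man_dim P = d \<longrightarrow> amb_bound P = b \<longrightarrow>
       man P = M \<longrightarrow> coef_lip P = lip \<longrightarrow> rnk P = r \<longrightarrow> R = \<rho> * (2 * sqrt (real r) * U\<^sup>2 / lambda_min (gram P)) \<longrightarrow>
       2 * sqrt (real r) * U\<^sup>2 / lambda_min (gram P) \<le> R \<longrightarrow>
       erm_estimator P n (net_class D M r R (2 * max 1 b) (L n) (p n) (K n)) ahat \<longrightarrow>
       regular_problem.est_error P n ahat
         \<le> ennreal (c * ((real r)\<^sup>2 * U ^ 4 / (lambda_min (gram P))\<^sup>2) * real n powr (- 2 / (2 + real d)) * ln (real n) ^ 3)))"
proof -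
  obtain C' where C': "0 \<le> C'" "\<And>e. 0 < e \<Longrightarrow> e \<le> 1 \<Longrightarrow>
    \<exists>Z. finite Z \<and> Z \<subseteq> M \<and> real (card Z) \<le> C' * (1 / e) ^ d \<and> (\<forall>x\<in>M. \<exists>z\<in>Z. dist x z \<le> e)"
    by (rule submanifold_covering_number[OF M(1,2)]) blast
  define C where "C = max 1 C'"
  obtain \<Lambda> where \<Lambda>: "0 \<le> \<Lambda>" "\<And>p q. p \<in> M \<Longrightarrow> q \<in> M \<Longrightarrow> (\<exists>l. joined_by M p q l) \<and> geodesic_dist M p q \<le> \<Lambda> * dist p q"
    by (rule geodesic_dist_lipschitz[OF M]) blast
  define \<Delta> where "\<Delta> = diameter M"
  have \<Delta>: "dist x y \<le> \<Delta>" if "x \<in> M" "y \<in> M" for x y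
    unfolding \<Delta>_def by (rule diameter_bounded_bound[OF compact_imp_bounded[OF M(2)] that])
  \<comment> \<open>This power of two dominates the Euclidean Lipschitz constant of the coefficients
    and also their size, so one number serves as slope and as normalization.\<close>
  obtain T :: nat where Tb: "max (lip * \<Lambda>) (1 + lip * \<Lambda> * \<Delta>) < 2 ^ T" using real_arch_pow[of "2 :: real"] one_less_numeral_iff semiring_norm(76) by blast
  have C1: "1 \<le> C" by (simp add: C_def)
  let ?g = "\<lambda>n. ln (real n)" and ?u = "\<lambda>n. real n powr (real d / (2 + real d))"
    and ?\<epsilon> = "\<lambda>n. real n powr (- 1 / (2 + real d))" and ?\<delta> = "\<lambda>n. real n powr (- 2 / (2 + real d))"
  obtain n0 c0 and t :: "nat \<Rightarrow> nat" where n0: "3 \<le> n0" and c0: "0 \<le> c0"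
    and t: "\<And>n g u \<epsilon> L p K \<kappa> X \<eta>. n \<ge> n0 \<Longrightarrow> g = ln (real n) \<Longrightarrow> u = real n powr (real d / (2 + real d)) \<Longrightarrow>
      \<epsilon> = real n powr (- 1 / (2 + real d)) \<Longrightarrow> L = 2 * t n + T + 6 \<Longrightarrow> p = 2 ^ t n * (2 * D + 2 * r) \<Longrightarrow>
      K = 2 ^ t n * (4 * D + r * (2 * D + 4 * T + 23)) \<Longrightarrow> \<kappa> = 2 * max 1 b \<Longrightarrow> X = max 1 b \<Longrightarrow>
      \<eta> = 1 / (real n * sqrt (real r) * real L * (real (p + 1) * max 1 \<kappa>) ^ L * X) \<Longrightarrow>
      C * u \<le> 2 ^ t n \<and> 2 ^ (T + 1) * real D * \<epsilon> \<le> 2 \<and> real L \<le> g\<^sup>2 \<and> real p \<le> g * u \<and> real K \<le> g * u \<and>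
      ln (real L * (real L * real p * real (p + 1) * (2 * (\<kappa> / \<eta>) + 1)) ^ K) + 1 \<le> c0 * u * g\<^sup>2"
    using ex_network_sizes[OF D r1 C1 b, of d T] unfolding Let_def by blast
  \<comment> \<open>Below the threshold the sizes are set to one; the trivial error bound there asks
    nothing of the class.\<close>
  define L where "L n = (if n0 \<le> n then 2 * t n + T + 6 else 1)" for n
  define p where "p n = (if n0 \<le> n then 2 ^ t n * (2 * D + 2 * r) else 1)" for n
  define K where "K n = (if n0 \<le> n then 2 ^ t n * (4 * D + r * (2 * D + 4 * T + 23)) else 1)" for n
  \<comment> \<open>The summands stem from the approximation error, from the estimation error and
    from the trivial bound for \<open>n < n0\<close>.\<close>
  define c where "c = 8 * (2 ^ (T + 1) * real D)\<^sup>2 + 4 * (\<rho> + 2)\<^sup>2 * (6 + 2 * c0) + 32 * (\<rho> + 2)\<^sup>2 * real n0"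
  have c_pos: "0 \<le> c" unfolding c_def using c0 by (intro add_nonneg_nonneg mult_nonneg_nonneg) auto
  have sizes: "sizes_admissible d r n (L n) (p n) (K n)" if n: "2 \<le> n" for n
  proof -
    have u: "1 \<le> ?u n" using n by (intro ge_one_powr_ge_zero) auto
    have "ln 2 \<le> ?g n" using n by (intro ln_mono) auto
    then have g: "2 / 3 \<le> ?g n" using ln2_ge_two_thirds by linarith
    \<comment> \<open>At \<open>n = 2\<close> the logarithm is below one; since four times
      \<open>4 / 9\<close> exceeds one, the factor four in the size bounds accommodates networks of
      size one.\<close>
    then have gg: "4 / 9 \<le> (?g n)\<^sup>2" using power_mono[of "2/3" "?g n" 2] by (simp add: power2_eq_square)
    show ?thesis
    proof (cases "n0 \<le> n")
      case True
      then have "real 3 \<le> real n" using n0 by (intro of_nat_mono) linarith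
      then have "exp 1 \<le> real n" using exp_le by simp
      then have g1: "1 \<le> ?g n" using n by (simp add: ln_ge_iff)
      from t[OF True refl refl refl refl refl refl refl refl refl]
      have t': "real (L n) \<le> (?g n)\<^sup>2" "real (p n) \<le> ?g n * ?u n" "real (K n) \<le> ?g n * ?u n"
        unfolding L_def p_def K_def using True by simp_all
      have "?g n * ?u n \<le> (?g n)\<^sup>2 * ?u n"
        using mult_left_mono[OF g1, of "?g n"] g1 u by (intro mult_right_mono) (auto simp: power2_eq_square)
      moreover have "0 \<le> ?g n * ?u n" "0 \<le> (?g n)\<^sup>2" "0 \<le> (?g n)\<^sup>2 * ?u n" using g1 by auto
      ultimately have "real (L n) \<le> 4 * (?g n)\<^sup>2" "real (p n) \<le> 4 * ?g n * ?u n" "real (K n) \<le> 4 * (?g n)\<^sup>2 * ?u n"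
        using t' by linarith+
      moreover have "1 \<le> L n" "1 \<le> p n" "1 \<le> K n" using True D r1 by (simp_all add: L_def p_def K_def)
      ultimately show ?thesis by (intro sizes_admissibleI[OF n r1])
    next
      case False
      have "1 * 1 \<le> (4 * ?g n) * ?u n" "1 * 1 \<le> (4 * (?g n)\<^sup>2) * ?u n" using g gg u by (intro mult_mono; simp)+
      then show ?thesis using False gg by (intro sizes_admissibleI[OF n r1]) (auto simp: L_def p_def K_def)
    qed
  qed
  have err: "regular_problem.est_error P n ahat \<le> ennreal (c * ((real r)\<^sup>2 * U ^ 4 / (lambda_min (gram P))\<^sup>2) * ?\<delta> n * ?g n ^ 3)"
    if n: "2 \<le> n" and rp: "regular_problem P Lip U Cq" and P: "amb_dim P = D" "man_dim P = d" "amb_bound P = b"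
       "man P = M" "coef_lip P = lip" "rnk P = r" and R: "R = \<rho> * (2 * sqrt (real r) * U\<^sup>2 / lambda_min (gram P))"
       "2 * sqrt (real r) * U\<^sup>2 / lambda_min (gram P) \<le> R"
      and erm: "erm_estimator P n (net_class D M r R (2 * max 1 b) (L n) (p n) (K n)) ahat"
    for P Lip U Cq R ahat n
  proof -
    interpret regular_problem P Lip U Cq by (rule rp)
    let ?W = "U ^ 4 / (lambda_min (gram P))\<^sup>2"
    let ?s = "R + 1 + 2 * sqrt (real r) * U\<^sup>2 / lambda_min (gram P)"
    have s: "1 \<le> ?s" "?s\<^sup>2 \<le> 4 * (\<rho> + 2)\<^sup>2 * real r * ?W" "1 \<le> ?W"
      using sq_range_le[of R \<rho>, unfolded P(6), OF R] by simp_all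
    have rr: "real r \<le> (real r)\<^sup>2" using r1 by (simp add: power2_eq_square)
    have n1: "1 \<le> real n" using n by simp
    note pr = powr_rate[OF n1, of d]
    have "ln 2 \<le> ?g n" using n by (intro ln_mono) auto
    then have g: "1 / 2 \<le> ?g n" using ln2_ge_two_thirds by linarith
    have \<delta>0: "0 < ?\<delta> n" using n by simp
    show ?thesis
    proof (cases "n0 \<le> n")
      case False
      have "est_error n ahat \<le> ennreal (?s\<^sup>2)"
        unfolding est_error_def by (rule erm_trivial_error[unfolded P, OF erm R(2)])
      also have "?s\<^sup>2 \<le> c * ((real r)\<^sup>2 * U ^ 4 / (lambda_min (gram P))\<^sup>2) * ?\<delta> n * ?g n ^ 3"
      proof -
        \<comment> \<open>The factor \<open>n0\<close> compensates the rate for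
          \<open>n < n0\<close>, and the factor eight the cube of a logarithm that is at least
          \<open>1 / 2\<close>.\<close>
        have "1 \<le> real n0 * ?\<delta> n"
        proof -
          have "1 = real n0 * (1 / real n0)" using n0 by simp
          also have "\<dots> \<le> real n0 * (1 / real n)" using False n by (intro mult_left_mono) (auto simp: frac_le)
          also have "\<dots> \<le> real n0 * ?\<delta> n" using pr(4) by (intro mult_left_mono) auto
          finally show ?thesis .
        qed
        moreover have "1 \<le> 8 * ?g n ^ 3" using power_mono[OF g, of 3] by (simp add: power3_eq_cube)
        ultimately have one: "1 * 1 \<le> (real n0 * ?\<delta> n) * (8 * ?g n ^ 3)" by (intro mult_mono) auto
        have "?s\<^sup>2 \<le> 4 * (\<rho> + 2)\<^sup>2 * (real r)\<^sup>2 * ?W"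
          using s(2) mult_right_mono[OF mult_left_mono[OF rr, of "4 * (\<rho> + 2)\<^sup>2"], of ?W] s(3) by simp
        also have "\<dots> * 1 \<le> (4 * (\<rho> + 2)\<^sup>2 * (real r)\<^sup>2 * ?W) * ((real n0 * ?\<delta> n) * (8 * ?g n ^ 3))"
          using one s(3) by (intro mult_left_mono) auto
        finally have "?s\<^sup>2 \<le> (32 * (\<rho> + 2)\<^sup>2 * real n0) * ((real r)\<^sup>2 * ?W * ?\<delta> n * ?g n ^ 3)" by (simp add: mult_ac)
        also have "\<dots> \<le> c * ((real r)\<^sup>2 * ?W * ?\<delta> n * ?g n ^ 3)"
          unfolding c_def using c0 s(3) g \<delta>0 by (intro mult_right_mono mult_nonneg_nonneg zero_le_power) auto
        finally show ?thesis by (simp add: mult_ac)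
      qed
      finally show ?thesis by (simp add: ennreal_leI)
    next
      case True
      define e1 where "e1 = 2 ^ (T + 1) * real D * ?\<epsilon> n"
      define X where "X = max 1 b"
      define \<eta> where "\<eta> = 1 / (real n * sqrt (real r) * real (L n) * (real (p n + 1) * max 1 (2 * max 1 b)) ^ L n * X)"
      have LpK: "L n = 2 * t n + T + 6" "p n = 2 ^ t n * (2 * D + 2 * r)" "K n = 2 ^ t n * (4 * D + r * (2 * D + 4 * T + 23))"
        using True by (simp_all add: L_def p_def K_def)
      note tns = t[OF True refl refl refl LpK refl X_def \<eta>_def]
      have tn: "C * ?u n \<le> 2 ^ t n" "2 ^ (T + 1) * real D * ?\<epsilon> n \<le> 2"
        "ln (real (L n) * (real (L n) * real (p n) * real (p n + 1) * (2 * (2 * max 1 b / \<eta>) + 1)) ^ K n) + 1 \<le> c0 * ?u n * (?g n)\<^sup>2"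
        using tns by blast+
      have "real 3 \<le> real n" using n0 True by (intro of_nat_mono) linarith
      then have "exp 1 \<le> real n" using exp_le by simp
      then have g1: "1 \<le> ?g n" using n by (simp add: ln_ge_iff)
      have eps: "0 < ?\<epsilon> n" "?\<epsilon> n \<le> 1" using n powr_mono[of "- 1 / (2 + real d)" 0 "real n"] by (auto simp: divide_nonpos_pos)
      obtain Z where Z: "finite Z" "Z \<subseteq> M" "real (card Z) \<le> C' * (1 / ?\<epsilon> n) ^ d" "\<And>x. x \<in> M \<Longrightarrow> \<exists>z\<in>Z. dist x z \<le> ?\<epsilon> n"
        using C'(2)[OF eps] by blast
      have "real (card Z) \<le> C * ?u n"
        using Z(3) unfolding pr(3) using mult_right_mono[of C' C "?u n"] by (simp add: C_def)
      then have "real (card Z) \<le> real (2 ^ t n)" using tn(1) by (simp only: of_nat_power of_nat_numeral)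
      then have cZ: "card Z \<le> 2 ^ t n" by (simp only: of_nat_le_iff)
      have lipM: "par_dist P x y \<le> \<Lambda> * dist x y" if "x \<in> M" "y \<in> M" for x y
        using \<Lambda>(2)[OF that] unfolding par_dist_def P(4) by blast
      have L0: "\<bar>coord (coef P \<mu>) s - coord (coef P \<nu>) s\<bar> \<le> lip * \<Lambda> * dist \<mu> \<nu>"
        if "s < r" "\<mu> \<in> M" "\<nu> \<in> M" for s \<mu> \<nu>
        using coord_coef_lipschitz(1)[unfolded P, OF that] mult_left_mono[OF lipM[OF that(2,3)] lip] by simp
      have L1: "\<bar>coord (coef P \<mu>) s - coord (coef P \<nu>) s\<bar> \<le> 2 ^ T * dist \<mu> \<nu>"
        if "s < r" "\<mu> \<in> M" "\<nu> \<in> M" for s \<mu> \<nu>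
        using L0[OF that] mult_right_mono[of "lip * \<Lambda>" "2 ^ T" "dist \<mu> \<nu>"] Tb by simp
      \<comment> \<open>A sup bound free of \<open>U\<close> and \<open>\<gamma>\<close>: at a node
        the coefficient vector is a unit vector, and the Lipschitz bound carries this over the
        diameter. So \<open>T\<close> depends on the manifold and the Lipschitz radius
        alone.\<close>
      have A1: "\<bar>coord (coef P \<mu>) s\<bar> \<le> 2 ^ T" if "s < r" "\<mu> \<in> M" for s \<mu>
      proof -
        have r0: "0 < rnk P" using r1 P(6) by simp
        have node: "par_nodes P 0 \<in> M" using par_nodes_in_man[OF regular_problem.T[OF rp] r0] P(4) by simp
        have "\<bar>coord (coef P \<mu>) s - coord (coef P (par_nodes P 0)) s\<bar> \<le> lip * \<Lambda> * dist \<mu> (par_nodes P 0)"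
          by (rule L0[OF that node])
        also have "\<dots> \<le> lip * \<Lambda> * \<Delta>" using \<Delta>[OF that(2) node] lip \<Lambda>(1) by (intro mult_left_mono) auto
        finally have "\<bar>coord (coef P \<mu>) s - coord (coef P (par_nodes P 0)) s\<bar> \<le> lip * \<Lambda> * \<Delta>" .
        moreover have "\<bar>coord (coef P (par_nodes P 0)) s\<bar> \<le> 1" using coef_at_node[OF r0] by simp
        ultimately show ?thesis using Tb by linarith
      qed
      obtain S where S: "S \<in> net_class D M r R (2 * max 1 b) (L n) (p n) (K n)"
        "\<And>\<mu>. \<mu> \<in> M \<Longrightarrow> norm (S \<mu> - coef P \<mu>) \<le> 2 * sqrt (real r) * e1"
      proof -
        have "\<exists>S\<in>net_class D M r R (2 * max 1 b) (L n) (p n) (K n). \<forall>\<mu>\<in>M. norm (S \<mu> - coef P \<mu>) \<le> 2 * sqrt (real r) * e1"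
          unfolding LpK
          by (rule approximant[unfolded P, OF L1 A1 Z(1,2) cZ Z(4) e1_def _ _ R(2)])
            (use tn(2) eps in \<open>auto simp: e1_def\<close>)
        then show ?thesis using that by blast
      qed
      let ?B = "2 * (2 * sqrt (real r) * e1)\<^sup>2 + 6 * ?s / real n + 2 * ?s\<^sup>2 / real n *
        (ln (real (L n) * (real (L n) * real (p n) * real (p n + 1) * (2 * (2 * max 1 b / \<eta>) + 1)) ^ K n) + 1)"
      have pw: "1 \<le> p n" "D \<le> p n" "r \<le> p n" "1 \<le> L n"
      proof -
        have "1 * (2 * D + 2 * r) \<le> p n" unfolding LpK by (rule mult_le_mono1) simp
        then show "1 \<le> p n" "D \<le> p n" "r \<le> p n" using D by simp_all
      qed (simp add: LpK)
      have "est_error n ahat \<le> ennreal ?B"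
        unfolding est_error_def
        by (rule erm_expected_error[unfolded P, OF erm R(2) _ _ pw(4,1) order_refl pw(2,3) S _ _ \<eta>_def])
          (use n in \<open>auto simp: X_def\<close>)
      also have "?B \<le> c * ((real r)\<^sup>2 * ?W * ?\<delta> n * ?g n ^ 3)"
      proof -
        have e: "(2 * sqrt (real r) * e1)\<^sup>2 = 4 * real r * (2 ^ (T + 1) * real D)\<^sup>2 * ?\<delta> n"
          unfolding e1_def power_mult_distrib pr(1)[symmetric] by simp
        have u1: "1 \<le> ?u n" using n by (intro ge_one_powr_ge_zero) auto
        have gg: "1 \<le> (?g n)\<^sup>2" using g1 by simp
        have ug: "1 \<le> ?u n * (?g n)\<^sup>2" using mult_mono[OF u1 gg] by simp
        have s2: "?s \<le> ?s\<^sup>2" using s(1) by (simp add: power2_eq_square)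
        have "6 * ?s / real n \<le> 6 * ?s\<^sup>2 / real n" using s2 n by (intro divide_right_mono mult_left_mono) auto
        also have "\<dots> = ?s\<^sup>2 / real n * 6" by simp
        also have "\<dots> \<le> ?s\<^sup>2 / real n * (6 * (?u n * (?g n)\<^sup>2))" using ug by (intro mult_left_mono) auto
        finally have b1: "6 * ?s / real n \<le> ?s\<^sup>2 / real n * (6 * (?u n * (?g n)\<^sup>2))" .
        have b2: "2 * ?s\<^sup>2 / real n * (ln (real (L n) * (real (L n) * real (p n) * real (p n + 1) * (2 * (2 * max 1 b / \<eta>) + 1)) ^ K n) + 1)
          \<le> 2 * ?s\<^sup>2 / real n * (c0 * ?u n * (?g n)\<^sup>2)" by (rule mult_left_mono[OF tn(3)]) simp
        have eq: "2 * (4 * a * b * x) + S / m * (6 * (u * y)) + 2 * S / m * (c0 * u * y) = 8 * b * (a * x) + S * ((6 + 2 * c0) * (u / m) * y)"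
          for a b x S m u y :: real by (simp add: algebra_simps add_divide_distrib)
        have eq2: "A * (a * b * x * y) + (B * a * b) * (c1 * x * y) = (A + B * c1) * (a * b * x * y)"
          for A B a b c1 x y :: real by (simp add: algebra_simps)
        have "?B \<le> 2 * (4 * real r * (2 ^ (T + 1) * real D)\<^sup>2 * ?\<delta> n) + ?s\<^sup>2 / real n * (6 * (?u n * (?g n)\<^sup>2))
           + 2 * ?s\<^sup>2 / real n * (c0 * ?u n * (?g n)\<^sup>2)" unfolding e using b1 b2 by linarith
        also have "\<dots> = 8 * (2 ^ (T + 1) * real D)\<^sup>2 * (real r * ?\<delta> n) + ?s\<^sup>2 * ((6 + 2 * c0) * (?u n / real n) * (?g n)\<^sup>2)"
          by (rule eq)
        also have "\<dots> \<le> 8 * (2 ^ (T + 1) * real D)\<^sup>2 * ((real r)\<^sup>2 * ?W * ?\<delta> n * ?g n ^ 3)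
          + (4 * (\<rho> + 2)\<^sup>2 * (real r)\<^sup>2 * ?W) * ((6 + 2 * c0) * ?\<delta> n * ?g n ^ 3)"
        proof (rule add_mono)
          have "real r * 1 * ?\<delta> n * 1 \<le> (real r)\<^sup>2 * ?W * ?\<delta> n * ?g n ^ 3"
            using rr s(3) g1 \<delta>0 by (intro mult_mono) auto
          then show "8 * (2 ^ (T + 1) * real D)\<^sup>2 * (real r * ?\<delta> n) \<le> 8 * (2 ^ (T + 1) * real D)\<^sup>2 * ((real r)\<^sup>2 * ?W * ?\<delta> n * ?g n ^ 3)"
            by (intro mult_left_mono) auto
          have g23: "(?g n)\<^sup>2 \<le> ?g n ^ 3" using g1 by (intro power_increasing) auto
          show "?s\<^sup>2 * ((6 + 2 * c0) * (?u n / real n) * (?g n)\<^sup>2)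
            \<le> (4 * (\<rho> + 2)\<^sup>2 * (real r)\<^sup>2 * ?W) * ((6 + 2 * c0) * ?\<delta> n * ?g n ^ 3)"
          proof (rule mult_mono)
            show "?s\<^sup>2 \<le> 4 * (\<rho> + 2)\<^sup>2 * (real r)\<^sup>2 * ?W"
              using s(2) mult_right_mono[OF mult_left_mono[OF rr, of "4 * (\<rho> + 2)\<^sup>2"], of ?W] s(3) by simp
            show "(6 + 2 * c0) * (?u n / real n) * (?g n)\<^sup>2 \<le> (6 + 2 * c0) * ?\<delta> n * ?g n ^ 3"
              unfolding pr(2) using g23 c0 \<delta>0 by (intro mult_left_mono) auto
            show "0 \<le> 4 * (\<rho> + 2)\<^sup>2 * (real r)\<^sup>2 * ?W" using s(3) by (intro mult_nonneg_nonneg) auto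
            show "0 \<le> (6 + 2 * c0) * (?u n / real n) * (?g n)\<^sup>2" using c0 by simp
          qed
        qed
        also have "\<dots> = (8 * (2 ^ (T + 1) * real D)\<^sup>2 + 4 * (\<rho> + 2)\<^sup>2 * (6 + 2 * c0)) * ((real r)\<^sup>2 * ?W * ?\<delta> n * ?g n ^ 3)"
          by (rule eq2)
        also have "\<dots> \<le> c * ((real r)\<^sup>2 * ?W * ?\<delta> n * ?g n ^ 3)"
          unfolding c_def using s(3) g \<delta>0 by (intro mult_right_mono mult_nonneg_nonneg zero_le_power) auto
        finally show ?thesis .
      qed
      finally show ?thesis by (simp add: ennreal_leI mult_ac)
    qed
  qed
  show ?thesis using c_pos sizes err by blast
qed

text \<open>Pigeonhole: the Lipschitz radius separates the nodes, so for a sufficiently fine net no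
  two nodes are assigned the same net point, and the rank is at most the number of net
  points.\<close>

lemma ex_rank_bound:
  fixes M :: "evec set" and lip :: real
  assumes M: "submanifold D d M" "compact M" "connected M" and lip: "0 \<le> lip"
  shows "\<exists>N. \<forall>P Lip U Cq. regular_problem P Lip U Cq \<longrightarrow> man P = M \<longrightarrow> coef_lip P = lip \<longrightarrow> rnk P \<le> N"
proof -
  obtain \<Lambda> where \<Lambda>: "0 \<le> \<Lambda>" "\<And>p q. p \<in> M \<Longrightarrow> q \<in> M \<Longrightarrow> (\<exists>l. joined_by M p q l) \<and> geodesic_dist M p q \<le> \<Lambda> * dist p q"
    by (rule geodesic_dist_lipschitz[OF M]) blast
  obtain C where C: "0 \<le> C" "\<And>e. 0 < e \<Longrightarrow> e \<le> 1 \<Longrightarrow>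
    \<exists>Z. finite Z \<and> Z \<subseteq> M \<and> real (card Z) \<le> C * (1 / e) ^ d \<and> (\<forall>x\<in>M. \<exists>z\<in>Z. dist x z \<le> e)"
    by (rule submanifold_covering_number[OF M(1,2)]) blast
  \<comment> \<open>Two nodes sharing a net point are within \<open>2 * e\<close>, and this choice
    makes \<open>lip * \<Lambda> * (2 * e)\<close> less than one, against
    \<open>nodes_separated\<close>.\<close>
  define e where "e = 1 / (2 * (lip * \<Lambda> + 1))"
  have l0: "0 \<le> lip * \<Lambda>" using lip \<Lambda>(1) by simp
  then have e: "0 < e" "e \<le> 1" "lip * \<Lambda> * (2 * e) < 1" by (auto simp: e_def field_simps)
  obtain Z where Z: "finite Z" "\<forall>x\<in>M. \<exists>z\<in>Z. dist x z \<le> e" using C(2)[OF e(1,2)] by blast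
  then obtain f where f: "\<And>x. x \<in> M \<Longrightarrow> f x \<in> Z \<and> dist x (f x) \<le> e" by metis
  have "rnk P \<le> card Z" if rp: "regular_problem P Lip U Cq" and P: "man P = M" "coef_lip P = lip" for P Lip U Cq
  proof -
    interpret regular_problem P Lip U Cq by (rule rp)
    have node: "par_nodes P s \<in> M" if "s < rnk P" for s using par_nodes_in_man[OF T that] P(1) by simp
    have "inj_on (\<lambda>s. f (par_nodes P s)) {..<rnk P}"
    proof (rule inj_onI, rule ccontr)
      fix s s' assume s: "s \<in> {..<rnk P}" "s' \<in> {..<rnk P}" and eq: "f (par_nodes P s) = f (par_nodes P s')" and ne: "s \<noteq> s'"
      have n: "par_nodes P s \<in> M" "par_nodes P s' \<in> M" using node s by auto
      have "dist (par_nodes P s) (par_nodes P s') \<le> dist (par_nodes P s) (f (par_nodes P s)) + dist (par_nodes P s') (f (par_nodes P s))"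
        by (rule dist_triangle2)
      also have "\<dots> \<le> 2 * e" using f[OF n(1)] f[OF n(2)] unfolding eq by linarith
      finally have d: "dist (par_nodes P s) (par_nodes P s') \<le> 2 * e" .
      have "1 \<le> lip * par_dist P (par_nodes P s) (par_nodes P s')"
        using nodes_separated[of s s'] s ne unfolding P by auto
      also have "\<dots> \<le> lip * (\<Lambda> * dist (par_nodes P s) (par_nodes P s'))"
        using \<Lambda>(2)[OF n] unfolding par_dist_def P(1) by (intro mult_left_mono lip) blast
      also have "\<dots> \<le> lip * \<Lambda> * (2 * e)" using mult_left_mono[OF d l0] by (simp add: mult.assoc)
      finally show False using e(3) by linarith
    qed
    then have "card {..<rnk P} \<le> card Z" by (rule card_inj_on_le) (use f node Z(1) in auto)
    then show ?thesis by simp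
  qed
  then show ?thesis by blast
qed

lemma est_error_mono_const:
  assumes "a \<le> ennreal (c * x * y * z)" "c \<le> c'" "0 \<le> x" "0 \<le> y" "0 \<le> z"
  shows "a \<le> ennreal (c' * x * y * z)"
  using assms(1) by (rule order_trans) (intro ennreal_leI mult_right_mono assms)

text \<open>Here \<open>c\<close> is fixed before the problem, whereas the sizes may depend on the
  problem; this order of quantifiers is the claim that the constant sees only the listed
  data.\<close>

definition rate_const :: "nat \<Rightarrow> nat \<Rightarrow> real \<Rightarrow> evec set \<Rightarrow> real \<Rightarrow> real \<Rightarrow> real \<Rightarrow> bool" where
  "rate_const D d b M lip \<rho> c \<longleftrightarrow> 0 \<le> c \<and> (\<forall>P Lip U Cq R.
     regular_problem P Lip U Cq \<longrightarrow> amb_dim P = D \<longrightarrow> man_dim P = d \<longrightarrow> amb_bound P = b \<longrightarrow>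
       man P = M \<longrightarrow> coef_lip P = lip \<longrightarrow> R = \<rho> * (2 * sqrt (real (rnk P)) * U\<^sup>2 / lambda_min (gram P)) \<longrightarrow>
       2 * sqrt (real (rnk P)) * U\<^sup>2 / lambda_min (gram P) \<le> R \<longrightarrow>
     (\<exists>L p K. \<forall>n\<ge>2. sizes_admissible d (rnk P) n (L n) (p n) (K n) \<and>
       (\<forall>ahat. erm_estimator P n (net_class D M (rnk P) R (2 * max 1 b) (L n) (p n) (K n)) ahat \<longrightarrow>
          regular_problem.est_error P n ahat
            \<le> ennreal (c * ((real (rnk P))\<^sup>2 * U ^ 4 / (lambda_min (gram P))\<^sup>2) * real n powr (- 2 / (2 + real d)) * ln (real n) ^ 3))))"

lemma ex_rate_const:
  fixes M :: "evec set" and D d :: nat and b lip \<rho> :: real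
  assumes M: "submanifold D d M" "compact M" "connected M" and D: "1 \<le> D" and b: "0 < b" and lip: "0 \<le> lip"
  shows "\<exists>c. rate_const D d b M lip \<rho> c"
proof -
  obtain N where N: "\<And>P Lip U Cq. regular_problem P Lip U Cq \<Longrightarrow> man P = M \<Longrightarrow> coef_lip P = lip \<Longrightarrow> rnk P \<le> N"
    using ex_rank_bound[OF M lip] by blast
  define good where "good r c \<longleftrightarrow> (\<exists>L p K. 0 \<le> c \<and> (\<forall>n\<ge>2. sizes_admissible d r n (L n) (p n) (K n) \<and>
    (\<forall>P Lip U Cq R ahat. regular_problem P Lip U Cq \<longrightarrow> amb_dim P = D \<longrightarrow> man_dim P = d \<longrightarrow> amb_bound P = b \<longrightarrow>
       man P = M \<longrightarrow> coef_lip P = lip \<longrightarrow> rnk P = r \<longrightarrow> R = \<rho> * (2 * sqrt (real r) * U\<^sup>2 / lambda_min (gram P)) \<longrightarrow>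
       2 * sqrt (real r) * U\<^sup>2 / lambda_min (gram P) \<le> R \<longrightarrow>
       erm_estimator P n (net_class D M r R (2 * max 1 b) (L n) (p n) (K n)) ahat \<longrightarrow>
       regular_problem.est_error P n ahat
         \<le> ennreal (c * ((real r)\<^sup>2 * U ^ 4 / (lambda_min (gram P))\<^sup>2) * real n powr (- 2 / (2 + real d)) * ln (real n) ^ 3))))" for r c
  have "\<exists>c. good r c" if "1 \<le> r" for r
    unfolding good_def by (rule ex_estimation_rate_rank[OF M D that b lip])
  then obtain c where c: "\<And>r. 1 \<le> r \<Longrightarrow> good r (c r)" by metis
  have c0: "0 \<le> c r" if "1 \<le> r" for r using c[OF that] unfolding good_def by blast
  show ?thesis unfolding rate_const_def
  \<comment> \<open>Only finitely many ranks occur for given \<open>M\<close> and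
    \<open>lip\<close>, and a sum of nonnegative constants dominates each of them.\<close>
  proof (intro exI[of _ "\<Sum>r=1..N. c r"] conjI allI impI)
    show "0 \<le> (\<Sum>r=1..N. c r)" by (rule sum_nonneg) (use c0 in auto)
    fix P Lip U Cq R
    assume rp: "regular_problem P Lip U Cq" and P: "amb_dim P = D" "man_dim P = d" "amb_bound P = b" "man P = M" "coef_lip P = lip"
      and R: "R = \<rho> * (2 * sqrt (real (rnk P)) * U\<^sup>2 / lambda_min (gram P))"
       "2 * sqrt (real (rnk P)) * U\<^sup>2 / lambda_min (gram P) \<le> R"
    have r: "1 \<le> rnk P" by (rule regular_problem.r[OF rp])
    have "c (rnk P) \<le> (\<Sum>r=1..N. c r)"
      by (rule member_le_sum) (use r N[OF rp P(4,5)] c0 in auto)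
    note mono = est_error_mono_const[OF _ this]
    have "good (rnk P) (c (rnk P))" by (rule c[OF r])
    then obtain L p K where *: "\<And>n. 2 \<le> n \<Longrightarrow> sizes_admissible d (rnk P) n (L n) (p n) (K n) \<and>
       (\<forall>ahat. erm_estimator P n (net_class D M (rnk P) R (2 * max 1 b) (L n) (p n) (K n)) ahat \<longrightarrow>
          regular_problem.est_error P n ahat
            \<le> ennreal (c (rnk P) * ((real (rnk P))\<^sup>2 * U ^ 4 / (lambda_min (gram P))\<^sup>2) * real n powr (- 2 / (2 + real d)) * ln (real n) ^ 3))"
      unfolding good_def using rp P R by blast
    show "\<exists>L p K. \<forall>n\<ge>2. sizes_admissible d (rnk P) n (L n) (p n) (K n) \<and>
       (\<forall>ahat. erm_estimator P n (net_class D M (rnk P) R (2 * max 1 b) (L n) (p n) (K n)) ahat \<longrightarrow>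
          regular_problem.est_error P n ahat
            \<le> ennreal ((\<Sum>r=1..N. c r) * ((real (rnk P))\<^sup>2 * U ^ 4 / (lambda_min (gram P))\<^sup>2) * real n powr (- 2 / (2 + real d)) * ln (real n) ^ 3))"
    proof (rule exI[of _ L], rule exI[of _ p], rule exI[of _ K], intro allI impI conjI)
      fix n :: nat assume n: "2 \<le> n"
      show "sizes_admissible d (rnk P) n (L n) (p n) (K n)" using *[OF n] by blast
      fix ahat assume "erm_estimator P n (net_class D M (rnk P) R (2 * max 1 b) (L n) (p n) (K n)) ahat"
      then have "regular_problem.est_error P n ahat
            \<le> ennreal (c (rnk P) * ((real (rnk P))\<^sup>2 * U ^ 4 / (lambda_min (gram P))\<^sup>2) * real n powr (- 2 / (2 + real d)) * ln (real n) ^ 3)"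
        using *[OF n] by blast
      then show "regular_problem.est_error P n ahat
            \<le> ennreal ((\<Sum>r=1..N. c r) * ((real (rnk P))\<^sup>2 * U ^ 4 / (lambda_min (gram P))\<^sup>2) * real n powr (- 2 / (2 + real d)) * ln (real n) ^ 3)"
        by (rule mono) (use n in auto)
    qed
  qed
qed

lemma (in regular_problem) rate_const_problem:
  "\<exists>c. rate_const D (man_dim P) (amb_bound P) (man P) (coef_lip P) \<rho> c"
proof (rule ex_rate_const)
  note TD = transport_settingD[OF T]
  show "submanifold D (man_dim P) (man P)" "compact (man P)" "connected (man P)" "0 < amb_bound P" by (rule TD)+
  show "1 \<le> D" using TD(1) by simp
  obtain \<mu> where "\<mu> \<in> man P" using man_nonempty[OF T] by blast
  then show "0 \<le> coef_lip P" using coord_coef_lipschitz(2)[of 0 \<mu> \<mu>] r by simp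
qed

text \<open>The ambient dimension is determined by its logarithm, as it is positive.\<close>

definition rate_fun :: "real \<Rightarrow> nat \<Rightarrow> real \<Rightarrow> real \<Rightarrow> evec set \<Rightarrow> real \<Rightarrow> real \<Rightarrow> real" where
  "rate_fun l d b \<kappa> M lip \<rho> = (SOME c. rate_const (nat \<lfloor>exp l\<rfloor>) d b M lip \<rho> c)"

lemma (in regular_problem) rate_fun:
  "rate_const D (man_dim P) (amb_bound P) (man P) (coef_lip P) \<rho>
    (rate_fun (ln (real D)) (man_dim P) (amb_bound P) \<kappa> (man P) (coef_lip P) \<rho>)"
proof -
  have "0 < D" using transport_settingD(1)[OF T] by simp
  then have "nat \<lfloor>exp (ln (real D))\<rfloor> = D" by simp
  then show ?thesis unfolding rate_fun_def using someI_ex[OF rate_const_problem] by simp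
qed

lemma (in regular_problem) expected_error_rate:
  fixes R \<theta> C :: real
  defines "c \<equiv> rate_fun (ln (real D)) (man_dim P) (amb_bound P) (2 * max 1 (amb_bound P)) (man P) (coef_lip P) (R / R\<^sub>a)"
  assumes vc: "volume_condition P \<theta>" and sa: "skeleton_accurate P \<theta> C" and R: "R\<^sub>a \<le> R"
  shows "\<exists>L p K. \<forall>n\<ge>2. sizes_admissible (man_dim P) r n (L n) (p n) (K n) \<and>
    (\<forall>ahat. erm_estimator P n (net_class D (man P) r R (2 * max 1 (amb_bound P)) (L n) (p n) (K n)) ahat \<longrightarrow>
       expected_error P n ahat \<le> ennreal (
         4 * C\<^sup>2 * (real r + 1)\<^sup>2 * (sing_val P (r + 1))\<^sup>2 / \<theta>\<^sup>2
         + 4 * quad_const r \<gamma> U Lip Cq * \<Gamma> * h\<^sup>2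
         + 2 * c * \<Gamma> * ((real r)\<^sup>2 * U ^ 4 / \<gamma>\<^sup>2)
             * (real n powr (- 2 / (2 + real (man_dim P))) + real D / real n) * ln (real n) ^ 3))"
proof -
  have Ra: "0 < R\<^sub>a" using R_a_ge_2 by linarith
  \<comment> \<open>\<open>R\<close> has to be presented as a multiple of \<open>R\<^sub>a\<close>
    in order to match \<open>rate_const\<close>.\<close>
  have "x / y * y = x" if "0 < y" for x y :: real using that by simp
  then have R': "R = R / R\<^sub>a * R\<^sub>a" using Ra by metis
  have rc: "rate_const D (man_dim P) (amb_bound P) (man P) (coef_lip P) (R / R\<^sub>a) c" unfolding c_def by (rule rate_fun)
  then have c0: "0 \<le> c" unfolding rate_const_def by blast
  have rp: "regular_problem P Lip U Cq" by unfold_locales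
  obtain L p K where *: "\<And>n. 2 \<le> n \<Longrightarrow> sizes_admissible (man_dim P) r n (L n) (p n) (K n) \<and>
       (\<forall>ahat. erm_estimator P n (net_class D (man P) r R (2 * max 1 (amb_bound P)) (L n) (p n) (K n)) ahat \<longrightarrow>
          est_error n ahat
            \<le> ennreal (c * ((real r)\<^sup>2 * U ^ 4 / \<gamma>\<^sup>2) * real n powr (- 2 / (2 + real (man_dim P))) * ln (real n) ^ 3))"
    using rc[unfolded rate_const_def, THEN conjunct2, rule_format, OF rp refl refl refl refl refl R' R] by blast
  show ?thesis
  proof (rule exI[of _ L], rule exI[of _ p], rule exI[of _ K], intro allI impI conjI)
    fix n :: nat assume n: "2 \<le> n"
    show "sizes_admissible (man_dim P) r n (L n) (p n) (K n)" using *[OF n] by blast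
    fix ahat assume erm: "erm_estimator P n (net_class D (man P) r R (2 * max 1 (amb_bound P)) (L n) (p n) (K n)) ahat"
    let ?\<delta> = "real n powr (- 2 / (2 + real (man_dim P)))" and ?W = "(real r)\<^sup>2 * U ^ 4 / \<gamma>\<^sup>2"
    let ?B = "c * ?W * ?\<delta> * ln (real n) ^ 3" and ?E = "C * (real r + 1) / \<theta> * sing_val P (r + 1)"
      and ?Q = "quad_const r \<gamma> U Lip Cq"
    have g: "0 \<le> ln (real n)" using n by simp
    have W: "0 \<le> ?W" by simp
    have V: "(\<integral>\<^sup>+X. ennreal (LINT \<mu>|par_law P. (norm (ahat X \<mu> - coef P \<mu>))\<^sup>2) \<partial>sample_law P n) \<le> ennreal ?B"
      using *[OF n] erm unfolding est_error_def by blast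
    have B: "0 \<le> ?B" using c0 W g by (intro mult_nonneg_nonneg zero_le_power) auto
    have "2 * ?E\<^sup>2 + 2 * (\<Gamma> * (?Q * h\<^sup>2)) + 2 * \<Gamma> * ?B
      \<le> 4 * ?E\<^sup>2 + 4 * (?Q * \<Gamma> * h\<^sup>2) + 2 * c * \<Gamma> * ?W * (?\<delta> + real D / real n) * ln (real n) ^ 3"
    proof -
      have "0 \<le> ?E\<^sup>2" by simp
      moreover have "0 \<le> ?Q * \<Gamma> * h\<^sup>2" using Gamma_pos by (simp add: quad_const_def)
      moreover have "\<Gamma> * (?Q * h\<^sup>2) = ?Q * \<Gamma> * h\<^sup>2" by (simp only: mult_ac)
      moreover have "2 * \<Gamma> * ?B = (2 * c * \<Gamma> * ?W) * ?\<delta> * ln (real n) ^ 3" by (simp only: mult_ac)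
      moreover have "(2 * c * \<Gamma> * ?W) * ?\<delta> * ln (real n) ^ 3 \<le> (2 * c * \<Gamma> * ?W) * (?\<delta> + real D / real n) * ln (real n) ^ 3"
        using c0 W g Gamma_pos by (intro mult_right_mono mult_left_mono mult_nonneg_nonneg zero_le_power) auto
      moreover have "2 * e + 2 * x + a \<le> 4 * e + 4 * q + z" if "0 \<le> e" "0 \<le> q" "x = q" "a = y" "y \<le> z"
        for e x a q z y :: real using that by simp
      ultimately show ?thesis by blast
    qed
    also have "4 * ?E\<^sup>2 = 4 * C\<^sup>2 * (real r + 1)\<^sup>2 * (sing_val P (r + 1))\<^sup>2 / \<theta>\<^sup>2"
      by (simp add: power_mult_distrib power_divide)
    also have "4 * (?Q * \<Gamma> * h\<^sup>2) = 4 * ?Q * \<Gamma> * h\<^sup>2" by (simp only: mult.assoc)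
    finally show "expected_error P n ahat \<le> ennreal (
         4 * C\<^sup>2 * (real r + 1)\<^sup>2 * (sing_val P (r + 1))\<^sup>2 / \<theta>\<^sup>2 + 4 * ?Q * \<Gamma> * h\<^sup>2
         + 2 * c * \<Gamma> * ((real r)\<^sup>2 * U ^ 4 / \<gamma>\<^sup>2) * (?\<delta> + real D / real n) * ln (real n) ^ 3)"
      using expected_error_le[OF erm vc sa B V] by (meson ennreal_leI order_trans)
  qed
qed

text \<open>The weight bound \<open>2 * max 1 b\<close> has to cover the factor two of the doubling
  layers, the biases up to two that encode values, and the coordinates of the net points, which
  appear as biases and are at most \<open>b\<close>.\<close>

lemma weight_bound:
  fixes b :: real and x y :: ereal
  shows "ereal (2 * max 1 b) \<le> ereal 2 * Max {1, ereal b, x, y}"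
proof -
  have "ereal (max 1 b) = max 1 (ereal b)" by (simp add: max_def one_ereal_def)
  also have "\<dots> \<le> Max {1, ereal b, x, y}" by (intro max.boundedI Max_ge) auto
  finally have "ereal 2 * ereal (max 1 b) \<le> ereal 2 * Max {1, ereal b, x, y}" by (rule ereal_mult_left_mono) simp
  then show ?thesis by (simp only: times_ereal.simps(1))
qed

theorem theorem2:
  "\<exists>(A :: nat \<Rightarrow> real) (q :: nat) (A\<^sub>\<kappa> :: real) (\<kappa> :: nat \<Rightarrow> real \<Rightarrow> ereal \<Rightarrow> real)
     (C\<^sub>1 :: nat \<Rightarrow> real \<Rightarrow> real \<Rightarrow> real \<Rightarrow> real \<Rightarrow> real)
     (c :: real \<Rightarrow> nat \<Rightarrow> real \<Rightarrow> real \<Rightarrow> evec set \<Rightarrow> real \<Rightarrow> real \<Rightarrow> real).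
     (\<forall>d b \<tau>. 0 < b \<longrightarrow> 0 < \<tau> \<longrightarrow>
        0 < \<kappa> d b \<tau> \<and> ereal (\<kappa> d b \<tau>) \<le> ereal A\<^sub>\<kappa> * Max {1, ereal b, ereal (sqrt (real d)), \<tau>\<^sup>2}) \<and>
     (\<forall>P L\<^sub>\<Psi> U. transport_setting P \<longrightarrow> kernel_regular P L\<^sub>\<Psi> U \<longrightarrow>
        (let D = amb_dim P; d = man_dim P; b = amb_bound P; M = man P; \<tau> = reach D M;
             r = rnk P; \<gamma> = lambda_min (gram P); \<Gamma> = lambda_max (gram P);
             h = fill_space P; R\<^sub>a = 2 * sqrt (real r) * U\<^sup>2 / \<gamma>;
             \<theta>\<^sub>0 = 1 - real r powr (real r / 2 + 1) * U ^ (r - 1) * L\<^sub>\<Psi> * (fill_par P + h) / Delta_cont P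
         in
          (\<forall>C\<^sub>q \<theta> C R. 0 < \<tau> \<longrightarrow> quadrature_regular P L\<^sub>\<Psi> U C\<^sub>q \<longrightarrow>
             volume_condition P \<theta> \<longrightarrow> skeleton_accurate P \<theta> C \<longrightarrow> R\<^sub>a \<le> R \<longrightarrow>
             (\<exists>L p K :: nat \<Rightarrow> nat. \<forall>n\<ge>2.
                1 \<le> L n \<and> real (L n) \<le> A d * ln (real n) ^ q * (ln (real n) / (2 + real d)) \<and>
                1 \<le> p n \<and> real (p n) \<le> A d * ln (real n) ^ q * (real r * real n powr (real d / (2 + real d))) \<and>
                1 \<le> K n \<and> real (K n) \<le> A d * ln (real n) ^ q * (real r / (2 + real d) * real n powr (real d / (2 + real d)) * ln (real n)) \<and>
                (\<forall>ahat. erm_estimator P n (net_class D M r R (\<kappa> d b \<tau>) (L n) (p n) (K n)) ahat \<longrightarrow>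
                   expected_error P n ahat \<le> ennreal (
                     4 * C\<^sup>2 * (real r + 1)\<^sup>2 * (sing_val P (r + 1))\<^sup>2 / \<theta>\<^sup>2
                     + 4 * C\<^sub>1 r \<gamma> U L\<^sub>\<Psi> C\<^sub>q * \<Gamma> * h\<^sup>2
                     + 2 * c (ln (real D)) d b (\<kappa> d b \<tau>) M (coef_lip P) (R / R\<^sub>a) * \<Gamma> * ((real r)\<^sup>2 * U ^ 4 / \<gamma>\<^sup>2)
                         * (real n powr (- 2 / (2 + real d)) + real D / real n) * ln (real n) ^ 3)))) \<and>
          (0 < \<theta>\<^sub>0 \<longrightarrow> volume_condition P \<theta>\<^sub>0)))"
\<comment> \<open>The witnesses: the soft-order prefactor \<open>4 * (2 + d)\<close> with one
  logarithm, the weight bound of the network construction, \<open>quad_const\<close> for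
  \<open>C\<^sub>1\<close> and the function \<open>rate_fun\<close> for \<open>c\<close>. None of
  them refers to a particular problem.\<close>
proof (intro exI[of _ "\<lambda>d. 4 * (2 + real d)"] exI[of _ "1 :: nat"] exI[of _ "2 :: real"]
    exI[of _ "\<lambda>d b \<tau>. 2 * max 1 b"] exI[of _ quad_const] exI[of _ rate_fun] conjI allI impI)
  show "0 < 2 * max 1 b" for b :: real by simp
  show "ereal (2 * max 1 b) \<le> ereal 2 * Max {1, ereal b, ereal (sqrt (real d)), \<tau>\<^sup>2}" for b \<tau> and d :: nat
    by (rule weight_bound)
  fix P L\<^sub>\<Psi> U assume T: "transport_setting P" and kr: "kernel_regular P L\<^sub>\<Psi> U"
  note dr = dist_regularI[OF T]
  have vol: "volume_condition P \<theta>\<^sub>0"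
    if "\<theta>\<^sub>0 = 1 - real (rnk P) powr (real (rnk P) / 2 + 1) * U ^ (rnk P - 1) * L\<^sub>\<Psi> * (fill_par P + fill_space P) / Delta_cont P"
      and "0 < \<theta>\<^sub>0" for \<theta>\<^sub>0
    using volume_condition_of_fill[OF T kr dr] that by blast
  note main = regular_problem.expected_error_rate[OF regular_problem.intro[OF T kr dr], unfolded sizes_admissible_def conj_assoc]
  show "let D = amb_dim P; d = man_dim P; b = amb_bound P; M = man P; \<tau> = reach D M;
             r = rnk P; \<gamma> = lambda_min (gram P); \<Gamma> = lambda_max (gram P);
             h = fill_space P; R\<^sub>a = 2 * sqrt (real r) * U\<^sup>2 / \<gamma>;
             \<theta>\<^sub>0 = 1 - real r powr (real r / 2 + 1) * U ^ (r - 1) * L\<^sub>\<Psi> * (fill_par P + h) / Delta_cont P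
         in
          (\<forall>C\<^sub>q \<theta> C R. 0 < \<tau> \<longrightarrow> quadrature_regular P L\<^sub>\<Psi> U C\<^sub>q \<longrightarrow>
             volume_condition P \<theta> \<longrightarrow> skeleton_accurate P \<theta> C \<longrightarrow> R\<^sub>a \<le> R \<longrightarrow>
             (\<exists>L p K :: nat \<Rightarrow> nat. \<forall>n\<ge>2.
                1 \<le> L n \<and> real (L n) \<le> 4 * (2 + real d) * ln (real n) ^ 1 * (ln (real n) / (2 + real d)) \<and>
                1 \<le> p n \<and> real (p n) \<le> 4 * (2 + real d) * ln (real n) ^ 1 * (real r * real n powr (real d / (2 + real d))) \<and>
                1 \<le> K n \<and> real (K n) \<le> 4 * (2 + real d) * ln (real n) ^ 1 * (real r / (2 + real d) * real n powr (real d / (2 + real d)) * ln (real n)) \<and>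
                (\<forall>ahat. erm_estimator P n (net_class D M r R (2 * max 1 b) (L n) (p n) (K n)) ahat \<longrightarrow>
                   expected_error P n ahat \<le> ennreal (
                     4 * C\<^sup>2 * (real r + 1)\<^sup>2 * (sing_val P (r + 1))\<^sup>2 / \<theta>\<^sup>2
                     + 4 * quad_const r \<gamma> U L\<^sub>\<Psi> C\<^sub>q * \<Gamma> * h\<^sup>2
                     + 2 * rate_fun (ln (real D)) d b (2 * max 1 b) M (coef_lip P) (R / R\<^sub>a) * \<Gamma> * ((real r)\<^sup>2 * U ^ 4 / \<gamma>\<^sup>2)
                         * (real n powr (- 2 / (2 + real d)) + real D / real n) * ln (real n) ^ 3)))) \<and>
          (0 < \<theta>\<^sub>0 \<longrightarrow> volume_condition P \<theta>\<^sub>0)"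
    unfolding Let_def
    by (intro conjI allI impI) (erule (3) main, erule vol[OF refl])
qed

end
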